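(* Let $(B,\mathcal S)$ be a quasitriangular Hopf algebra over a field $\Bbbk$. Then the duoidal category $(\mathcal C,\circ,I,\bullet,J)=({}_B\mathfrak M_B,\otimes_B,B,\otimes_\Bbbk,\Bbbk)$ of $B$-bimodules is $\bullet$-braided. Moreover, the category $\mathrm{Bimon}_{\mathrm{coc}}(\mathcal C,\circ,\bullet)$ of cocommutative bimonoids in it is isomorphic to the coslice category $(B,\mathcal S)/\mathrm{QTrBialg}$ of quasitriangular bialgebras under $(B,\mathcal S)$.
   Context: Duoidal structure on ${}_B\mathfrak M_B$: $\circ=\otimes_B$, $I=B$; $\bullet=\otimes_\Bbbk$ with diagonal $B$-bimodule structure $b(x\bullet y)b'=b_1xb_1'\bullet b_2yb_2'$, $J=\Bbbk$ a $B$-bimodule via $\varepsilon_B$; interchange law $\zeta_{A,E,C,D}((a\bullet e)\circ(c\bullet d))=(a\circ c)\bullet(e\circ d)$; $\Delta_I=\Delta_B$, $m_J(k\circ k')=kk'$, $\varepsilon_I=u_J=\varepsilon_B$. A duoidal category is $\bullet$-braided if $(\mathcal C,\bullet,J)$ has a braiding $\sigma$ with $\sigma_{A\circ C,B\circ D}\zeta_{A,B,C,D}=\zeta_{B,A,D,C}(\sigma_{A,B}\circ\sigma_{C,D})$ and $\sigma_{I,I}\Delta_I=\Delta_I$. The braiding meant here is $\sigma_{X,Y}:X\otimes Y\to Y\otimes X$, $\sigma_{X,Y}(x\otimes y)=\mathcal S^{-1}(y\otimes x)\mathcal S$ (acting by $B\otimes B$ on both sides of $Y\otimes X$). Bimonoid: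 an object $H$ that is a monoid for $\circ$ and a comonoid for $\bullet$ with $\Delta_Hm_H=(m_H\bullet m_H)\zeta_{H,H,H,H}(\Delta_H\circ\Delta_H)$, $\varepsilon_Hm_H=m_J(\varepsilon_H\circ\varepsilon_H)$, $\Delta_Hu_H=(u_H\bullet u_H)\Delta_I$, $\varepsilon_Hu_H=\varepsilon_I$; morphisms are morphisms of monoids and comonoids; cocommutative means $\sigma_{H,H}\Delta_H=\Delta_H$. A quasitriangular bialgebra $(H,\mathcal R)$ is a bialgebra with an invertible $\mathcal R\in H\otimes H$ such that $\Delta^{\mathrm{op}}(\cdot)=\mathcal R\Delta(\cdot)\mathcal R^{-1}$, $(\mathrm{Id}\otimes\Delta)(\mathcal R)=\mathcal R_{13}\mathcal R_{12}$, $(\Delta\otimes\mathrm{Id})(\mathcal R)=\mathcal R_{13}\mathcal R_{23}$; a morphism $f:(A,\mathcal R)\to(H,\mathcal S)$ in $\mathrm{QTrBialg}$ is a bialgebra map with $(f\otimes f)(\mathcal R)=\mathcal S$. A quasitriangular Hopf algebra is a quasitriangular bialgebra with antipode. *)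

theory Defs
  imports "HOL-Algebra.Module" "HOL-Library.FuncSet"
    "HOL-Library.Infinite_Typeclass"
begin

section \<open>Categories\<close>

record ('o, 'a) category =
  Ob :: "'o set"
  Ar :: "'a set"
  dom_of :: "'a \<Rightarrow> 'o"
  cod_of :: "'a \<Rightarrow> 'o"
  ide :: "'o \<Rightarrow> 'a"
  cmp :: "'a \<Rightarrow> 'a \<Rightarrow> 'a"

definition arr :: "('o, 'a, 'x) category_scheme \<Rightarrow> 'o \<Rightarrow> 'o \<Rightarrow> 'a set"
  where "arr C X Y = {f \<in> Ar C. dom_of C f = X \<and> cod_of C f = Y}"

locale category =
  fixes C :: "('o, 'a) category"
  assumes dom_Ob: "f \<in> Ar C \<Longrightarrow> dom_of C f \<in> Ob C"
    and cod_Ob: "f \<in> Ar C \<Longrightarrow> cod_of C f \<in> Ob C"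
    and ide_arr: "X \<in> Ob C \<Longrightarrow> ide C X \<in> arr C X X"
    and cmp_arr: "f \<in> arr C X Y \<Longrightarrow> g \<in> arr C Y Z \<Longrightarrow> cmp C g f \<in> arr C X Z"
    and cmp_ide: "f \<in> arr C X Y \<Longrightarrow> cmp C f (ide C X) = f"
    and ide_cmp: "f \<in> arr C X Y \<Longrightarrow> cmp C (ide C Y) f = f"
    and cmp_assoc: "f \<in> arr C W X \<Longrightarrow> g \<in> arr C X Y \<Longrightarrow> h \<in> arr C Y Z \<Longrightarrow>
      cmp C h (cmp C g f) = cmp C (cmp C h g) f"

definition inverse_arr :: "('o, 'a, 'x) category_scheme \<Rightarrow> 'a \<Rightarrow> 'a \<Rightarrow> bool"
  where "inverse_arr C f g \<longleftrightarrow> f \<in> Ar C \<and> g \<in> arr C (cod_of C f) (dom_of C f) \<and>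
    cmp C g f = ide C (dom_of C f) \<and> cmp C f g = ide C (cod_of C f)"

definition iso_arr :: "('o, 'a, 'x) category_scheme \<Rightarrow> 'a \<Rightarrow> bool"
  where "iso_arr C f \<longleftrightarrow> (\<exists>g. inverse_arr C f g)"

definition inv_arr :: "('o, 'a, 'x) category_scheme \<Rightarrow> 'a \<Rightarrow> 'a"
  where "inv_arr C f = (THE g. inverse_arr C f g)"

locale cat_functor = C: category C + D: category D
  for C :: "('o, 'a) category" and D :: "('p, 'b) category" +
  fixes Fo :: "'o \<Rightarrow> 'p" and Fa :: "'a \<Rightarrow> 'b"
  assumes Fo_Ob: "X \<in> Ob C \<Longrightarrow> Fo X \<in> Ob D"
    and Fa_arr: "f \<in> arr C X Y \<Longrightarrow> Fa f \<in> arr D (Fo X) (Fo Y)"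
    and Fa_ide: "X \<in> Ob C \<Longrightarrow> Fa (ide C X) = ide D (Fo X)"
    and Fa_cmp: "f \<in> arr C X Y \<Longrightarrow> g \<in> arr C Y Z \<Longrightarrow> Fa (cmp C g f) = cmp D (Fa g) (Fa f)"

definition isomorphic_categories :: "('o, 'a) category \<Rightarrow> ('p, 'b) category \<Rightarrow> bool"
  where "isomorphic_categories C D \<longleftrightarrow> (\<exists>Fo Fa Go Ga.
    cat_functor C D Fo Fa \<and> cat_functor D C Go Ga \<and>
    (\<forall>X\<in>Ob C. Go (Fo X) = X) \<and> (\<forall>f\<in>Ar C. Ga (Fa f) = f) \<and>
    (\<forall>X\<in>Ob D. Fo (Go X) = X) \<and> (\<forall>f\<in>Ar D. Fa (Ga f) = f))"

text \<open>Arrows of concrete categories: a datum together with its source and target.\<close>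

record ('o, 'm) arrow =
  src :: 'o
  trg :: 'o
  map_of_arrow :: 'm

text \<open>An arrow of the coslice category from \<open>f\<close> to \<open>g\<close> is an arrow \<open>h\<close> of \<open>C\<close>
  with \<open>h \<circ> f = g\<close>.\<close>

definition coslice :: "'o \<Rightarrow> ('o, 'a) category \<Rightarrow> ('a, ('a, 'a) arrow) category"
  where "coslice X C =
    \<lparr>Ob = {f \<in> Ar C. dom_of C f = X},
     Ar = {\<lparr>src = f, trg = g, map_of_arrow = h\<rparr> | f g h.
             f \<in> Ar C \<and> g \<in> Ar C \<and> dom_of C f = X \<and> dom_of C g = X \<and>
             h \<in> arr C (cod_of C f) (cod_of C g) \<and> cmp C h f = g},
     dom_of = src,
     cod_of = trg,
     ide = (\<lambda>f. \<lparr>src = f, trg = f, map_of_arrow = ide C (cod_of C f)\<rparr>),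
     cmp = (\<lambda>k h. \<lparr>src = src h, trg = trg k,
                   map_of_arrow = cmp C (map_of_arrow k) (map_of_arrow h)\<rparr>)\<rparr>"


section \<open>Monoidal, braided and duoidal categories\<close>

record ('o, 'a) tensor_data =
  tenO :: "'o \<Rightarrow> 'o \<Rightarrow> 'o"
  tenA :: "'a \<Rightarrow> 'a \<Rightarrow> 'a"
  munit :: 'o
  asc :: "'o \<Rightarrow> 'o \<Rightarrow> 'o \<Rightarrow> 'a"
  lun :: "'o \<Rightarrow> 'a"
  run :: "'o \<Rightarrow> 'a"

locale monoidal_category = category C for C :: "('o, 'a) category" +
  fixes T :: "('o, 'a) tensor_data"
  fixes tensO (infixr \<open>\<bullet>\<close> 75) and tensA (infixr \<open>\<bullet>\<^sub>a\<close> 75)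
    and comp (infixr \<open>\<cdot>\<close> 65)
  defines "tensO \<equiv> tenO T" and "tensA \<equiv> tenA T" and "comp \<equiv> cmp C"
  assumes ten_Ob: "X \<in> Ob C \<Longrightarrow> Y \<in> Ob C \<Longrightarrow> X \<bullet> Y \<in> Ob C"
    and ten_arr: "f \<in> arr C X X' \<Longrightarrow> g \<in> arr C Y Y' \<Longrightarrow>
      f \<bullet>\<^sub>a g \<in> arr C (X \<bullet> Y) (X' \<bullet> Y')"
    and ten_ide: "X \<in> Ob C \<Longrightarrow> Y \<in> Ob C \<Longrightarrow> ide C X \<bullet>\<^sub>a ide C Y = ide C (X \<bullet> Y)"
    and ten_cmp: "f \<in> arr C X X' \<Longrightarrow> f' \<in> arr C X' X'' \<Longrightarrow> g \<in> arr C Y Y' \<Longrightarrow>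
      g' \<in> arr C Y' Y'' \<Longrightarrow> (f' \<cdot> f) \<bullet>\<^sub>a (g' \<cdot> g) = (f' \<bullet>\<^sub>a g') \<cdot> (f \<bullet>\<^sub>a g)"
    and munit_Ob: "munit T \<in> Ob C"
    and asc_arr: "X \<in> Ob C \<Longrightarrow> Y \<in> Ob C \<Longrightarrow> Z \<in> Ob C \<Longrightarrow>
      asc T X Y Z \<in> arr C ((X \<bullet> Y) \<bullet> Z) (X \<bullet> (Y \<bullet> Z))"
    and asc_iso: "X \<in> Ob C \<Longrightarrow> Y \<in> Ob C \<Longrightarrow> Z \<in> Ob C \<Longrightarrow> iso_arr C (asc T X Y Z)"
    and asc_natural: "f \<in> arr C X X' \<Longrightarrow> g \<in> arr C Y Y' \<Longrightarrow> h \<in> arr C Z Z' \<Longrightarrow>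
      asc T X' Y' Z' \<cdot> ((f \<bullet>\<^sub>a g) \<bullet>\<^sub>a h) = (f \<bullet>\<^sub>a (g \<bullet>\<^sub>a h)) \<cdot> asc T X Y Z"
    and lun_arr: "X \<in> Ob C \<Longrightarrow> lun T X \<in> arr C (munit T \<bullet> X) X"
    and lun_iso: "X \<in> Ob C \<Longrightarrow> iso_arr C (lun T X)"
    and lun_natural: "f \<in> arr C X Y \<Longrightarrow> lun T Y \<cdot> (ide C (munit T) \<bullet>\<^sub>a f) = f \<cdot> lun T X"
    and run_arr: "X \<in> Ob C \<Longrightarrow> run T X \<in> arr C (X \<bullet> munit T) X"
    and run_iso: "X \<in> Ob C \<Longrightarrow> iso_arr C (run T X)"
    and run_natural: "f \<in> arr C X Y \<Longrightarrow> run T Y \<cdot> (f \<bullet>\<^sub>a ide C (munit T)) = f \<cdot> run T X"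
    and pentagon: "W \<in> Ob C \<Longrightarrow> X \<in> Ob C \<Longrightarrow> Y \<in> Ob C \<Longrightarrow> Z \<in> Ob C \<Longrightarrow>
      asc T W X (Y \<bullet> Z) \<cdot> asc T (W \<bullet> X) Y Z =
      (ide C W \<bullet>\<^sub>a asc T X Y Z) \<cdot> asc T W (X \<bullet> Y) Z \<cdot> (asc T W X Y \<bullet>\<^sub>a ide C Z)"
    and triangle: "X \<in> Ob C \<Longrightarrow> Y \<in> Ob C \<Longrightarrow>
      (ide C X \<bullet>\<^sub>a lun T Y) \<cdot> asc T X (munit T) Y = run T X \<bullet>\<^sub>a ide C Y"

locale braided_monoidal_category = monoidal_category C T
  for C :: "('o, 'a) category" and T :: "('o, 'a) tensor_data" +
  fixes \<sigma> :: "'o \<Rightarrow> 'o \<Rightarrow> 'a"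
  assumes braid_arr: "X \<in> Ob C \<Longrightarrow> Y \<in> Ob C \<Longrightarrow> \<sigma> X Y \<in> arr C (X \<bullet> Y) (Y \<bullet> X)"
    and braid_iso: "X \<in> Ob C \<Longrightarrow> Y \<in> Ob C \<Longrightarrow> iso_arr C (\<sigma> X Y)"
    and braid_natural: "f \<in> arr C X X' \<Longrightarrow> g \<in> arr C Y Y' \<Longrightarrow>
      \<sigma> X' Y' \<cdot> (f \<bullet>\<^sub>a g) = (g \<bullet>\<^sub>a f) \<cdot> \<sigma> X Y"
    and hexagon1: "X \<in> Ob C \<Longrightarrow> Y \<in> Ob C \<Longrightarrow> Z \<in> Ob C \<Longrightarrow>
      asc T Y Z X \<cdot> \<sigma> X (Y \<bullet> Z) \<cdot> asc T X Y Z =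
      (ide C Y \<bullet>\<^sub>a \<sigma> X Z) \<cdot> asc T Y X Z \<cdot> (\<sigma> X Y \<bullet>\<^sub>a ide C Z)"
    and hexagon2: "X \<in> Ob C \<Longrightarrow> Y \<in> Ob C \<Longrightarrow> Z \<in> Ob C \<Longrightarrow>
      inv_arr C (asc T Z X Y) \<cdot> \<sigma> (X \<bullet> Y) Z \<cdot> inv_arr C (asc T X Y Z) =
      (\<sigma> X Z \<bullet>\<^sub>a ide C Y) \<cdot> inv_arr C (asc T X Z Y) \<cdot> (ide C X \<bullet>\<^sub>a \<sigma> Y Z)"

text \<open>The field \<open>eps_I\<close> is the common arrow \<open>\<epsilon>\<^sub>I = u\<^sub>J\<close> from \<open>I\<close> to \<open>J\<close>.\<close>

record ('o, 'a) duoidal_data =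
  circ :: "('o, 'a) tensor_data"
  bull :: "('o, 'a) tensor_data"
  zeta :: "'o \<Rightarrow> 'o \<Rightarrow> 'o \<Rightarrow> 'o \<Rightarrow> 'a"
  Delta_I :: 'a
  m_J :: 'a
  eps_I :: 'a

locale duoidal_category = category C for C :: "('o, 'a) category" +
  fixes D :: "('o, 'a) duoidal_data"
  fixes circO (infixr \<open>\<star>\<close> 75) and circA (infixr \<open>\<star>\<^sub>a\<close> 75)
    and bullO (infixr \<open>\<bullet>\<close> 75) and bullA (infixr \<open>\<bullet>\<^sub>a\<close> 75)
    and comp (infixr \<open>\<cdot>\<close> 65) and I and J
  defines "circO \<equiv> tenO (circ D)" and "circA \<equiv> tenA (circ D)"
    and "bullO \<equiv> tenO (bull D)" and "bullA \<equiv> tenA (bull D)"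
    and "comp \<equiv> cmp C" and "I \<equiv> munit (circ D)" and "J \<equiv> munit (bull D)"
  assumes circ_monoidal: "monoidal_category C (circ D)"
    and bull_monoidal: "monoidal_category C (bull D)"
    and zeta_arr: "X \<in> Ob C \<Longrightarrow> Y \<in> Ob C \<Longrightarrow> Z \<in> Ob C \<Longrightarrow> W \<in> Ob C \<Longrightarrow>
      zeta D X Y Z W \<in> arr C ((X \<bullet> Y) \<star> (Z \<bullet> W)) ((X \<star> Z) \<bullet> (Y \<star> W))"
    and zeta_natural: "f \<in> arr C X X' \<Longrightarrow> g \<in> arr C Y Y' \<Longrightarrow> h \<in> arr C Z Z' \<Longrightarrow>
      k \<in> arr C W W' \<Longrightarrow>
      zeta D X' Y' Z' W' \<cdot> ((f \<bullet>\<^sub>a g) \<star>\<^sub>a (h \<bullet>\<^sub>a k)) =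
      ((f \<star>\<^sub>a h) \<bullet>\<^sub>a (g \<star>\<^sub>a k)) \<cdot> zeta D X Y Z W"
    and Delta_I_arr: "Delta_I D \<in> arr C I (I \<bullet> I)"
    and m_J_arr: "m_J D \<in> arr C (J \<star> J) J"
    and eps_I_arr: "eps_I D \<in> arr C I J"
    \<comment> \<open>associativity\<close>
    and zeta_circ_assoc: "X \<in> Ob C \<Longrightarrow> Y \<in> Ob C \<Longrightarrow> Z \<in> Ob C \<Longrightarrow> W \<in> Ob C \<Longrightarrow>
      U \<in> Ob C \<Longrightarrow> V \<in> Ob C \<Longrightarrow>
      (asc (circ D) X Z U \<bullet>\<^sub>a asc (circ D) Y W V) \<cdot> zeta D (X \<star> Z) (Y \<star> W) U V \<cdot>
        (zeta D X Y Z W \<star>\<^sub>a ide C (U \<bullet> V)) =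
      zeta D X Y (Z \<star> U) (W \<star> V) \<cdot> (ide C (X \<bullet> Y) \<star>\<^sub>a zeta D Z W U V) \<cdot>
        asc (circ D) (X \<bullet> Y) (Z \<bullet> W) (U \<bullet> V)"
    and zeta_bull_assoc: "X \<in> Ob C \<Longrightarrow> Y \<in> Ob C \<Longrightarrow> Z \<in> Ob C \<Longrightarrow> W \<in> Ob C \<Longrightarrow>
      U \<in> Ob C \<Longrightarrow> V \<in> Ob C \<Longrightarrow>
      asc (bull D) (X \<star> W) (Y \<star> U) (Z \<star> V) \<cdot> (zeta D X Y W U \<bullet>\<^sub>a ide C (Z \<star> V)) \<cdot>
        zeta D (X \<bullet> Y) Z (W \<bullet> U) V =
      (ide C (X \<star> W) \<bullet>\<^sub>a zeta D Y Z U V) \<cdot> zeta D X (Y \<bullet> Z) W (U \<bullet> V) \<cdot>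
        (asc (bull D) X Y Z \<star>\<^sub>a asc (bull D) W U V)"
    \<comment> \<open>unitality\<close>
    and zeta_circ_lunit: "X \<in> Ob C \<Longrightarrow> Y \<in> Ob C \<Longrightarrow>
      (lun (circ D) X \<bullet>\<^sub>a lun (circ D) Y) \<cdot> zeta D I I X Y \<cdot> (Delta_I D \<star>\<^sub>a ide C (X \<bullet> Y)) =
      lun (circ D) (X \<bullet> Y)"
    and zeta_circ_runit: "X \<in> Ob C \<Longrightarrow> Y \<in> Ob C \<Longrightarrow>
      (run (circ D) X \<bullet>\<^sub>a run (circ D) Y) \<cdot> zeta D X Y I I \<cdot> (ide C (X \<bullet> Y) \<star>\<^sub>a Delta_I D) =
      run (circ D) (X \<bullet> Y)"
    and zeta_bull_lunit: "X \<in> Ob C \<Longrightarrow> Y \<in> Ob C \<Longrightarrow>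
      lun (bull D) (X \<star> Y) \<cdot> (m_J D \<bullet>\<^sub>a ide C (X \<star> Y)) \<cdot> zeta D J X J Y =
      lun (bull D) X \<star>\<^sub>a lun (bull D) Y"
    and zeta_bull_runit: "X \<in> Ob C \<Longrightarrow> Y \<in> Ob C \<Longrightarrow>
      run (bull D) (X \<star> Y) \<cdot> (ide C (X \<star> Y) \<bullet>\<^sub>a m_J D) \<cdot> zeta D X J Y J =
      run (bull D) X \<star>\<^sub>a run (bull D) Y"
    \<comment> \<open>\<open>(I, \<Delta>\<^sub>I, \<epsilon>\<^sub>I)\<close> is a comonoid for the second product\<close>
    and I_coassoc: "asc (bull D) I I I \<cdot> (Delta_I D \<bullet>\<^sub>a ide C I) \<cdot> Delta_I D =
      (ide C I \<bullet>\<^sub>a Delta_I D) \<cdot> Delta_I D"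
    and I_lcounit: "lun (bull D) I \<cdot> (eps_I D \<bullet>\<^sub>a ide C I) \<cdot> Delta_I D = ide C I"
    and I_rcounit: "run (bull D) I \<cdot> (ide C I \<bullet>\<^sub>a eps_I D) \<cdot> Delta_I D = ide C I"
    \<comment> \<open>\<open>(J, m\<^sub>J, u\<^sub>J)\<close> is a monoid for the first product\<close>
    and J_assoc: "m_J D \<cdot> (ide C J \<star>\<^sub>a m_J D) \<cdot> asc (circ D) J J J =
      m_J D \<cdot> (m_J D \<star>\<^sub>a ide C J)"
    and J_lunit: "m_J D \<cdot> (eps_I D \<star>\<^sub>a ide C J) = lun (circ D) J"
    and J_runit: "m_J D \<cdot> (ide C J \<star>\<^sub>a eps_I D) = run (circ D) J"

locale bullet_braided_duoidal_category = duoidal_category C D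
  for C :: "('o, 'a) category" and D :: "('o, 'a) duoidal_data" +
  fixes \<sigma> :: "'o \<Rightarrow> 'o \<Rightarrow> 'a"
  assumes bull_braided: "braided_monoidal_category C (bull D) \<sigma>"
    and braid_zeta: "X \<in> Ob C \<Longrightarrow> Y \<in> Ob C \<Longrightarrow> Z \<in> Ob C \<Longrightarrow> W \<in> Ob C \<Longrightarrow>
      \<sigma> (X \<star> Z) (Y \<star> W) \<cdot> zeta D X Y Z W = zeta D Y X W Z \<cdot> (\<sigma> X Y \<star>\<^sub>a \<sigma> Z W)"
    and braid_Delta_I: "\<sigma> I I \<cdot> Delta_I D = Delta_I D"

record ('o, 'a) bimonoid =
  obj :: 'o
  mult_of :: 'a
  unit_of :: 'a
  comult_of :: 'a
  counit_of :: 'a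

context
  fixes C :: "('o, 'a) category" and D :: "('o, 'a) duoidal_data"
begin

private abbreviation circO (infixr \<open>\<star>\<close> 75) where "X \<star> Y \<equiv> tenO (circ D) X Y"
private abbreviation circA (infixr \<open>\<star>\<^sub>a\<close> 75) where "f \<star>\<^sub>a g \<equiv> tenA (circ D) f g"
private abbreviation bullO (infixr \<open>\<bullet>\<close> 75) where "X \<bullet> Y \<equiv> tenO (bull D) X Y"
private abbreviation bullA (infixr \<open>\<bullet>\<^sub>a\<close> 75) where "f \<bullet>\<^sub>a g \<equiv> tenA (bull D) f g"
private abbreviation comp (infixr \<open>\<cdot>\<close> 65) where "g \<cdot> f \<equiv> cmp C g f"
private abbreviation "I \<equiv> munit (circ D)"
private abbreviation "J \<equiv> munit (bull D)"

definition circ_monoid :: "'o \<Rightarrow> 'a \<Rightarrow> 'a \<Rightarrow> bool"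
  where "circ_monoid H m u \<longleftrightarrow> H \<in> Ob C \<and> m \<in> arr C (H \<star> H) H \<and> u \<in> arr C I H \<and>
    m \<cdot> (ide C H \<star>\<^sub>a m) \<cdot> asc (circ D) H H H = m \<cdot> (m \<star>\<^sub>a ide C H) \<and>
    m \<cdot> (u \<star>\<^sub>a ide C H) = lun (circ D) H \<and>
    m \<cdot> (ide C H \<star>\<^sub>a u) = run (circ D) H"

definition bull_comonoid :: "'o \<Rightarrow> 'a \<Rightarrow> 'a \<Rightarrow> bool"
  where "bull_comonoid H d e \<longleftrightarrow> H \<in> Ob C \<and> d \<in> arr C H (H \<bullet> H) \<and> e \<in> arr C H J \<and>
    asc (bull D) H H H \<cdot> (d \<bullet>\<^sub>a ide C H) \<cdot> d = (ide C H \<bullet>\<^sub>a d) \<cdot> d \<and>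
    lun (bull D) H \<cdot> (e \<bullet>\<^sub>a ide C H) \<cdot> d = ide C H \<and>
    run (bull D) H \<cdot> (ide C H \<bullet>\<^sub>a e) \<cdot> d = ide C H"

definition is_bimonoid :: "('o, 'a) bimonoid \<Rightarrow> bool"
  where "is_bimonoid B \<longleftrightarrow>
    (let H = obj B; m = mult_of B; u = unit_of B; d = comult_of B; e = counit_of B in
      circ_monoid H m u \<and> bull_comonoid H d e \<and>
      d \<cdot> m = (m \<bullet>\<^sub>a m) \<cdot> zeta D H H H H \<cdot> (d \<star>\<^sub>a d) \<and>
      e \<cdot> m = m_J D \<cdot> (e \<star>\<^sub>a e) \<and>
      d \<cdot> u = (u \<bullet>\<^sub>a u) \<cdot> Delta_I D \<and>
      e \<cdot> u = eps_I D)"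

definition bimonoid_mor :: "('o, 'a) bimonoid \<Rightarrow> ('o, 'a) bimonoid \<Rightarrow> 'a \<Rightarrow> bool"
  where "bimonoid_mor B B' f \<longleftrightarrow> f \<in> arr C (obj B) (obj B') \<and>
    f \<cdot> mult_of B = mult_of B' \<cdot> (f \<star>\<^sub>a f) \<and>
    f \<cdot> unit_of B = unit_of B' \<and>
    comult_of B' \<cdot> f = (f \<bullet>\<^sub>a f) \<cdot> comult_of B \<and>
    counit_of B' \<cdot> f = counit_of B"

definition cocommutative_bimonoid :: "('o \<Rightarrow> 'o \<Rightarrow> 'a) \<Rightarrow> ('o, 'a) bimonoid \<Rightarrow> bool"
  where "cocommutative_bimonoid \<sigma> B \<longleftrightarrow> is_bimonoid B \<and>
    \<sigma> (obj B) (obj B) \<cdot> comult_of B = comult_of B"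

definition Bimon_coc ::
  "('o \<Rightarrow> 'o \<Rightarrow> 'a) \<Rightarrow> (('o, 'a) bimonoid, (('o, 'a) bimonoid, 'a) arrow) category"
  where "Bimon_coc \<sigma> =
    \<lparr>Ob = {B. cocommutative_bimonoid \<sigma> B},
     Ar = {\<lparr>src = B, trg = B', map_of_arrow = f\<rparr> | B B' f.
             cocommutative_bimonoid \<sigma> B \<and> cocommutative_bimonoid \<sigma> B' \<and> bimonoid_mor B B' f},
     dom_of = src,
     cod_of = trg,
     ide = (\<lambda>B. \<lparr>src = B, trg = B, map_of_arrow = ide C (obj B)\<rparr>),
     cmp = (\<lambda>g f. \<lparr>src = src f, trg = trg g,
                   map_of_arrow = map_of_arrow g \<cdot> map_of_arrow f\<rparr>)\<rparr>"

end


section \<open>Vector spaces and their tensor products\<close>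

text \<open>
  The elements of all structures, the base field included, are drawn from one fixed infinite
  type \<open>'u\<close>, which plays the role of the universe; as \<open>'u\<close> is infinite, the universe is closed
  under tensor products up to isomorphism.  Equality of objects has to be equality of
  mathematical structures (the theorem claims an isomorphism of categories), so operations are required to be \<open>undefined\<close> outside the carrier, and
  the ring multiplication fields of the record type \<open>module\<close> are required to be \<open>undefined\<close>
  where the structure is only a vector space.
\<close>

definition restrict2 :: "'a set \<Rightarrow> 'b set \<Rightarrow> ('a \<Rightarrow> 'b \<Rightarrow> 'c) \<Rightarrow> 'a \<Rightarrow> 'b \<Rightarrow> 'c"
  where "restrict2 A B f = (\<lambda>x y. if x \<in> A \<and> y \<in> B then f x y else undefined)"

definition extensional2 :: "'a set \<Rightarrow> 'b set \<Rightarrow> ('a \<Rightarrow> 'b \<Rightarrow> 'c) set"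
  where "extensional2 A B = {f. \<forall>x y. x \<notin> A \<or> y \<notin> B \<longrightarrow> f x y = undefined}"

definition linear_map ::
  "'u ring \<Rightarrow> ('u, 'u, 'x) module_scheme \<Rightarrow> ('u, 'u, 'y) module_scheme \<Rightarrow> ('u \<Rightarrow> 'u) \<Rightarrow> bool"
  where "linear_map K M N f \<longleftrightarrow> f \<in> carrier M \<rightarrow>\<^sub>E carrier N \<and>
    (\<forall>x\<in>carrier M. \<forall>y\<in>carrier M. f (x \<oplus>\<^bsub>M\<^esub> y) = f x \<oplus>\<^bsub>N\<^esub> f y) \<and>
    (\<forall>c\<in>carrier K. \<forall>x\<in>carrier M. f (c \<odot>\<^bsub>M\<^esub> x) = c \<odot>\<^bsub>N\<^esub> f x)"

text \<open>The base field as a vector space over itself.\<close>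

definition base_space :: "'u ring \<Rightarrow> ('u, 'u) module"
  where "base_space K = \<lparr>carrier = carrier K, mult = (\<lambda>_ _. undefined), one = undefined,
    zero = \<zero>\<^bsub>K\<^esub>, add = restrict2 (carrier K) (carrier K) (\<lambda>x y. x \<oplus>\<^bsub>K\<^esub> y),
    smult = restrict2 (carrier K) (carrier K) (\<lambda>x y. x \<otimes>\<^bsub>K\<^esub> y)\<rparr>"

text \<open>
  \<open>tens_equiv K M N Q\<close> is the congruence on formal sums (lists) of pairs \<open>(x, y)\<close>, standing for
  \<open>x \<otimes> y\<close>, whose quotient is the tensor product of \<open>M\<close> and \<open>N\<close> over \<open>K\<close> modulo the additional
  identifications of pure tensors listed in \<open>Q\<close>.
\<close>

inductive tens_equiv :: "'u ring \<Rightarrow> ('u, 'u, 'x) module_scheme \<Rightarrow> ('u, 'u, 'y) module_scheme \<Rightarrow>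
    (('u \<times> 'u) \<times> ('u \<times> 'u)) set \<Rightarrow> ('u \<times> 'u) list \<Rightarrow> ('u \<times> 'u) list \<Rightarrow> bool"
  for K M N Q
where
  refl: "l \<in> lists (carrier M \<times> carrier N) \<Longrightarrow> tens_equiv K M N Q l l"
| sym: "tens_equiv K M N Q l l' \<Longrightarrow> tens_equiv K M N Q l' l"
| trans: "tens_equiv K M N Q l l' \<Longrightarrow> tens_equiv K M N Q l' l'' \<Longrightarrow> tens_equiv K M N Q l l''"
| append: "tens_equiv K M N Q l l' \<Longrightarrow> tens_equiv K M N Q r r' \<Longrightarrow>
    tens_equiv K M N Q (l @ r) (l' @ r')"
| commute: "l \<in> lists (carrier M \<times> carrier N) \<Longrightarrow> r \<in> lists (carrier M \<times> carrier N) \<Longrightarrow>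
    tens_equiv K M N Q (l @ r) (r @ l)"
| zero: "tens_equiv K M N Q [(\<zero>\<^bsub>M\<^esub>, \<zero>\<^bsub>N\<^esub>)] []"
| add_left: "x \<in> carrier M \<Longrightarrow> x' \<in> carrier M \<Longrightarrow> y \<in> carrier N \<Longrightarrow>
    tens_equiv K M N Q [(x \<oplus>\<^bsub>M\<^esub> x', y)] [(x, y), (x', y)]"
| add_right: "x \<in> carrier M \<Longrightarrow> y \<in> carrier N \<Longrightarrow> y' \<in> carrier N \<Longrightarrow>
    tens_equiv K M N Q [(x, y \<oplus>\<^bsub>N\<^esub> y')] [(x, y), (x, y')]"
| scalar: "c \<in> carrier K \<Longrightarrow> x \<in> carrier M \<Longrightarrow> y \<in> carrier N \<Longrightarrow>
    tens_equiv K M N Q [(c \<odot>\<^bsub>M\<^esub> x, y)] [(x, c \<odot>\<^bsub>N\<^esub> y)]"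
| balance: "(p, q) \<in> Q \<Longrightarrow> p \<in> carrier M \<times> carrier N \<Longrightarrow> q \<in> carrier M \<times> carrier N \<Longrightarrow>
    tens_equiv K M N Q [p] [q]"

definition encode :: "('u \<times> 'u) list \<Rightarrow> 'u"
  where "encode = (SOME f. inj f)"

lemma inj_encode:
  includes cardinal_syntax
  shows "inj (encode :: (('u :: infinite) \<times> 'u) list \<Rightarrow> 'u)"
proof -
  let ?U = "UNIV :: 'u set"
  let ?L = "\<lambda>n. {l :: ('u \<times> 'u) list. length l = n}"
  have inf: "infinite ?U" by (rule infinite_UNIV)
  have sq: "|?U \<times> ?U| =o |?U|" by (rule card_of_Times_same_infinite[OF inf])
  have L: "|?L n| \<le>o |?U|" for n
  proof (induction n)
    case 0
    have "?L 0 = {[]}" by auto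
    then show ?case using card_of_singl_ordLeq[OF UNIV_not_empty] by metis
  next
    case (Suc n)
    let ?f = "\<lambda>l :: ('u \<times> 'u) list. (hd l, tl l)"
    have "inj_on ?f (?L (Suc n))"
      unfolding inj_on_def by (metis (mono_tags, lifting) hd_Cons_tl length_0_conv mem_Collect_eq
        nat.distinct(1) prod.inject)
    moreover have "?f ` ?L (Suc n) \<subseteq> (?U \<times> ?U) \<times> ?L n" by force
    ultimately have "|?L (Suc n)| \<le>o |(?U \<times> ?U) \<times> ?L n|"
      using card_of_ordLeq[of "?L (Suc n)" "(?U \<times> ?U) \<times> ?L n"] by blast
    moreover have "|(?U \<times> ?U) \<times> ?L n| \<le>o |?U|"
      by (rule card_of_Sigma_ordLeq_infinite[OF inf ordIso_imp_ordLeq[OF sq]]) (use Suc in blast)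
    ultimately show ?case by (rule ordLeq_transitive)
  qed
  have "|\<Union>n\<in>(UNIV :: nat set). ?L n| \<le>o |?U|"
    by (rule card_of_UNION_ordLeq_infinite[OF inf infinite_iff_card_of_nat[THEN iffD1, OF inf]])
      (use L in blast)
  moreover have "(\<Union>n\<in>(UNIV :: nat set). ?L n) = UNIV" by auto
  ultimately have "|UNIV :: ('u \<times> 'u) list set| \<le>o |?U|" by simp
  then have "\<exists>f :: ('u \<times> 'u) list \<Rightarrow> 'u. inj f"
    using card_of_ordLeq[of "UNIV :: ('u \<times> 'u) list set" ?U] by auto
  then show ?thesis unfolding encode_def by (rule someI_ex)
qed

definition decode :: "'u \<Rightarrow> ('u \<times> 'u) list"
  where "decode = inv_into UNIV encode"

text \<open>The class of a formal sum, encoded by a representative depending only on the class.\<close>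

definition tens_class :: "'u ring \<Rightarrow> ('u, 'u, 'x) module_scheme \<Rightarrow> ('u, 'u, 'y) module_scheme \<Rightarrow>
    (('u \<times> 'u) \<times> ('u \<times> 'u)) set \<Rightarrow> ('u \<times> 'u) list \<Rightarrow> 'u"
  where "tens_class K M N Q l = encode (SOME l'. tens_equiv K M N Q l l')"

definition tens_quot :: "'u ring \<Rightarrow> ('u, 'u, 'x) module_scheme \<Rightarrow> ('u, 'u, 'y) module_scheme \<Rightarrow>
    (('u \<times> 'u) \<times> ('u \<times> 'u)) set \<Rightarrow> ('u, 'u) module"
  where "tens_quot K M N Q =
    (let T = tens_class K M N Q ` lists (carrier M \<times> carrier N) in
      \<lparr>carrier = T, mult = (\<lambda>_ _. undefined), one = undefined,
       zero = tens_class K M N Q [],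
       add = restrict2 T T (\<lambda>s t. tens_class K M N Q (decode s @ decode t)),
       smult = restrict2 (carrier K) T
         (\<lambda>c t. tens_class K M N Q (map (\<lambda>(x, y). (c \<odot>\<^bsub>M\<^esub> x, y)) (decode t)))\<rparr>)"

text \<open>For \<open>t = \<Sum>\<^sub>i x\<^sub>i \<otimes> y\<^sub>i\<close>, \<open>lift P \<phi> t\<close> is \<open>\<Sum>\<^sub>i \<phi> x\<^sub>i y\<^sub>i\<close>, computed in \<open>P\<close>.\<close>

definition lift :: "('u, 'u, 'x) module_scheme \<Rightarrow> ('u \<Rightarrow> 'u \<Rightarrow> 'u) \<Rightarrow> 'u \<Rightarrow> 'u"
  where "lift P \<phi> t = foldr (\<lambda>(x, y) s. \<phi> x y \<oplus>\<^bsub>P\<^esub> s) (decode t) \<zero>\<^bsub>P\<^esub>"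

abbreviation tensK ::
  "'u ring \<Rightarrow> ('u, 'u, 'x) module_scheme \<Rightarrow> ('u, 'u, 'y) module_scheme \<Rightarrow> ('u, 'u) module"
  where "tensK K M N \<equiv> tens_quot K M N {}"

abbreviation pureK ::
  "'u ring \<Rightarrow> ('u, 'u, 'x) module_scheme \<Rightarrow> ('u, 'u, 'y) module_scheme \<Rightarrow> 'u \<Rightarrow> 'u \<Rightarrow> 'u"
  where "pureK K M N x y \<equiv> tens_class K M N {} [(x, y)]"


section \<open>Quasitriangular bialgebras and Hopf algebras\<close>

record 'u bialg = "('u, 'u) module" +
  comult :: "'u \<Rightarrow> 'u"
  counit :: "'u \<Rightarrow> 'u"

definition unital_algebra :: "'u ring \<Rightarrow> ('u, 'u, 'x) module_scheme \<Rightarrow> bool"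
  where "unital_algebra K A \<longleftrightarrow> Module.module K A \<and> ring A \<and>
    (\<forall>c\<in>carrier K. \<forall>x\<in>carrier A. \<forall>y\<in>carrier A.
      (c \<odot>\<^bsub>A\<^esub> x) \<otimes>\<^bsub>A\<^esub> y = c \<odot>\<^bsub>A\<^esub> (x \<otimes>\<^bsub>A\<^esub> y) \<and>
      x \<otimes>\<^bsub>A\<^esub> (c \<odot>\<^bsub>A\<^esub> y) = c \<odot>\<^bsub>A\<^esub> (x \<otimes>\<^bsub>A\<^esub> y)) \<and>
    add A \<in> extensional2 (carrier A) (carrier A) \<and>
    mult A \<in> extensional2 (carrier A) (carrier A) \<and>
    smult A \<in> extensional2 (carrier K) (carrier A)"

text \<open>The tensor product algebra, with \<open>(a \<otimes> b)(c \<otimes> d) = ac \<otimes> bd\<close>.\<close>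

definition tens_alg ::
  "'u ring \<Rightarrow> ('u, 'u, 'x) module_scheme \<Rightarrow> ('u, 'u, 'y) module_scheme \<Rightarrow> ('u, 'u) module"
  where "tens_alg K A A' = (let T = tensK K A A' in T
    \<lparr>mult := restrict2 (carrier T) (carrier T) (\<lambda>s t.
       lift T (\<lambda>a b. lift T (\<lambda>c d. pureK K A A' (a \<otimes>\<^bsub>A\<^esub> c) (b \<otimes>\<^bsub>A'\<^esub> d)) t) s),
     one := pureK K A A' \<one>\<^bsub>A\<^esub> \<one>\<^bsub>A'\<^esub>\<rparr>)"

definition bialgebra :: "'u ring \<Rightarrow> 'u bialg \<Rightarrow> bool"
  where "bialgebra K H \<longleftrightarrow> unital_algebra K H \<and>
    linear_map K H (tensK K H H) (comult H) \<and>
    linear_map K H (base_space K) (counit H) \<and>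
    (\<forall>h\<in>carrier H.
      lift (tensK K H (tensK K H H))
        (\<lambda>x z. lift (tensK K H (tensK K H H))
          (\<lambda>x' y. pureK K H (tensK K H H) x' (pureK K H H y z)) (comult H x)) (comult H h) =
      lift (tensK K H (tensK K H H))
        (\<lambda>x y. pureK K H (tensK K H H) x (comult H y)) (comult H h)) \<and>
    (\<forall>h\<in>carrier H. lift H (\<lambda>x y. counit H x \<odot>\<^bsub>H\<^esub> y) (comult H h) = h) \<and>
    (\<forall>h\<in>carrier H. lift H (\<lambda>x y. counit H y \<odot>\<^bsub>H\<^esub> x) (comult H h) = h) \<and>
    comult H \<in> ring_hom H (tens_alg K H H) \<and>
    counit H \<in> ring_hom H K"

definition hopf_algebra :: "'u ring \<Rightarrow> 'u bialg \<Rightarrow> bool"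
  where "hopf_algebra K H \<longleftrightarrow> bialgebra K H \<and>
    (\<exists>S. linear_map K H H S \<and> (\<forall>h\<in>carrier H.
      lift H (\<lambda>x y. S x \<otimes>\<^bsub>H\<^esub> y) (comult H h) = counit H h \<odot>\<^bsub>H\<^esub> \<one>\<^bsub>H\<^esub> \<and>
      lift H (\<lambda>x y. x \<otimes>\<^bsub>H\<^esub> S y) (comult H h) = counit H h \<odot>\<^bsub>H\<^esub> \<one>\<^bsub>H\<^esub>))"

definition flip ::
  "'u ring \<Rightarrow> ('u, 'u, 'x) module_scheme \<Rightarrow> ('u, 'u, 'y) module_scheme \<Rightarrow> 'u \<Rightarrow> 'u"
  where "flip K M N t = lift (tensK K N M) (\<lambda>x y. pureK K N M y x) t"

text \<open>
  The triple tensor product is realised as \<open>H \<otimes> (H \<otimes> H)\<close>, and \<open>(\<Delta> \<otimes> Id)(R)\<close> is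
  rebracketed accordingly.
\<close>

definition quasitriangular :: "'u ring \<Rightarrow> 'u bialg \<Rightarrow> 'u \<Rightarrow> bool"
  where "quasitriangular K H R \<longleftrightarrow>
    (let H2 = tens_alg K H H;
         H3 = tens_alg K H H2;
         ten2 = pureK K H H;
         ten3 = (\<lambda>x y z. pureK K H H2 x (ten2 y z));
         R12 = lift H3 (\<lambda>x y. ten3 x y \<one>\<^bsub>H\<^esub>) R;
         R13 = lift H3 (\<lambda>x y. ten3 x \<one>\<^bsub>H\<^esub> y) R;
         R23 = lift H3 (\<lambda>x y. ten3 \<one>\<^bsub>H\<^esub> x y) R
     in R \<in> Units H2 \<and>
       (\<forall>h\<in>carrier H. flip K H H (comult H h) = R \<otimes>\<^bsub>H2\<^esub> comult H h \<otimes>\<^bsub>H2\<^esub> inv\<^bsub>H2\<^esub> R) \<and>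
       lift H3 (\<lambda>x y. pureK K H H2 x (comult H y)) R = R13 \<otimes>\<^bsub>H3\<^esub> R12 \<and>
       lift H3 (\<lambda>x z. lift H3 (\<lambda>x' y. ten3 x' y z) (comult H x)) R = R13 \<otimes>\<^bsub>H3\<^esub> R23)"

definition quasitriangular_bialgebra :: "'u ring \<Rightarrow> 'u bialg \<Rightarrow> 'u \<Rightarrow> bool"
  where "quasitriangular_bialgebra K H R \<longleftrightarrow> bialgebra K H \<and> quasitriangular K H R"

definition quasitriangular_hopf_algebra :: "'u ring \<Rightarrow> 'u bialg \<Rightarrow> 'u \<Rightarrow> bool"
  where "quasitriangular_hopf_algebra K H R \<longleftrightarrow> hopf_algebra K H \<and> quasitriangular K H R"

definition bialgebra_map :: "'u ring \<Rightarrow> 'u bialg \<Rightarrow> 'u bialg \<Rightarrow> ('u \<Rightarrow> 'u) \<Rightarrow> bool"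
  where "bialgebra_map K A H f \<longleftrightarrow> linear_map K A H f \<and> f \<in> ring_hom A H \<and>
    (\<forall>a\<in>carrier A.
      comult H (f a) = lift (tensK K H H) (\<lambda>x y. pureK K H H (f x) (f y)) (comult A a) \<and>
      counit H (f a) = counit A a)"

definition QTrBialg ::
  "'u ring \<Rightarrow> ('u bialg \<times> 'u, ('u bialg \<times> 'u, 'u \<Rightarrow> 'u) arrow) category"
  where "QTrBialg K =
    \<lparr>Ob = {(H, R). quasitriangular_bialgebra K H R},
     Ar = {\<lparr>src = (A, R), trg = (H, S), map_of_arrow = f\<rparr> | A R H S f.
             quasitriangular_bialgebra K A R \<and> quasitriangular_bialgebra K H S \<and>
             bialgebra_map K A H f \<and>
             lift (tensK K H H) (\<lambda>x y. pureK K H H (f x) (f y)) R = S},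
     dom_of = src,
     cod_of = trg,
     ide = (\<lambda>X. \<lparr>src = X, trg = X, map_of_arrow = (\<lambda>x\<in>carrier (fst X). x)\<rparr>),
     cmp = (\<lambda>g f. \<lparr>src = src f, trg = trg g,
       map_of_arrow = compose (carrier (fst (src f))) (map_of_arrow g) (map_of_arrow f)\<rparr>)\<rparr>"


section \<open>The category of bimodules and its duoidal structure\<close>

record 'u bimod = "('u, 'u) module" +
  lact :: "'u \<Rightarrow> 'u \<Rightarrow> 'u"
  ract :: "'u \<Rightarrow> 'u \<Rightarrow> 'u"

text \<open>\<open>lact M b x\<close> is \<open>b x\<close> and \<open>ract M x b\<close> is \<open>x b\<close>.\<close>

definition bimodule :: "'u ring \<Rightarrow> 'u bialg \<Rightarrow> 'u bimod \<Rightarrow> bool"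
  where "bimodule K B M \<longleftrightarrow> Module.module K M \<and>
    (\<forall>b\<in>carrier B. \<forall>x\<in>carrier M. lact M b x \<in> carrier M \<and> ract M x b \<in> carrier M) \<and>
    (\<forall>b\<in>carrier B. \<forall>x\<in>carrier M. \<forall>y\<in>carrier M.
      lact M b (x \<oplus>\<^bsub>M\<^esub> y) = lact M b x \<oplus>\<^bsub>M\<^esub> lact M b y \<and>
      ract M (x \<oplus>\<^bsub>M\<^esub> y) b = ract M x b \<oplus>\<^bsub>M\<^esub> ract M y b) \<and>
    (\<forall>b\<in>carrier B. \<forall>b'\<in>carrier B. \<forall>x\<in>carrier M.
      lact M (b \<oplus>\<^bsub>B\<^esub> b') x = lact M b x \<oplus>\<^bsub>M\<^esub> lact M b' x \<and>
      ract M x (b \<oplus>\<^bsub>B\<^esub> b') = ract M x b \<oplus>\<^bsub>M\<^esub> ract M x b' \<and>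
      lact M (b \<otimes>\<^bsub>B\<^esub> b') x = lact M b (lact M b' x) \<and>
      ract M x (b \<otimes>\<^bsub>B\<^esub> b') = ract M (ract M x b) b' \<and>
      ract M (lact M b x) b' = lact M b (ract M x b')) \<and>
    (\<forall>c\<in>carrier K. \<forall>x\<in>carrier M.
      lact M (c \<odot>\<^bsub>B\<^esub> \<one>\<^bsub>B\<^esub>) x = c \<odot>\<^bsub>M\<^esub> x \<and> ract M x (c \<odot>\<^bsub>B\<^esub> \<one>\<^bsub>B\<^esub>) = c \<odot>\<^bsub>M\<^esub> x) \<and>
    add M \<in> extensional2 (carrier M) (carrier M) \<and>
    smult M \<in> extensional2 (carrier K) (carrier M) \<and>
    lact M \<in> extensional2 (carrier B) (carrier M) \<and>
    ract M \<in> extensional2 (carrier M) (carrier B) \<and>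
    mult M = (\<lambda>_ _. undefined) \<and> one M = undefined"

type_synonym 'u bimod_arrow = "('u bimod, 'u \<Rightarrow> 'u) arrow"

definition bimodule_map :: "'u ring \<Rightarrow> 'u bialg \<Rightarrow> 'u bimod \<Rightarrow> 'u bimod \<Rightarrow> ('u \<Rightarrow> 'u) \<Rightarrow> bool"
  where "bimodule_map K B M N f \<longleftrightarrow> linear_map K M N f \<and>
    (\<forall>b\<in>carrier B. \<forall>x\<in>carrier M.
      f (lact M b x) = lact N b (f x) \<and> f (ract M x b) = ract N (f x) b)"

definition bimod_cat :: "'u ring \<Rightarrow> 'u bialg \<Rightarrow> ('u bimod, 'u bimod_arrow) category"
  where "bimod_cat K B =
    \<lparr>Ob = {M. bimodule K B M},
     Ar = {\<lparr>src = M, trg = N, map_of_arrow = f\<rparr> | M N f.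
             bimodule K B M \<and> bimodule K B N \<and> bimodule_map K B M N f},
     dom_of = src,
     cod_of = trg,
     ide = (\<lambda>M. \<lparr>src = M, trg = M, map_of_arrow = (\<lambda>x\<in>carrier M. x)\<rparr>),
     cmp = (\<lambda>g f. \<lparr>src = src f, trg = trg g,
       map_of_arrow = compose (carrier (src f)) (map_of_arrow g) (map_of_arrow f)\<rparr>)\<rparr>"

definition mk_bimod ::
  "'u bialg \<Rightarrow> ('u, 'u) module \<Rightarrow> ('u \<Rightarrow> 'u \<Rightarrow> 'u) \<Rightarrow> ('u \<Rightarrow> 'u \<Rightarrow> 'u) \<Rightarrow> 'u bimod"
  where "mk_bimod B V l r =
    \<lparr>carrier = carrier V, mult = (\<lambda>_ _. undefined), one = undefined, zero = zero V, add = add V,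
     smult = smult V,
     lact = restrict2 (carrier B) (carrier V) l, ract = restrict2 (carrier V) (carrier B) r\<rparr>"

definition mk_arrow :: "'u bimod \<Rightarrow> 'u bimod \<Rightarrow> ('u \<Rightarrow> 'u) \<Rightarrow> 'u bimod_arrow"
  where "mk_arrow M N f = \<lparr>src = M, trg = N, map_of_arrow = restrict f (carrier M)\<rparr>"


subsection \<open>The tensor product over \<open>B\<close>\<close>

definition balB :: "'u bialg \<Rightarrow> 'u bimod \<Rightarrow> 'u bimod \<Rightarrow> (('u \<times> 'u) \<times> ('u \<times> 'u)) set"
  where "balB B M N = {((ract M x b, y), (x, lact N b y)) | x b y.
    x \<in> carrier M \<and> b \<in> carrier B \<and> y \<in> carrier N}"

abbreviation pureB :: "'u ring \<Rightarrow> 'u bialg \<Rightarrow> 'u bimod \<Rightarrow> 'u bimod \<Rightarrow> 'u \<Rightarrow> 'u \<Rightarrow> 'u"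
  where "pureB K B M N x y \<equiv> tens_class K M N (balB B M N) [(x, y)]"

definition tensB :: "'u ring \<Rightarrow> 'u bialg \<Rightarrow> 'u bimod \<Rightarrow> 'u bimod \<Rightarrow> 'u bimod"
  where "tensB K B M N = (let T = tens_quot K M N (balB B M N) in mk_bimod B T
    (\<lambda>b t. lift T (\<lambda>x y. pureB K B M N (lact M b x) y) t)
    (\<lambda>t b. lift T (\<lambda>x y. pureB K B M N x (ract N y b)) t))"

definition regular_bimod :: "'u bialg \<Rightarrow> 'u bimod"
  where "regular_bimod B = mk_bimod B (module.truncate B) (mult B) (mult B)"

definition circ_data :: "'u ring \<Rightarrow> 'u bialg \<Rightarrow> ('u bimod, 'u bimod_arrow) tensor_data"
  where "circ_data K B =
    (let ten = tensB K B; pt = pureB K B; I = regular_bimod B in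
      \<lparr>tenO = ten,
       tenA = (\<lambda>f g. let P = ten (trg f) (trg g) in
         mk_arrow (ten (src f) (src g)) P
           (lift P (\<lambda>x y. pt (trg f) (trg g) (map_of_arrow f x) (map_of_arrow g y)))),
       munit = I,
       asc = (\<lambda>X Y Z. let P = ten X (ten Y Z) in
         mk_arrow (ten (ten X Y) Z) P
           (lift P (\<lambda>s z. lift P (\<lambda>x y. pt X (ten Y Z) x (pt Y Z y z)) s))),
       lun = (\<lambda>X. mk_arrow (ten I X) X (lift X (\<lambda>b x. lact X b x))),
       run = (\<lambda>X. mk_arrow (ten X I) X (lift X (\<lambda>x b. ract X x b)))\<rparr>)"


subsection \<open>The tensor product over the base field\<close>

text \<open>The actions \<open>(a \<otimes> b)(x \<otimes> y) = ax \<otimes> by\<close> and \<open>(x \<otimes> y)(a \<otimes> b) = xa \<otimes> yb\<close> of \<open>B \<otimes> B\<close>.\<close>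

definition lact2 :: "'u ring \<Rightarrow> 'u bimod \<Rightarrow> 'u bimod \<Rightarrow> 'u \<Rightarrow> 'u \<Rightarrow> 'u"
  where "lact2 K M N s t = lift (tensK K M N) (\<lambda>a b.
    lift (tensK K M N) (\<lambda>x y. pureK K M N (lact M a x) (lact N b y)) t) s"

definition ract2 :: "'u ring \<Rightarrow> 'u bimod \<Rightarrow> 'u bimod \<Rightarrow> 'u \<Rightarrow> 'u \<Rightarrow> 'u"
  where "ract2 K M N t s = lift (tensK K M N) (\<lambda>a b.
    lift (tensK K M N) (\<lambda>x y. pureK K M N (ract M x a) (ract N y b)) t) s"

definition tens_diag :: "'u ring \<Rightarrow> 'u bialg \<Rightarrow> 'u bimod \<Rightarrow> 'u bimod \<Rightarrow> 'u bimod"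
  where "tens_diag K B M N = mk_bimod B (tensK K M N)
    (\<lambda>b t. lact2 K M N (comult B b) t) (\<lambda>t b. ract2 K M N t (comult B b))"

definition trivial_bimod :: "'u ring \<Rightarrow> 'u bialg \<Rightarrow> 'u bimod"
  where "trivial_bimod K B = mk_bimod B (base_space K)
    (\<lambda>b c. counit B b \<otimes>\<^bsub>K\<^esub> c) (\<lambda>c b. c \<otimes>\<^bsub>K\<^esub> counit B b)"

definition bull_data :: "'u ring \<Rightarrow> 'u bialg \<Rightarrow> ('u bimod, 'u bimod_arrow) tensor_data"
  where "bull_data K B =
    (let ten = tens_diag K B; pt = (\<lambda>X Y. pureK K X Y); J = trivial_bimod K B in
      \<lparr>tenO = ten,
       tenA = (\<lambda>f g. let P = ten (trg f) (trg g) in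
         mk_arrow (ten (src f) (src g)) P
           (lift P (\<lambda>x y. pt (trg f) (trg g) (map_of_arrow f x) (map_of_arrow g y)))),
       munit = J,
       asc = (\<lambda>X Y Z. let P = ten X (ten Y Z) in
         mk_arrow (ten (ten X Y) Z) P
           (lift P (\<lambda>s z. lift P (\<lambda>x y. pt X (ten Y Z) x (pt Y Z y z)) s))),
       lun = (\<lambda>X. mk_arrow (ten J X) X (lift X (\<lambda>c x. c \<odot>\<^bsub>X\<^esub> x))),
       run = (\<lambda>X. mk_arrow (ten X J) X (lift X (\<lambda>x c. c \<odot>\<^bsub>X\<^esub> x)))\<rparr>)"


subsection \<open>Interchange law and braiding\<close>

definition bimod_duoidal :: "'u ring \<Rightarrow> 'u bialg \<Rightarrow> ('u bimod, 'u bimod_arrow) duoidal_data"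
  where "bimod_duoidal K B =
    (let oo = tensB K B; bb = tens_diag K B; I = regular_bimod B; J = trivial_bimod K B in
      \<lparr>circ = circ_data K B,
       bull = bull_data K B,
       zeta = (\<lambda>A E C D. let P = bb (oo A C) (oo E D) in
         mk_arrow (oo (bb A E) (bb C D)) P
           (lift P (\<lambda>s t. lift P (\<lambda>a e. lift P (\<lambda>c d.
             pureK K (oo A C) (oo E D) (pureB K B A C a c) (pureB K B E D e d)) t) s))),
       Delta_I = mk_arrow I (bb I I) (comult B),
       m_J = mk_arrow (oo J J) J (lift J (\<lambda>k k'. k \<otimes>\<^bsub>K\<^esub> k')),
       eps_I = mk_arrow I J (counit B)\<rparr>)"

definition bimod_braiding ::
  "'u ring \<Rightarrow> 'u bialg \<Rightarrow> 'u \<Rightarrow> 'u bimod \<Rightarrow> 'u bimod \<Rightarrow> 'u bimod_arrow"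
  where "bimod_braiding K B S X Y = mk_arrow (tens_diag K B X Y) (tens_diag K B Y X)
    (\<lambda>t. ract2 K Y X (lact2 K Y X (inv\<^bsub>tens_alg K B B\<^esub> S) (flip K X Y t)) S)"

end

theory Submission
  imports Defs
begin

text \<open>
  All structure maps of the duoidal category, and the braiding, are determined by their values on
  pure tensors, so each axiom is checked there and reduces to an identity of \<open>B\<close>: the interchange
  law to multiplicativity of the comultiplication, \<open>B\<close>-linearity of the braiding to
  \<open>\<Delta>\<^sup>o\<^sup>p = S \<Delta> S\<^sup>-\<^sup>1\<close>, and the hexagons to the two coproduct formulas for \<open>S\<close>.

  The unit axioms of a bimonoid \<open>H\<close> with unit \<open>u : B \<rightarrow> H\<close> force \<open>b x = u(b) x\<close> and \<open>x b = x u(b)\<close>.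
  Hence the bimodule structure is redundant, and \<open>H\<close> is a bialgebra together with a bialgebra map
  \<open>u\<close> from \<open>B\<close>. The braiding of \<open>H\<close> with itself becomes \<open>t \<mapsto> R\<^sup>-\<^sup>1 t\<^sup>o\<^sup>p R\<close> for \<open>R = (u \<otimes> u)(S)\<close>, so
  cocommutativity says exactly that \<open>\<Delta>\<^sup>o\<^sup>p R = R \<Delta>\<close>. The remaining axioms of an R-matrix are
  inherited from \<open>S\<close> along \<open>u\<close>.
\<close>

text \<open>Two obstacles shape the proof. \<open>S\<close>, its inverse and
  \<open>comult B b\<close> are not pure tensors, and an element of a tensor product is merely a
  code for one chosen list of pairs, so there is no Sweedler notation. An identity about such an
  element is stated for an arbitrary element of B \<otimes> B, where both sides are linear in it,
  and specialised only after it is proved. This is why the lemmas on actions speak of all of B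
  \<otimes> B: at \<open>comult B b\<close> they give B-linearity, at \<open>S\<close> they give
  facts about the braiding. In the hexagons B \<otimes> (B \<otimes> B) takes this role; two
  consecutive braidings become two conjugations there, and the coproduct formulas merge them into
  one. The other obstacle is that an isomorphism of categories compares objects by equality. Both
  round trips have to return the very same records, values outside the carriers included. A bimonoid
  and a bialgebra are therefore compared through a relation between raw data, prior to the axioms of
  either, under which uniqueness and the equivalence of the axioms are proved separately.\<close>

lemma decode_encode [simp]: "decode (encode l) = (l :: ('u::infinite \<times> 'u) list)"
  unfolding decode_def by (simp add: inj_encode)

text \<open>This is \<open>lift\<close> on the list itself, before encoding. Inductions run over
  lists, whereas an element of the tensor product only gives access to one chosen list.\<close>

definition lsum :: "('u, 'u, 'x) module_scheme \<Rightarrow> ('u \<Rightarrow> 'u \<Rightarrow> 'u) \<Rightarrow> ('u \<times> 'u) list \<Rightarrow> 'u"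
  where "lsum P \<phi> l = foldr (\<lambda>(x, y) s. \<phi> x y \<oplus>\<^bsub>P\<^esub> s) l \<zero>\<^bsub>P\<^esub>"

lemma lsum_simps [simp]:
  "lsum P \<phi> [] = \<zero>\<^bsub>P\<^esub>" "lsum P \<phi> (z # l) = \<phi> (fst z) (snd z) \<oplus>\<^bsub>P\<^esub> lsum P \<phi> l"
  by (simp_all add: lsum_def case_prod_beta)

lemma lift_lsum: "lift P \<phi> t = lsum P \<phi> (decode t)"
  by (simp add: lift_def lsum_def)

section \<open>Linear and bilinear maps between vector spaces over \<open>K\<close>\<close>

locale vect =
  fixes K :: "('u :: infinite) ring"
  assumes K_cring: "cring K"
begin

abbreviation vs :: "('u, 'u, 'x) module_scheme \<Rightarrow> bool" where "vs M \<equiv> Module.module K M"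

text \<open>In contrast to \<open>linear_map\<close>, extensionality is left out, so that lambda
  terms and composites qualify without being restricted; \<open>linear_map_iff\<close> adds it
  back.\<close>

definition lin :: "('u, 'u, 'x) module_scheme \<Rightarrow> ('u, 'u, 'y) module_scheme \<Rightarrow> ('u \<Rightarrow> 'u) \<Rightarrow> bool"
  where "lin M N f \<longleftrightarrow> (\<forall>x\<in>carrier M. f x \<in> carrier N) \<and>
    (\<forall>x\<in>carrier M. \<forall>y\<in>carrier M. f (x \<oplus>\<^bsub>M\<^esub> y) = f x \<oplus>\<^bsub>N\<^esub> f y) \<and>
    (\<forall>c\<in>carrier K. \<forall>x\<in>carrier M. f (c \<odot>\<^bsub>M\<^esub> x) = c \<odot>\<^bsub>N\<^esub> f x)"

definition bil :: "('u, 'u, 'x) module_scheme \<Rightarrow> ('u, 'u, 'y) module_scheme \<Rightarrow>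
    ('u, 'u, 'z) module_scheme \<Rightarrow> ('u \<Rightarrow> 'u \<Rightarrow> 'u) \<Rightarrow> bool"
  where "bil M N P \<phi> \<longleftrightarrow> (\<forall>x\<in>carrier M. lin N P (\<phi> x)) \<and> (\<forall>y\<in>carrier N. lin M P (\<lambda>x. \<phi> x y))"

text \<open>The condition under which a map of pairs descends along the extra identifications
  \<open>Q\<close>. Pairs outside the carriers are exempt, as they are in the rule
  \<open>balance\<close>.\<close>

definition resp :: "('u, 'u, 'x) module_scheme \<Rightarrow> ('u, 'u, 'y) module_scheme \<Rightarrow>
    (('u \<times> 'u) \<times> ('u \<times> 'u)) set \<Rightarrow> ('u \<Rightarrow> 'u \<Rightarrow> 'u) \<Rightarrow> bool"
  where "resp M N Q \<phi> \<longleftrightarrow> (\<forall>x y x' y'. ((x, y), (x', y')) \<in> Q \<longrightarrow> x \<in> carrier M \<longrightarrow> y \<in> carrier N \<longrightarrow>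
    x' \<in> carrier M \<longrightarrow> y' \<in> carrier N \<longrightarrow> \<phi> x y = \<phi> x' y')"

text \<open>Scalars act on a formal sum through the left factors, so the congruence generated by
  \<open>Q\<close> has to be stable under scaling of left factors. This is what makes the scalar
  multiplication of \<open>tens_quot\<close> well defined.\<close>

definition scaled :: "('u, 'u, 'x) module_scheme \<Rightarrow> ('u, 'u, 'y) module_scheme \<Rightarrow>
    (('u \<times> 'u) \<times> ('u \<times> 'u)) set \<Rightarrow> bool"
  where "scaled M N Q \<longleftrightarrow> (\<forall>x y x' y' c. ((x, y), (x', y')) \<in> Q \<longrightarrow> x \<in> carrier M \<longrightarrow> y \<in> carrier N \<longrightarrow>
    x' \<in> carrier M \<longrightarrow> y' \<in> carrier N \<longrightarrow> c \<in> carrier K \<longrightarrow>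
    ((c \<odot>\<^bsub>M\<^esub> x, y), (c \<odot>\<^bsub>M\<^esub> x', y')) \<in> Q)"

lemma resp_empty [simp]: "resp M N {} \<phi>" by (simp add: resp_def)
lemma scaled_empty [simp]: "scaled M N {}" by (simp add: scaled_def)

lemma linI:
  assumes "\<And>x. x \<in> carrier M \<Longrightarrow> f x \<in> carrier N"
    and "\<And>x y. x \<in> carrier M \<Longrightarrow> y \<in> carrier M \<Longrightarrow> f (x \<oplus>\<^bsub>M\<^esub> y) = f x \<oplus>\<^bsub>N\<^esub> f y"
    and "\<And>c x. c \<in> carrier K \<Longrightarrow> x \<in> carrier M \<Longrightarrow> f (c \<odot>\<^bsub>M\<^esub> x) = c \<odot>\<^bsub>N\<^esub> f x"
  shows "lin M N f"
  using assms by (simp add: lin_def)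

lemma lin_cl: "lin M N f \<Longrightarrow> x \<in> carrier M \<Longrightarrow> f x \<in> carrier N"
  and lin_add: "lin M N f \<Longrightarrow> x \<in> carrier M \<Longrightarrow> y \<in> carrier M \<Longrightarrow> f (x \<oplus>\<^bsub>M\<^esub> y) = f x \<oplus>\<^bsub>N\<^esub> f y"
  and lin_smult: "lin M N f \<Longrightarrow> c \<in> carrier K \<Longrightarrow> x \<in> carrier M \<Longrightarrow> f (c \<odot>\<^bsub>M\<^esub> x) = c \<odot>\<^bsub>N\<^esub> f x"
  by (auto simp: lin_def)

lemma bil_cl: "bil M N P \<phi> \<Longrightarrow> x \<in> carrier M \<Longrightarrow> y \<in> carrier N \<Longrightarrow> \<phi> x y \<in> carrier P"
  by (simp add: bil_def lin_def)

lemma linear_map_iff: "linear_map K M N f \<longleftrightarrow> lin M N f \<and> f \<in> extensional (carrier M)"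
  by (auto simp: linear_map_def lin_def PiE_def)

lemma vs_ab: "vs M \<Longrightarrow> abelian_group M" by (rule module.axioms(2))

lemma add_cl [simp]: "vs M \<Longrightarrow> x \<in> carrier M \<Longrightarrow> y \<in> carrier M \<Longrightarrow> x \<oplus>\<^bsub>M\<^esub> y \<in> carrier M"
  by (rule abelian_monoid.a_closed[OF abelian_group.axioms(1)[OF vs_ab]])
lemma zero_cl [simp]: "vs M \<Longrightarrow> \<zero>\<^bsub>M\<^esub> \<in> carrier M"
  by (rule abelian_monoid.zero_closed[OF abelian_group.axioms(1)[OF vs_ab]])
lemma smult_cl [simp]: "vs M \<Longrightarrow> c \<in> carrier K \<Longrightarrow> x \<in> carrier M \<Longrightarrow> c \<odot>\<^bsub>M\<^esub> x \<in> carrier M"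
  by (rule module.smult_closed)
lemma add_assoc: "vs M \<Longrightarrow> x \<in> carrier M \<Longrightarrow> y \<in> carrier M \<Longrightarrow> z \<in> carrier M \<Longrightarrow>
    (x \<oplus>\<^bsub>M\<^esub> y) \<oplus>\<^bsub>M\<^esub> z = x \<oplus>\<^bsub>M\<^esub> (y \<oplus>\<^bsub>M\<^esub> z)"
  by (rule abelian_monoid.a_assoc[OF abelian_group.axioms(1)[OF vs_ab]])
lemma add_comm: "vs M \<Longrightarrow> x \<in> carrier M \<Longrightarrow> y \<in> carrier M \<Longrightarrow> x \<oplus>\<^bsub>M\<^esub> y = y \<oplus>\<^bsub>M\<^esub> x"
  by (rule abelian_monoid.a_comm[OF abelian_group.axioms(1)[OF vs_ab]])
lemma add_zero [simp]: "vs M \<Longrightarrow> x \<in> carrier M \<Longrightarrow> x \<oplus>\<^bsub>M\<^esub> \<zero>\<^bsub>M\<^esub> = x"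
  by (rule abelian_monoid.r_zero[OF abelian_group.axioms(1)[OF vs_ab]])
lemma zero_add [simp]: "vs M \<Longrightarrow> x \<in> carrier M \<Longrightarrow> \<zero>\<^bsub>M\<^esub> \<oplus>\<^bsub>M\<^esub> x = x"
  by (rule abelian_monoid.l_zero[OF abelian_group.axioms(1)[OF vs_ab]])
lemma add_lcomm: "vs M \<Longrightarrow> x \<in> carrier M \<Longrightarrow> y \<in> carrier M \<Longrightarrow> z \<in> carrier M \<Longrightarrow>
    x \<oplus>\<^bsub>M\<^esub> (y \<oplus>\<^bsub>M\<^esub> z) = y \<oplus>\<^bsub>M\<^esub> (x \<oplus>\<^bsub>M\<^esub> z)"
  using add_assoc[of M x y z] add_assoc[of M y x z] add_comm[of M x y] by simp
lemma zero_smult [simp]: "vs M \<Longrightarrow> x \<in> carrier M \<Longrightarrow> \<zero>\<^bsub>K\<^esub> \<odot>\<^bsub>M\<^esub> x = \<zero>\<^bsub>M\<^esub>"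
  by (rule module.smult_l_null)
lemma smult_zero [simp]: "vs M \<Longrightarrow> c \<in> carrier K \<Longrightarrow> c \<odot>\<^bsub>M\<^esub> \<zero>\<^bsub>M\<^esub> = \<zero>\<^bsub>M\<^esub>"
  by (rule module.smult_r_null)
lemma one_smult [simp]: "vs M \<Longrightarrow> x \<in> carrier M \<Longrightarrow> \<one>\<^bsub>K\<^esub> \<odot>\<^bsub>M\<^esub> x = x"
  by (rule module.smult_one)
lemma smult_add: "vs M \<Longrightarrow> c \<in> carrier K \<Longrightarrow> x \<in> carrier M \<Longrightarrow> y \<in> carrier M \<Longrightarrow>
    c \<odot>\<^bsub>M\<^esub> (x \<oplus>\<^bsub>M\<^esub> y) = c \<odot>\<^bsub>M\<^esub> x \<oplus>\<^bsub>M\<^esub> c \<odot>\<^bsub>M\<^esub> y"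
  by (rule module.smult_r_distr)
lemma add_smult: "vs M \<Longrightarrow> c \<in> carrier K \<Longrightarrow> d \<in> carrier K \<Longrightarrow> x \<in> carrier M \<Longrightarrow>
    (c \<oplus>\<^bsub>K\<^esub> d) \<odot>\<^bsub>M\<^esub> x = c \<odot>\<^bsub>M\<^esub> x \<oplus>\<^bsub>M\<^esub> d \<odot>\<^bsub>M\<^esub> x"
  by (rule module.smult_l_distr)
lemma smult_smult: "vs M \<Longrightarrow> c \<in> carrier K \<Longrightarrow> d \<in> carrier K \<Longrightarrow> x \<in> carrier M \<Longrightarrow>
    (c \<otimes>\<^bsub>K\<^esub> d) \<odot>\<^bsub>M\<^esub> x = c \<odot>\<^bsub>M\<^esub> (d \<odot>\<^bsub>M\<^esub> x)"
  by (rule module.smult_assoc1)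
lemma smult_lcomm: "vs M \<Longrightarrow> c \<in> carrier K \<Longrightarrow> d \<in> carrier K \<Longrightarrow> x \<in> carrier M \<Longrightarrow>
    c \<odot>\<^bsub>M\<^esub> (d \<odot>\<^bsub>M\<^esub> x) = d \<odot>\<^bsub>M\<^esub> (c \<odot>\<^bsub>M\<^esub> x)"
  using smult_smult[of M c d x] smult_smult[of M d c x] cring.cring_simprules(14)[OF K_cring, of c d] by simp

lemma K_simps [simp]: "\<zero>\<^bsub>K\<^esub> \<in> carrier K" "\<one>\<^bsub>K\<^esub> \<in> carrier K"
  "c \<in> carrier K \<Longrightarrow> d \<in> carrier K \<Longrightarrow> c \<oplus>\<^bsub>K\<^esub> d \<in> carrier K"
  "c \<in> carrier K \<Longrightarrow> d \<in> carrier K \<Longrightarrow> c \<otimes>\<^bsub>K\<^esub> d \<in> carrier K"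
  using cring.cring_simprules(1,2,5,6)[OF K_cring] by simp_all

lemma lin_zero: "vs M \<Longrightarrow> vs N \<Longrightarrow> lin M N f \<Longrightarrow> f \<zero>\<^bsub>M\<^esub> = \<zero>\<^bsub>N\<^esub>"
  using lin_smult[of M N f "\<zero>\<^bsub>K\<^esub>" "\<zero>\<^bsub>M\<^esub>"] lin_cl[of M N f "\<zero>\<^bsub>M\<^esub>"] by simp

text \<open>Negatives are supplied by the scalar -1: from (-1 + 1) x = 0 x = 0 the element (-1) x is
  inverse to x. A vector space is thus recognised from addition, zero and scalars, which suits
  quotients of formal sums without signs.\<close>

lemma vs_I:
  assumes "\<And>x y. x \<in> carrier M \<Longrightarrow> y \<in> carrier M \<Longrightarrow> x \<oplus>\<^bsub>M\<^esub> y \<in> carrier M"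
    and "\<zero>\<^bsub>M\<^esub> \<in> carrier M"
    and "\<And>x y z. x \<in> carrier M \<Longrightarrow> y \<in> carrier M \<Longrightarrow> z \<in> carrier M \<Longrightarrow>
      (x \<oplus>\<^bsub>M\<^esub> y) \<oplus>\<^bsub>M\<^esub> z = x \<oplus>\<^bsub>M\<^esub> (y \<oplus>\<^bsub>M\<^esub> z)"
    and "\<And>x y. x \<in> carrier M \<Longrightarrow> y \<in> carrier M \<Longrightarrow> x \<oplus>\<^bsub>M\<^esub> y = y \<oplus>\<^bsub>M\<^esub> x"
    and "\<And>x. x \<in> carrier M \<Longrightarrow> \<zero>\<^bsub>M\<^esub> \<oplus>\<^bsub>M\<^esub> x = x"
    and "\<And>c x. c \<in> carrier K \<Longrightarrow> x \<in> carrier M \<Longrightarrow> c \<odot>\<^bsub>M\<^esub> x \<in> carrier M"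
    and z: "\<And>x. x \<in> carrier M \<Longrightarrow> \<zero>\<^bsub>K\<^esub> \<odot>\<^bsub>M\<^esub> x = \<zero>\<^bsub>M\<^esub>"
    and o: "\<And>x. x \<in> carrier M \<Longrightarrow> \<one>\<^bsub>K\<^esub> \<odot>\<^bsub>M\<^esub> x = x"
    and "\<And>c x y. c \<in> carrier K \<Longrightarrow> x \<in> carrier M \<Longrightarrow> y \<in> carrier M \<Longrightarrow>
      c \<odot>\<^bsub>M\<^esub> (x \<oplus>\<^bsub>M\<^esub> y) = c \<odot>\<^bsub>M\<^esub> x \<oplus>\<^bsub>M\<^esub> c \<odot>\<^bsub>M\<^esub> y"
    and a: "\<And>c d x. c \<in> carrier K \<Longrightarrow> d \<in> carrier K \<Longrightarrow> x \<in> carrier M \<Longrightarrow>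
      (c \<oplus>\<^bsub>K\<^esub> d) \<odot>\<^bsub>M\<^esub> x = c \<odot>\<^bsub>M\<^esub> x \<oplus>\<^bsub>M\<^esub> d \<odot>\<^bsub>M\<^esub> x"
    and "\<And>c d x. c \<in> carrier K \<Longrightarrow> d \<in> carrier K \<Longrightarrow> x \<in> carrier M \<Longrightarrow>
      (c \<otimes>\<^bsub>K\<^esub> d) \<odot>\<^bsub>M\<^esub> x = c \<odot>\<^bsub>M\<^esub> (d \<odot>\<^bsub>M\<^esub> x)"
  shows "vs M"
proof (rule Module.module.intro[OF K_cring])
  have m: "\<ominus>\<^bsub>K\<^esub> \<one>\<^bsub>K\<^esub> \<in> carrier K" "\<ominus>\<^bsub>K\<^esub> \<one>\<^bsub>K\<^esub> \<oplus>\<^bsub>K\<^esub> \<one>\<^bsub>K\<^esub> = \<zero>\<^bsub>K\<^esub>"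
    using cring.cring_simprules(3,9)[OF K_cring] by simp_all
  show "abelian_group M"
  proof (rule abelian_groupI)
    fix x assume x: "x \<in> carrier M"
    have "(\<ominus>\<^bsub>K\<^esub> \<one>\<^bsub>K\<^esub>) \<odot>\<^bsub>M\<^esub> x \<oplus>\<^bsub>M\<^esub> x = \<zero>\<^bsub>M\<^esub>"
      using a[OF m(1) K_simps(2) x] x by (simp add: m o z)
    then show "\<exists>y\<in>carrier M. y \<oplus>\<^bsub>M\<^esub> x = \<zero>\<^bsub>M\<^esub>" using assms(6)[OF m(1) x] by blast
  qed (fact assms)+
  show "Module.module_axioms K M" by (rule Module.module_axioms.intro) (fact assms)+
qed

subsection \<open>Tensor products\<close>

text \<open>One vector space occurs inside records of several types (module, bimodule, bialgebra)
  and inside records that differ in other fields. This lemma and the next ones express that the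
  linear notions see at most \<open>carrier\<close>, \<open>add\<close>, \<open>zero\<close> and
  \<open>smult\<close>.\<close>

lemma vs_cong:
  assumes "carrier M = carrier M'" "add M = add M'" "zero M = zero M'" "smult M = smult M'"
  shows "vs M \<longleftrightarrow> vs M'"
proof -
  have *: "vs M'" if "vs M" "carrier M = carrier M'" "add M = add M'" "zero M = zero M'" "smult M = smult M'"
    for M :: "('u, 'u, 'x) module_scheme" and M' :: "('u, 'u, 'y) module_scheme"
    by (rule vs_I) (fact add_cl[OF that(1), unfolded that(2-)] zero_cl[OF that(1), unfolded that(2-)]
      smult_cl[OF that(1), unfolded that(2-)] add_assoc[OF that(1), unfolded that(2-)]
      add_comm[OF that(1), unfolded that(2-)] zero_add[OF that(1), unfolded that(2-)]
      zero_smult[OF that(1), unfolded that(2-)] one_smult[OF that(1), unfolded that(2-)]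
      smult_add[OF that(1), unfolded that(2-)] add_smult[OF that(1), unfolded that(2-)]
      smult_smult[OF that(1), unfolded that(2-)])+
  show ?thesis using *[of M M'] *[of M' M] assms by metis
qed

lemma tens_equiv_mono:
  assumes "tens_equiv K M N Q l l'"
    and "carrier M = carrier M'" "add M = add M'" "zero M = zero M'" "smult M = smult M'"
    and "carrier N = carrier N'" "add N = add N'" "zero N = zero N'" "smult N = smult N'"
  shows "tens_equiv K M' N' Q l l'"
  using assms
  apply (induction rule: tens_equiv.induct)
           apply (auto intro: tens_equiv.refl)[1]
          apply (metis tens_equiv.sym)
         apply (metis tens_equiv.trans)
        apply (metis tens_equiv.append)
       apply (metis tens_equiv.commute)
      apply (metis tens_equiv.zero)
     apply (metis tens_equiv.add_left)
    apply (metis tens_equiv.add_right)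
   apply (metis tens_equiv.scalar)
  apply (metis tens_equiv.balance)
  done

lemma tens_equiv_cong:
  assumes "carrier M = carrier M'" "add M = add M'" "zero M = zero M'" "smult M = smult M'"
    and "carrier N = carrier N'" "add N = add N'" "zero N = zero N'" "smult N = smult N'"
  shows "tens_equiv K M N Q = tens_equiv K M' N' Q"
  using tens_equiv_mono[of M N Q _ _ M' N'] tens_equiv_mono[of M' N' Q _ _ M N] assms
  by (intro ext) metis

lemma tens_class_cong:
  assumes "carrier M = carrier M'" "add M = add M'" "zero M = zero M'" "smult M = smult M'"
    and "carrier N = carrier N'" "add N = add N'" "zero N = zero N'" "smult N = smult N'"
  shows "tens_class K M N Q = tens_class K M' N' Q"
  unfolding tens_class_def tens_equiv_cong[OF assms] ..

lemma tens_quot_cong: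
  assumes "carrier M = carrier M'" "add M = add M'" "zero M = zero M'" "smult M = smult M'"
    and "carrier N = carrier N'" "add N = add N'" "zero N = zero N'" "smult N = smult N'"
  shows "tens_quot K M N Q = tens_quot K M' N' Q"
  unfolding tens_quot_def tens_class_cong[OF assms] using assms by simp

lemma lin_cong:
  assumes "carrier M = carrier M'" "add M = add M'" "zero M = zero M'" "smult M = smult M'"
    and "carrier N = carrier N'" "add N = add N'" "zero N = zero N'" "smult N = smult N'"
  shows "lin M N = lin M' N'"
  using assms by (intro ext) (simp add: lin_def)

lemma lift_cong_struct:
  assumes "add M = add M'" "zero M = zero M'"
  shows "lift M = lift M'"
  using assms by (intro ext) (simp add: lift_def)

context
  fixes M :: "('u, 'u, 'x) module_scheme" and N :: "('u, 'u, 'y) module_scheme"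
    and Q :: "(('u \<times> 'u) \<times> ('u \<times> 'u)) set"
  assumes M: "vs M" and N: "vs N"
begin

lemma equiv_lists:
  "tens_equiv K M N Q l l' \<Longrightarrow> l \<in> lists (carrier M \<times> carrier N) \<and> l' \<in> lists (carrier M \<times> carrier N)"
  by (induction rule: tens_equiv.induct) (use M N in auto)

text \<open>By symmetry and transitivity, equivalent lists have the same predicate
  \<open>tens_equiv K M N Q l\<close>, and the choice operator picks the same representative from
  equal predicates.\<close>

lemma class_eqI: "tens_equiv K M N Q l l' \<Longrightarrow> tens_class K M N Q l = tens_class K M N Q l'"
proof -
  assume a: "tens_equiv K M N Q l l'"
  have "tens_equiv K M N Q l = tens_equiv K M N Q l'"
    using a by (intro ext) (meson tens_equiv.sym tens_equiv.trans)
  then show ?thesis by (simp add: tens_class_def)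
qed

lemma decode_class: "l \<in> lists (carrier M \<times> carrier N) \<Longrightarrow> tens_equiv K M N Q l (decode (tens_class K M N Q l))"
  unfolding tens_class_def by (simp, rule someI[of _ l]) (rule tens_equiv.refl)

lemma in_tens_decode:
  assumes "t \<in> carrier (tens_quot K M N Q)"
  shows "decode t \<in> lists (carrier M \<times> carrier N)" "tens_class K M N Q (decode t) = t"
proof -
  obtain l where l: "l \<in> lists (carrier M \<times> carrier N)" "t = tens_class K M N Q l"
    using assms by (auto simp: tens_quot_def Let_def)
  then show "decode t \<in> lists (carrier M \<times> carrier N)" using decode_class equiv_lists by blast
  show "tens_class K M N Q (decode t) = t" using l decode_class class_eqI by metis
qed

lemma class_in_tens [simp]: "l \<in> lists (carrier M \<times> carrier N) \<Longrightarrow> tens_class K M N Q l \<in> carrier (tens_quot K M N Q)"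
  by (simp add: tens_quot_def Let_def)

lemma class_append:
  assumes "l \<in> lists (carrier M \<times> carrier N)" "r \<in> lists (carrier M \<times> carrier N)"
  shows "tens_class K M N Q l \<oplus>\<^bsub>tens_quot K M N Q\<^esub> tens_class K M N Q r = tens_class K M N Q (l @ r)"
  using class_in_tens[OF assms(1)] class_in_tens[OF assms(2)]
    class_eqI[OF tens_equiv.append[OF decode_class[OF assms(1)] decode_class[OF assms(2)]]]
  by (simp add: tens_quot_def Let_def restrict2_def)

lemma tens_zero: "\<zero>\<^bsub>tens_quot K M N Q\<^esub> = tens_class K M N Q []"
  by (simp add: tens_quot_def Let_def)

text \<open>Write the zero of \<open>M\<close> as the scalar 0 times itself and move the scalar to
  the right factor; this reaches the pair of zeros, which the rule \<open>zero\<close>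
  removes.\<close>

lemma equiv_zero_left:
  assumes "y \<in> carrier N" shows "tens_equiv K M N Q [(\<zero>\<^bsub>M\<^esub>, y)] []"
  using tens_equiv.scalar[of "\<zero>\<^bsub>K\<^esub>" K "\<zero>\<^bsub>M\<^esub>" M y N Q] assms M N tens_equiv.zero[of K M N Q]
  by (simp add: tens_equiv.trans)

text \<open>Induction over the congruence; the hypothesis \<open>scaled\<close> is what the case
  \<open>balance\<close> consumes, and the case \<open>scalar\<close> uses that scalars
  commute.\<close>

lemma equiv_scale:
  assumes "tens_equiv K M N Q l l'" "c \<in> carrier K" "scaled M N Q"
  shows "tens_equiv K M N Q (map (\<lambda>(x, y). (c \<odot>\<^bsub>M\<^esub> x, y)) l) (map (\<lambda>(x, y). (c \<odot>\<^bsub>M\<^esub> x, y)) l')"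
  using assms
proof (induction rule: tens_equiv.induct)
  case (refl l) then show ?case by (intro tens_equiv.refl) (use M in fastforce)
next
  case (sym l l') then show ?case by (blast intro: tens_equiv.sym)
next
  case (trans l l' l'') then show ?case by (blast intro: tens_equiv.trans)
next
  case (append l l' r r') then show ?case by (simp add: tens_equiv.append)
next
  case (commute l r)
  have "map (\<lambda>(x, y). (c \<odot>\<^bsub>M\<^esub> x, y)) l \<in> lists (carrier M \<times> carrier N)"
    if "l \<in> lists (carrier M \<times> carrier N)" for l
    using that M commute(3) by fastforce
  then show ?case using commute by (simp add: tens_equiv.commute)
next
  case zero then show ?case using M by (simp add: tens_equiv.zero)
next
  case (add_left x x' y) then show ?case using M by (simp add: smult_add tens_equiv.add_left)
next
  case (add_right x y y') then show ?case using M by (simp add: tens_equiv.add_right)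
next
  case (scalar d x y) then show ?case
    using M tens_equiv.scalar[of d K "c \<odot>\<^bsub>M\<^esub> x" M y N Q] by (simp add: smult_lcomm[of M c d])
next
  case (balance p q)
  then have "((c \<odot>\<^bsub>M\<^esub> fst p, snd p), (c \<odot>\<^bsub>M\<^esub> fst q, snd q)) \<in> Q"
    unfolding scaled_def by (metis mem_Times_iff prod.collapse)
  then show ?case using balance M by (auto simp: case_prod_beta intro!: tens_equiv.balance)
qed

lemma class_smult:
  assumes "l \<in> lists (carrier M \<times> carrier N)" "c \<in> carrier K" "scaled M N Q"
  shows "c \<odot>\<^bsub>tens_quot K M N Q\<^esub> tens_class K M N Q l = tens_class K M N Q (map (\<lambda>(x, y). (c \<odot>\<^bsub>M\<^esub> x, y)) l)"
  using class_in_tens[OF assms(1)] assms(2)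
    class_eqI[OF equiv_scale[OF decode_class[OF assms(1)] assms(2,3)]]
  by (simp add: tens_quot_def Let_def restrict2_def)

text \<open>No case for zero appears, because the empty sum equals the pure tensor of the two
  zeros.\<close>

lemma class_induct:
  assumes t: "t \<in> carrier (tens_quot K M N Q)"
    and p: "\<And>x y. x \<in> carrier M \<Longrightarrow> y \<in> carrier N \<Longrightarrow> P (tens_class K M N Q [(x, y)])"
    and a: "\<And>s t. s \<in> carrier (tens_quot K M N Q) \<Longrightarrow> t \<in> carrier (tens_quot K M N Q) \<Longrightarrow>
      P s \<Longrightarrow> P t \<Longrightarrow> P (s \<oplus>\<^bsub>tens_quot K M N Q\<^esub> t)"
  shows "P t"
proof -
  have "P (tens_class K M N Q l)" if "l \<in> lists (carrier M \<times> carrier N)" for l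
    using that
  proof (induction l)
    case Nil
    then show ?case using p[of "\<zero>\<^bsub>M\<^esub>" "\<zero>\<^bsub>N\<^esub>"] M N class_eqI[OF tens_equiv.zero] by simp
  next
    case (Cons z l)
    then have "P (tens_class K M N Q [z])" using p by (cases z) auto
    then have "P (tens_class K M N Q [z] \<oplus>\<^bsub>tens_quot K M N Q\<^esub> tens_class K M N Q l)"
      by (intro a) (use Cons in auto)
    then show ?case using Cons by (subst (asm) class_append) auto
  qed
  then show ?thesis using in_tens_decode[OF t] by metis
qed

lemma map_scale_lists: "c \<in> carrier K \<Longrightarrow> l \<in> lists (carrier M \<times> carrier N) \<Longrightarrow>
    map (\<lambda>(x, y). (c \<odot>\<^bsub>M\<^esub> x, y)) l \<in> lists (carrier M \<times> carrier N)"
  using M by fastforce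

lemma tens_vs: assumes Q: "scaled M N Q" shows "vs (tens_quot K M N Q)"
proof -
  let ?T = "tens_quot K M N Q" and ?L = "lists (carrier M \<times> carrier N)" and ?c = "tens_class K M N Q"
  have ex: "\<exists>l. l \<in> ?L \<and> t = ?c l" if "t \<in> carrier ?T" for t
    using in_tens_decode[OF that] by metis
  have closed: "c \<odot>\<^bsub>?T\<^esub> t \<in> carrier ?T" if ct: "c \<in> carrier K" "t \<in> carrier ?T" for c t
  proof -
    obtain l where "l \<in> ?L" "t = ?c l" using ex[OF ct(2)] by blast
    then show ?thesis using ct(1) Q class_smult map_scale_lists class_in_tens by metis
  qed
  have add_closed: "s \<oplus>\<^bsub>?T\<^esub> t \<in> carrier ?T" if st: "s \<in> carrier ?T" "t \<in> carrier ?T" for s t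
  proof -
    obtain l r where "l \<in> ?L" "s = ?c l" "r \<in> ?L" "t = ?c r" using ex[OF st(1)] ex[OF st(2)] by blast
    then show ?thesis by (simp add: class_append)
  qed
  have assoc: "(s \<oplus>\<^bsub>?T\<^esub> t) \<oplus>\<^bsub>?T\<^esub> u = s \<oplus>\<^bsub>?T\<^esub> (t \<oplus>\<^bsub>?T\<^esub> u)"
    if stu: "s \<in> carrier ?T" "t \<in> carrier ?T" "u \<in> carrier ?T" for s t u
  proof -
    obtain l r k where "l \<in> ?L" "s = ?c l" "r \<in> ?L" "t = ?c r" "k \<in> ?L" "u = ?c k"
      using ex[OF stu(1)] ex[OF stu(2)] ex[OF stu(3)] by blast
    then show ?thesis by (simp add: class_append)
  qed
  have comm: "s \<oplus>\<^bsub>?T\<^esub> t = t \<oplus>\<^bsub>?T\<^esub> s" if st: "s \<in> carrier ?T" "t \<in> carrier ?T" for s t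
  proof -
    obtain l r where "l \<in> ?L" "s = ?c l" "r \<in> ?L" "t = ?c r" using ex[OF st(1)] ex[OF st(2)] by blast
    then show ?thesis by (simp add: class_append class_eqI tens_equiv.commute)
  qed
  \<comment> \<open>Rearrangement of four summands, used when distributivity over a sum of scalars
    is propagated to a sum of tensors.\<close>
  have m4: "(s \<oplus>\<^bsub>?T\<^esub> t) \<oplus>\<^bsub>?T\<^esub> (u \<oplus>\<^bsub>?T\<^esub> v) = (s \<oplus>\<^bsub>?T\<^esub> u) \<oplus>\<^bsub>?T\<^esub> (t \<oplus>\<^bsub>?T\<^esub> v)"
    if "s \<in> carrier ?T" "t \<in> carrier ?T" "u \<in> carrier ?T" "v \<in> carrier ?T" for s t u v
  proof -
    have "t \<oplus>\<^bsub>?T\<^esub> (u \<oplus>\<^bsub>?T\<^esub> v) = u \<oplus>\<^bsub>?T\<^esub> (t \<oplus>\<^bsub>?T\<^esub> v)"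
      using that by (metis assoc comm)
    then show ?thesis using that by (simp add: assoc add_closed)
  qed
  have smadd: "c \<odot>\<^bsub>?T\<^esub> (s \<oplus>\<^bsub>?T\<^esub> t) = c \<odot>\<^bsub>?T\<^esub> s \<oplus>\<^bsub>?T\<^esub> c \<odot>\<^bsub>?T\<^esub> t"
    if "c \<in> carrier K" and st: "s \<in> carrier ?T" "t \<in> carrier ?T" for c s t
  proof -
    obtain l r where "l \<in> ?L" "s = ?c l" "r \<in> ?L" "t = ?c r" using ex[OF st(1)] ex[OF st(2)] by blast
    then show ?thesis using that(1) Q
      by (simp add: class_append class_smult map_scale_lists)
  qed
  show ?thesis
  proof (rule vs_I)
    fix x assume x: "x \<in> carrier ?T"
    show "\<zero>\<^bsub>?T\<^esub> \<oplus>\<^bsub>?T\<^esub> x = x" using ex[OF x] by (metis tens_zero class_append lists.Nil append_Nil)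
    show "\<one>\<^bsub>K\<^esub> \<odot>\<^bsub>?T\<^esub> x = x" using x
      by (rule class_induct) (use M Q smadd in \<open>simp_all add: class_smult\<close>)
    show "\<zero>\<^bsub>K\<^esub> \<odot>\<^bsub>?T\<^esub> x = \<zero>\<^bsub>?T\<^esub>" using x
    proof (rule class_induct)
      fix x y assume "x \<in> carrier M" "y \<in> carrier N"
      then show "\<zero>\<^bsub>K\<^esub> \<odot>\<^bsub>?T\<^esub> ?c [(x, y)] = \<zero>\<^bsub>?T\<^esub>"
        using M Q class_eqI[OF equiv_zero_left[of y]] by (simp add: class_smult tens_zero)
    qed (simp_all add: smadd, simp add: tens_zero class_append)
    fix c d assume c: "c \<in> carrier K" "d \<in> carrier K"
    show "(c \<oplus>\<^bsub>K\<^esub> d) \<odot>\<^bsub>?T\<^esub> x = c \<odot>\<^bsub>?T\<^esub> x \<oplus>\<^bsub>?T\<^esub> d \<odot>\<^bsub>?T\<^esub> x" using x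
    proof (rule class_induct)
      fix x y assume "x \<in> carrier M" "y \<in> carrier N"
      then show "(c \<oplus>\<^bsub>K\<^esub> d) \<odot>\<^bsub>?T\<^esub> ?c [(x, y)] = c \<odot>\<^bsub>?T\<^esub> ?c [(x, y)] \<oplus>\<^bsub>?T\<^esub> d \<odot>\<^bsub>?T\<^esub> ?c [(x, y)]"
        using M Q c by (simp add: class_smult class_append add_smult class_eqI tens_equiv.add_left)
    next
      fix s t assume "s \<in> carrier ?T" "t \<in> carrier ?T"
        and "(c \<oplus>\<^bsub>K\<^esub> d) \<odot>\<^bsub>?T\<^esub> s = c \<odot>\<^bsub>?T\<^esub> s \<oplus>\<^bsub>?T\<^esub> d \<odot>\<^bsub>?T\<^esub> s"
        and "(c \<oplus>\<^bsub>K\<^esub> d) \<odot>\<^bsub>?T\<^esub> t = c \<odot>\<^bsub>?T\<^esub> t \<oplus>\<^bsub>?T\<^esub> d \<odot>\<^bsub>?T\<^esub> t"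
      then show "(c \<oplus>\<^bsub>K\<^esub> d) \<odot>\<^bsub>?T\<^esub> (s \<oplus>\<^bsub>?T\<^esub> t) = c \<odot>\<^bsub>?T\<^esub> (s \<oplus>\<^bsub>?T\<^esub> t) \<oplus>\<^bsub>?T\<^esub> d \<odot>\<^bsub>?T\<^esub> (s \<oplus>\<^bsub>?T\<^esub> t)"
        using c by (simp add: smadd closed m4)
    qed
    show "(c \<otimes>\<^bsub>K\<^esub> d) \<odot>\<^bsub>?T\<^esub> x = c \<odot>\<^bsub>?T\<^esub> (d \<odot>\<^bsub>?T\<^esub> x)" using x
      by (rule class_induct) (use M Q c in \<open>simp_all add: class_smult smult_smult smadd closed\<close>)
  qed (fact add_closed assoc comm closed smadd | simp add: tens_zero)+
qed

lemma lsum_append: "vs P \<Longrightarrow> (\<And>x y. x \<in> carrier M \<Longrightarrow> y \<in> carrier N \<Longrightarrow> \<phi> x y \<in> carrier P) \<Longrightarrow>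
    l \<in> lists (carrier M \<times> carrier N) \<Longrightarrow> r \<in> lists (carrier M \<times> carrier N) \<Longrightarrow>
    lsum P \<phi> l \<in> carrier P \<and> lsum P \<phi> (l @ r) = lsum P \<phi> l \<oplus>\<^bsub>P\<^esub> lsum P \<phi> r \<and> lsum P \<phi> r \<in> carrier P"
proof (induction l)
  case Nil
  from Nil(4) have "lsum P \<phi> r \<in> carrier P"
    by (induction r) (use Nil(1,2) in auto)
  then show ?case using Nil by simp
next
  case (Cons z l)
  then have "\<phi> (fst z) (snd z) \<in> carrier P" by auto
  then show ?case using Cons by (simp add: add_assoc)
qed

text \<open>The value of a formal sum is invariant under each generator of the congruence. Hence
  \<open>lift\<close>, computed on the chosen representative, may be evaluated on any other one;
  this is the universal property of the quotient.\<close>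

lemma lsum_equiv:
  assumes "vs P" "bil M N P \<phi>" "resp M N Q \<phi>" "tens_equiv K M N Q l l'"
  shows "lsum P \<phi> l = lsum P \<phi> l'"
  using assms(4)
proof (induction rule: tens_equiv.induct)
  have cl: "\<And>x y. x \<in> carrier M \<Longrightarrow> y \<in> carrier N \<Longrightarrow> \<phi> x y \<in> carrier P"
    using assms(2) by (auto simp: bil_def lin_def)
  have ap: "lsum P \<phi> l \<in> carrier P \<and> lsum P \<phi> (l @ r) = lsum P \<phi> l \<oplus>\<^bsub>P\<^esub> lsum P \<phi> r \<and> lsum P \<phi> r \<in> carrier P"
    if "l \<in> lists (carrier M \<times> carrier N)" "r \<in> lists (carrier M \<times> carrier N)" for l r
    using lsum_append[OF assms(1) _ that, of \<phi>] cl by blast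
  {
    case (append l l' r r')
    then show ?case using ap[of l r] ap[of l' r'] equiv_lists[OF append(1)] equiv_lists[OF append(2)] by simp
  next
    case (commute l r)
    then show ?case using ap[of l r] ap[of r l] assms(1) by (simp add: add_comm)
  next
    case zero
    have "\<phi> \<zero>\<^bsub>M\<^esub> \<zero>\<^bsub>N\<^esub> = \<zero>\<^bsub>P\<^esub>" using assms(1,2) M N lin_zero[OF N assms(1)] by (auto simp: bil_def)
    then show ?case using assms(1) by simp
  next
    case (add_left x x' y) then show ?case using assms(1,2) cl by (auto simp: bil_def lin_def add_assoc)
  next
    case (add_right x x' y) then show ?case using assms(1,2) cl by (auto simp: bil_def lin_def add_assoc)
  next
    case (scalar c x y)
    then have "lin M P (\<lambda>x. \<phi> x y)" "lin N P (\<phi> x)" using assms(2) by (auto simp: bil_def)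
    then show ?case using scalar assms(1) cl M N by (simp add: lin_smult[of M P "\<lambda>x. \<phi> x y"] lin_smult[of N P "\<phi> x"])
  next
    case (balance p q)
    then have "\<phi> (fst p) (snd p) = \<phi> (fst q) (snd q)"
      using assms(3) unfolding resp_def by (metis mem_Times_iff prod.collapse)
    then show ?case by simp
  }
qed (simp_all (no_asm_simp))

lemma lift_class:
  assumes "vs P" "bil M N P \<phi>" "resp M N Q \<phi>" "l \<in> lists (carrier M \<times> carrier N)"
  shows "lift P \<phi> (tens_class K M N Q l) = lsum P \<phi> l"
  using lsum_equiv[OF assms(1-3) decode_class[OF assms(4)]] by (simp add: lift_lsum)

lemma lift_pure:
  assumes "vs P" "bil M N P \<phi>" "resp M N Q \<phi>" "x \<in> carrier M" "y \<in> carrier N"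
  shows "lift P \<phi> (tens_class K M N Q [(x, y)]) = \<phi> x y"
  using lift_class[OF assms(1-3), of "[(x,y)]"] assms(1,4,5) bil_cl[OF assms(2,4,5)] by simp

lemma lift_cl:
  assumes "vs P" "\<And>x y. x \<in> carrier M \<Longrightarrow> y \<in> carrier N \<Longrightarrow> \<phi> x y \<in> carrier P"
    "t \<in> carrier (tens_quot K M N Q)"
  shows "lift P \<phi> t \<in> carrier P"
  using lsum_append[of P \<phi>] assms in_tens_decode[OF assms(3)] by (simp add: lift_lsum)

text \<open>Additivity comes from concatenating representatives; with it at hand, homogeneity only
  has to be checked on pure tensors.\<close>

lemma lift_lin:
  assumes P: "vs P" and b: "bil M N P \<phi>" and r: "resp M N Q \<phi>" and Q: "scaled M N Q"
  shows "lin (tens_quot K M N Q) P (lift P \<phi>)"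
proof (rule linI)
  let ?T = "tens_quot K M N Q"
  have cl: "\<And>x y. x \<in> carrier M \<Longrightarrow> y \<in> carrier N \<Longrightarrow> \<phi> x y \<in> carrier P"
    using b by (auto simp: bil_def lin_def)
  note V = tens_vs[OF Q]
  show cl': "lift P \<phi> x \<in> carrier P" if "x \<in> carrier ?T" for x using lift_cl[of P \<phi> x] P cl that by blast
  show ad: "lift P \<phi> (s \<oplus>\<^bsub>?T\<^esub> t) = lift P \<phi> s \<oplus>\<^bsub>P\<^esub> lift P \<phi> t" if st: "s \<in> carrier ?T" "t \<in> carrier ?T" for s t
  proof -
    have l: "decode s @ decode t \<in> lists (carrier M \<times> carrier N)"
      using in_tens_decode st by simp
    have "lift P \<phi> (s \<oplus>\<^bsub>?T\<^esub> t) = lift P \<phi> (tens_class K M N Q (decode s @ decode t))"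
      using class_append[of "decode s" "decode t"] in_tens_decode st by simp
    also have "\<dots> = lsum P \<phi> (decode s @ decode t)" by (rule lift_class[OF P b r l])
    finally show ?thesis using lsum_append[of P \<phi> "decode s" "decode t"] P cl in_tens_decode st by (simp add: lift_lsum)
  qed
  fix c t assume c: "c \<in> carrier K" and t: "t \<in> carrier ?T"
  from t show "lift P \<phi> (c \<odot>\<^bsub>?T\<^esub> t) = c \<odot>\<^bsub>P\<^esub> lift P \<phi> t"
  proof (rule class_induct)
    fix x y assume xy: "x \<in> carrier M" "y \<in> carrier N"
    then have "lin M P (\<lambda>x. \<phi> x y)" using b by (simp add: bil_def)
    from lin_smult[OF this c xy(1)]
    show "lift P \<phi> (c \<odot>\<^bsub>?T\<^esub> tens_class K M N Q [(x, y)]) = c \<odot>\<^bsub>P\<^esub> lift P \<phi> (tens_class K M N Q [(x, y)])"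
      using xy M c by (simp add: class_smult Q lift_pure[OF P b r])
  next
    fix s t assume "s \<in> carrier ?T" "t \<in> carrier ?T"
      and "lift P \<phi> (c \<odot>\<^bsub>?T\<^esub> s) = c \<odot>\<^bsub>P\<^esub> lift P \<phi> s" "lift P \<phi> (c \<odot>\<^bsub>?T\<^esub> t) = c \<odot>\<^bsub>P\<^esub> lift P \<phi> t"
    then show "lift P \<phi> (c \<odot>\<^bsub>?T\<^esub> (s \<oplus>\<^bsub>?T\<^esub> t)) = c \<odot>\<^bsub>P\<^esub> lift P \<phi> (s \<oplus>\<^bsub>?T\<^esub> t)"
      using c by (simp add: smult_add[OF V] V ad smult_add[OF P] cl')
  qed
qed

lemma pure_lin1: "scaled M N Q \<Longrightarrow> y \<in> carrier N \<Longrightarrow> lin M (tens_quot K M N Q) (\<lambda>x. tens_class K M N Q [(x, y)])"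
  by (rule linI) (use M N in \<open>simp_all add: class_append class_smult class_eqI tens_equiv.add_left\<close>)

lemma pure_lin2: "scaled M N Q \<Longrightarrow> x \<in> carrier M \<Longrightarrow> lin N (tens_quot K M N Q) (\<lambda>y. tens_class K M N Q [(x, y)])"
  by (rule linI) (use M N in \<open>simp_all add: class_append class_smult class_eqI tens_equiv.add_right
     class_eqI[OF tens_equiv.scalar]\<close>)

lemma pure_Q: "((x, y), (x', y')) \<in> Q \<Longrightarrow> x \<in> carrier M \<Longrightarrow> x' \<in> carrier M \<Longrightarrow> y \<in> carrier N \<Longrightarrow> y' \<in> carrier N \<Longrightarrow>
    tens_class K M N Q [(x, y)] = tens_class K M N Q [(x', y')]"
  by (rule class_eqI, rule tens_equiv.balance) auto

lemma lin_eq_tens: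
  assumes "lin (tens_quot K M N Q) P f" "lin (tens_quot K M N Q) P g"
    and "\<And>x y. x \<in> carrier M \<Longrightarrow> y \<in> carrier N \<Longrightarrow>
      f (tens_class K M N Q [(x, y)]) = g (tens_class K M N Q [(x, y)])"
    and "t \<in> carrier (tens_quot K M N Q)"
  shows "f t = g t"
  using assms(4) by (rule class_induct) (use assms(1-3) in \<open>simp_all add: lin_add\<close>)

text \<open>The decoded list of \<open>t\<close> consists of pairs from the carriers, so only the
  values of the function there enter the sum.\<close>

lemma lift_cong:
  assumes "\<And>x y. x \<in> carrier M \<Longrightarrow> y \<in> carrier N \<Longrightarrow> \<phi> x y = \<psi> x y" "t \<in> carrier (tens_quot K M N Q)"
  shows "lift P \<phi> t = lift P \<psi> t"
proof -
  have "lsum P \<phi> l = lsum P \<psi> l" if "l \<in> lists (carrier M \<times> carrier N)" for l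
    using that by (induction l) (auto simp: assms(1))
  then show ?thesis using in_tens_decode(1)[OF assms(2)] by (simp add: lift_lsum)
qed

text \<open>With \<open>t\<close> fixed, \<open>lift\<close> is a finite sum of functions of
  \<open>u\<close>, each of them linear. Together with \<open>lift_lin\<close> this yields
  bilinearity of nested lifts, in which the inner function depends on outer variables.\<close>

lemma lift_param:
  assumes "vs P" "vs A" "t \<in> carrier (tens_quot K M N Q)"
    and "\<And>x y. x \<in> carrier M \<Longrightarrow> y \<in> carrier N \<Longrightarrow> lin A P (\<lambda>u. \<phi> u x y)"
  shows "lin A P (\<lambda>u. lift P (\<phi> u) t)"
proof -
  have cl: "\<phi> u x y \<in> carrier P" if "u \<in> carrier A" "x \<in> carrier M" "y \<in> carrier N" for u x y
    using assms(4)[OF that(2,3)] that(1) by (rule lin_cl)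
  have "lin A P (\<lambda>u. lsum P (\<phi> u) l)" if "l \<in> lists (carrier M \<times> carrier N)" for l
    using that
  proof (induction l)
    case Nil
    then show ?case using assms(1) by (simp add: lin_def)
  next
    case (Cons z l)
    then have 1: "lin A P (\<lambda>u. \<phi> u (fst z) (snd z))" "lin A P (\<lambda>u. lsum P (\<phi> u) l)" using assms(4) by auto
    have c: "u \<in> carrier A \<Longrightarrow> \<phi> u (fst z) (snd z) \<in> carrier P" "u \<in> carrier A \<Longrightarrow> lsum P (\<phi> u) l \<in> carrier P" for u
      using lin_cl[OF 1(1)] lin_cl[OF 1(2)] by auto
    show ?case unfolding lsum_simps
    proof (rule linI)
      fix x y assume "x \<in> carrier A" "y \<in> carrier A"
      then show "\<phi> (x \<oplus>\<^bsub>A\<^esub> y) (fst z) (snd z) \<oplus>\<^bsub>P\<^esub> lsum P (\<phi> (x \<oplus>\<^bsub>A\<^esub> y)) l =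
        \<phi> x (fst z) (snd z) \<oplus>\<^bsub>P\<^esub> lsum P (\<phi> x) l \<oplus>\<^bsub>P\<^esub> (\<phi> y (fst z) (snd z) \<oplus>\<^bsub>P\<^esub> lsum P (\<phi> y) l)"
        using assms(1,2) by (simp add: lin_add[OF 1(1)] lin_add[OF 1(2)] c add_assoc add_lcomm)
    qed (use assms(1,2) in \<open>simp_all add: c lin_smult[OF 1(1)] lin_smult[OF 1(2)] smult_add\<close>)
  qed
  then show ?thesis using in_tens_decode(1)[OF assms(3)] by (simp add: lift_lsum)
qed

end

section \<open>Bilinear and trilinear maps, and actions of tensor products of algebras\<close>

lemma bilI: "(\<And>x. x \<in> carrier M \<Longrightarrow> lin N P (\<phi> x)) \<Longrightarrow> (\<And>y. y \<in> carrier N \<Longrightarrow> lin M P (\<lambda>x. \<phi> x y)) \<Longrightarrow> bil M N P \<phi>"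
  by (simp add: bil_def)

lemma bil_l: "bil M N P \<phi> \<Longrightarrow> x \<in> carrier M \<Longrightarrow> lin N P (\<phi> x)"
  and bil_r: "bil M N P \<phi> \<Longrightarrow> y \<in> carrier N \<Longrightarrow> lin M P (\<lambda>x. \<phi> x y)"
  by (simp_all add: bil_def)

lemma lin_id [simp]: "lin A A (\<lambda>x. x)" by (simp add: lin_def)

lemma lin_comp: "lin M N f \<Longrightarrow> lin N P g \<Longrightarrow> lin M P (\<lambda>x. g (f x))"
  by (simp add: lin_def)

lemma bil_comp: "lin M M' f \<Longrightarrow> lin N N' g \<Longrightarrow> bil M' N' P \<phi> \<Longrightarrow> bil M N P (\<lambda>x y. \<phi> (f x) (g y))"
  by (simp add: bil_def lin_def)

lemma bil_lin: "lin P P' f \<Longrightarrow> bil M N P \<phi> \<Longrightarrow> bil M N P' (\<lambda>x y. f (\<phi> x y))"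
  by (simp add: bil_def lin_def)

lemma tensK_vs [simp]: "vs M \<Longrightarrow> vs N \<Longrightarrow> vs (tensK K M N)"
  by (rule tens_vs) simp_all

lemma lin_pureL: "vs M \<Longrightarrow> vs N \<Longrightarrow> scaled M N Q \<Longrightarrow> lin A M f \<Longrightarrow> y \<in> carrier N \<Longrightarrow>
    lin A (tens_quot K M N Q) (\<lambda>u. tens_class K M N Q [(f u, y)])"
  using lin_comp[OF _ pure_lin1] by blast

lemma lin_pureR: "vs M \<Longrightarrow> vs N \<Longrightarrow> scaled M N Q \<Longrightarrow> lin A N f \<Longrightarrow> x \<in> carrier M \<Longrightarrow>
    lin A (tens_quot K M N Q) (\<lambda>u. tens_class K M N Q [(x, f u)])"
  using lin_comp[OF _ pure_lin2] by blast

lemma bil_pure: "vs M \<Longrightarrow> vs N \<Longrightarrow> scaled M N Q \<Longrightarrow> bil M N (tens_quot K M N Q) (\<lambda>x y. tens_class K M N Q [(x, y)])"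
  by (rule bilI) (simp_all add: lin_pureL lin_pureR)

text \<open>Apply \<open>lin_eq_tens\<close> in one variable at a time. This takes the place of
  writing both arguments in Sweedler notation.\<close>

lemma bil_ext:
  assumes "vs M" "vs N" "vs M'" "vs N'"
    and f: "bil (tens_quot K M N Q) (tens_quot K M' N' Q') P f"
    and g: "bil (tens_quot K M N Q) (tens_quot K M' N' Q') P g"
    and eq: "\<And>x y x' y'. x \<in> carrier M \<Longrightarrow> y \<in> carrier N \<Longrightarrow> x' \<in> carrier M' \<Longrightarrow> y' \<in> carrier N' \<Longrightarrow>
      f (tens_class K M N Q [(x, y)]) (tens_class K M' N' Q' [(x', y')]) =
      g (tens_class K M N Q [(x, y)]) (tens_class K M' N' Q' [(x', y')])"
    and s: "s \<in> carrier (tens_quot K M N Q)" and t: "t \<in> carrier (tens_quot K M' N' Q')"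
  shows "f s t = g s t"
proof -
  have "f (tens_class K M N Q [(x, y)]) t = g (tens_class K M N Q [(x, y)]) t"
    if xy: "x \<in> carrier M" "y \<in> carrier N" for x y
    by (rule lin_eq_tens[OF assms(3,4) bil_l[OF f] bil_l[OF g] _ t]) (use xy assms(1,2) eq in auto)
  then show ?thesis
    by (intro lin_eq_tens[OF assms(1,2) bil_r[OF f t] bil_r[OF g t] _ s])
qed

definition tri :: "('u, 'u, 'x) module_scheme \<Rightarrow> ('u, 'u, 'y) module_scheme \<Rightarrow> ('u, 'u, 'z) module_scheme \<Rightarrow>
    ('u, 'u, 'w) module_scheme \<Rightarrow> ('u \<Rightarrow> 'u \<Rightarrow> 'u \<Rightarrow> 'u) \<Rightarrow> bool"
  where "tri A M N P f \<longleftrightarrow> (\<forall>a\<in>carrier A. bil M N P (f a)) \<and>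
    (\<forall>x\<in>carrier M. \<forall>y\<in>carrier N. lin A P (\<lambda>a. f a x y))"

text \<open>The next three lemmas are the ways in which two bilinear maps compose to a trilinear
  one, distinguished by the pair of variables that is combined first. They supply the hypotheses of
  \<open>tri_ext\<close>.\<close>

lemma tri_1: "bil A B C f \<Longrightarrow> bil C D E g \<Longrightarrow> tri A B D E (\<lambda>a b d. g (f a b) d)"
  by (simp add: tri_def bil_def lin_def)
lemma tri_2: "bil B D C h \<Longrightarrow> bil A C E g \<Longrightarrow> tri A B D E (\<lambda>a b d. g a (h b d))"
  by (simp add: tri_def bil_def lin_def)
lemma tri_3: "bil A D C h \<Longrightarrow> bil B C E g \<Longrightarrow> tri A B D E (\<lambda>a b d. g b (h a d))"
  by (simp add: tri_def bil_def lin_def)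

lemma tri_ext:
  assumes "vs M" "vs N" "vs M'" "vs N'" "vs M''" "vs N''"
    and f: "tri (tens_quot K M N Q) (tens_quot K M' N' Q') (tens_quot K M'' N'' Q'') P f"
    and g: "tri (tens_quot K M N Q) (tens_quot K M' N' Q') (tens_quot K M'' N'' Q'') P g"
    and eq: "\<And>x y x' y' x'' y''. x \<in> carrier M \<Longrightarrow> y \<in> carrier N \<Longrightarrow> x' \<in> carrier M' \<Longrightarrow> y' \<in> carrier N' \<Longrightarrow>
      x'' \<in> carrier M'' \<Longrightarrow> y'' \<in> carrier N'' \<Longrightarrow>
      f (tens_class K M N Q [(x, y)]) (tens_class K M' N' Q' [(x', y')]) (tens_class K M'' N'' Q'' [(x'', y'')]) =
      g (tens_class K M N Q [(x, y)]) (tens_class K M' N' Q' [(x', y')]) (tens_class K M'' N'' Q'' [(x'', y'')])"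
    and s: "s \<in> carrier (tens_quot K M N Q)" and t: "t \<in> carrier (tens_quot K M' N' Q')"
    and u: "u \<in> carrier (tens_quot K M'' N'' Q'')"
  shows "f s t u = g s t u"
proof -
  have "f (tens_class K M N Q [(x, y)]) t u = g (tens_class K M N Q [(x, y)]) t u"
    if xy: "x \<in> carrier M" "y \<in> carrier N" for x y
    by (rule bil_ext[OF assms(3-6) _ _ _ t u, of P "f (tens_class K M N Q [(x, y)])" "g (tens_class K M N Q [(x, y)])"])
      (use xy assms(1,2) f g eq in \<open>auto simp: tri_def\<close>)
  moreover have "lin (tens_quot K M N Q) P (\<lambda>s. f s t u)" "lin (tens_quot K M N Q) P (\<lambda>s. g s t u)"
    using f g t u by (auto simp: tri_def)
  ultimately show ?thesis using lin_eq_tens[OF assms(1,2) _ _ _ s] by blast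
qed

text \<open>The nested lift extends a map in four variables to a bilinear map of two tensors. The
  action of a tensor product of algebras and the interchange law are both of this form.\<close>

lemma lift2:
  assumes "vs A" "vs A'" "vs M" "vs N" "vs P" "scaled A A' Q" "scaled M N Q'"
    and 1: "\<And>b x y. b \<in> carrier A' \<Longrightarrow> x \<in> carrier M \<Longrightarrow> y \<in> carrier N \<Longrightarrow> lin A P (\<lambda>a. \<phi> a b x y)"
    and 2: "\<And>a x y. a \<in> carrier A \<Longrightarrow> x \<in> carrier M \<Longrightarrow> y \<in> carrier N \<Longrightarrow> lin A' P (\<lambda>b. \<phi> a b x y)"
    and 3: "\<And>a b y. a \<in> carrier A \<Longrightarrow> b \<in> carrier A' \<Longrightarrow> y \<in> carrier N \<Longrightarrow> lin M P (\<lambda>x. \<phi> a b x y)"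
    and 4: "\<And>a b x. a \<in> carrier A \<Longrightarrow> b \<in> carrier A' \<Longrightarrow> x \<in> carrier M \<Longrightarrow> lin N P (\<lambda>y. \<phi> a b x y)"
    and r1: "\<And>x y. x \<in> carrier M \<Longrightarrow> y \<in> carrier N \<Longrightarrow> resp A A' Q (\<lambda>a b. \<phi> a b x y)"
    and r2: "\<And>a b. a \<in> carrier A \<Longrightarrow> b \<in> carrier A' \<Longrightarrow> resp M N Q' (\<phi> a b)"
  shows lift2_bil: "bil (tens_quot K A A' Q) (tens_quot K M N Q') P (\<lambda>s t. lift P (\<lambda>a b. lift P (\<phi> a b) t) s)"
    and lift2_pure: "\<And>a b x y. a \<in> carrier A \<Longrightarrow> b \<in> carrier A' \<Longrightarrow> x \<in> carrier M \<Longrightarrow> y \<in> carrier N \<Longrightarrow>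
      lift P (\<lambda>a b. lift P (\<phi> a b) (tens_class K M N Q' [(x, y)])) (tens_class K A A' Q [(a, b)]) = \<phi> a b x y"
proof -
  have b: "bil M N P (\<phi> a b)" if "a \<in> carrier A" "b \<in> carrier A'" for a b
    using that 3 4 by (intro bilI)
  have l: "lin (tens_quot K M N Q') P (lift P (\<phi> a b))" if "a \<in> carrier A" "b \<in> carrier A'" for a b
    using that assms(3-5,7) b r2 by (intro lift_lin)
  have l1: "lin A P (\<lambda>a. lift P (\<phi> a b) t)" if "b \<in> carrier A'" "t \<in> carrier (tens_quot K M N Q')" for b t
    using that 1 assms(1-5) by (intro lift_param[OF assms(3,4)]) auto
  have l2: "lin A' P (\<lambda>b. lift P (\<phi> a b) t)" if "a \<in> carrier A" "t \<in> carrier (tens_quot K M N Q')" for a t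
    using that 2 assms(1-5) by (intro lift_param[OF assms(3,4)]) auto
  have b': "bil A A' P (\<lambda>a b. lift P (\<phi> a b) t)" if "t \<in> carrier (tens_quot K M N Q')" for t
    using that l1 l2 by (intro bilI)
  have r: "resp A A' Q (\<lambda>a b. lift P (\<phi> a b) t)" if t: "t \<in> carrier (tens_quot K M N Q')" for t
    unfolding resp_def
  proof (intro allI impI)
    fix a b a' b' assume *: "((a, b), (a', b')) \<in> Q" "a \<in> carrier A" "b \<in> carrier A'" "a' \<in> carrier A" "b' \<in> carrier A'"
    show "lift P (\<phi> a b) t = lift P (\<phi> a' b') t"
      by (rule lift_cong[OF assms(3,4) _ t]) (use r1 * in \<open>auto simp: resp_def\<close>)
  qed
  show "bil (tens_quot K A A' Q) (tens_quot K M N Q') P (\<lambda>s t. lift P (\<lambda>a b. lift P (\<phi> a b) t) s)"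
  proof (rule bilI)
    show "lin (tens_quot K M N Q') P (\<lambda>t. lift P (\<lambda>a b. lift P (\<phi> a b) t) s)" if "s \<in> carrier (tens_quot K A A' Q)" for s
      using that l assms by (intro lift_param[OF assms(1,2)]) (auto intro: tens_vs)
    show "lin (tens_quot K A A' Q) P (\<lambda>s. lift P (\<lambda>a b. lift P (\<phi> a b) t) s)" if "t \<in> carrier (tens_quot K M N Q')" for t
      using that b' r assms by (intro lift_lin) auto
  qed
  fix a b x y assume *: "a \<in> carrier A" "b \<in> carrier A'" "x \<in> carrier M" "y \<in> carrier N"
  let ?t = "tens_class K M N Q' [(x, y)]"
  have "?t \<in> carrier (tens_quot K M N Q')" using * assms by simp
  then have "lift P (\<lambda>a b. lift P (\<phi> a b) ?t) (tens_class K A A' Q [(a, b)]) = lift P (\<phi> a b) ?t"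
    using * b' r assms by (intro lift_pure) auto
  also have "\<dots> = \<phi> a b x y" using * b r2 assms by (intro lift_pure) auto
  finally show "lift P (\<lambda>a b. lift P (\<phi> a b) (tens_class K M N Q' [(x, y)])) (tens_class K A A' Q [(a, b)]) = \<phi> a b x y" .
qed

text \<open>\<open>act2\<close> specialises to \<open>lact2\<close>, to \<open>ract2\<close> and to the product of \<open>tens_alg\<close>.\<close>

definition act2 :: "('u, 'u, 'x) module_scheme \<Rightarrow> ('u, 'u, 'y) module_scheme \<Rightarrow>
    ('u \<Rightarrow> 'u \<Rightarrow> 'u) \<Rightarrow> ('u \<Rightarrow> 'u \<Rightarrow> 'u) \<Rightarrow> 'u \<Rightarrow> 'u \<Rightarrow> 'u"
  where "act2 M N l l' s t = lift (tensK K M N) (\<lambda>a b. lift (tensK K M N) (\<lambda>x y. pureK K M N (l a x) (l' b y)) t) s"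

lemma act2:
  assumes v: "vs A" "vs A'" "vs M" "vs N" "vs M'" "vs N'" and l: "bil A M M' l" and l': "bil A' N N' l'"
  shows act2_bil: "bil (tensK K A A') (tensK K M N) (tensK K M' N') (act2 M' N' l l')"
    and act2_pure: "\<And>a b x y. a \<in> carrier A \<Longrightarrow> b \<in> carrier A' \<Longrightarrow> x \<in> carrier M \<Longrightarrow> y \<in> carrier N \<Longrightarrow>
      act2 M' N' l l' (pureK K A A' a b) (pureK K M N x y) = pureK K M' N' (l a x) (l' b y)"
proof -
  note c = bil_cl[OF l] bil_cl[OF l'] bil_l[OF l] bil_l[OF l'] bil_r[OF l] bil_r[OF l']
  show "bil (tensK K A A') (tensK K M N) (tensK K M' N') (act2 M' N' l l')"
    unfolding act2_def by (rule lift2_bil) (use v c in \<open>auto simp: lin_pureL lin_pureR\<close>)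
  show "act2 M' N' l l' (pureK K A A' a b) (pureK K M N x y) = pureK K M' N' (l a x) (l' b y)"
    if "a \<in> carrier A" "b \<in> carrier A'" "x \<in> carrier M" "y \<in> carrier N" for a b x y
    unfolding act2_def by (rule lift2_pure[of A A' M N]) (use v c that in \<open>auto simp: lin_pureL lin_pureR\<close>)
qed

text \<open>Right actions are handled as actions with the scalar as first argument. This converts
  between the two orders of the arguments, in particular between the product of a tensor algebra and
  the one built from opposite factors.\<close>

lemma act2_swap:
  assumes v: "vs A" "vs A'" "vs M" "vs N" "vs M'" "vs N'" and l: "bil A M M' l" and l': "bil A' N N' l'"
    and s: "s \<in> carrier (tensK K A A')" and t: "t \<in> carrier (tensK K M N)"
  shows "act2 M' N' (\<lambda>x a. l a x) (\<lambda>y b. l' b y) t s = act2 M' N' l l' s t"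
proof -
  have f: "bil M A M' (\<lambda>x a. l a x)" "bil N A' N' (\<lambda>y b. l' b y)" using l l' by (auto simp: bil_def)
  have b: "bil (tensK K A A') (tensK K M N) (tensK K M' N') (\<lambda>s t. act2 M' N' (\<lambda>x a. l a x) (\<lambda>y b. l' b y) t s)"
    using act2_bil[OF v(3,4,1,2,5,6) f] by (auto simp: bil_def)
  show ?thesis
    by (rule bil_ext[OF v(1-4) b act2_bil[OF v l l'] _ s t])
      (simp add: act2_pure[OF v l l'] act2_pure[OF v(3,4,1,2,5,6) f])
qed

lemma act2_assoc:
  assumes v: "vs A" "vs A'" "vs M" "vs N" and l: "bil A M M l" and l': "bil A' N N l'"
    and m: "bil A A A m" and m': "bil A' A' A' m'"
    and a: "\<And>a b x. a \<in> carrier A \<Longrightarrow> b \<in> carrier A \<Longrightarrow> x \<in> carrier M \<Longrightarrow> l (m a b) x = l a (l b x)"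
    and a': "\<And>a b x. a \<in> carrier A' \<Longrightarrow> b \<in> carrier A' \<Longrightarrow> x \<in> carrier N \<Longrightarrow> l' (m' a b) x = l' a (l' b x)"
    and s: "s \<in> carrier (tensK K A A')" and s': "s' \<in> carrier (tensK K A A')" and t: "t \<in> carrier (tensK K M N)"
  shows "act2 M N l l' (act2 A A' m m' s s') t = act2 M N l l' s (act2 M N l l' s' t)"
proof -
  note L = act2[OF v v(3,4) l l'] and M = act2[OF v(1,2,1,2,1,2) m m']
  show ?thesis
    by (rule tri_ext[OF v(1,2,1,2,3,4) tri_1[OF M(1) L(1)] tri_2[OF L(1) L(1)] _ s s' t])
      (simp add: L(2) M(2) bil_cl[OF l] bil_cl[OF l'] bil_cl[OF m] bil_cl[OF m'] a a')
qed

lemma act2_commute: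
  assumes v: "vs A" "vs A'" "vs C" "vs C'" "vs M" "vs N" and l: "bil A M M l" and l': "bil A' N N l'"
    and r: "bil C M M r" and r': "bil C' N N r'"
    and a: "\<And>a b x. a \<in> carrier A \<Longrightarrow> b \<in> carrier C \<Longrightarrow> x \<in> carrier M \<Longrightarrow> l a (r b x) = r b (l a x)"
    and a': "\<And>a b x. a \<in> carrier A' \<Longrightarrow> b \<in> carrier C' \<Longrightarrow> x \<in> carrier N \<Longrightarrow> l' a (r' b x) = r' b (l' a x)"
    and s: "s \<in> carrier (tensK K A A')" and s': "s' \<in> carrier (tensK K C C')" and t: "t \<in> carrier (tensK K M N)"
  shows "act2 M N l l' s (act2 M N r r' s' t) = act2 M N r r' s' (act2 M N l l' s t)"
proof -
  note L = act2[OF v(1,2,5,6,5,6) l l'] and R = act2[OF v(3,4,5,6,5,6) r r']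
  show ?thesis
    by (rule tri_ext[OF v tri_2[OF R(1) L(1)] tri_3[OF L(1) R(1)] _ s s' t])
      (simp add: L(2) R(2) bil_cl[OF l] bil_cl[OF l'] bil_cl[OF r] bil_cl[OF r'] a a')
qed

lemma act2_unit:
  assumes v: "vs A" "vs A'" "vs M" "vs N" and l: "bil A M M l" and l': "bil A' N N l'"
    and e: "e \<in> carrier A" "\<And>x. x \<in> carrier M \<Longrightarrow> l e x = x"
    and e': "e' \<in> carrier A'" "\<And>x. x \<in> carrier N \<Longrightarrow> l' e' x = x"
    and t: "t \<in> carrier (tensK K M N)"
  shows "act2 M N l l' (pureK K A A' e e') t = t"
proof -
  note L = act2[OF v v(3,4) l l']
  show ?thesis
    by (rule lin_eq_tens[OF v(3,4) bil_l[OF L(1)] lin_id _ t]) (use e e' v in \<open>simp_all add: L(2)\<close>)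
qed

text \<open>\<open>gmod m e A M l\<close>: \<open>l\<close> is an action on \<open>M\<close> of \<open>A\<close> with product \<open>m\<close> and unit \<open>e\<close>. Right actions
  are the case of the opposite product.\<close>

definition gmod :: "('u \<Rightarrow> 'u \<Rightarrow> 'u) \<Rightarrow> 'u \<Rightarrow> ('u, 'u, 'x) module_scheme \<Rightarrow> ('u, 'u, 'y) module_scheme \<Rightarrow>
    ('u \<Rightarrow> 'u \<Rightarrow> 'u) \<Rightarrow> bool"
  where "gmod m e A M l \<longleftrightarrow> vs A \<and> vs M \<and> bil A A A m \<and> bil A M M l \<and> e \<in> carrier A \<and>
    (\<forall>a\<in>carrier A. \<forall>b\<in>carrier A. \<forall>x\<in>carrier M. l (m a b) x = l a (l b x)) \<and>
    (\<forall>x\<in>carrier M. l e x = x)"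

lemma gmodD:
  assumes "gmod m e A M l"
  shows "vs A" "vs M" "bil A A A m" "bil A M M l" "e \<in> carrier A"
    "\<And>a b x. a \<in> carrier A \<Longrightarrow> b \<in> carrier A \<Longrightarrow> x \<in> carrier M \<Longrightarrow> l (m a b) x = l a (l b x)"
    "\<And>x. x \<in> carrier M \<Longrightarrow> l e x = x"
  using assms by (auto simp: gmod_def)

text \<open>Since \<open>gmod\<close> speaks of an arbitrary product and not of a ring record, the
  lemma applies again to its own conclusion and thereby covers threefold tensor products.\<close>

lemma gmod_tens:
  assumes g: "gmod m e A M l" and g': "gmod m' e' A' N l'"
  shows "gmod (act2 A A' m m') (pureK K A A' e e') (tensK K A A') (tensK K M N) (act2 M N l l')"
proof -
  note d = gmodD[OF g] and d' = gmodD[OF g']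
  show ?thesis unfolding gmod_def
    using d(1,2,5) d'(1,2,5) act2_bil[OF d(1) d'(1) d(1) d'(1) d(1) d'(1) d(3) d'(3)]
      act2_bil[OF d(1) d'(1) d(2) d'(2) d(2) d'(2) d(4) d'(4)]
      act2_assoc[OF d(1) d'(1) d(2) d'(2) d(4) d'(4) d(3) d'(3) d(6) d'(6)]
      act2_unit[OF d(1) d'(1) d(2) d'(2) d(4) d'(4) d(5) d(7) d'(5) d'(7)]
    by simp
qed

text \<open>Restriction of scalars along a map that respects product and unit. The diagonal bimodule
  structure arises in this way from the comultiplication, and the bimodule of an algebra under
  \<open>B\<close> from its unit map.\<close>

lemma gmod_pull:
  assumes g: "gmod m2 e2 A2 M l" and A: "vs A" "bil A A A m" "e \<in> carrier A" and f: "lin A A2 f"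
    and "\<And>a b. a \<in> carrier A \<Longrightarrow> b \<in> carrier A \<Longrightarrow> f (m a b) = m2 (f a) (f b)" "f e = e2"
  shows "gmod m e A M (\<lambda>a. l (f a))"
  using assms gmodD[OF g] bil_comp[OF f lin_id gmodD(4)[OF g]] lin_cl[OF f]
  unfolding gmod_def by simp

subsection \<open>Algebras\<close>

lemma tens_alg_fields [simp]:
  "carrier (tens_alg K A A') = carrier (tensK K A A')" "add (tens_alg K A A') = add (tensK K A A')"
  "zero (tens_alg K A A') = zero (tensK K A A')" "smult (tens_alg K A A') = smult (tensK K A A')"
  "one (tens_alg K A A') = pureK K A A' \<one>\<^bsub>A\<^esub> \<one>\<^bsub>A'\<^esub>"
  by (simp_all add: tens_alg_def Let_def)

text \<open>Only \<open>mult\<close> and \<open>one\<close> distinguish the tensor algebra from the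
  underlying tensor product, so linear algebra is always carried out in the latter.\<close>

lemma tens_alg_cong [simp]:
  "vs (tens_alg K A A') \<longleftrightarrow> vs (tensK K A A')"
  "lin (tens_alg K A A') N = lin (tensK K A A') N" "lin N (tens_alg K A A') = lin N (tensK K A A')"
  "tens_quot K (tens_alg K A A') N Q = tens_quot K (tensK K A A') N Q"
  "tens_quot K N (tens_alg K A A') Q = tens_quot K N (tensK K A A') Q"
  "tens_class K (tens_alg K A A') N Q = tens_class K (tensK K A A') N Q"
  "tens_class K N (tens_alg K A A') Q = tens_class K N (tensK K A A') Q"
  "lift (tens_alg K A A') = lift (tensK K A A')"
  "bil (tens_alg K A A') N P f = bil (tensK K A A') N P f"
  "bil N (tens_alg K A A') P f = bil N (tensK K A A') P f"
  "bil N P (tens_alg K A A') f = bil N P (tensK K A A') f"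
  by (rule vs_cong lin_cong tens_quot_cong tens_class_cong lift_cong_struct; simp)+
    (simp_all add: bil_def lin_def)

abbreviation ualg :: "('u, 'u, 'x) module_scheme \<Rightarrow> bool" where "ualg A \<equiv> unital_algebra K A"

lemma ualgD:
  assumes "ualg A"
  shows "vs A" "ring A" "monoid A"
    "\<And>c x y. c \<in> carrier K \<Longrightarrow> x \<in> carrier A \<Longrightarrow> y \<in> carrier A \<Longrightarrow> (c \<odot>\<^bsub>A\<^esub> x) \<otimes>\<^bsub>A\<^esub> y = c \<odot>\<^bsub>A\<^esub> (x \<otimes>\<^bsub>A\<^esub> y)"
    "\<And>c x y. c \<in> carrier K \<Longrightarrow> x \<in> carrier A \<Longrightarrow> y \<in> carrier A \<Longrightarrow> x \<otimes>\<^bsub>A\<^esub> (c \<odot>\<^bsub>A\<^esub> y) = c \<odot>\<^bsub>A\<^esub> (x \<otimes>\<^bsub>A\<^esub> y)"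
    "add A \<in> extensional2 (carrier A) (carrier A)" "mult A \<in> extensional2 (carrier A) (carrier A)"
    "smult A \<in> extensional2 (carrier K) (carrier A)"
  using assms by (auto simp: unital_algebra_def ring.is_monoid)

lemma ualg_mult [simp]: "ualg A \<Longrightarrow> x \<in> carrier A \<Longrightarrow> y \<in> carrier A \<Longrightarrow> x \<otimes>\<^bsub>A\<^esub> y \<in> carrier A"
  by (meson ualgD(3) monoid.m_closed)
lemma ualg_one [simp]: "ualg A \<Longrightarrow> \<one>\<^bsub>A\<^esub> \<in> carrier A"
  by (meson ualgD(3) monoid.one_closed)
lemma ualg_l_one [simp]: "ualg A \<Longrightarrow> x \<in> carrier A \<Longrightarrow> \<one>\<^bsub>A\<^esub> \<otimes>\<^bsub>A\<^esub> x = x"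
  by (meson ualgD(3) monoid.l_one)
lemma ualg_r_one [simp]: "ualg A \<Longrightarrow> x \<in> carrier A \<Longrightarrow> x \<otimes>\<^bsub>A\<^esub> \<one>\<^bsub>A\<^esub> = x"
  by (meson ualgD(3) monoid.r_one)
lemma ualg_assoc: "ualg A \<Longrightarrow> x \<in> carrier A \<Longrightarrow> y \<in> carrier A \<Longrightarrow> z \<in> carrier A \<Longrightarrow>
    x \<otimes>\<^bsub>A\<^esub> y \<otimes>\<^bsub>A\<^esub> z = x \<otimes>\<^bsub>A\<^esub> (y \<otimes>\<^bsub>A\<^esub> z)"
  by (meson ualgD(3) monoid.m_assoc)
lemma ualg_vs [simp]: "ualg A \<Longrightarrow> vs A" by (rule ualgD)

lemma ualg_bil: "ualg A \<Longrightarrow> bil A A A (mult A)"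
  by (intro bilI linI) (simp_all add: ualgD(4,5) ring.ring_simprules(13,23)[OF ualgD(2)])

lemma ualgI:
  assumes "vs A" and b: "bil A A A (mult A)" and o: "\<one>\<^bsub>A\<^esub> \<in> carrier A"
    and "\<And>x. x \<in> carrier A \<Longrightarrow> \<one>\<^bsub>A\<^esub> \<otimes>\<^bsub>A\<^esub> x = x" "\<And>x. x \<in> carrier A \<Longrightarrow> x \<otimes>\<^bsub>A\<^esub> \<one>\<^bsub>A\<^esub> = x"
    and "\<And>x y z. x \<in> carrier A \<Longrightarrow> y \<in> carrier A \<Longrightarrow> z \<in> carrier A \<Longrightarrow>
      x \<otimes>\<^bsub>A\<^esub> y \<otimes>\<^bsub>A\<^esub> z = x \<otimes>\<^bsub>A\<^esub> (y \<otimes>\<^bsub>A\<^esub> z)"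
    and "add A \<in> extensional2 (carrier A) (carrier A)" "mult A \<in> extensional2 (carrier A) (carrier A)"
      "smult A \<in> extensional2 (carrier K) (carrier A)"
  shows "ualg A"
proof -
  have "monoid A" using assms bil_cl[OF b] by (intro monoidI) auto
  then have "ring A" using vs_ab[OF assms(1)] lin_add[OF bil_l[OF b]] lin_add[OF bil_r[OF b]]
    by (intro ringI) auto
  then show ?thesis using assms lin_smult[OF bil_l[OF b]] lin_smult[OF bil_r[OF b]]
    by (auto simp: unital_algebra_def)
qed

lemma tens_alg_mult: "s \<in> carrier (tensK K A A') \<Longrightarrow> t \<in> carrier (tensK K A A') \<Longrightarrow>
    s \<otimes>\<^bsub>tens_alg K A A'\<^esub> t = act2 A A' (mult A) (mult A') s t"
  by (simp add: tens_alg_def Let_def restrict2_def act2_def)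

lemma tens_alg_pure: "ualg A \<Longrightarrow> ualg A' \<Longrightarrow> a \<in> carrier A \<Longrightarrow> b \<in> carrier A' \<Longrightarrow> c \<in> carrier A \<Longrightarrow> d \<in> carrier A' \<Longrightarrow>
    pureK K A A' a b \<otimes>\<^bsub>tens_alg K A A'\<^esub> pureK K A A' c d = pureK K A A' (a \<otimes>\<^bsub>A\<^esub> c) (b \<otimes>\<^bsub>A'\<^esub> d)"
  by (subst tens_alg_mult) (simp_all add: act2_pure[OF _ _ _ _ _ _ ualg_bil ualg_bil])

lemma tens_quot_ext:
  "add (tens_quot K M N Q) \<in> extensional2 (carrier (tens_quot K M N Q)) (carrier (tens_quot K M N Q))"
  "smult (tens_quot K M N Q) \<in> extensional2 (carrier K) (carrier (tens_quot K M N Q))"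
  by (auto simp: tens_quot_def Let_def extensional2_def restrict2_def)

lemma bil_cong: "(\<And>x y. x \<in> carrier M \<Longrightarrow> y \<in> carrier N \<Longrightarrow> \<phi> x y = \<psi> x y) \<Longrightarrow> vs M \<Longrightarrow> vs N \<Longrightarrow>
    bil M N P \<phi> \<longleftrightarrow> bil M N P \<psi>"
  by (simp add: bil_def lin_def)

lemma gmod_reg: "ualg A \<Longrightarrow> gmod (mult A) \<one>\<^bsub>A\<^esub> A A (mult A)"
  by (simp add: gmod_def ualg_bil ualg_assoc)

lemma tens_ualg [simp]:
  assumes A: "ualg A" and A': "ualg A'"
  shows "ualg (tens_alg K A A')"
proof -
  let ?m = "act2 A A' (mult A) (mult A')"
  note g = gmodD[OF gmod_tens[OF gmod_reg[OF A] gmod_reg[OF A']]]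
  \<comment> \<open>An action only provides the left unit law; the right one gets its own check on
    pure tensors.\<close>
  have r: "?m t (pureK K A A' \<one>\<^bsub>A\<^esub> \<one>\<^bsub>A'\<^esub>) = t" if t: "t \<in> carrier (tensK K A A')" for t
    by (rule lin_eq_tens[OF _ _ bil_r[OF g(4)] lin_id _ t])
      (use A A' in \<open>simp_all add: act2_pure[OF _ _ _ _ _ _ ualg_bil ualg_bil]\<close>)
  show ?thesis
  proof (rule ualgI)
    show "bil (tens_alg K A A') (tens_alg K A A') (tens_alg K A A') (mult (tens_alg K A A'))"
      using g(3) by (simp add: bil_cong[OF tens_alg_mult] g(1))
    show "mult (tens_alg K A A') \<in> extensional2 (carrier (tens_alg K A A')) (carrier (tens_alg K A A'))"
      by (simp add: tens_alg_def Let_def restrict2_def extensional2_def)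
  qed (use A A' g(4-7) r in \<open>simp_all add: tens_alg_mult bil_cl[OF g(3)] tens_quot_ext\<close>)
qed

definition alg_hom :: "('u, 'u, 'x) module_scheme \<Rightarrow> ('u, 'u, 'y) module_scheme \<Rightarrow> ('u \<Rightarrow> 'u) \<Rightarrow> bool"
  where "alg_hom A C f \<longleftrightarrow> ualg A \<and> ualg C \<and> lin A C f \<and> f \<one>\<^bsub>A\<^esub> = \<one>\<^bsub>C\<^esub> \<and>
    (\<forall>x\<in>carrier A. \<forall>y\<in>carrier A. f (x \<otimes>\<^bsub>A\<^esub> y) = f x \<otimes>\<^bsub>C\<^esub> f y)"

lemma alg_homD:
  assumes "alg_hom A C f"
  shows "ualg A" "ualg C" "lin A C f" "f \<one>\<^bsub>A\<^esub> = \<one>\<^bsub>C\<^esub>"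
    "\<And>x y. x \<in> carrier A \<Longrightarrow> y \<in> carrier A \<Longrightarrow> f (x \<otimes>\<^bsub>A\<^esub> y) = f x \<otimes>\<^bsub>C\<^esub> f y"
    "\<And>x. x \<in> carrier A \<Longrightarrow> f x \<in> carrier C"
  using assms by (auto simp: alg_hom_def lin_def)

text \<open>Multiplicativity is an equality of two bilinear maps on the tensor algebra and is
  therefore decided on pure tensors. The leg embeddings of an R-matrix as well as \<Delta> \<otimes>
  Id, Id \<otimes> \<Delta> and f \<otimes> f are obtained from it.\<close>

lemma alg_hom_lift:
  assumes A: "ualg A" and A': "ualg A'" and C: "ualg C" and b: "bil A A' C \<phi>"
    and o: "\<phi> \<one>\<^bsub>A\<^esub> \<one>\<^bsub>A'\<^esub> = \<one>\<^bsub>C\<^esub>"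
    and m: "\<And>x y x' y'. x \<in> carrier A \<Longrightarrow> x' \<in> carrier A \<Longrightarrow> y \<in> carrier A' \<Longrightarrow> y' \<in> carrier A' \<Longrightarrow>
      \<phi> (x \<otimes>\<^bsub>A\<^esub> x') (y \<otimes>\<^bsub>A'\<^esub> y') = \<phi> x y \<otimes>\<^bsub>C\<^esub> \<phi> x' y'"
  shows "alg_hom (tens_alg K A A') C (lift C \<phi>)"
proof -
  have v: "vs A" "vs A'" "vs C" using A A' C by simp_all
  have l: "lin (tensK K A A') C (lift C \<phi>)" by (rule lift_lin[OF v b]) simp_all
  have p: "lift C \<phi> (pureK K A A' x y) = \<phi> x y" if "x \<in> carrier A" "y \<in> carrier A'" for x y
    using that by (intro lift_pure[OF v b]) simp_all
  have "lift C \<phi> (s \<otimes>\<^bsub>tens_alg K A A'\<^esub> t) = lift C \<phi> s \<otimes>\<^bsub>C\<^esub> lift C \<phi> t"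
    if st: "s \<in> carrier (tensK K A A')" "t \<in> carrier (tensK K A A')" for s t
    by (rule bil_ext[OF v(1,2,1,2) _ _ _ st, of C "\<lambda>s t. lift C \<phi> (s \<otimes>\<^bsub>tens_alg K A A'\<^esub> t)" "\<lambda>s t. lift C \<phi> s \<otimes>\<^bsub>C\<^esub> lift C \<phi> t"])
      (use ualg_bil[OF tens_ualg[OF A A']] bil_comp[OF l l ualg_bil[OF C]] in
        \<open>simp_all add: bil_lin[OF l] A A' tens_alg_pure p m\<close>)
  then show ?thesis using l A A' C p o by (simp add: alg_hom_def)
qed

end

abbreviation val_at :: "('o, 'a \<Rightarrow> 'b) arrow \<Rightarrow> 'a \<Rightarrow> 'b"  (infixl \<open>$\<close> 95)
  where "f $ x \<equiv> map_of_arrow f x"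

context vect begin

subsection \<open>Bialgebras and bimodules\<close>

lemma base_fields [simp]: "carrier (base_space K) = carrier K" "zero (base_space K) = \<zero>\<^bsub>K\<^esub>"
  "x \<in> carrier K \<Longrightarrow> y \<in> carrier K \<Longrightarrow> x \<oplus>\<^bsub>base_space K\<^esub> y = x \<oplus>\<^bsub>K\<^esub> y"
  "x \<in> carrier K \<Longrightarrow> y \<in> carrier K \<Longrightarrow> x \<odot>\<^bsub>base_space K\<^esub> y = x \<otimes>\<^bsub>K\<^esub> y"
  by (simp_all add: base_space_def restrict2_def)

lemma base_vs [simp]: "vs (base_space K)"
proof -
  note r = cring.cring_simprules[OF K_cring]
  show ?thesis
    by (rule vs_I) (simp_all add: r(7,8,11,12,13,25,26), simp_all only: r(10))
qed

lemma bialgD: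
  assumes "bialgebra K H"
  shows "ualg H" "lin H (tensK K H H) (comult H)" "lin H (base_space K) (counit H)"
    "comult H \<in> extensional (carrier H)" "counit H \<in> extensional (carrier H)"
    "\<And>h. h \<in> carrier H \<Longrightarrow> comult H h \<in> carrier (tensK K H H)"
    "\<And>h. h \<in> carrier H \<Longrightarrow> counit H h \<in> carrier K"
    "\<And>h k. h \<in> carrier H \<Longrightarrow> k \<in> carrier H \<Longrightarrow>
      comult H (h \<otimes>\<^bsub>H\<^esub> k) = comult H h \<otimes>\<^bsub>tens_alg K H H\<^esub> comult H k"
    "comult H \<one>\<^bsub>H\<^esub> = pureK K H H \<one>\<^bsub>H\<^esub> \<one>\<^bsub>H\<^esub>"
    "\<And>h k. h \<in> carrier H \<Longrightarrow> k \<in> carrier H \<Longrightarrow> counit H (h \<otimes>\<^bsub>H\<^esub> k) = counit H h \<otimes>\<^bsub>K\<^esub> counit H k"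
    "counit H \<one>\<^bsub>H\<^esub> = \<one>\<^bsub>K\<^esub>"
    "\<And>h. h \<in> carrier H \<Longrightarrow> lift H (\<lambda>x y. counit H x \<odot>\<^bsub>H\<^esub> y) (comult H h) = h"
    "\<And>h. h \<in> carrier H \<Longrightarrow> lift H (\<lambda>x y. counit H y \<odot>\<^bsub>H\<^esub> x) (comult H h) = h"
    "\<And>h. h \<in> carrier H \<Longrightarrow> lift (tensK K H (tensK K H H))
        (\<lambda>x z. lift (tensK K H (tensK K H H))
          (\<lambda>x' y. pureK K H (tensK K H H) x' (pureK K H H y z)) (comult H x)) (comult H h) =
      lift (tensK K H (tensK K H H))
        (\<lambda>x y. pureK K H (tensK K H H) x (comult H y)) (comult H h)"
proof -
  note a = assms[unfolded bialgebra_def linear_map_iff]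
  have h: "comult H \<in> ring_hom H (tens_alg K H H)" "counit H \<in> ring_hom H K" using a by blast+
  show l: "lin H (tensK K H H) (comult H)" "lin H (base_space K) (counit H)" using a by blast+
  show "ualg H" "comult H \<in> extensional (carrier H)" "counit H \<in> extensional (carrier H)" using a by blast+
  show "\<And>h. h \<in> carrier H \<Longrightarrow> comult H h \<in> carrier (tensK K H H)" by (rule lin_cl[OF l(1)])
  show "\<And>h. h \<in> carrier H \<Longrightarrow> counit H h \<in> carrier K" using lin_cl[OF l(2)] by simp
  show "comult H \<one>\<^bsub>H\<^esub> = pureK K H H \<one>\<^bsub>H\<^esub> \<one>\<^bsub>H\<^esub>" using ring_hom_one[OF h(1)] by simp
  show "counit H \<one>\<^bsub>H\<^esub> = \<one>\<^bsub>K\<^esub>" by (rule ring_hom_one[OF h(2)])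
  show "\<And>h k. h \<in> carrier H \<Longrightarrow> k \<in> carrier H \<Longrightarrow>
      comult H (h \<otimes>\<^bsub>H\<^esub> k) = comult H h \<otimes>\<^bsub>tens_alg K H H\<^esub> comult H k" by (rule ring_hom_mult[OF h(1)])
  show "\<And>h k. h \<in> carrier H \<Longrightarrow> k \<in> carrier H \<Longrightarrow> counit H (h \<otimes>\<^bsub>H\<^esub> k) = counit H h \<otimes>\<^bsub>K\<^esub> counit H k"
    by (rule ring_hom_mult[OF h(2)])
qed (use assms[unfolded bialgebra_def] in blast)+

end

locale bial = vect K for K :: "('u :: infinite) ring" +
  fixes B :: "'u bialg"
  assumes B: "bialgebra K B"
begin

abbreviation "C \<equiv> bimod_cat K B"
abbreviation "bm \<equiv> bimodule K B"

lemmas Bs [simp] = bialgD(1,6,7)[OF B]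

lemma B_vs [simp]: "vs B" using ualg_vs Bs by blast

lemma bmD:
  assumes "bm M"
  shows "vs M"
    "\<And>b x. b \<in> carrier B \<Longrightarrow> x \<in> carrier M \<Longrightarrow> lact M b x \<in> carrier M"
    "\<And>b x. b \<in> carrier B \<Longrightarrow> x \<in> carrier M \<Longrightarrow> ract M x b \<in> carrier M"
    "\<And>a b x. a \<in> carrier B \<Longrightarrow> b \<in> carrier B \<Longrightarrow> x \<in> carrier M \<Longrightarrow> lact M (a \<otimes>\<^bsub>B\<^esub> b) x = lact M a (lact M b x)"
    "\<And>a b x. a \<in> carrier B \<Longrightarrow> b \<in> carrier B \<Longrightarrow> x \<in> carrier M \<Longrightarrow> ract M x (a \<otimes>\<^bsub>B\<^esub> b) = ract M (ract M x a) b"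
    "\<And>a b x. a \<in> carrier B \<Longrightarrow> b \<in> carrier B \<Longrightarrow> x \<in> carrier M \<Longrightarrow> ract M (lact M a x) b = lact M a (ract M x b)"
    "\<And>c x. c \<in> carrier K \<Longrightarrow> x \<in> carrier M \<Longrightarrow> lact M (c \<odot>\<^bsub>B\<^esub> \<one>\<^bsub>B\<^esub>) x = c \<odot>\<^bsub>M\<^esub> x"
    "\<And>c x. c \<in> carrier K \<Longrightarrow> x \<in> carrier M \<Longrightarrow> ract M x (c \<odot>\<^bsub>B\<^esub> \<one>\<^bsub>B\<^esub>) = c \<odot>\<^bsub>M\<^esub> x"
    "add M \<in> extensional2 (carrier M) (carrier M)" "smult M \<in> extensional2 (carrier K) (carrier M)"
    "lact M \<in> extensional2 (carrier B) (carrier M)" "ract M \<in> extensional2 (carrier M) (carrier B)"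
    "mult M = (\<lambda>_ _. undefined)" "one M = undefined"
    "\<And>b x y. b \<in> carrier B \<Longrightarrow> x \<in> carrier M \<Longrightarrow> y \<in> carrier M \<Longrightarrow> lact M b (x \<oplus>\<^bsub>M\<^esub> y) = lact M b x \<oplus>\<^bsub>M\<^esub> lact M b y"
    "\<And>b x y. b \<in> carrier B \<Longrightarrow> x \<in> carrier M \<Longrightarrow> y \<in> carrier M \<Longrightarrow> ract M (x \<oplus>\<^bsub>M\<^esub> y) b = ract M x b \<oplus>\<^bsub>M\<^esub> ract M y b"
    "\<And>a b x. a \<in> carrier B \<Longrightarrow> b \<in> carrier B \<Longrightarrow> x \<in> carrier M \<Longrightarrow> lact M (a \<oplus>\<^bsub>B\<^esub> b) x = lact M a x \<oplus>\<^bsub>M\<^esub> lact M b x"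
    "\<And>a b x. a \<in> carrier B \<Longrightarrow> b \<in> carrier B \<Longrightarrow> x \<in> carrier M \<Longrightarrow> ract M x (a \<oplus>\<^bsub>B\<^esub> b) = ract M x a \<oplus>\<^bsub>M\<^esub> ract M x b"
  using assms unfolding bimodule_def by blast+

lemma bm_vs [simp]: "bm M \<Longrightarrow> vs M" by (rule bmD)
lemma lact_cl [simp]: "bm M \<Longrightarrow> b \<in> carrier B \<Longrightarrow> x \<in> carrier M \<Longrightarrow> lact M b x \<in> carrier M" by (rule bmD)
lemma ract_cl [simp]: "bm M \<Longrightarrow> b \<in> carrier B \<Longrightarrow> x \<in> carrier M \<Longrightarrow> ract M x b \<in> carrier M" by (rule bmD)

lemma lact_one [simp]: "bm M \<Longrightarrow> x \<in> carrier M \<Longrightarrow> lact M \<one>\<^bsub>B\<^esub> x = x"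
  using bmD(7)[of M "\<one>\<^bsub>K\<^esub>" x] by simp
lemma ract_one [simp]: "bm M \<Longrightarrow> x \<in> carrier M \<Longrightarrow> ract M x \<one>\<^bsub>B\<^esub> = x"
  using bmD(8)[of M "\<one>\<^bsub>K\<^esub>" x] by simp

text \<open>The bimodule axioms prescribe only how c 1 acts. Factoring c b as (c 1) b or as b (c 1)
  is the way to linearity of the actions over \<open>K\<close>.\<close>

lemma scal_B: "c \<in> carrier K \<Longrightarrow> b \<in> carrier B \<Longrightarrow> c \<odot>\<^bsub>B\<^esub> b = (c \<odot>\<^bsub>B\<^esub> \<one>\<^bsub>B\<^esub>) \<otimes>\<^bsub>B\<^esub> b"
  "c \<in> carrier K \<Longrightarrow> b \<in> carrier B \<Longrightarrow> c \<odot>\<^bsub>B\<^esub> b = b \<otimes>\<^bsub>B\<^esub> (c \<odot>\<^bsub>B\<^esub> \<one>\<^bsub>B\<^esub>)"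
  by (simp_all add: ualgD(4,5)[OF Bs(1)])

text \<open>Additivity is an axiom; homogeneity comes from the two factorisations of c b. The first
  pulls the scalar out in front, the second pushes it onto the module element.\<close>

lemma lact_bil: assumes "bm M" shows "bil B M M (lact M)"
proof -
  have s1: "lact M (c \<odot>\<^bsub>B\<^esub> b) x = c \<odot>\<^bsub>M\<^esub> lact M b x" if "c \<in> carrier K" "b \<in> carrier B" "x \<in> carrier M" for b c x
    using that assms by (subst scal_B(1)) (simp_all add: bmD(4-8))
  have s2: "lact M b (c \<odot>\<^bsub>M\<^esub> x) = c \<odot>\<^bsub>M\<^esub> lact M b x" if "c \<in> carrier K" "b \<in> carrier B" "x \<in> carrier M" for b c x
  proof -
    have "lact M (c \<odot>\<^bsub>B\<^esub> b) x = lact M b (lact M (c \<odot>\<^bsub>B\<^esub> \<one>\<^bsub>B\<^esub>) x)"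
      using that assms by (subst scal_B(2)) (simp_all add: bmD(4))
    then show ?thesis using that assms by (simp add: bmD(7) s1)
  qed
  show ?thesis using assms by (intro bilI linI) (simp_all add: s1 s2 bmD(15-18))
qed

lemma ract_bil: assumes "bm M" shows "bil B M M (\<lambda>b x. ract M x b)"
proof -
  have s1: "ract M x (c \<odot>\<^bsub>B\<^esub> b) = c \<odot>\<^bsub>M\<^esub> ract M x b" if "c \<in> carrier K" "b \<in> carrier B" "x \<in> carrier M" for b c x
    using that assms by (subst scal_B(2)) (simp_all add: bmD(4-8))
  have s2: "ract M (c \<odot>\<^bsub>M\<^esub> x) b = c \<odot>\<^bsub>M\<^esub> ract M x b" if "c \<in> carrier K" "b \<in> carrier B" "x \<in> carrier M" for b c x
  proof -
    have "ract M x (c \<odot>\<^bsub>B\<^esub> b) = ract M (ract M x (c \<odot>\<^bsub>B\<^esub> \<one>\<^bsub>B\<^esub>)) b"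
      using that assms by (subst scal_B(1)) (simp_all add: bmD(5))
    then show ?thesis using that assms by (simp add: bmD(8) s1)
  qed
  show ?thesis using assms by (intro bilI linI) (simp_all add: s1 s2 bmD(15-18))
qed

text \<open>Right modules are treated as left modules over the opposite product, with the scalar as
  first argument. Statements about the two sides of a bimodule then become two instances of one
  lemma.\<close>

abbreviation opm :: "'u \<Rightarrow> 'u \<Rightarrow> 'u" where "opm \<equiv> \<lambda>a b. b \<otimes>\<^bsub>B\<^esub> a"
abbreviation la :: "'u bimod \<Rightarrow> 'u \<Rightarrow> 'u \<Rightarrow> 'u" where "la M \<equiv> \<lambda>b x. lact M b x"
abbreviation ra :: "'u bimod \<Rightarrow> 'u \<Rightarrow> 'u \<Rightarrow> 'u" where "ra M \<equiv> \<lambda>b x. ract M x b"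
abbreviation "actL X Y \<equiv> act2 X Y (la X) (la Y)"
abbreviation "actR X Y \<equiv> act2 X Y (ra X) (ra Y)"

lemma opm_bil: "bil B B B opm" using ualg_bil[OF Bs(1)] by (auto simp: bil_def)

lemma lact_gmod: "bm M \<Longrightarrow> gmod (mult B) \<one>\<^bsub>B\<^esub> B M (la M)"
  by (simp add: gmod_def lact_bil ualg_bil bmD(4))

lemma ract_gmod: "bm M \<Longrightarrow> gmod opm \<one>\<^bsub>B\<^esub> B M (ra M)"
  by (simp add: gmod_def ract_bil opm_bil bmD(5))

lemma mk_bimod_fields [simp]:
  "carrier (mk_bimod B V l r) = carrier V" "zero (mk_bimod B V l r) = zero V"
  "add (mk_bimod B V l r) = add V" "smult (mk_bimod B V l r) = smult V"
  "b \<in> carrier B \<Longrightarrow> x \<in> carrier V \<Longrightarrow> lact (mk_bimod B V l r) b x = l b x"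
  "b \<in> carrier B \<Longrightarrow> x \<in> carrier V \<Longrightarrow> ract (mk_bimod B V l r) x b = r x b"
  by (simp_all add: mk_bimod_def restrict2_def)

lemma mk_bimod_cong [simp]:
  "vs (mk_bimod B V l r) \<longleftrightarrow> vs V"
  "lin (mk_bimod B V l r) N = lin V N" "lin N (mk_bimod B V l r) = lin N V"
  "tens_quot K (mk_bimod B V l r) N Q = tens_quot K V N Q"
  "tens_quot K N (mk_bimod B V l r) Q = tens_quot K N V Q"
  "tens_class K (mk_bimod B V l r) N Q = tens_class K V N Q"
  "tens_class K N (mk_bimod B V l r) Q = tens_class K N V Q"
  "lift (mk_bimod B V l r) = lift V"
  "bil (mk_bimod B V l r) N P f = bil V N P f"
  "bil N (mk_bimod B V l r) P f = bil N V P f"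
  "bil N P (mk_bimod B V l r) f = bil N P V f"
  by (rule vs_cong lin_cong tens_quot_cong tens_class_cong lift_cong_struct; simp)+
    (simp_all add: bil_def lin_def)

lemma mk_bimod_bm:
  assumes V: "vs V" "add V \<in> extensional2 (carrier V) (carrier V)" "smult V \<in> extensional2 (carrier K) (carrier V)"
    and l: "gmod (mult B) \<one>\<^bsub>B\<^esub> B V l" and r: "gmod opm \<one>\<^bsub>B\<^esub> B V (\<lambda>b x. r x b)"
    and c: "\<And>a b x. a \<in> carrier B \<Longrightarrow> b \<in> carrier B \<Longrightarrow> x \<in> carrier V \<Longrightarrow> r (l a x) b = l a (r x b)"
  shows "bm (mk_bimod B V l r)"
proof -
  note L = gmodD[OF l] and R = gmodD[OF r]
  have cl: "l b x \<in> carrier V" "r x b \<in> carrier V" if "b \<in> carrier B" "x \<in> carrier V" for b x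
    using that bil_cl[OF L(4)] bil_cl[OF R(4)] by auto
  have "restrict2 (carrier B) (carrier V) l \<in> extensional2 (carrier B) (carrier V)"
    "restrict2 (carrier V) (carrier B) r \<in> extensional2 (carrier V) (carrier B)"
    by (auto simp: extensional2_def restrict2_def)
  then have e: "lact (mk_bimod B V l r) \<in> extensional2 (carrier B) (carrier V)"
    "ract (mk_bimod B V l r) \<in> extensional2 (carrier V) (carrier B)"
    "mult (mk_bimod B V l r) = (\<lambda>_ _. undefined)" "one (mk_bimod B V l r) = undefined"
    by (simp_all add: mk_bimod_def)
  show ?thesis unfolding bimodule_def
    using V e by (simp add: cl L(6,7) R(6,7) c lin_add[OF bil_l[OF L(4)]] lin_add[OF bil_r[OF L(4)]]
       lin_smult[OF bil_r[OF L(4)]] lin_add[OF bil_l[OF R(4)]] lin_add[OF bil_r[OF R(4)]]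
       lin_smult[OF bil_r[OF R(4)]])
qed

subsection \<open>The category of bimodules\<close>

lemma Ob_C [simp]: "X \<in> Ob C \<longleftrightarrow> bm X" by (simp add: bimod_cat_def)
lemma dom_C [simp]: "dom_of C f = src f" and cod_C [simp]: "cod_of C f = trg f"
  by (simp_all add: bimod_cat_def)
lemma arr_C: "f \<in> arr C X Y \<longleftrightarrow> f \<in> Ar C \<and> src f = X \<and> trg f = Y" by (simp add: arr_def)

lemma mk_arrow_fields [simp]: "src (mk_arrow M N f) = M" "trg (mk_arrow M N f) = N"
  "x \<in> carrier M \<Longrightarrow> mk_arrow M N f $ x = f x"
  by (simp_all add: mk_arrow_def)

lemma Ar_C: "f \<in> Ar C \<longleftrightarrow> bm (src f) \<and> bm (trg f) \<and> bimodule_map K B (src f) (trg f) (map_of_arrow f)"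
  unfolding bimod_cat_def by (cases f) auto

lemma ArD:
  assumes "f \<in> Ar C"
  shows "bm (src f)" "bm (trg f)" "lin (src f) (trg f) (map_of_arrow f)"
    "\<And>b x. b \<in> carrier B \<Longrightarrow> x \<in> carrier (src f) \<Longrightarrow> f $ (lact (src f) b x) = lact (trg f) b (f $ x)"
    "\<And>b x. b \<in> carrier B \<Longrightarrow> x \<in> carrier (src f) \<Longrightarrow> f $ (ract (src f) x b) = ract (trg f) (f $ x) b"
    "map_of_arrow f \<in> extensional (carrier (src f))"
  using assms by (auto simp: Ar_C bimodule_map_def linear_map_iff)

lemma mk_arrow_Ar:
  assumes "bm M" "bm N" "lin M N f"
    "\<And>b x. b \<in> carrier B \<Longrightarrow> x \<in> carrier M \<Longrightarrow> f (lact M b x) = lact N b (f x)"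
    "\<And>b x. b \<in> carrier B \<Longrightarrow> x \<in> carrier M \<Longrightarrow> f (ract M x b) = ract N (f x) b"
  shows "mk_arrow M N f \<in> Ar C"
proof -
  have "lin M N (restrict f (carrier M))" using assms(1,3) by (simp add: lin_def)
  then show ?thesis using assms
    by (simp add: Ar_C mk_arrow_def bimodule_map_def linear_map_iff)
qed

lemma val_cl [simp]: "f \<in> Ar C \<Longrightarrow> trg f = Y \<Longrightarrow> x \<in> carrier (src f) \<Longrightarrow> f $ x \<in> carrier Y"
  using lin_cl[OF ArD(3)] by blast

lemma arr_eqI:
  assumes "f \<in> Ar C" "g \<in> Ar C" "src f = src g" "trg f = trg g"
    "\<And>x. x \<in> carrier (src g) \<Longrightarrow> f $ x = g $ x"
  shows "f = g"
proof -
  have "map_of_arrow f = map_of_arrow g"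
    using ArD(6)[OF assms(1)] ArD(6)[OF assms(2)] assms(3,5) by (intro extensionalityI[of _ "carrier (src g)"]) auto
  then show ?thesis using assms(3,4) by simp
qed

lemma src_cmp [simp]: "src (cmp C g f) = src f" and trg_cmp [simp]: "trg (cmp C g f) = trg g"
  and val_cmp [simp]: "x \<in> carrier (src f) \<Longrightarrow> cmp C g f $ x = g $ (f $ x)"
  by (simp_all add: bimod_cat_def compose_def)

lemma cmp_Ar [simp]: "f \<in> Ar C \<Longrightarrow> g \<in> Ar C \<Longrightarrow> trg f = src g \<Longrightarrow> cmp C g f \<in> Ar C"
proof -
  assume a: "f \<in> Ar C" "g \<in> Ar C" "trg f = src g"
  have "cmp C g f = mk_arrow (src f) (trg g) (\<lambda>x. g $ (f $ x))"
    by (simp add: bimod_cat_def mk_arrow_def compose_def)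
  moreover have "mk_arrow (src f) (trg g) (\<lambda>x. g $ (f $ x)) \<in> Ar C"
    by (rule mk_arrow_Ar)
      (use a ArD[OF a(1)] ArD[OF a(2)] in \<open>auto intro: lin_comp\<close>)
  ultimately show ?thesis by simp
qed

lemma ide_Ar [simp]: "bm X \<Longrightarrow> ide C X \<in> Ar C" and src_ide [simp]: "src (ide C X) = X"
  and trg_ide [simp]: "trg (ide C X) = X" and val_ide [simp]: "x \<in> carrier X \<Longrightarrow> ide C X $ x = x"
proof -
  have *: "ide C X = mk_arrow X X (\<lambda>x. x)" by (simp add: bimod_cat_def mk_arrow_def restrict_def)
  show "bm X \<Longrightarrow> ide C X \<in> Ar C" unfolding * by (rule mk_arrow_Ar) simp_all
qed (simp_all add: bimod_cat_def)

sublocale cat: category C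
  by unfold_locales (auto simp: arr_C ArD(1,2) intro!: arr_eqI)

lemma inverse_arr_unique: "inverse_arr C f g \<Longrightarrow> inverse_arr C f g' \<Longrightarrow> g = g'"
proof -
  assume a: "inverse_arr C f g" "inverse_arr C f g'"
  then have *: "f \<in> Ar C" "g \<in> Ar C" "g' \<in> Ar C" "src g = trg f" "src g' = trg f" "trg g = src f" "trg g' = src f"
    by (auto simp: inverse_arr_def arr_C)
  have g: "cmp C g f = ide C (src f)" "cmp C f g' = ide C (trg f)" using a by (auto simp: inverse_arr_def)
  have "cmp C g (cmp C f g') = cmp C (cmp C g f) g'"
    using * by (intro arr_eqI) auto
  then have 1: "cmp C g (ide C (trg f)) = cmp C (ide C (src f)) g'" by (simp add: g)
  have "cmp C g (ide C (trg f)) = g" using * ArD(1,2)[OF *(1)] by (intro arr_eqI) auto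
  moreover have "cmp C (ide C (src f)) g' = g'" using * ArD(1,2)[OF *(1)] by (intro arr_eqI) auto
  ultimately show "g = g'" using 1 by simp
qed

lemma inv_arr_eq: "inverse_arr C f g \<Longrightarrow> inv_arr C f = g"
  unfolding inv_arr_def using inverse_arr_unique by blast

text \<open>A linear inverse of a bimodule map commutes with the actions: apply the map to both
  candidates and cancel. Invertibility in the category thus reduces to linear algebra.\<close>

lemma inverse_arr_lin:
  assumes f: "f \<in> Ar C" and g: "lin (trg f) (src f) g"
    and gf: "\<And>x. x \<in> carrier (src f) \<Longrightarrow> g (f $ x) = x" and fg: "\<And>y. y \<in> carrier (trg f) \<Longrightarrow> f $ (g y) = y"
  shows "mk_arrow (trg f) (src f) g \<in> Ar C" "inverse_arr C f (mk_arrow (trg f) (src f) g)"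
proof -
  note F = ArD[OF f]
  show g': "mk_arrow (trg f) (src f) g \<in> Ar C"
  proof (rule mk_arrow_Ar[OF F(2,1) g])
    fix b y assume b: "b \<in> carrier B" and y: "y \<in> carrier (trg f)"
    have c: "g y \<in> carrier (src f)" using g y by (rule lin_cl)
    have "f $ (lact (src f) b (g y)) = lact (trg f) b y" using F(4)[OF b c] fg[OF y] by simp
    then show "g (lact (trg f) b y) = lact (src f) b (g y)" using gf[of "lact (src f) b (g y)"] b c F(1) by simp
    have "f $ (ract (src f) (g y) b) = ract (trg f) y b" using F(5)[OF b c] fg[OF y] by simp
    then show "g (ract (trg f) y b) = ract (src f) (g y) b" using gf[of "ract (src f) (g y) b"] b c F(1) by simp
  qed
  show "inverse_arr C f (mk_arrow (trg f) (src f) g)"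
    unfolding inverse_arr_def using g' f F(1,2) gf fg lin_cl[OF g]
    by (auto simp: arr_C intro!: arr_eqI)
qed

lemma iso_lin: "f \<in> Ar C \<Longrightarrow> lin (trg f) (src f) g \<Longrightarrow>
    (\<And>x. x \<in> carrier (src f) \<Longrightarrow> g (f $ x) = x) \<Longrightarrow> (\<And>y. y \<in> carrier (trg f) \<Longrightarrow> f $ (g y) = y) \<Longrightarrow> iso_arr C f"
  unfolding iso_arr_def using inverse_arr_lin by blast

end

text \<open>Both monoidal products of the duoidal category are quotients of the tensor product of
  vector spaces. Everything about them is determined by the values on the pure tensors \<open>pt\<close>; the
  values of the unit isomorphisms are called \<open>lu\<close> and \<open>ru\<close>.\<close>

locale ctensor = bial K B for K :: "('u :: infinite) ring" and B +
  fixes T :: "('u bimod, 'u bimod_arrow) tensor_data"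
    and pt :: "'u bimod \<Rightarrow> 'u bimod \<Rightarrow> 'u \<Rightarrow> 'u \<Rightarrow> 'u"
    and lu :: "'u bimod \<Rightarrow> 'u \<Rightarrow> 'u \<Rightarrow> 'u" and ru :: "'u bimod \<Rightarrow> 'u \<Rightarrow> 'u \<Rightarrow> 'u"
    and ten :: "'u bimod \<Rightarrow> 'u bimod \<Rightarrow> 'u bimod" (infixr \<open>\<diamondop>\<close> 75)
    and tena :: "'u bimod_arrow \<Rightarrow> 'u bimod_arrow \<Rightarrow> 'u bimod_arrow" (infixr \<open>\<diamondop>\<^sub>a\<close> 75)
    and U :: "'u bimod"
  assumes T_ops: "tenO T = ten" "tenA T = tena" "munit T = U"
    and ten_bm [simp]: "bm X \<Longrightarrow> bm Y \<Longrightarrow> bm (X \<diamondop> Y)"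
    and pt_bil: "bm X \<Longrightarrow> bm Y \<Longrightarrow> bil X Y (X \<diamondop> Y) (pt X Y)"
    and ten_ind: "\<And>X Y t P. bm X \<Longrightarrow> bm Y \<Longrightarrow> t \<in> carrier (X \<diamondop> Y) \<Longrightarrow>
      (\<And>x y. x \<in> carrier X \<Longrightarrow> y \<in> carrier Y \<Longrightarrow> P (pt X Y x y)) \<Longrightarrow>
      (\<And>s t. s \<in> carrier (X \<diamondop> Y) \<Longrightarrow> t \<in> carrier (X \<diamondop> Y) \<Longrightarrow> P s \<Longrightarrow> P t \<Longrightarrow> P (s \<oplus>\<^bsub>X \<diamondop> Y\<^esub> t)) \<Longrightarrow> P t"
    and tena_src [simp]: "src (f \<diamondop>\<^sub>a g) = src f \<diamondop> src g"
    and tena_trg [simp]: "trg (f \<diamondop>\<^sub>a g) = trg f \<diamondop> trg g"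
    and tena_Ar [simp]: "f \<in> Ar C \<Longrightarrow> g \<in> Ar C \<Longrightarrow> f \<diamondop>\<^sub>a g \<in> Ar C"
    and tena_pt [simp]: "f \<in> Ar C \<Longrightarrow> g \<in> Ar C \<Longrightarrow> src f = X \<Longrightarrow> src g = Y \<Longrightarrow> x \<in> carrier X \<Longrightarrow> y \<in> carrier Y \<Longrightarrow>
      (f \<diamondop>\<^sub>a g) $ pt X Y x y = pt (trg f) (trg g) (f $ x) (g $ y)"
    and U_bm [simp]: "bm (U)"
    and asc_src [simp]: "src (asc T X Y Z) = (X \<diamondop> Y) \<diamondop> Z" and asc_trg [simp]: "trg (asc T X Y Z) = X \<diamondop> (Y \<diamondop> Z)"
    and asc_Ar [simp]: "bm X \<Longrightarrow> bm Y \<Longrightarrow> bm Z \<Longrightarrow> asc T X Y Z \<in> Ar C"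
    and asc_pt [simp]: "bm X \<Longrightarrow> bm Y \<Longrightarrow> bm Z \<Longrightarrow> x \<in> carrier X \<Longrightarrow> y \<in> carrier Y \<Longrightarrow> z \<in> carrier Z \<Longrightarrow>
      asc T X Y Z $ (pt (X \<diamondop> Y) Z (pt X Y x y) z) = pt X (Y \<diamondop> Z) x (pt Y Z y z)"
    and asc_inv: "bm X \<Longrightarrow> bm Y \<Longrightarrow> bm Z \<Longrightarrow> \<exists>g. lin (X \<diamondop> (Y \<diamondop> Z)) ((X \<diamondop> Y) \<diamondop> Z) g \<and>
      (\<forall>x\<in>carrier X. \<forall>y\<in>carrier Y. \<forall>z\<in>carrier Z. g (pt X (Y \<diamondop> Z) x (pt Y Z y z)) = pt (X \<diamondop> Y) Z (pt X Y x y) z)"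
    and lun_src [simp]: "src (lun T X) = U \<diamondop> X" and lun_trg [simp]: "trg (lun T X) = X"
    and lun_Ar [simp]: "bm X \<Longrightarrow> lun T X \<in> Ar C"
    and lun_pt [simp]: "bm X \<Longrightarrow> u \<in> carrier (U) \<Longrightarrow> x \<in> carrier X \<Longrightarrow> lun T X $ (pt (U) X u x) = lu X u x"
    and lun_inv: "bm X \<Longrightarrow> \<exists>g. lin X (U \<diamondop> X) g \<and> (\<forall>x\<in>carrier X. lun T X $ (g x) = x) \<and>
      (\<forall>u\<in>carrier (U). \<forall>x\<in>carrier X. g (lu X u x) = pt (U) X u x)"
    and lu_nat: "f \<in> Ar C \<Longrightarrow> u \<in> carrier (U) \<Longrightarrow> x \<in> carrier (src f) \<Longrightarrow> f $ lu (src f) u x = lu (trg f) u (f $ x)"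
    and run_src [simp]: "src (run T X) = X \<diamondop> U" and run_trg [simp]: "trg (run T X) = X"
    and run_Ar [simp]: "bm X \<Longrightarrow> run T X \<in> Ar C"
    and run_pt [simp]: "bm X \<Longrightarrow> u \<in> carrier (U) \<Longrightarrow> x \<in> carrier X \<Longrightarrow> run T X $ (pt X (U) x u) = ru X x u"
    and run_inv: "bm X \<Longrightarrow> \<exists>g. lin X (X \<diamondop> U) g \<and> (\<forall>x\<in>carrier X. run T X $ (g x) = x) \<and>
      (\<forall>u\<in>carrier (U). \<forall>x\<in>carrier X. g (ru X x u) = pt X (U) x u)"
    and ru_nat: "f \<in> Ar C \<Longrightarrow> u \<in> carrier (U) \<Longrightarrow> x \<in> carrier (src f) \<Longrightarrow> f $ ru (src f) x u = ru (trg f) (f $ x) u"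
    and lu_ru: "bm X \<Longrightarrow> bm Y \<Longrightarrow> u \<in> carrier (U) \<Longrightarrow> x \<in> carrier X \<Longrightarrow> y \<in> carrier Y \<Longrightarrow>
      pt X Y x (lu Y u y) = pt X Y (ru X x u) y"
begin

lemma pt_cl [simp]: "bm X \<Longrightarrow> bm Y \<Longrightarrow> x \<in> carrier X \<Longrightarrow> y \<in> carrier Y \<Longrightarrow> pt X Y x y \<in> carrier (X \<diamondop> Y)"
  using bil_cl[OF pt_bil] by blast

lemma lin_ext2:
  assumes "bm X" "bm Y" and f: "lin (X \<diamondop> Y) P f" and g: "lin (X \<diamondop> Y) P g"
    and eq: "\<And>x y. x \<in> carrier X \<Longrightarrow> y \<in> carrier Y \<Longrightarrow> f (pt X Y x y) = g (pt X Y x y)"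
    and t: "t \<in> carrier (X \<diamondop> Y)"
  shows "f t = g t"
  by (rule ten_ind[OF assms(1,2) t]) (simp_all add: eq lin_add[OF f] lin_add[OF g])

lemma lin_ext3L:
  assumes b: "bm X" "bm Y" "bm Z" and f: "lin ((X \<diamondop> Y) \<diamondop> Z) P f" and g: "lin ((X \<diamondop> Y) \<diamondop> Z) P g"
    and eq: "\<And>x y z. x \<in> carrier X \<Longrightarrow> y \<in> carrier Y \<Longrightarrow> z \<in> carrier Z \<Longrightarrow>
      f (pt (X \<diamondop> Y) Z (pt X Y x y) z) = g (pt (X \<diamondop> Y) Z (pt X Y x y) z)"
    and t: "t \<in> carrier ((X \<diamondop> Y) \<diamondop> Z)"
  shows "f t = g t"
proof (rule lin_ext2[OF _ b(3) f g _ t])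
  fix s z assume s: "s \<in> carrier (X \<diamondop> Y)" and z: "z \<in> carrier Z"
  have l: "lin (X \<diamondop> Y) ((X \<diamondop> Y) \<diamondop> Z) (\<lambda>s. pt (X \<diamondop> Y) Z s z)" using pt_bil b z by (simp add: bil_def)
  show "f (pt (X \<diamondop> Y) Z s z) = g (pt (X \<diamondop> Y) Z s z)"
    by (rule lin_ext2[OF b(1,2) lin_comp[OF l f] lin_comp[OF l g] _ s]) (simp add: eq z)
qed (use b in simp)

lemma lin_ext3R:
  assumes b: "bm X" "bm Y" "bm Z" and f: "lin (X \<diamondop> (Y \<diamondop> Z)) P f" and g: "lin (X \<diamondop> (Y \<diamondop> Z)) P g"
    and eq: "\<And>x y z. x \<in> carrier X \<Longrightarrow> y \<in> carrier Y \<Longrightarrow> z \<in> carrier Z \<Longrightarrow>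
      f (pt X (Y \<diamondop> Z) x (pt Y Z y z)) = g (pt X (Y \<diamondop> Z) x (pt Y Z y z))"
    and t: "t \<in> carrier (X \<diamondop> (Y \<diamondop> Z))"
  shows "f t = g t"
proof (rule lin_ext2[OF b(1) _ f g _ t])
  fix s x assume s: "s \<in> carrier (Y \<diamondop> Z)" and x: "x \<in> carrier X"
  have l: "lin (Y \<diamondop> Z) (X \<diamondop> (Y \<diamondop> Z)) (pt X (Y \<diamondop> Z) x)" using pt_bil b x by (simp add: bil_def)
  show "f (pt X (Y \<diamondop> Z) x s) = g (pt X (Y \<diamondop> Z) x s)"
    by (rule lin_ext2[OF b(2,3) lin_comp[OF l f] lin_comp[OF l g] _ s]) (simp add: eq x)
qed (use b in simp)

lemma lin_ext4:
  assumes b: "bm W" "bm X" "bm Y" "bm Z"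
    and f: "lin (((W \<diamondop> X) \<diamondop> Y) \<diamondop> Z) P f" and g: "lin (((W \<diamondop> X) \<diamondop> Y) \<diamondop> Z) P g"
    and eq: "\<And>w x y z. w \<in> carrier W \<Longrightarrow> x \<in> carrier X \<Longrightarrow> y \<in> carrier Y \<Longrightarrow> z \<in> carrier Z \<Longrightarrow>
      f (pt ((W \<diamondop> X) \<diamondop> Y) Z (pt (W \<diamondop> X) Y (pt W X w x) y) z) = g (pt ((W \<diamondop> X) \<diamondop> Y) Z (pt (W \<diamondop> X) Y (pt W X w x) y) z)"
    and t: "t \<in> carrier (((W \<diamondop> X) \<diamondop> Y) \<diamondop> Z)"
  shows "f t = g t"
proof (rule lin_ext2[OF _ b(4) f g _ t])
  fix s z assume s: "s \<in> carrier ((W \<diamondop> X) \<diamondop> Y)" and z: "z \<in> carrier Z"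
  have l: "lin ((W \<diamondop> X) \<diamondop> Y) (((W \<diamondop> X) \<diamondop> Y) \<diamondop> Z) (\<lambda>s. pt ((W \<diamondop> X) \<diamondop> Y) Z s z)" using pt_bil b z by (simp add: bil_def)
  show "f (pt ((W \<diamondop> X) \<diamondop> Y) Z s z) = g (pt ((W \<diamondop> X) \<diamondop> Y) Z s z)"
    by (rule lin_ext3L[OF b(1-3) lin_comp[OF l f] lin_comp[OF l g] _ s]) (simp add: eq z)
qed (use b in simp)

lemma arr_ext2:
  assumes "bm X" "bm Y" "f \<in> Ar C" "g \<in> Ar C" "src f = X \<diamondop> Y" "src g = X \<diamondop> Y" "trg f = trg g"
    and "\<And>x y. x \<in> carrier X \<Longrightarrow> y \<in> carrier Y \<Longrightarrow> f $ (pt X Y x y) = g $ (pt X Y x y)"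
  shows "f = g"
  by (rule arr_eqI) (use assms lin_ext2[OF assms(1,2), of "trg g"] ArD(3)[OF assms(3)] ArD(3)[OF assms(4)] in auto)

lemma arr_ext3L:
  assumes "bm X" "bm Y" "bm Z" "f \<in> Ar C" "g \<in> Ar C" "src f = (X \<diamondop> Y) \<diamondop> Z" "src g = (X \<diamondop> Y) \<diamondop> Z" "trg f = trg g"
    and "\<And>x y z. x \<in> carrier X \<Longrightarrow> y \<in> carrier Y \<Longrightarrow> z \<in> carrier Z \<Longrightarrow>
      f $ (pt (X \<diamondop> Y) Z (pt X Y x y) z) = g $ (pt (X \<diamondop> Y) Z (pt X Y x y) z)"
  shows "f = g"
  by (rule arr_eqI) (use assms lin_ext3L[OF assms(1-3), of "trg g"] ArD(3)[OF assms(4)] ArD(3)[OF assms(5)] in auto)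

lemma arr_ext4:
  assumes "bm W" "bm X" "bm Y" "bm Z" "f \<in> Ar C" "g \<in> Ar C" "src f = ((W \<diamondop> X) \<diamondop> Y) \<diamondop> Z" "src g = ((W \<diamondop> X) \<diamondop> Y) \<diamondop> Z" "trg f = trg g"
    and "\<And>w x y z. w \<in> carrier W \<Longrightarrow> x \<in> carrier X \<Longrightarrow> y \<in> carrier Y \<Longrightarrow> z \<in> carrier Z \<Longrightarrow>
      f $ (pt ((W \<diamondop> X) \<diamondop> Y) Z (pt (W \<diamondop> X) Y (pt W X w x) y) z) = g $ (pt ((W \<diamondop> X) \<diamondop> Y) Z (pt (W \<diamondop> X) Y (pt W X w x) y) z)"
  shows "f = g"
  by (rule arr_eqI) (use assms lin_ext4[OF assms(1-4), of "trg g"] ArD(3)[OF assms(5)] ArD(3)[OF assms(6)] in auto)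

text \<open>The locale provides a linear map with the expected values on pure tensors. Its
  composites with the associator agree with the identity there, hence everywhere, and
  \<open>inverse_arr_lin\<close> makes an arrow of it.\<close>

lemma asc_inverse:
  assumes b: "bm X" "bm Y" "bm Z"
  obtains g where "inverse_arr C (asc T X Y Z) g" "inv_arr C (asc T X Y Z) = g"
    "\<And>x y z. x \<in> carrier X \<Longrightarrow> y \<in> carrier Y \<Longrightarrow> z \<in> carrier Z \<Longrightarrow>
      g $ (pt X (Y \<diamondop> Z) x (pt Y Z y z)) = pt (X \<diamondop> Y) Z (pt X Y x y) z"
proof -
  let ?a = "asc T X Y Z"
  obtain g where g: "lin (X \<diamondop> (Y \<diamondop> Z)) ((X \<diamondop> Y) \<diamondop> Z) g"
    and gv: "\<And>x y z. x \<in> carrier X \<Longrightarrow> y \<in> carrier Y \<Longrightarrow> z \<in> carrier Z \<Longrightarrow> g (pt X (Y \<diamondop> Z) x (pt Y Z y z)) = pt (X \<diamondop> Y) Z (pt X Y x y) z"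
    using asc_inv[OF b] by blast
  have a: "?a \<in> Ar C" "lin ((X \<diamondop> Y) \<diamondop> Z) (X \<diamondop> (Y \<diamondop> Z)) (map_of_arrow ?a)"
    using b ArD(3)[of ?a] by auto
  have 1: "g (?a $ t) = t" if "t \<in> carrier ((X \<diamondop> Y) \<diamondop> Z)" for t
    by (rule lin_ext3L[OF b lin_comp[OF a(2) g] lin_id _ that]) (simp add: b gv)
  have 2: "?a $ (g t) = t" if "t \<in> carrier (X \<diamondop> (Y \<diamondop> Z))" for t
    by (rule lin_ext3R[OF b lin_comp[OF g a(2)] lin_id _ that]) (simp add: b gv)
  have i: "inverse_arr C ?a (mk_arrow (X \<diamondop> (Y \<diamondop> Z)) ((X \<diamondop> Y) \<diamondop> Z) g)"
    using inverse_arr_lin(2)[OF a(1), of g] g 1 2 by simp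
  show thesis by (rule that[OF i inv_arr_eq[OF i]]) (use b gv in simp)
qed

lemma iasc [simp]:
  assumes b: "bm X" "bm Y" "bm Z"
  shows "inv_arr C (asc T X Y Z) \<in> Ar C" "src (inv_arr C (asc T X Y Z)) = X \<diamondop> (Y \<diamondop> Z)"
    "trg (inv_arr C (asc T X Y Z)) = (X \<diamondop> Y) \<diamondop> Z"
    "x \<in> carrier X \<Longrightarrow> y \<in> carrier Y \<Longrightarrow> z \<in> carrier Z \<Longrightarrow>
      inv_arr C (asc T X Y Z) $ (pt X (Y \<diamondop> Z) x (pt Y Z y z)) = pt (X \<diamondop> Y) Z (pt X Y x y) z"
  by (rule asc_inverse[OF b]; auto simp: inverse_arr_def arr_C)+

lemma lun_iso: assumes b: "bm X" shows "iso_arr C (lun T X)"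
proof -
  obtain g where g: "lin X (U \<diamondop> X) g" "\<And>x. x \<in> carrier X \<Longrightarrow> lun T X $ (g x) = x"
    "\<And>u x. u \<in> carrier (U) \<Longrightarrow> x \<in> carrier X \<Longrightarrow> g (lu X u x) = pt (U) X u x" using lun_inv[OF b] by blast
  have l: "lin (U \<diamondop> X) X (map_of_arrow (lun T X))" using b ArD(3)[of "lun T X"] by simp
  have "g (lun T X $ t) = t" if "t \<in> carrier (U \<diamondop> X)" for t
    by (rule lin_ext2[OF _ b lin_comp[OF l g(1)] lin_id _ that]) (simp_all add: b g)
  then show ?thesis using b g by (intro iso_lin[of _ g]) auto
qed

lemma run_iso: assumes b: "bm X" shows "iso_arr C (run T X)"
proof -
  obtain g where g: "lin X (X \<diamondop> U) g" "\<And>x. x \<in> carrier X \<Longrightarrow> run T X $ (g x) = x"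
    "\<And>u x. u \<in> carrier (U) \<Longrightarrow> x \<in> carrier X \<Longrightarrow> g (ru X x u) = pt X (U) x u" using run_inv[OF b] by blast
  have l: "lin (X \<diamondop> U) X (map_of_arrow (run T X))" using b ArD(3)[of "run T X"] by simp
  have "g (run T X $ t) = t" if "t \<in> carrier (X \<diamondop> U)" for t
    by (rule lin_ext2[OF b _ lin_comp[OF l g(1)] lin_id _ that]) (simp_all add: b g)
  then show ?thesis using b g by (intro iso_lin[of _ g]) auto
qed

lemma asc_iso: "bm X \<Longrightarrow> bm Y \<Longrightarrow> bm Z \<Longrightarrow> iso_arr C (asc T X Y Z)"
  using asc_inverse[of X Y Z] by (auto simp: iso_arr_def)

text \<open>Pentagon and naturality of the associator hold because both sides rebracket the same
  pure tensor. The triangle is exactly \<open>lu_ru\<close>, and naturality of the unit isomorphisms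
  is \<open>lu_nat\<close> and \<open>ru_nat\<close>.\<close>

lemma monoidal: "monoidal_category C T"
  apply unfold_locales
                 apply (simp_all only: arr_C Ob_C T_ops)
                 apply (simp_all add: lun_iso run_iso asc_iso)
       subgoal for X Y by (rule arr_ext2[of X Y]; simp)
      subgoal for f f' g g' by (elim conjE, rule arr_ext2[of "src f" "src g"]; simp add: ArD(1,2))
     subgoal for f g h by (rule arr_ext3L[of "src f" "src g" "src h"]; simp add: ArD(1,2))
    subgoal for f by (rule arr_ext2[of U "src f"]; simp add: ArD(1,2) lu_nat)
   subgoal for f by (rule arr_ext2[of "src f" U]; simp add: ArD(1,2) ru_nat)
  subgoal for W X Y Z by (rule arr_ext4[of W X Y Z]; simp)
  subgoal for X Y by (rule arr_ext3L[of X U Y]; simp add: lu_ru)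
  done

end

text \<open>Taking \<open>A\<close> to be the carrier of \<open>B\<close> gives \<open>\<otimes>\<^sub>B\<close>, and \<open>A = {}\<close> gives \<open>\<otimes>\<^sub>K\<close>.\<close>

locale quot_tensor0 = bial K B for K :: "('u :: infinite) ring" and B +
  fixes A :: "'u set" and Q :: "'u bimod \<Rightarrow> 'u bimod \<Rightarrow> (('u \<times> 'u) \<times> ('u \<times> 'u)) set"
    and P :: "'u bimod \<Rightarrow> 'u bimod \<Rightarrow> 'u \<Rightarrow> 'u \<Rightarrow> 'u"
    and L :: "'u bimod \<Rightarrow> 'u bimod \<Rightarrow> 'u \<Rightarrow> 'u \<Rightarrow> 'u" and R :: "'u bimod \<Rightarrow> 'u bimod \<Rightarrow> 'u \<Rightarrow> 'u \<Rightarrow> 'u"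
    and ten :: "'u bimod \<Rightarrow> 'u bimod \<Rightarrow> 'u bimod" (infixr \<open>\<box>\<close> 75)
  assumes Q_def: "\<And>X Y. Q X Y = {((ract X x b, y), (x, lact Y b y)) | x b y. x \<in> carrier X \<and> b \<in> A \<and> y \<in> carrier Y}"
    and P_def: "\<And>X Y x y. P X Y x y = tens_class K X Y (Q X Y) [(x, y)]"
    and ten_def: "\<And>X Y. X \<box> Y = mk_bimod B (tens_quot K X Y (Q X Y)) (L X Y) (R X Y)"
    and AB: "A \<subseteq> carrier B"
    and ten_bm: "bm X \<Longrightarrow> bm Y \<Longrightarrow> bm (X \<box> Y)"
    and A_lact: "bm X \<Longrightarrow> bm Y \<Longrightarrow> b \<in> A \<Longrightarrow> x \<in> carrier X \<Longrightarrow> y \<in> carrier Y \<Longrightarrow>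
      lact (X \<box> Y) b (P X Y x y) = P X Y (lact X b x) y"
    and A_ract: "bm X \<Longrightarrow> bm Y \<Longrightarrow> b \<in> A \<Longrightarrow> x \<in> carrier X \<Longrightarrow> y \<in> carrier Y \<Longrightarrow>
      ract (X \<box> Y) (P X Y x y) b = P X Y x (ract Y y b)"
begin

text \<open>The outer lift runs over a tensor \<open>s\<close> of the first two factors and an
  element \<open>z\<close>; the inner one takes \<open>s\<close> apart with \<open>z\<close> fixed.
  Well-definedness is accordingly a matter of two lifts.\<close>

definition ascf :: "'u bimod \<Rightarrow> 'u bimod \<Rightarrow> 'u bimod \<Rightarrow> 'u \<Rightarrow> 'u"
  where "ascf X Y Z = lift (X \<box> (Y \<box> Z)) (\<lambda>s z. lift (X \<box> (Y \<box> Z)) (\<lambda>x y. P X (Y \<box> Z) x (P Y Z y z)) s)"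

lemma AB' [simp]: "b \<in> A \<Longrightarrow> b \<in> carrier B" using AB by blast

lemma Q_scaled: assumes "bm X" "bm Y" shows "scaled X Y (Q X Y)"
proof -
  have "c \<odot>\<^bsub>X\<^esub> ract X x b = ract X (c \<odot>\<^bsub>X\<^esub> x) b" if "c \<in> carrier K" "b \<in> A" "x \<in> carrier X" for c b x
    using lin_smult[OF bil_l[OF ract_bil[OF assms(1)]], of b c x] that by simp
  then show ?thesis using assms by (fastforce simp: scaled_def Q_def)
qed

lemma P_bal: "bm X \<Longrightarrow> bm Y \<Longrightarrow> b \<in> A \<Longrightarrow> x \<in> carrier X \<Longrightarrow> y \<in> carrier Y \<Longrightarrow> P X Y (ract X x b) y = P X Y x (lact Y b y)"
  unfolding P_def by (rule pure_Q) (auto simp: Q_def)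

lemma respI: "(\<And>b x y. b \<in> A \<Longrightarrow> x \<in> carrier X \<Longrightarrow> y \<in> carrier Y \<Longrightarrow> \<phi> (ract X x b) y = \<phi> x (lact Y b y)) \<Longrightarrow>
    resp X Y (Q X Y) \<phi>"
  by (auto simp: resp_def Q_def)

lemma ten_car: "carrier (X \<box> Y) = carrier (tens_quot K X Y (Q X Y))" "add (X \<box> Y) = add (tens_quot K X Y (Q X Y))"
  by (simp_all add: ten_def)

lemma ten_lin: "lin (X \<box> Y) N = lin (tens_quot K X Y (Q X Y)) N" by (simp add: ten_def)

lemma P_cl [simp]: "bm X \<Longrightarrow> bm Y \<Longrightarrow> x \<in> carrier X \<Longrightarrow> y \<in> carrier Y \<Longrightarrow> P X Y x y \<in> carrier (X \<box> Y)"
  by (simp add: ten_car P_def)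

lemma P_bil: "bm X \<Longrightarrow> bm Y \<Longrightarrow> bil X Y (X \<box> Y) (P X Y)"
  by (simp add: P_def[abs_def] ten_def bil_pure Q_scaled)

lemma P_ind:
  assumes "bm X" "bm Y" "t \<in> carrier (X \<box> Y)" "\<And>x y. x \<in> carrier X \<Longrightarrow> y \<in> carrier Y \<Longrightarrow> Z (P X Y x y)"
    "\<And>s t. s \<in> carrier (X \<box> Y) \<Longrightarrow> t \<in> carrier (X \<box> Y) \<Longrightarrow> Z s \<Longrightarrow> Z t \<Longrightarrow> Z (s \<oplus>\<^bsub>X \<box> Y\<^esub> t)"
  shows "Z t"
proof (rule class_induct[of X Y t "Q X Y"])
  show "\<And>x y. x \<in> carrier X \<Longrightarrow> y \<in> carrier Y \<Longrightarrow> Z (tens_class K X Y (Q X Y) [(x, y)])"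
    using assms(4) by (simp add: P_def)
  show "\<And>s t. s \<in> carrier (tens_quot K X Y (Q X Y)) \<Longrightarrow> t \<in> carrier (tens_quot K X Y (Q X Y)) \<Longrightarrow> Z s \<Longrightarrow> Z t \<Longrightarrow>
      Z (s \<oplus>\<^bsub>tens_quot K X Y (Q X Y)\<^esub> t)"
    using assms(5) by (simp add: ten_car)
qed (use assms in \<open>simp_all add: ten_car\<close>)

lemma P_ext:
  assumes "bm X" "bm Y" "lin (X \<box> Y) Z f" "lin (X \<box> Y) Z g"
    "\<And>x y. x \<in> carrier X \<Longrightarrow> y \<in> carrier Y \<Longrightarrow> f (P X Y x y) = g (P X Y x y)" "t \<in> carrier (X \<box> Y)"
  shows "f t = g t"
  by (rule P_ind[OF assms(1,2,6)]) (simp_all add: assms(5) lin_add[OF assms(3)] lin_add[OF assms(4)])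

lemma P_lift:
  assumes b: "bm X" "bm Y" "vs Z" "bil X Y Z \<phi>"
    and A: "\<And>b x y. b \<in> A \<Longrightarrow> x \<in> carrier X \<Longrightarrow> y \<in> carrier Y \<Longrightarrow> \<phi> (ract X x b) y = \<phi> x (lact Y b y)"
  shows "lin (X \<box> Y) Z (lift Z \<phi>)" "\<And>x y. x \<in> carrier X \<Longrightarrow> y \<in> carrier Y \<Longrightarrow> lift Z \<phi> (P X Y x y) = \<phi> x y"
proof -
  have r: "resp X Y (Q X Y) \<phi>" using A by (rule respI)
  show "lin (X \<box> Y) Z (lift Z \<phi>)" unfolding ten_lin by (rule lift_lin) (use b r Q_scaled in auto)
  show "\<And>x y. x \<in> carrier X \<Longrightarrow> y \<in> carrier Y \<Longrightarrow> lift Z \<phi> (P X Y x y) = \<phi> x y"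
    unfolding P_def by (rule lift_pure) (use b r in auto)
qed

lemma lift_par:
  assumes "bm X" "bm Y" "vs V" "vs Z" "t \<in> carrier (X \<box> Y)" "\<And>x y. x \<in> carrier X \<Longrightarrow> y \<in> carrier Y \<Longrightarrow> lin V Z (\<lambda>u. \<phi> u x y)"
  shows "lin V Z (\<lambda>u. lift Z (\<phi> u) t)"
  by (rule lift_param[of X Y]) (use assms in \<open>auto simp: ten_car\<close>)

text \<open>Balancing survives since \<open>f\<close> respects the right action on the first factor
  and \<open>g\<close> the left action on the second.\<close>

lemma tena_lin:
  assumes "f \<in> Ar C" "g \<in> Ar C"
  defines "\<phi> \<equiv> \<lambda>x y. P (trg f) (trg g) (f $ x) (g $ y)"
  shows "lin (src f \<box> src g) (trg f \<box> trg g) (lift (trg f \<box> trg g) \<phi>)"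
    "\<And>x y. x \<in> carrier (src f) \<Longrightarrow> y \<in> carrier (src g) \<Longrightarrow> lift (trg f \<box> trg g) \<phi> (P (src f) (src g) x y) = \<phi> x y"
proof -
  note F = ArD[OF assms(1)] and G = ArD[OF assms(2)]
  have b: "bil (src f) (src g) (trg f \<box> trg g) \<phi>" unfolding \<phi>_def
    by (rule bil_comp[OF F(3) G(3) P_bil]) (use F G in auto)
  have a: "\<phi> (ract (src f) x b) y = \<phi> x (lact (src g) b y)"
    if "b \<in> A" "x \<in> carrier (src f)" "y \<in> carrier (src g)" for b x y
    using that F(1,2) G(1,2) assms by (simp add: \<phi>_def F(5) G(4) P_bal)
  show "lin (src f \<box> src g) (trg f \<box> trg g) (lift (trg f \<box> trg g) \<phi>)"
    "\<And>x y. x \<in> carrier (src f) \<Longrightarrow> y \<in> carrier (src g) \<Longrightarrow> lift (trg f \<box> trg g) \<phi> (P (src f) (src g) x y) = \<phi> x y"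
    using P_lift[OF F(1) G(1) _ b a] F(2) G(2) ten_bm by auto
qed

lemma lact_lin: "bm M \<Longrightarrow> b \<in> carrier B \<Longrightarrow> lin M M (lact M b)" by (rule bil_l[OF lact_bil])
lemma ract_lin: "bm M \<Longrightarrow> b \<in> carrier B \<Longrightarrow> lin M M (\<lambda>x. ract M x b)" by (rule bil_l[OF ract_bil])

lemma P_arrow:
  assumes b: "bm X" "bm Y" "bm Z" and f: "lin (X \<box> Y) Z f"
    and l: "\<And>b x y. b \<in> carrier B \<Longrightarrow> x \<in> carrier X \<Longrightarrow> y \<in> carrier Y \<Longrightarrow> f (lact (X \<box> Y) b (P X Y x y)) = lact Z b (f (P X Y x y))"
    and r: "\<And>b x y. b \<in> carrier B \<Longrightarrow> x \<in> carrier X \<Longrightarrow> y \<in> carrier Y \<Longrightarrow> f (ract (X \<box> Y) (P X Y x y) b) = ract Z (f (P X Y x y)) b"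
  shows "mk_arrow (X \<box> Y) Z f \<in> Ar C"
proof (rule mk_arrow_Ar[OF ten_bm[OF b(1,2)] b(3) f])
  fix c t assume c: "c \<in> carrier B" and t: "t \<in> carrier (X \<box> Y)"
  show "f (lact (X \<box> Y) c t) = lact Z c (f t)"
    by (rule P_ext[OF b(1,2) lin_comp[OF lact_lin f] lin_comp[OF f lact_lin] _ t]) (use b c l ten_bm in auto)
  show "f (ract (X \<box> Y) t c) = ract Z (f t) c"
    by (rule P_ext[OF b(1,2) lin_comp[OF ract_lin f] lin_comp[OF f ract_lin] _ t]) (use b c r ten_bm in auto)
qed

lemma P_arrow3:
  assumes b: "bm X" "bm Y" "bm V" "bm Z" and f: "lin ((X \<box> Y) \<box> V) Z f"
    and l: "\<And>b x y v. b \<in> carrier B \<Longrightarrow> x \<in> carrier X \<Longrightarrow> y \<in> carrier Y \<Longrightarrow> v \<in> carrier V \<Longrightarrow>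
      f (lact ((X \<box> Y) \<box> V) b (P (X \<box> Y) V (P X Y x y) v)) = lact Z b (f (P (X \<box> Y) V (P X Y x y) v))"
    and r: "\<And>b x y v. b \<in> carrier B \<Longrightarrow> x \<in> carrier X \<Longrightarrow> y \<in> carrier Y \<Longrightarrow> v \<in> carrier V \<Longrightarrow>
      f (ract ((X \<box> Y) \<box> V) (P (X \<box> Y) V (P X Y x y) v) b) = ract Z (f (P (X \<box> Y) V (P X Y x y) v)) b"
  shows "mk_arrow ((X \<box> Y) \<box> V) Z f \<in> Ar C"
proof (rule P_arrow[OF ten_bm[OF b(1,2)] b(3,4) f])
  fix c s v assume c: "c \<in> carrier B" and s: "s \<in> carrier (X \<box> Y)" and v: "v \<in> carrier V"
  have XY: "bm (X \<box> Y)" "bm ((X \<box> Y) \<box> V)" using b ten_bm by auto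
  have p: "lin (X \<box> Y) ((X \<box> Y) \<box> V) (\<lambda>s. P (X \<box> Y) V s v)" by (rule bil_r[OF P_bil]) (use b XY v in auto)
  show "f (lact ((X \<box> Y) \<box> V) c (P (X \<box> Y) V s v)) = lact Z c (f (P (X \<box> Y) V s v))"
    by (rule P_ext[OF b(1,2) lin_comp[OF lin_comp[OF p lact_lin] f] lin_comp[OF lin_comp[OF p f] lact_lin] _ s])
      (use XY b c v l in auto)
  show "f (ract ((X \<box> Y) \<box> V) (P (X \<box> Y) V s v) c) = ract Z (f (P (X \<box> Y) V s v)) c"
    by (rule P_ext[OF b(1,2) lin_comp[OF lin_comp[OF p ract_lin] f] lin_comp[OF lin_comp[OF p f] ract_lin] _ s])
      (use XY b c v r in auto)
qed

text \<open>For fixed \<open>z\<close>, balancing between X and Y holds because A acts on the left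
  of the product of Y and Z through Y (\<open>A_lact\<close>). Balancing against Z holds because A
  acts on the right of the product of X and Y through Y (\<open>A_ract\<close>), where the scalar
  can be moved on to \<open>z\<close>.\<close>

lemma ascf:
  assumes b: "bm X" "bm Y" "bm Z"
  shows ascf_lin: "lin ((X \<box> Y) \<box> Z) (X \<box> (Y \<box> Z)) (ascf X Y Z)"
    and ascf_P: "\<And>x y z. x \<in> carrier X \<Longrightarrow> y \<in> carrier Y \<Longrightarrow> z \<in> carrier Z \<Longrightarrow>
      ascf X Y Z (P (X \<box> Y) Z (P X Y x y) z) = P X (Y \<box> Z) x (P Y Z y z)"
proof -
  have bb: "bm (X \<box> Y)" "bm (Y \<box> Z)" "bm (X \<box> (Y \<box> Z))" "bm ((X \<box> Y) \<box> Z)" using b ten_bm by auto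
  let ?W = "X \<box> (Y \<box> Z)"
  let ?p = "\<lambda>z x y. P X (Y \<box> Z) x (P Y Z y z)"
  have q1: "lin X ?W (\<lambda>x. P X (Y \<box> Z) x s)" if "s \<in> carrier (Y \<box> Z)" for s
    using bil_r[OF P_bil[OF b(1) bb(2)]] that by auto
  have q2: "lin (Y \<box> Z) ?W (P X (Y \<box> Z) x)" if "x \<in> carrier X" for x
    using bil_l[OF P_bil[OF b(1) bb(2)]] that by auto
  have q3: "lin Y (Y \<box> Z) (\<lambda>y. P Y Z y z)" if "z \<in> carrier Z" for z
    using bil_r[OF P_bil[OF b(2,3)]] that by auto
  have q4: "lin Z (Y \<box> Z) (P Y Z y)" if "y \<in> carrier Y" for y
    using bil_l[OF P_bil[OF b(2,3)]] that by auto
  have i: "bil X Y ?W (?p z)" if "z \<in> carrier Z" for z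
    by (rule bilI) (use that q1 lin_comp[OF q3 q2] b in auto)
  have il: "lin (X \<box> Y) ?W (lift ?W (?p z))" "\<And>x y. x \<in> carrier X \<Longrightarrow> y \<in> carrier Y \<Longrightarrow> lift ?W (?p z) (P X Y x y) = ?p z x y"
    if "z \<in> carrier Z" for z
    using P_lift[OF b(1,2) _ i[OF that], unfolded bm_vs[OF bb(3)]] that b bb by (auto simp: P_bal A_lact)
  have o: "bil (X \<box> Y) Z ?W (\<lambda>s z. lift ?W (?p z) s)"
  proof (rule bilI)
    show "lin Z ?W (\<lambda>z. lift ?W (?p z) s)" if "s \<in> carrier (X \<box> Y)" for s
      by (rule lift_par[OF b(1,2) _ _ that]) (use b bb lin_comp[OF q4 q2] in auto)
  qed (rule il)
  have oA: "lift ?W (?p z) (ract (X \<box> Y) s c) = lift ?W (?p (lact Z c z)) s"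
    if c: "c \<in> A" and s: "s \<in> carrier (X \<box> Y)" and z: "z \<in> carrier Z" for c s z
    by (rule P_ext[OF b(1,2) lin_comp[OF ract_lin il(1)] il(1) _ s])
      (use b bb c z in \<open>simp_all add: A_ract il(2) P_bal\<close>)
  note l = P_lift[OF bb(1) b(3) bm_vs[OF bb(3)] o oA]
  show "lin ((X \<box> Y) \<box> Z) (X \<box> (Y \<box> Z)) (ascf X Y Z)" unfolding ascf_def by (rule l(1))
  show "\<And>x y z. x \<in> carrier X \<Longrightarrow> y \<in> carrier Y \<Longrightarrow> z \<in> carrier Z \<Longrightarrow>
      ascf X Y Z (P (X \<box> Y) Z (P X Y x y) z) = P X (Y \<box> Z) x (P Y Z y z)"
    unfolding ascf_def using l(2) il(2) b by simp
qed

lemma ascf_inv: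
  assumes b: "bm X" "bm Y" "bm Z"
  shows "\<exists>g. lin (X \<box> (Y \<box> Z)) ((X \<box> Y) \<box> Z) g \<and>
      (\<forall>x\<in>carrier X. \<forall>y\<in>carrier Y. \<forall>z\<in>carrier Z. g (P X (Y \<box> Z) x (P Y Z y z)) = P (X \<box> Y) Z (P X Y x y) z)"
proof -
  have bb: "bm (X \<box> Y)" "bm (Y \<box> Z)" "bm (X \<box> (Y \<box> Z))" "bm ((X \<box> Y) \<box> Z)" using b ten_bm by auto
  let ?W = "(X \<box> Y) \<box> Z"
  let ?p = "\<lambda>x y z. P (X \<box> Y) Z (P X Y x y) z"
  have q1: "lin (X \<box> Y) ?W (\<lambda>s. P (X \<box> Y) Z s z)" if "z \<in> carrier Z" for z
    using bil_r[OF P_bil[OF bb(1) b(3)]] that by auto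
  have q2: "lin Z ?W (P (X \<box> Y) Z s)" if "s \<in> carrier (X \<box> Y)" for s
    using bil_l[OF P_bil[OF bb(1) b(3)]] that by auto
  have q3: "lin X (X \<box> Y) (\<lambda>x. P X Y x y)" if "y \<in> carrier Y" for y
    using bil_r[OF P_bil[OF b(1,2)]] that by auto
  have q4: "lin Y (X \<box> Y) (P X Y x)" if "x \<in> carrier X" for x
    using bil_l[OF P_bil[OF b(1,2)]] that by auto
  have i: "bil Y Z ?W (?p x)" if "x \<in> carrier X" for x
    by (rule bilI) (use that q2 lin_comp[OF q4 q1] b in auto)
  have il: "lin (Y \<box> Z) ?W (lift ?W (?p x))" "\<And>y z. y \<in> carrier Y \<Longrightarrow> z \<in> carrier Z \<Longrightarrow> lift ?W (?p x) (P Y Z y z) = ?p x y z"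
    if "x \<in> carrier X" for x
    using P_lift[OF b(2,3) bm_vs[OF bb(4)] i[OF that]] that b bb P_bal[OF bb(1) b(3), symmetric] by (auto simp: A_ract)
  have o: "bil X (Y \<box> Z) ?W (\<lambda>x s. lift ?W (?p x) s)"
  proof (rule bilI)
    show "lin X ?W (\<lambda>x. lift ?W (?p x) s)" if "s \<in> carrier (Y \<box> Z)" for s
      by (rule lift_par[OF b(2,3) _ _ that]) (use b bb lin_comp[OF q3 q1] in auto)
  qed (rule il)
  have oA: "lift ?W (?p (ract X x c)) s = lift ?W (?p x) (lact (Y \<box> Z) c s)"
    if c: "c \<in> A" and s: "s \<in> carrier (Y \<box> Z)" and x: "x \<in> carrier X" for c s x
    by (rule P_ext[OF b(2,3) il(1) lin_comp[OF lact_lin il(1)] _ s])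
      (use b bb c x in \<open>simp_all add: A_lact il(2) P_bal\<close>)
  note l = P_lift[OF b(1) bb(2) bm_vs[OF bb(4)] o oA]
  show ?thesis
    by (rule exI[of _ "lift ?W (\<lambda>x s. lift ?W (?p x) s)"]) (use l il(2) b in simp)
qed

end

text \<open>The second layer adds what the relations do not determine: the unit object, the unit
  isomorphisms and the action of all of \<open>B\<close> on tensors. It is separate because the data
  \<open>T\<close> refer to the associator \<open>ascf\<close> of the first layer. The element
  \<open>e\<close> is the unit vector: tensoring with it inverts the unit isomorphisms.\<close>

locale quot_tensor = quot_tensor0 K B A Q P L R ten
  for K :: "('u :: infinite) ring" and B A Q P L R and ten (infixr \<open>\<box>\<close> 75) +
  fixes U :: "'u bimod" and e :: 'u
    and lu :: "'u bimod \<Rightarrow> 'u \<Rightarrow> 'u \<Rightarrow> 'u" and ru :: "'u bimod \<Rightarrow> 'u \<Rightarrow> 'u \<Rightarrow> 'u"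
    and T :: "('u bimod, 'u bimod_arrow) tensor_data"
  assumes T: "T = \<lparr>tenO = ten, tenA = (\<lambda>f g. mk_arrow (src f \<box> src g) (trg f \<box> trg g)
         (lift (trg f \<box> trg g) (\<lambda>x y. P (trg f) (trg g) (f $ x) (g $ y)))), munit = U,
       asc = (\<lambda>X Y Z. mk_arrow ((X \<box> Y) \<box> Z) (X \<box> (Y \<box> Z)) (ascf X Y Z)),
       lun = (\<lambda>X. mk_arrow (U \<box> X) X (lift X (lu X))), run = (\<lambda>X. mk_arrow (X \<box> U) X (lift X (ru X)))\<rparr>"
    and tena_lact: "f \<in> Ar C \<Longrightarrow> g \<in> Ar C \<Longrightarrow> b \<in> carrier B \<Longrightarrow> x \<in> carrier (src f) \<Longrightarrow> y \<in> carrier (src g) \<Longrightarrow>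
      lift (trg f \<box> trg g) (\<lambda>x y. P (trg f) (trg g) (f $ x) (g $ y)) (lact (src f \<box> src g) b (P (src f) (src g) x y)) =
      lact (trg f \<box> trg g) b (P (trg f) (trg g) (f $ x) (g $ y))"
    and tena_ract: "f \<in> Ar C \<Longrightarrow> g \<in> Ar C \<Longrightarrow> b \<in> carrier B \<Longrightarrow> x \<in> carrier (src f) \<Longrightarrow> y \<in> carrier (src g) \<Longrightarrow>
      lift (trg f \<box> trg g) (\<lambda>x y. P (trg f) (trg g) (f $ x) (g $ y)) (ract (src f \<box> src g) (P (src f) (src g) x y) b) =
      ract (trg f \<box> trg g) (P (trg f) (trg g) (f $ x) (g $ y)) b"
    and asc_lact: "bm X \<Longrightarrow> bm Y \<Longrightarrow> bm Z \<Longrightarrow> b \<in> carrier B \<Longrightarrow> x \<in> carrier X \<Longrightarrow> y \<in> carrier Y \<Longrightarrow> z \<in> carrier Z \<Longrightarrow>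
      ascf X Y Z (lact ((X \<box> Y) \<box> Z) b (P (X \<box> Y) Z (P X Y x y) z)) = lact (X \<box> (Y \<box> Z)) b (P X (Y \<box> Z) x (P Y Z y z))"
    and asc_ract: "bm X \<Longrightarrow> bm Y \<Longrightarrow> bm Z \<Longrightarrow> b \<in> carrier B \<Longrightarrow> x \<in> carrier X \<Longrightarrow> y \<in> carrier Y \<Longrightarrow> z \<in> carrier Z \<Longrightarrow>
      ascf X Y Z (ract ((X \<box> Y) \<box> Z) (P (X \<box> Y) Z (P X Y x y) z) b) = ract (X \<box> (Y \<box> Z)) (P X (Y \<box> Z) x (P Y Z y z)) b"
    and U: "bm U" and e: "e \<in> carrier U"
    and lu_bil: "bm X \<Longrightarrow> bil U X X (lu X)" and ru_bil: "bm X \<Longrightarrow> bil X U X (ru X)"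
    and lu_A: "bm X \<Longrightarrow> u \<in> carrier U \<Longrightarrow> b \<in> A \<Longrightarrow> x \<in> carrier X \<Longrightarrow> lu X (ract U u b) x = lu X u (lact X b x)"
    and ru_A: "bm X \<Longrightarrow> u \<in> carrier U \<Longrightarrow> b \<in> A \<Longrightarrow> x \<in> carrier X \<Longrightarrow> ru X (ract X x b) u = ru X x (lact U b u)"
    and lu_lact: "bm X \<Longrightarrow> u \<in> carrier U \<Longrightarrow> b \<in> carrier B \<Longrightarrow> x \<in> carrier X \<Longrightarrow>
      lift X (lu X) (lact (U \<box> X) b (P U X u x)) = lact X b (lu X u x)"
    and lu_ract: "bm X \<Longrightarrow> u \<in> carrier U \<Longrightarrow> b \<in> carrier B \<Longrightarrow> x \<in> carrier X \<Longrightarrow>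
      lift X (lu X) (ract (U \<box> X) (P U X u x) b) = ract X (lu X u x) b"
    and ru_lact: "bm X \<Longrightarrow> u \<in> carrier U \<Longrightarrow> b \<in> carrier B \<Longrightarrow> x \<in> carrier X \<Longrightarrow>
      lift X (ru X) (lact (X \<box> U) b (P X U x u)) = lact X b (ru X x u)"
    and ru_ract: "bm X \<Longrightarrow> u \<in> carrier U \<Longrightarrow> b \<in> carrier B \<Longrightarrow> x \<in> carrier X \<Longrightarrow>
      lift X (ru X) (ract (X \<box> U) (P X U x u) b) = ract X (ru X x u) b"
    and lu_e: "bm X \<Longrightarrow> x \<in> carrier X \<Longrightarrow> lu X e x = x" and ru_e: "bm X \<Longrightarrow> x \<in> carrier X \<Longrightarrow> ru X x e = x"
    and P_lu: "bm X \<Longrightarrow> u \<in> carrier U \<Longrightarrow> x \<in> carrier X \<Longrightarrow> P U X e (lu X u x) = P U X u x"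
    and P_ru: "bm X \<Longrightarrow> u \<in> carrier U \<Longrightarrow> x \<in> carrier X \<Longrightarrow> P X U (ru X x u) e = P X U x u"
    and lu_nat: "f \<in> Ar C \<Longrightarrow> u \<in> carrier U \<Longrightarrow> x \<in> carrier (src f) \<Longrightarrow> f $ lu (src f) u x = lu (trg f) u (f $ x)"
    and ru_nat: "f \<in> Ar C \<Longrightarrow> u \<in> carrier U \<Longrightarrow> x \<in> carrier (src f) \<Longrightarrow> f $ ru (src f) x u = ru (trg f) (f $ x) u"
    and lu_ru: "bm X \<Longrightarrow> bm Y \<Longrightarrow> u \<in> carrier U \<Longrightarrow> x \<in> carrier X \<Longrightarrow> y \<in> carrier Y \<Longrightarrow>
      P X Y x (lu Y u y) = P X Y (ru X x u) y"
begin

lemma T_simps: "tenO T = ten" "munit T = U"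
  "tenA T f g = mk_arrow (src f \<box> src g) (trg f \<box> trg g) (lift (trg f \<box> trg g) (\<lambda>x y. P (trg f) (trg g) (f $ x) (g $ y)))"
  "asc T X Y Z = mk_arrow ((X \<box> Y) \<box> Z) (X \<box> (Y \<box> Z)) (ascf X Y Z)"
  "lun T X = mk_arrow (U \<box> X) X (lift X (lu X))" "run T X = mk_arrow (X \<box> U) X (lift X (ru X))"
  by (simp_all add: T)

lemma lu_lin: assumes "bm X" shows "lin (U \<box> X) X (lift X (lu X))"
    "\<And>u x. u \<in> carrier U \<Longrightarrow> x \<in> carrier X \<Longrightarrow> lift X (lu X) (P U X u x) = lu X u x"
  using P_lift[OF U assms bm_vs[OF assms] lu_bil[OF assms]] lu_A assms by auto

lemma ru_lin: assumes "bm X" shows "lin (X \<box> U) X (lift X (ru X))"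
    "\<And>u x. u \<in> carrier U \<Longrightarrow> x \<in> carrier X \<Longrightarrow> lift X (ru X) (P X U x u) = ru X x u"
  using P_lift[OF assms U bm_vs[OF assms] ru_bil[OF assms]] ru_A assms by auto

lemma lun_inv: assumes b: "bm X"
  shows "\<exists>g. lin X (U \<box> X) g \<and> (\<forall>x\<in>carrier X. lift X (lu X) (g x) = x) \<and>
      (\<forall>u\<in>carrier U. \<forall>x\<in>carrier X. g (lu X u x) = P U X u x)"
  by (rule exI[of _ "P U X e"])
    (use b e bil_l[OF P_bil[OF U b] e] in \<open>simp add: lu_lin lu_e P_lu\<close>)

lemma run_inv: assumes b: "bm X"
  shows "\<exists>g. lin X (X \<box> U) g \<and> (\<forall>x\<in>carrier X. lift X (ru X) (g x) = x) \<and>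
      (\<forall>u\<in>carrier U. \<forall>x\<in>carrier X. g (ru X x u) = P X U x u)"
  by (rule exI[of _ "\<lambda>x. P X U x e"])
    (use b e bil_r[OF P_bil[OF b U] e] in \<open>simp add: ru_lin ru_e P_ru\<close>)

lemma ctensor: "ctensor K B T P lu ru ten (tenA T) U"
proof (unfold_locales, unfold T_simps)
  fix X Y Z :: "'u bimod" assume b: "bm X" "bm Y" "bm Z"
  show "mk_arrow ((X \<box> Y) \<box> Z) (X \<box> (Y \<box> Z)) (ascf X Y Z) \<in> Ar C"
    by (rule P_arrow3) (use b ten_bm ascf_lin ascf_P asc_lact asc_ract in auto)
next
  fix f g assume fg: "f \<in> Ar C" "g \<in> Ar C"
  note F = ArD[OF fg(1)] and G = ArD[OF fg(2)]
  show "mk_arrow (src f \<box> src g) (trg f \<box> trg g) (lift (trg f \<box> trg g) (\<lambda>x y. P (trg f) (trg g) (f $ x) (g $ y))) \<in> Ar C"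
    by (rule P_arrow) (use fg F(1,2) G(1,2) ten_bm tena_lin tena_lact tena_ract in auto)
next
  fix X :: "'u bimod" assume b: "bm X"
  show "mk_arrow (U \<box> X) X (lift X (lu X)) \<in> Ar C"
    by (rule P_arrow) (use b U lu_lin lu_lact lu_ract in auto)
  show "mk_arrow (X \<box> U) X (lift X (ru X)) \<in> Ar C"
    by (rule P_arrow) (use b U ru_lin ru_lact ru_ract in auto)
  show "\<exists>g. lin X (U \<box> X) g \<and> (\<forall>x\<in>carrier X. mk_arrow (U \<box> X) X (lift X (lu X)) $ (g x) = x) \<and>
      (\<forall>u\<in>carrier U. \<forall>x\<in>carrier X. g (lu X u x) = P U X u x)"
    using lun_inv[OF b] lin_cl by fastforce
  show "\<exists>g. lin X (X \<box> U) g \<and> (\<forall>x\<in>carrier X. mk_arrow (X \<box> U) X (lift X (ru X)) $ (g x) = x) \<and>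
      (\<forall>u\<in>carrier U. \<forall>x\<in>carrier X. g (ru X x u) = P X U x u)"
    using run_inv[OF b] lin_cl by fastforce
qed (use ArD(1) ten_bm P_bil U ascf_inv ascf_P lu_nat ru_nat lu_ru tena_lin(2) lu_lin(2) ru_lin(2) in \<open>auto intro: P_ind\<close>)

end

section \<open>The maps \<Delta> \<otimes> Id and Id \<otimes> \<Delta>\<close>

context vect begin

text \<open>Appends a third factor \<open>c\<close> on the right and rebrackets. It is a map in
  \<open>u\<close> because it will be applied to coproducts, which are not pure.\<close>

definition asc3 :: "'u bialg \<Rightarrow> 'u \<Rightarrow> 'u \<Rightarrow> 'u"
  where "asc3 H c u = lift (tensK K H (tensK K H H)) (\<lambda>x y. pureK K H (tensK K H H) x (pureK K H H y c)) u"

text \<open>\<open>Dl\<close> and \<open>Dr\<close> are \<open>\<Delta> \<otimes> Id\<close> and \<open>Id \<otimes> \<Delta>\<close>, both with values in \<open>H \<otimes> (H \<otimes> H)\<close>.\<close>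

definition Dl :: "'u bialg \<Rightarrow> 'u \<Rightarrow> 'u"
  where "Dl H s = lift (tensK K H (tensK K H H)) (\<lambda>x z. asc3 H z (comult H x)) s"

definition Dr :: "'u bialg \<Rightarrow> 'u \<Rightarrow> 'u"
  where "Dr H s = lift (tensK K H (tensK K H H)) (\<lambda>x y. pureK K H (tensK K H H) x (comult H y)) s"

lemma asc3:
  assumes H: "vs (H :: 'u bialg)"
  shows asc3_lin: "c \<in> carrier H \<Longrightarrow> lin (tensK K H H) (tensK K H (tensK K H H)) (asc3 H c)"
    and asc3_lin': "u \<in> carrier (tensK K H H) \<Longrightarrow> lin H (tensK K H (tensK K H H)) (\<lambda>c. asc3 H c u)"
    and asc3_pure: "x \<in> carrier H \<Longrightarrow> y \<in> carrier H \<Longrightarrow> c \<in> carrier H \<Longrightarrow>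
      asc3 H c (pureK K H H x y) = pureK K H (tensK K H H) x (pureK K H H y c)"
proof -
  let ?H2 = "tensK K H H" let ?H3 = "tensK K H ?H2"
  have b: "bil H H ?H3 (\<lambda>x y. pureK K H ?H2 x (pureK K H H y c))" if "c \<in> carrier H" for c
    by (rule bilI) (use that H in \<open>auto intro!: lin_pureL lin_pureR\<close>)
  show "lin ?H2 ?H3 (asc3 H c)" if "c \<in> carrier H"
    unfolding asc3_def[abs_def] by (rule lift_lin) (use H b that in auto)
  show "lin H ?H3 (\<lambda>c. asc3 H c u)" if "u \<in> carrier ?H2"
    unfolding asc3_def by (rule lift_param[of H H]) (use H that in \<open>auto intro!: lin_pureL lin_pureR\<close>)
  show "asc3 H c (pureK K H H x y) = pureK K H ?H2 x (pureK K H H y c)"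
    if "x \<in> carrier H" "y \<in> carrier H" "c \<in> carrier H"
    unfolding asc3_def by (rule lift_pure) (use H b that in auto)
qed

lemma D:
  assumes H: "vs (H :: 'u bialg)" "lin H (tensK K H H) (comult H)"
  shows Dl_lin: "lin (tensK K H H) (tensK K H (tensK K H H)) (Dl H)"
    and Dl_pure: "x \<in> carrier H \<Longrightarrow> z \<in> carrier H \<Longrightarrow> Dl H (pureK K H H x z) = asc3 H z (comult H x)"
    and Dr_lin: "lin (tensK K H H) (tensK K H (tensK K H H)) (Dr H)"
    and Dr_pure: "x \<in> carrier H \<Longrightarrow> z \<in> carrier H \<Longrightarrow> Dr H (pureK K H H x z) = pureK K H (tensK K H H) x (comult H z)"
proof -
  let ?H2 = "tensK K H H" let ?H3 = "tensK K H ?H2"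
  have c: "h \<in> carrier H \<Longrightarrow> comult H h \<in> carrier ?H2" for h using H(2) lin_cl by blast
  have bl: "bil H H ?H3 (\<lambda>x z. asc3 H z (comult H x))"
    by (rule bilI) (use H c asc3_lin'[OF H(1)] lin_comp[OF H(2) asc3_lin[OF H(1)]] in auto)
  have br: "bil H H ?H3 (\<lambda>x y. pureK K H ?H2 x (comult H y))"
    by (rule bilI) (use H c in \<open>auto intro!: lin_pureL lin_pureR\<close>)
  show "lin ?H2 ?H3 (Dl H)" unfolding Dl_def[abs_def] by (rule lift_lin) (use H bl in auto)
  show "lin ?H2 ?H3 (Dr H)" unfolding Dr_def[abs_def] by (rule lift_lin) (use H br in auto)
  show "x \<in> carrier H \<Longrightarrow> z \<in> carrier H \<Longrightarrow> Dl H (pureK K H H x z) = asc3 H z (comult H x)"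
    unfolding Dl_def by (rule lift_pure) (use H bl in auto)
  show "x \<in> carrier H \<Longrightarrow> z \<in> carrier H \<Longrightarrow> Dr H (pureK K H H x z) = pureK K H ?H2 x (comult H z)"
    unfolding Dr_def by (rule lift_pure) (use H br in auto)
qed

lemma coassoc: "bialgebra K H \<Longrightarrow> h \<in> carrier H \<Longrightarrow> Dl H (comult H h) = Dr H (comult H h)"
  unfolding Dl_def Dr_def asc3_def by (rule bialgD(14))

text \<open>These lifts are \<epsilon> \<otimes> Id and Id \<otimes> \<epsilon>, followed by the
  identification of K \<otimes> H and H \<otimes> K with H.\<close>

lemma counit_lift:
  assumes v: "vs (H :: 'u bialg)" and l: "lin H (base_space K) (counit H)"
  shows "lin (tensK K H H) H (lift H (\<lambda>x y. counit H x \<odot>\<^bsub>H\<^esub> y))"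
    "lin (tensK K H H) H (lift H (\<lambda>x y. counit H y \<odot>\<^bsub>H\<^esub> x))"
    "x \<in> carrier H \<Longrightarrow> y \<in> carrier H \<Longrightarrow> lift H (\<lambda>x y. counit H x \<odot>\<^bsub>H\<^esub> y) (pureK K H H x y) = counit H x \<odot>\<^bsub>H\<^esub> y"
    "x \<in> carrier H \<Longrightarrow> y \<in> carrier H \<Longrightarrow> lift H (\<lambda>x y. counit H y \<odot>\<^bsub>H\<^esub> x) (pureK K H H x y) = counit H y \<odot>\<^bsub>H\<^esub> x"
proof -
  have h: "x \<in> carrier H \<Longrightarrow> counit H x \<in> carrier K" for x using lin_cl[OF l] by simp
  have a: "counit H (x \<oplus>\<^bsub>H\<^esub> y) = counit H x \<oplus>\<^bsub>K\<^esub> counit H y" if "x \<in> carrier H" "y \<in> carrier H" for x y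
    using lin_add[OF l that] h that by simp
  have s: "counit H (c \<odot>\<^bsub>H\<^esub> y) = c \<otimes>\<^bsub>K\<^esub> counit H y" if "c \<in> carrier K" "y \<in> carrier H" for c y
    using lin_smult[OF l that] h that by simp
  have b: "bil H H H (\<lambda>x y. counit H x \<odot>\<^bsub>H\<^esub> y)"
    by (intro bilI linI) (use v h in \<open>simp_all add: smult_add add_smult a s smult_smult smult_lcomm\<close>)
  then have b': "bil H H H (\<lambda>x y. counit H y \<odot>\<^bsub>H\<^esub> x)" by (auto simp: bil_def)
  show "lin (tensK K H H) H (lift H (\<lambda>x y. counit H x \<odot>\<^bsub>H\<^esub> y))"
    "lin (tensK K H H) H (lift H (\<lambda>x y. counit H y \<odot>\<^bsub>H\<^esub> x))"
    by (rule lift_lin[OF v v v]; use b b' in simp)+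
  show "x \<in> carrier H \<Longrightarrow> y \<in> carrier H \<Longrightarrow> lift H (\<lambda>x y. counit H x \<odot>\<^bsub>H\<^esub> y) (pureK K H H x y) = counit H x \<odot>\<^bsub>H\<^esub> y"
    by (rule lift_pure[OF v v v b]) simp_all
  show "x \<in> carrier H \<Longrightarrow> y \<in> carrier H \<Longrightarrow> lift H (\<lambda>x y. counit H y \<odot>\<^bsub>H\<^esub> x) (pureK K H H x y) = counit H y \<odot>\<^bsub>H\<^esub> x"
    by (rule lift_pure[OF v v v b']) simp_all
qed

end

context bial begin

subsection \<open>The tensor product over \<open>B\<close>\<close>

abbreviation (input) "TB X Y \<equiv> tens_quot K X Y (balB B X Y)"
abbreviation (input) "pB \<equiv> \<lambda>X Y x y. pureB K B X Y x y"
definition "Lc X Y = (\<lambda>b t. lift (TB X Y) (\<lambda>x y. pureB K B X Y (lact X b x) y) t)"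
definition "Rc X Y = (\<lambda>t b. lift (TB X Y) (\<lambda>x y. pureB K B X Y x (ract Y y b)) t)"

lemma tensB_eq: "tensB K B X Y = mk_bimod B (TB X Y) (Lc X Y) (Rc X Y)"
  by (simp add: tensB_def Let_def Lc_def Rc_def)

lemma balB_scaled: assumes "bm X" shows "scaled X Y (balB B X Y)"
proof -
  have "c \<odot>\<^bsub>X\<^esub> ract X x b = ract X (c \<odot>\<^bsub>X\<^esub> x) b" if "c \<in> carrier K" "b \<in> carrier B" "x \<in> carrier X" for c b x
    using lin_smult[OF bil_l[OF ract_bil[OF assms(1)]], of b c x] that by simp
  then show ?thesis using assms by (fastforce simp: scaled_def balB_def)
qed

lemma pureB_bal: "bm X \<Longrightarrow> bm Y \<Longrightarrow> b \<in> carrier B \<Longrightarrow> x \<in> carrier X \<Longrightarrow> y \<in> carrier Y \<Longrightarrow>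
    pureB K B X Y (ract X x b) y = pureB K B X Y x (lact Y b y)"
  by (rule pure_Q) (auto simp: balB_def)

lemma TB_vs: "bm X \<Longrightarrow> bm Y \<Longrightarrow> vs (TB X Y)"
  by (rule tens_vs) (simp_all add: balB_scaled)

lemma respB: "(\<And>b x y. b \<in> carrier B \<Longrightarrow> x \<in> carrier X \<Longrightarrow> y \<in> carrier Y \<Longrightarrow> \<phi> (ract X x b) y = \<phi> x (lact Y b y)) \<Longrightarrow>
    resp X Y (balB B X Y) \<phi>"
  by (auto simp: resp_def balB_def)

text \<open>Balancing is preserved as the left and right actions on X commute. The module laws then
  pass from X to the quotient by a check on pure tensors.\<close>

lemma Lc:
  assumes X: "bm X" and Y: "bm Y"
  shows Lc_pure: "\<And>b x y. b \<in> carrier B \<Longrightarrow> x \<in> carrier X \<Longrightarrow> y \<in> carrier Y \<Longrightarrow>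
      Lc X Y b (pureB K B X Y x y) = pureB K B X Y (lact X b x) y"
    and Lc_gmod: "gmod (mult B) \<one>\<^bsub>B\<^esub> B (TB X Y) (Lc X Y)"
proof -
  have v: "vs X" "vs Y" "vs (TB X Y)" "scaled X Y (balB B X Y)" using X Y TB_vs balB_scaled by auto
  have b: "bil X Y (TB X Y) (\<lambda>x y. pureB K B X Y (lact X b x) y)" if "b \<in> carrier B" for b
    by (rule bilI) (use v that X bil_l[OF lact_bil[OF X]] in \<open>auto intro!: lin_pureL lin_pureR\<close>)
  have r: "resp X Y (balB B X Y) (\<lambda>x y. pureB K B X Y (lact X b x) y)" if "b \<in> carrier B" for b
    by (rule respB) (use that X Y in \<open>simp add: bmD(6)[symmetric] pureB_bal\<close>)
  have l: "lin (TB X Y) (TB X Y) (Lc X Y b)" if "b \<in> carrier B" for b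
    unfolding Lc_def by (rule lift_lin) (use v b[OF that] r[OF that] in auto)
  show p: "\<And>b x y. b \<in> carrier B \<Longrightarrow> x \<in> carrier X \<Longrightarrow> y \<in> carrier Y \<Longrightarrow>
      Lc X Y b (pureB K B X Y x y) = pureB K B X Y (lact X b x) y"
    unfolding Lc_def by (rule lift_pure) (use v b r in auto)
  have l': "lin B (TB X Y) (\<lambda>b. Lc X Y b t)" if "t \<in> carrier (TB X Y)" for t
    unfolding Lc_def by (rule lift_param[of X Y]) (use v that bil_r[OF lact_bil[OF X]] in \<open>auto intro!: lin_pureL\<close>)
  have bb: "bil B (TB X Y) (TB X Y) (Lc X Y)" using l l' by (intro bilI) auto
  have m: "Lc X Y (a \<otimes>\<^bsub>B\<^esub> c) t = Lc X Y a (Lc X Y c t)"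
    if "a \<in> carrier B" "c \<in> carrier B" and t: "t \<in> carrier (TB X Y)" for a c t
    by (rule lin_eq_tens[OF v(1,2) l lin_comp[OF l l] _ t]) (use that X Y in \<open>auto simp: p bmD(4)\<close>)
  have u: "Lc X Y \<one>\<^bsub>B\<^esub> t = t" if t: "t \<in> carrier (TB X Y)" for t
    by (rule lin_eq_tens[OF v(1,2) l lin_id _ t]) (use X Y in \<open>auto simp: p\<close>)
  show "gmod (mult B) \<one>\<^bsub>B\<^esub> B (TB X Y) (Lc X Y)"
    by (simp add: gmod_def v ualg_bil bb m u)
qed

lemma Rc:
  assumes X: "bm X" and Y: "bm Y"
  shows Rc_pure: "\<And>b x y. b \<in> carrier B \<Longrightarrow> x \<in> carrier X \<Longrightarrow> y \<in> carrier Y \<Longrightarrow>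
      Rc X Y (pureB K B X Y x y) b = pureB K B X Y x (ract Y y b)"
    and Rc_gmod: "gmod opm \<one>\<^bsub>B\<^esub> B (TB X Y) (\<lambda>b t. Rc X Y t b)"
proof -
  have v: "vs X" "vs Y" "vs (TB X Y)" "scaled X Y (balB B X Y)" using X Y TB_vs balB_scaled by auto
  have b: "bil X Y (TB X Y) (\<lambda>x y. pureB K B X Y x (ract Y y b))" if "b \<in> carrier B" for b
    by (rule bilI) (use v that Y bil_l[OF ract_bil[OF Y]] in \<open>auto intro!: lin_pureL lin_pureR\<close>)
  have r: "resp X Y (balB B X Y) (\<lambda>x y. pureB K B X Y x (ract Y y b))" if "b \<in> carrier B" for b
    by (rule respB) (use that X Y in \<open>simp add: bmD(6) pureB_bal\<close>)
  have l: "lin (TB X Y) (TB X Y) (\<lambda>t. Rc X Y t b)" if "b \<in> carrier B" for b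
    unfolding Rc_def by (rule lift_lin) (use v b[OF that] r[OF that] in auto)
  show p: "\<And>b x y. b \<in> carrier B \<Longrightarrow> x \<in> carrier X \<Longrightarrow> y \<in> carrier Y \<Longrightarrow>
      Rc X Y (pureB K B X Y x y) b = pureB K B X Y x (ract Y y b)"
    unfolding Rc_def by (rule lift_pure) (use v b r in auto)
  have l': "lin B (TB X Y) (\<lambda>b. Rc X Y t b)" if "t \<in> carrier (TB X Y)" for t
    unfolding Rc_def by (rule lift_param[of X Y]) (use v that bil_r[OF ract_bil[OF Y]] in \<open>auto intro!: lin_pureR\<close>)
  have bb: "bil B (TB X Y) (TB X Y) (\<lambda>b t. Rc X Y t b)" using l l' by (intro bilI) auto
  have m: "Rc X Y t (c \<otimes>\<^bsub>B\<^esub> a) = Rc X Y (Rc X Y t c) a"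
    if "a \<in> carrier B" "c \<in> carrier B" and t: "t \<in> carrier (TB X Y)" for a c t
    by (rule lin_eq_tens[OF v(1,2) l lin_comp[OF l l] _ t]) (use that X Y in \<open>auto simp: p bmD(5)\<close>)
  have u: "Rc X Y t \<one>\<^bsub>B\<^esub> = t" if t: "t \<in> carrier (TB X Y)" for t
    by (rule lin_eq_tens[OF v(1,2) l lin_id _ t]) (use X Y in \<open>auto simp: p\<close>)
  show "gmod opm \<one>\<^bsub>B\<^esub> B (TB X Y) (\<lambda>b t. Rc X Y t b)"
    by (simp add: gmod_def v opm_bil bb m u)
qed

lemma tensB_bm [simp]: assumes X: "bm X" and Y: "bm Y" shows "bm (tensB K B X Y)"
  unfolding tensB_eq
proof (rule mk_bimod_bm[OF _ _ _ Lc_gmod[OF X Y] Rc_gmod[OF X Y]])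
  fix a b t assume a: "a \<in> carrier B" "b \<in> carrier B" and t: "t \<in> carrier (TB X Y)"
  note l = bil_l[OF gmodD(4)[OF Lc_gmod[OF X Y]]] and r = bil_l[OF gmodD(4)[OF Rc_gmod[OF X Y]]]
  show "Rc X Y (Lc X Y a t) b = Lc X Y a (Rc X Y t b)"
    by (rule lin_eq_tens[OF bm_vs[OF X] bm_vs[OF Y] lin_comp[OF l r] lin_comp[OF r l] _ t])
      (use a X Y in \<open>auto simp: Lc_pure Rc_pure\<close>)
qed (use X Y TB_vs tens_quot_ext in auto)

lemma lact_tensB [simp]: "bm X \<Longrightarrow> bm Y \<Longrightarrow> b \<in> carrier B \<Longrightarrow> x \<in> carrier X \<Longrightarrow> y \<in> carrier Y \<Longrightarrow>
    lact (tensB K B X Y) b (pureB K B X Y x y) = pureB K B X Y (lact X b x) y"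
  by (simp add: tensB_eq Lc_pure)

lemma ract_tensB [simp]: "bm X \<Longrightarrow> bm Y \<Longrightarrow> b \<in> carrier B \<Longrightarrow> x \<in> carrier X \<Longrightarrow> y \<in> carrier Y \<Longrightarrow>
    ract (tensB K B X Y) (pureB K B X Y x y) b = pureB K B X Y x (ract Y y b)"
  by (simp add: tensB_eq Rc_pure)

lemma o0: "quot_tensor0 K B (carrier B) (balB B) pB Lc Rc (tensB K B)"
  by unfold_locales (rule balB_def tensB_eq | simp)+

lemma trunc [simp]: "carrier (module.truncate V) = carrier V" "add (module.truncate V) = add V"
  "zero (module.truncate V) = zero V" "smult (module.truncate V) = smult V"
  by (simp_all add: module.truncate_def)

abbreviation "I \<equiv> regular_bimod B"

lemma reg_fields [simp]: "carrier I = carrier B" "add I = add B" "zero I = zero B" "smult I = smult B"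
  "a \<in> carrier B \<Longrightarrow> b \<in> carrier B \<Longrightarrow> lact I a b = a \<otimes>\<^bsub>B\<^esub> b"
  "a \<in> carrier B \<Longrightarrow> b \<in> carrier B \<Longrightarrow> ract I a b = a \<otimes>\<^bsub>B\<^esub> b"
  by (simp_all add: regular_bimod_def)

lemma reg_cong [simp]:
  "vs I \<longleftrightarrow> vs B"
  "lin I N = lin B N" "lin N I = lin N B"
  "tens_quot K I N Q = tens_quot K B N Q" "tens_quot K N I Q = tens_quot K N B Q"
  "tens_class K I N Q = tens_class K B N Q" "tens_class K N I Q = tens_class K N B Q"
  "lift I = lift B"
  "bil I N P f = bil B N P f" "bil N I P f = bil N B P f" "bil N P I f = bil N P B f"
  by (rule vs_cong lin_cong tens_quot_cong tens_class_cong lift_cong_struct; simp)+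
    (simp_all add: bil_def lin_def)

lemma trunc_cong:
  "vs (module.truncate V) \<longleftrightarrow> vs V"
  "bil (module.truncate V) N P f = bil V N P f" "bil N (module.truncate V) P f = bil N V P f" "bil N P (module.truncate V) f = bil N P V f"
  by (rule vs_cong; simp) (simp_all add: bil_def lin_def)

lemma I_bm [simp]: "bm I"
  unfolding regular_bimod_def
  by (rule mk_bimod_bm) (simp_all add: trunc_cong ualgD(6,8)[OF Bs(1)] gmod_def ualg_bil opm_bil ualg_assoc)

text \<open>The unit vector is the unit of \<open>B\<close>, the unit isomorphisms are the actions,
  and balancing alone gives \<open>P_lu\<close>, \<open>P_ru\<close> and
  \<open>lu_ru\<close>.\<close>

lemma circ_tensor: "quot_tensor K B (carrier B) (balB B) pB Lc Rc (tensB K B) I \<one>\<^bsub>B\<^esub> lact ract (circ_data K B)"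
proof -
  interpret q: quot_tensor0 K B "carrier B" "balB B" pB Lc Rc "tensB K B" by (rule o0)
  have lu: "lift X (lact X) (pureB K B I X u x) = lact X u x" if "bm X" "u \<in> carrier B" "x \<in> carrier X" for X u x
    using q.P_lift(2)[OF I_bm that(1) bm_vs[OF that(1)], of "lact X"] that lact_bil by (simp add: bmD(4))
  have ru: "lift X (ract X) (pureB K B X I x u) = ract X x u" if "bm X" "u \<in> carrier B" "x \<in> carrier X" for X u x
    using q.P_lift(2)[OF that(1) I_bm bm_vs[OF that(1)], of "ract X"] that ract_bil[of X]
    by (simp add: bmD(5) bil_def)
  show ?thesis
  proof unfold_locales
    show "circ_data K B = \<lparr>tenO = tensB K B, tenA = (\<lambda>f g. mk_arrow (tensB K B (src f) (src g)) (tensB K B (trg f) (trg g))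
         (lift (tensB K B (trg f) (trg g)) (\<lambda>x y. pureB K B (trg f) (trg g) (f $ x) (g $ y)))), munit = I,
       asc = (\<lambda>X Y Z. mk_arrow (tensB K B (tensB K B X Y) Z) (tensB K B X (tensB K B Y Z)) (q.ascf X Y Z)),
       lun = (\<lambda>X. mk_arrow (tensB K B I X) X (lift X (lact X))), run = (\<lambda>X. mk_arrow (tensB K B X I) X (lift X (ract X)))\<rparr>"
      by (simp add: circ_data_def Let_def q.ascf_def)
  next
    fix f g b x y assume a: "f \<in> Ar C" "g \<in> Ar C" "b \<in> carrier B" "x \<in> carrier (src f)" "y \<in> carrier (src g)"
    note F = ArD[OF a(1)] and G = ArD[OF a(2)]
    show "lift (tensB K B (trg f) (trg g)) (\<lambda>x y. pureB K B (trg f) (trg g) (f $ x) (g $ y))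
        (lact (tensB K B (src f) (src g)) b (pureB K B (src f) (src g) x y)) =
      lact (tensB K B (trg f) (trg g)) b (pureB K B (trg f) (trg g) (f $ x) (g $ y))"
      using a F(1,2) G(1,2) by (simp add: q.tena_lin(2) F(4))
    show "lift (tensB K B (trg f) (trg g)) (\<lambda>x y. pureB K B (trg f) (trg g) (f $ x) (g $ y))
        (ract (tensB K B (src f) (src g)) (pureB K B (src f) (src g) x y) b) =
      ract (tensB K B (trg f) (trg g)) (pureB K B (trg f) (trg g) (f $ x) (g $ y)) b"
      using a F(1,2) G(1,2) by (simp add: q.tena_lin(2) G(5))
  next
    fix X u b x assume a: "bm X" "u \<in> carrier I" "b \<in> carrier B" "x \<in> carrier X"
    show "lift X (lact X) (lact (tensB K B I X) b (pureB K B I X u x)) = lact X b (lact X u x)"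
      "lift X (lact X) (ract (tensB K B I X) (pureB K B I X u x) b) = ract X (lact X u x) b"
      "lift X (ract X) (lact (tensB K B X I) b (pureB K B X I x u)) = lact X b (ract X x u)"
      "lift X (ract X) (ract (tensB K B X I) (pureB K B X I x u) b) = ract X (ract X x u) b"
      using a by (simp_all del: reg_cong add: lu ru bmD(4-6))
  next
    fix X u x assume a: "bm X" "u \<in> carrier I" "x \<in> carrier X"
    show "pureB K B I X \<one>\<^bsub>B\<^esub> (lact X u x) = pureB K B I X u x"
      using a pureB_bal[OF I_bm a(1), of u "\<one>\<^bsub>B\<^esub>" x] by simp
    show "pureB K B X I (ract X x u) \<one>\<^bsub>B\<^esub> = pureB K B X I x u"
      using a pureB_bal[OF a(1) I_bm, of u x "\<one>\<^bsub>B\<^esub>"] by simp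
  qed (simp_all add: lact_bil ract_bil bil_def lu ru bmD(4-6) ArD(4,5) pureB_bal q.ascf_P q.P_cl[simplified],
      (use lact_bil ract_bil in \<open>auto simp: bil_def\<close>)?)
qed

lemma o: "ctensor K B (circ_data K B) pB lact ract (tensB K B) (tenA (circ_data K B)) I"
  using quot_tensor.ctensor[OF circ_tensor] .

subsection \<open>The tensor product over \<open>K\<close>\<close>

abbreviation (input) "pK \<equiv> \<lambda>X Y x y. pureK K X Y x y"

text \<open>An action of \<open>B\<close> through the coproduct, with unspecified actions on the
  factors, so that one proof serves the left and the right side.\<close>

definition dg :: "'u bimod \<Rightarrow> 'u bimod \<Rightarrow> ('u \<Rightarrow> 'u \<Rightarrow> 'u) \<Rightarrow> ('u \<Rightarrow> 'u \<Rightarrow> 'u) \<Rightarrow> 'u \<Rightarrow> 'u \<Rightarrow> 'u"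
  where "dg X Y l l' b t = act2 X Y l l' (comult B b) t"

lemma tens_diag_eq: "tens_diag K B X Y = mk_bimod B (tensK K X Y) (dg X Y (la X) (la Y)) (\<lambda>t b. dg X Y (ra X) (ra Y) b t)"
  by (simp add: tens_diag_def lact2_def ract2_def act2_def dg_def[abs_def])

lemma Bcomult [simp]: "vs (tensK K B B)" "lin B (tensK K B B) (comult B)"
  using bialgD[OF B] by simp_all

lemma comult_mult: "a \<in> carrier B \<Longrightarrow> b \<in> carrier B \<Longrightarrow>
    comult B (a \<otimes>\<^bsub>B\<^esub> b) = act2 B B (mult B) (mult B) (comult B a) (comult B b)"
  using bialgD(8)[OF B] by (simp add: tens_alg_mult)

text \<open>The opposite of the tensor algebra is the tensor product of the opposites, so the
  coproduct is also multiplicative for the opposite products. The right diagonal action rests on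
  this.\<close>

lemma comult_opm: "a \<in> carrier B \<Longrightarrow> b \<in> carrier B \<Longrightarrow>
    comult B (b \<otimes>\<^bsub>B\<^esub> a) = act2 B B opm opm (comult B a) (comult B b)"
  using act2_swap[of B B B B B B "mult B" "mult B" "comult B b" "comult B a"] by (simp add: comult_mult ualg_bil)

lemma dg_lact: "bm X \<Longrightarrow> bm Y \<Longrightarrow> gmod (mult B) \<one>\<^bsub>B\<^esub> B (tensK K X Y) (dg X Y (la X) (la Y))"
  unfolding dg_def[abs_def]
  by (rule gmod_pull[OF gmod_tens[OF lact_gmod lact_gmod]]) (simp_all add: comult_mult ualg_bil bialgD(9)[OF B])

lemma dg_ract: "bm X \<Longrightarrow> bm Y \<Longrightarrow> gmod opm \<one>\<^bsub>B\<^esub> B (tensK K X Y) (dg X Y (ra X) (ra Y))"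
  unfolding dg_def[abs_def]
  by (rule gmod_pull[OF gmod_tens[OF ract_gmod ract_gmod]]) (simp_all add: comult_opm opm_bil bialgD(9)[OF B])

lemma diag_bm [simp]: assumes X: "bm X" and Y: "bm Y" shows "bm (tens_diag K B X Y)"
  unfolding tens_diag_eq
proof (rule mk_bimod_bm[OF _ _ _ dg_lact[OF X Y] dg_ract[OF X Y]])
  fix a b t assume "a \<in> carrier B" "b \<in> carrier B" "t \<in> carrier (tensK K X Y)"
  then show "dg X Y (ra X) (ra Y) b (dg X Y (la X) (la Y) a t) = dg X Y (la X) (la Y) a (dg X Y (ra X) (ra Y) b t)"
    unfolding dg_def by (intro act2_commute[of B B B B]) (use X Y in \<open>auto simp: lact_bil ract_bil bmD(6)\<close>)
qed (use X Y tens_quot_ext in auto)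

lemma diag_fields [simp]:
  "carrier (tens_diag K B X Y) = carrier (tensK K X Y)" "add (tens_diag K B X Y) = add (tensK K X Y)"
  "zero (tens_diag K B X Y) = zero (tensK K X Y)" "smult (tens_diag K B X Y) = smult (tensK K X Y)"
  by (simp_all add: tens_diag_eq)

lemma diag_act:
  assumes "b \<in> carrier B" "t \<in> carrier (tensK K X Y)"
  shows "lact (tens_diag K B X Y) b t = dg X Y (la X) (la Y) b t" "ract (tens_diag K B X Y) t b = dg X Y (ra X) (ra Y) b t"
  using assms by (simp_all add: tens_diag_eq)

lemma diag_cong [simp]:
  "vs (tens_diag K B X Y) \<longleftrightarrow> vs (tensK K X Y)"
  "lin (tens_diag K B X Y) N = lin (tensK K X Y) N" "lin N (tens_diag K B X Y) = lin N (tensK K X Y)"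
  "tens_quot K (tens_diag K B X Y) N Q = tens_quot K (tensK K X Y) N Q"
  "tens_quot K N (tens_diag K B X Y) Q = tens_quot K N (tensK K X Y) Q"
  "tens_class K (tens_diag K B X Y) N Q = tens_class K (tensK K X Y) N Q"
  "tens_class K N (tens_diag K B X Y) Q = tens_class K N (tensK K X Y) Q"
  "lift (tens_diag K B X Y) = lift (tensK K X Y)"
  "bil (tens_diag K B X Y) N P f = bil (tensK K X Y) N P f"
  "bil N (tens_diag K B X Y) P f = bil N (tensK K X Y) P f"
  "bil N P (tens_diag K B X Y) f = bil N P (tensK K X Y) f"
  by (simp_all add: tens_diag_eq)

lemma act2_struct [simp]: "act2 (tens_diag K B X Y) N = act2 (tensK K X Y) N" "act2 N (tens_diag K B X Y) = act2 N (tensK K X Y)"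
  by (intro ext; simp add: act2_def)+

definition "Ld X Y = (\<lambda>b t. dg X Y (la X) (la Y) b t)"
definition "Rd X Y = (\<lambda>t b. dg X Y (ra X) (ra Y) b t)"

lemma b0: "quot_tensor0 K B {} (\<lambda>_ _. {}) pK Ld Rd (tens_diag K B)"
  by unfold_locales (simp; fail | simp add: Ld_def Rd_def tens_diag_eq)+

abbreviation (input) "ascd \<equiv> quot_tensor0.ascf pK (tens_diag K B)"

lemma ascd:
  assumes "bm X" "bm Y" "bm Z"
  shows ascd_lin: "lin (tensK K (tensK K X Y) Z) (tensK K X (tensK K Y Z)) (ascd X Y Z)"
    and ascd_pure: "\<And>x y z. x \<in> carrier X \<Longrightarrow> y \<in> carrier Y \<Longrightarrow> z \<in> carrier Z \<Longrightarrow>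
      ascd X Y Z (pureK K (tensK K X Y) Z (pureK K X Y x y) z) = pureK K X (tensK K Y Z) x (pureK K Y Z y z)"
  using quot_tensor0.ascf_lin[OF b0 assms] quot_tensor0.ascf_P[OF b0 assms] by simp_all

text \<open>The associator intertwines the action of \<open>s \<in> B \<otimes> B\<close> on \<open>(X \<bullet> Y) \<otimes> Z\<close> with the action of
  \<open>(\<Delta> \<otimes> Id)(s)\<close> on \<open>X \<otimes> (Y \<otimes> Z)\<close>. The actions are left unspecified to cover both sides.\<close>

context
  fixes X Y Z :: "'u bimod" and aX aY aZ
  assumes X: "bm X" and Y: "bm Y" and Z: "bm Z" and aX: "bil B X X aX" and aY: "bil B Y Y aY" and aZ: "bil B Z Z aZ"
begin

lemma act3:
  shows act3_bil: "bil (tensK K B (tensK K B B)) (tensK K X (tensK K Y Z)) (tensK K X (tensK K Y Z))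
      (act2 X (tensK K Y Z) aX (act2 Y Z aY aZ))"
    and act3_pure: "\<And>a b c x y z. a \<in> carrier B \<Longrightarrow> b \<in> carrier B \<Longrightarrow> c \<in> carrier B \<Longrightarrow>
      x \<in> carrier X \<Longrightarrow> y \<in> carrier Y \<Longrightarrow> z \<in> carrier Z \<Longrightarrow>
      act2 X (tensK K Y Z) aX (act2 Y Z aY aZ) (pureK K B (tensK K B B) a (pureK K B B b c)) (pureK K X (tensK K Y Z) x (pureK K Y Z y z)) =
      pureK K X (tensK K Y Z) (aX a x) (pureK K Y Z (aY b y) (aZ c z))"
    and act3_pure': "\<And>a s x t. a \<in> carrier B \<Longrightarrow> s \<in> carrier (tensK K B B) \<Longrightarrow>
      x \<in> carrier X \<Longrightarrow> t \<in> carrier (tensK K Y Z) \<Longrightarrow>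
      act2 X (tensK K Y Z) aX (act2 Y Z aY aZ) (pureK K B (tensK K B B) a s) (pureK K X (tensK K Y Z) x t) =
      pureK K X (tensK K Y Z) (aX a x) (act2 Y Z aY aZ s t)"
proof -
  have v: "vs X" "vs Y" "vs Z" using X Y Z by auto
  note i = act2[OF B_vs B_vs v(2,3,2,3) aY aZ]
  have w: "vs (tensK K B B)" "vs (tensK K Y Z)" using v by auto
  note o = act2[OF B_vs w(1) v(1) w(2) v(1) w(2) aX i(1)]
  show "bil (tensK K B (tensK K B B)) (tensK K X (tensK K Y Z)) (tensK K X (tensK K Y Z)) (act2 X (tensK K Y Z) aX (act2 Y Z aY aZ))"
    by (rule o(1))
  show "act2 X (tensK K Y Z) aX (act2 Y Z aY aZ) (pureK K B (tensK K B B) a (pureK K B B b c)) (pureK K X (tensK K Y Z) x (pureK K Y Z y z)) =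
      pureK K X (tensK K Y Z) (aX a x) (pureK K Y Z (aY b y) (aZ c z))"
    if "a \<in> carrier B" "b \<in> carrier B" "c \<in> carrier B" "x \<in> carrier X" "y \<in> carrier Y" "z \<in> carrier Z" for a b c x y z
    using that v by (simp add: o(2) i(2))
  show "act2 X (tensK K Y Z) aX (act2 Y Z aY aZ) (pureK K B (tensK K B B) a s) (pureK K X (tensK K Y Z) x t) =
      pureK K X (tensK K Y Z) (aX a x) (act2 Y Z aY aZ s t)"
    if "a \<in> carrier B" "s \<in> carrier (tensK K B B)" "x \<in> carrier X" "t \<in> carrier (tensK K Y Z)" for a s x t
    using that by (rule o(2))
qed

lemma dg_bil: "bil B (tensK K X Y) (tensK K X Y) (dg X Y aX aY)" "bil B (tensK K Y Z) (tensK K Y Z) (dg Y Z aY aZ)"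
  unfolding dg_def[abs_def]
  by (rule bil_comp[OF Bcomult(2) lin_id act2_bil]; use X Y Z aX aY aZ in simp)+

lemma asc_act_L:
  assumes s: "s \<in> carrier (tensK K B B)" and x: "x \<in> carrier X" and y: "y \<in> carrier Y" and z: "z \<in> carrier Z"
  shows "ascd X Y Z (act2 (tensK K X Y) Z (dg X Y aX aY) aZ s (pureK K (tensK K X Y) Z (pureK K X Y x y) z)) =
    act2 X (tensK K Y Z) aX (act2 Y Z aY aZ) (Dl B s) (pureK K X (tensK K Y Z) x (pureK K Y Z y z))"
proof -
  have v: "vs X" "vs Y" "vs Z" "vs (tensK K X Y)" "vs (tensK K Y Z)" using X Y Z by auto
  let ?p = "pureK K X (tensK K Y Z) x (pureK K Y Z y z)"
  let ?A = "act2 X (tensK K Y Z) aX (act2 Y Z aY aZ)"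
  have p: "?p \<in> carrier (tensK K X (tensK K Y Z))" using v x y z by simp
  note al = ascd_lin[OF X Y Z] and A = bil_r[OF act3_bil p]
  note l2 = act2[OF B_vs B_vs v(4,3,4,3) dg_bil(1) aZ]
  have q: "pureK K (tensK K X Y) Z (pureK K X Y x y) z \<in> carrier (tensK K (tensK K X Y) Z)" using v x y z by simp
  note lL = lin_comp[OF bil_r[OF l2(1) q] al] and lR = lin_comp[OF Dl_lin[OF B_vs Bcomult(2)] A]
  show ?thesis
  proof (rule lin_eq_tens[OF B_vs B_vs lL lR _ s])
    fix a c assume a: "a \<in> carrier B" "c \<in> carrier B"
    \<comment> \<open>\<open>u\<close> takes the place of \<open>comult B a\<close>. Both sides are
      linear in \<open>u\<close>, so a check on pure tensors suffices although the coproduct is not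
      one.\<close>
    have *: "ascd X Y Z (pureK K (tensK K X Y) Z (act2 X Y aX aY u (pureK K X Y x y)) (aZ c z)) = ?A (asc3 B c u) ?p"
      if u: "u \<in> carrier (tensK K B B)" for u
    proof (rule lin_eq_tens[OF B_vs B_vs lin_comp[OF _ al] lin_comp[OF asc3_lin[OF B_vs a(2)] A] _ u])
      show "lin (tensK K B B) (tensK K (tensK K X Y) Z) (\<lambda>u. pureK K (tensK K X Y) Z (act2 X Y aX aY u (pureK K X Y x y)) (aZ c z))"
        by (rule lin_pureL) (use v x y z a bil_cl[OF aZ] bil_r[OF act2_bil[OF B_vs B_vs v(1,2,1,2) aX aY]] in auto)
      fix a1 a2 assume "a1 \<in> carrier B" "a2 \<in> carrier B"
      then show "ascd X Y Z (pureK K (tensK K X Y) Z (act2 X Y aX aY (pureK K B B a1 a2) (pureK K X Y x y)) (aZ c z)) =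
          ?A (asc3 B c (pureK K B B a1 a2)) ?p"
        using a x y z v by (simp add: act2_pure[OF B_vs B_vs v(1,2,1,2) aX aY] asc3_pure act3_pure
          ascd_pure[OF X Y Z] bil_cl[OF aX] bil_cl[OF aY] bil_cl[OF aZ])
    qed
    show "ascd X Y Z (act2 (tensK K X Y) Z (dg X Y aX aY) aZ (pureK K B B a c) (pureK K (tensK K X Y) Z (pureK K X Y x y) z)) =
        ?A (Dl B (pureK K B B a c)) ?p"
      using a x y z v by (simp add: l2(2) dg_def * Dl_pure)
  qed
qed

lemma asc_act_R:
  assumes s: "s \<in> carrier (tensK K B B)" and x: "x \<in> carrier X" and t: "t \<in> carrier (tensK K Y Z)"
  shows "act2 X (tensK K Y Z) aX (dg Y Z aY aZ) s (pureK K X (tensK K Y Z) x t) =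
    act2 X (tensK K Y Z) aX (act2 Y Z aY aZ) (Dr B s) (pureK K X (tensK K Y Z) x t)"
proof -
  have v: "vs X" "vs Y" "vs Z" "vs (tensK K X Y)" "vs (tensK K Y Z)" using X Y Z by auto
  let ?p = "pureK K X (tensK K Y Z) x t"
  have p: "?p \<in> carrier (tensK K X (tensK K Y Z))" using v x t by simp
  note l2 = act2[OF B_vs B_vs v(1,5,1,5) aX dg_bil(2)]
  show ?thesis
    by (rule lin_eq_tens[OF B_vs B_vs bil_r[OF l2(1) p] lin_comp[OF Dr_lin[OF B_vs Bcomult(2)] bil_r[OF act3_bil p]] _ s])
      (use x t v in \<open>simp add: l2(2) Dr_pure act3_pure' dg_def\<close>)
qed

text \<open>For s = \<Delta>(b) coassociativity identifies \<open>Dl\<close> with \<open>Dr\<close>,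
  hence the diagonal actions on the two bracketings: this is \<open>B\<close>-linearity of the
  associator.\<close>

lemma asc_dg:
  assumes b: "b \<in> carrier B" and x: "x \<in> carrier X" and y: "y \<in> carrier Y" and z: "z \<in> carrier Z"
  shows "ascd X Y Z (act2 (tensK K X Y) Z (dg X Y aX aY) aZ (comult B b) (pureK K (tensK K X Y) Z (pureK K X Y x y) z)) =
    act2 X (tensK K Y Z) aX (dg Y Z aY aZ) (comult B b) (pureK K X (tensK K Y Z) x (pureK K Y Z y z))"
  using assms Y Z by (simp add: asc_act_L asc_act_R coassoc[OF B])

end

end

context vect begin

lemma tens_map:
  assumes v: "vs X" "vs Y" "vs X'" "vs Y'" and f: "lin X X' f" and g: "lin Y Y' g"
  shows tens_map_lin: "lin (tensK K X Y) (tensK K X' Y') (lift (tensK K X' Y') (\<lambda>x y. pureK K X' Y' (f x) (g y)))"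
    and tens_map_pure: "\<And>x y. x \<in> carrier X \<Longrightarrow> y \<in> carrier Y \<Longrightarrow>
      lift (tensK K X' Y') (\<lambda>x y. pureK K X' Y' (f x) (g y)) (pureK K X Y x y) = pureK K X' Y' (f x) (g y)"
proof -
  have b: "bil X Y (tensK K X' Y') (\<lambda>x y. pureK K X' Y' (f x) (g y))"
    by (rule bil_comp[OF f g bil_pure]) (use v in auto)
  show "lin (tensK K X Y) (tensK K X' Y') (lift (tensK K X' Y') (\<lambda>x y. pureK K X' Y' (f x) (g y)))"
    by (rule lift_lin) (use v b in auto)
  show "\<And>x y. x \<in> carrier X \<Longrightarrow> y \<in> carrier Y \<Longrightarrow>
      lift (tensK K X' Y') (\<lambda>x y. pureK K X' Y' (f x) (g y)) (pureK K X Y x y) = pureK K X' Y' (f x) (g y)"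
    by (rule lift_pure) (use v b in auto)
qed

end

context bial begin

text \<open>The actions of a constructed bimodule agree with their defining formulas only on the
  carriers; this allows one to replace the other inside a tensor action.\<close>

lemma act2_cong:
  assumes "vs A" "vs A'" "vs M" "vs N"
    and "\<And>a x. a \<in> carrier A \<Longrightarrow> x \<in> carrier M \<Longrightarrow> l a x = m a x"
    and "\<And>a x. a \<in> carrier A' \<Longrightarrow> x \<in> carrier N \<Longrightarrow> l' a x = m' a x"
    and s: "s \<in> carrier (tensK K A A')" and t: "t \<in> carrier (tensK K M N)"
  shows "act2 P R l l' s t = act2 P R m m' s t"
  unfolding act2_def
proof (rule lift_cong[OF assms(1,2) _ s])
  fix a b assume "a \<in> carrier A" "b \<in> carrier A'"
  then show "lift (tensK K P R) (\<lambda>x y. pureK K P R (l a x) (l' b y)) t = lift (tensK K P R) (\<lambda>x y. pureK K P R (m a x) (m' b y)) t"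
    by (intro lift_cong[OF assms(3,4) _ t]) (simp add: assms(5,6))
qed

abbreviation "J \<equiv> trivial_bimod K B"

lemma triv_fields [simp]: "carrier J = carrier K" "zero J = \<zero>\<^bsub>K\<^esub>"
  "add J = add (base_space K)" "smult J = smult (base_space K)"
  "b \<in> carrier B \<Longrightarrow> c \<in> carrier K \<Longrightarrow> lact J b c = counit B b \<otimes>\<^bsub>K\<^esub> c"
  "b \<in> carrier B \<Longrightarrow> c \<in> carrier K \<Longrightarrow> ract J c b = c \<otimes>\<^bsub>K\<^esub> counit B b"
  by (simp_all add: trivial_bimod_def)

lemma J_cong:
  "vs J" "lin J N = lin (base_space K) N" "lin N J = lin N (base_space K)"
  by (simp_all add: trivial_bimod_def)

lemma K_mult: "c \<in> carrier K \<Longrightarrow> d \<in> carrier K \<Longrightarrow> c \<otimes>\<^bsub>K\<^esub> d = d \<otimes>\<^bsub>K\<^esub> c"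
  "c \<in> carrier K \<Longrightarrow> d \<in> carrier K \<Longrightarrow> e \<in> carrier K \<Longrightarrow> c \<otimes>\<^bsub>K\<^esub> d \<otimes>\<^bsub>K\<^esub> e = c \<otimes>\<^bsub>K\<^esub> (d \<otimes>\<^bsub>K\<^esub> e)"
  "c \<in> carrier K \<Longrightarrow> \<one>\<^bsub>K\<^esub> \<otimes>\<^bsub>K\<^esub> c = c" "c \<in> carrier K \<Longrightarrow> c \<otimes>\<^bsub>K\<^esub> \<one>\<^bsub>K\<^esub> = c"
proof -
  note r = cring.cring_simprules(14,11,12)[OF K_cring]
  show "c \<in> carrier K \<Longrightarrow> d \<in> carrier K \<Longrightarrow> c \<otimes>\<^bsub>K\<^esub> d = d \<otimes>\<^bsub>K\<^esub> c" by (rule r)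
  show "c \<in> carrier K \<Longrightarrow> d \<in> carrier K \<Longrightarrow> e \<in> carrier K \<Longrightarrow> c \<otimes>\<^bsub>K\<^esub> d \<otimes>\<^bsub>K\<^esub> e = c \<otimes>\<^bsub>K\<^esub> (d \<otimes>\<^bsub>K\<^esub> e)" by (rule r)
  show "c \<in> carrier K \<Longrightarrow> \<one>\<^bsub>K\<^esub> \<otimes>\<^bsub>K\<^esub> c = c" by (rule r)
  then show "c \<in> carrier K \<Longrightarrow> c \<otimes>\<^bsub>K\<^esub> \<one>\<^bsub>K\<^esub> = c" using r(1)[of c "\<one>\<^bsub>K\<^esub>"] by simp
qed

lemma K_bil: "bil (base_space K) (base_space K) (base_space K) (mult K)"
proof -
  have r: "c \<otimes>\<^bsub>K\<^esub> (d \<oplus>\<^bsub>K\<^esub> e) = c \<otimes>\<^bsub>K\<^esub> d \<oplus>\<^bsub>K\<^esub> c \<otimes>\<^bsub>K\<^esub> e" "(d \<oplus>\<^bsub>K\<^esub> e) \<otimes>\<^bsub>K\<^esub> c = d \<otimes>\<^bsub>K\<^esub> c \<oplus>\<^bsub>K\<^esub> e \<otimes>\<^bsub>K\<^esub> c"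
    if "c \<in> carrier K" "d \<in> carrier K" "e \<in> carrier K" for c d e
    using that cring.cring_simprules(13,25)[OF K_cring] by auto
  have lc: "x \<otimes>\<^bsub>K\<^esub> (c \<otimes>\<^bsub>K\<^esub> y) = c \<otimes>\<^bsub>K\<^esub> (x \<otimes>\<^bsub>K\<^esub> y)" if "c \<in> carrier K" "x \<in> carrier K" "y \<in> carrier K" for c x y
    using that K_mult(2)[of x c y] K_mult(2)[of c x y] K_mult(1)[of x c] by simp
  show ?thesis by (intro bilI linI) (simp_all add: r K_mult(2) lc)
qed

lemma counit_B: "a \<in> carrier B \<Longrightarrow> b \<in> carrier B \<Longrightarrow> counit B (a \<otimes>\<^bsub>B\<^esub> b) = counit B a \<otimes>\<^bsub>K\<^esub> counit B b"
  "counit B \<one>\<^bsub>B\<^esub> = \<one>\<^bsub>K\<^esub>"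
  using bialgD(10,11)[OF B] by auto

lemma J_act: "bil B (base_space K) (base_space K) (\<lambda>b c. counit B b \<otimes>\<^bsub>K\<^esub> c)"
  "bil B (base_space K) (base_space K) (\<lambda>b c. c \<otimes>\<^bsub>K\<^esub> counit B b)"
  using bil_comp[OF bialgD(3)[OF B] lin_id K_bil] bil_comp[OF lin_id bialgD(3)[OF B] K_bil]
  by (auto simp: bil_def)

lemma base_ext: "add (base_space K) \<in> extensional2 (carrier K) (carrier K)" "smult (base_space K) \<in> extensional2 (carrier K) (carrier K)"
  by (auto simp: base_space_def extensional2_def restrict2_def)

lemma J_bm [simp]: "bm J"
  unfolding trivial_bimod_def
proof (rule mk_bimod_bm)
  show "gmod (mult B) \<one>\<^bsub>B\<^esub> B (base_space K) (\<lambda>b c. counit B b \<otimes>\<^bsub>K\<^esub> c)"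
    by (simp add: gmod_def ualg_bil J_act counit_B K_mult(2,3))
  show "gmod opm \<one>\<^bsub>B\<^esub> B (base_space K) (\<lambda>b x. x \<otimes>\<^bsub>K\<^esub> counit B b)"
    unfolding gmod_def
  proof (intro conjI ballI)
    fix a b x assume "a \<in> carrier B" "b \<in> carrier B" "x \<in> carrier (base_space K)"
    then show "x \<otimes>\<^bsub>K\<^esub> counit B (b \<otimes>\<^bsub>B\<^esub> a) = (x \<otimes>\<^bsub>K\<^esub> counit B b) \<otimes>\<^bsub>K\<^esub> counit B a"
      by (simp add: counit_B K_mult(2))
  qed (simp_all add: J_act opm_bil counit_B K_mult(4))
qed (use base_ext in \<open>simp_all add: K_mult(2)\<close>)

lemma diag_act_pure:
  assumes X: "bm X" "bm Y" "b \<in> carrier B" "x \<in> carrier X" "y \<in> carrier Y"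
  shows "lact (tens_diag K B X Y) b (pureK K X Y x y) = actL X Y (comult B b) (pureK K X Y x y)"
    "ract (tens_diag K B X Y) (pureK K X Y x y) b = actR X Y (comult B b) (pureK K X Y x y)"
  using assms by (simp_all add: diag_act dg_def)

lemma tens_map_act:
  assumes v: "vs X" "vs Y" "vs X'" "vs Y'" and f: "lin X X' f" and g: "lin Y Y' g"
    and a: "bil B X X aX" "bil B Y Y aY" "bil B X' X' aX'" "bil B Y' Y' aY'"
    and fa: "\<And>b x. b \<in> carrier B \<Longrightarrow> x \<in> carrier X \<Longrightarrow> f (aX b x) = aX' b (f x)"
    and ga: "\<And>b y. b \<in> carrier B \<Longrightarrow> y \<in> carrier Y \<Longrightarrow> g (aY b y) = aY' b (g y)"
    and s: "s \<in> carrier (tensK K B B)" and t: "t \<in> carrier (tensK K X Y)"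
  shows "lift (tensK K X' Y') (\<lambda>x y. pureK K X' Y' (f x) (g y)) (act2 X Y aX aY s t) =
    act2 X' Y' aX' aY' s (lift (tensK K X' Y') (\<lambda>x y. pureK K X' Y' (f x) (g y)) t)"
proof -
  note m = tens_map[OF v f g]
  note a1 = act2[OF B_vs B_vs v(1,2,1,2) a(1,2)] and a2 = act2[OF B_vs B_vs v(3,4,3,4) a(3,4)]
  show ?thesis
    by (rule bil_ext[OF B_vs B_vs v(1,2) bil_lin[OF m(1) a1(1)] bil_comp[OF lin_id m(1) a2(1)] _ s t])
      (simp add: a1(2) a2(2) m(2) bil_cl[OF a(1)] bil_cl[OF a(2)] fa ga lin_cl[OF f] lin_cl[OF g])
qed

text \<open>Acting with \<Delta>(b) on c \<otimes> x and multiplying out gives the action of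
  \<epsilon>(b_1) b_2 on c x, and \<epsilon>(b_1) b_2 = b by the counit axiom. The assumption
  \<open>eq\<close> covers both actions on the base field at once, since \<open>K\<close> is
  commutative.\<close>

lemma unit_act:
  assumes X: "bm X" and aX: "bil B X X aX" and aJ: "bil B (base_space K) (base_space K) aJ"
    and eq: "\<And>b c. b \<in> carrier B \<Longrightarrow> c \<in> carrier K \<Longrightarrow> aJ b c = counit B b \<otimes>\<^bsub>K\<^esub> c"
    and b: "b \<in> carrier B" and c: "c \<in> carrier K" and x: "x \<in> carrier X"
    and f: "lin (tensK K J X) X f" "\<And>c x. c \<in> carrier K \<Longrightarrow> x \<in> carrier X \<Longrightarrow> f (pureK K J X c x) = c \<odot>\<^bsub>X\<^esub> x"
    and g: "lin (tensK K X J) X g" "\<And>c x. c \<in> carrier K \<Longrightarrow> x \<in> carrier X \<Longrightarrow> g (pureK K X J x c) = c \<odot>\<^bsub>X\<^esub> x"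
  shows "f (act2 J X aJ aX (comult B b) (pureK K J X c x)) = aX b (c \<odot>\<^bsub>X\<^esub> x)"
    "g (act2 X J aX aJ (comult B b) (pureK K X J x c)) = aX b (c \<odot>\<^bsub>X\<^esub> x)"
proof -
  have v: "vs J" "vs X" using X by auto
  have aJ': "bil B J J aJ" using aJ by (simp add: bil_def J_cong)
  have aJc: "aJ b c \<in> carrier K" if "b \<in> carrier B" "c \<in> carrier K" for b c using that by (simp add: eq)
  note l = act2[OF B_vs B_vs v v aJ' aX] and r = act2[OF B_vs B_vs v(2,1,2,1) aX aJ']
  have p: "pureK K J X c x \<in> carrier (tensK K J X)" "pureK K X J x c \<in> carrier (tensK K X J)" using v c x by auto
  note cu = counit_lift[OF B_vs bialgD(3)[OF B]]
  have y: "c \<odot>\<^bsub>X\<^esub> x \<in> carrier X" using v c x by simp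
  have sm: "aX (d \<odot>\<^bsub>B\<^esub> b) (c \<odot>\<^bsub>X\<^esub> x) = (d \<otimes>\<^bsub>K\<^esub> c) \<odot>\<^bsub>X\<^esub> aX b x" if "d \<in> carrier K" "b \<in> carrier B" for d b
    using that v c x lin_smult[OF bil_r[OF aX y], of d b] lin_smult[OF bil_l[OF aX, of b], of c x] bil_cl[OF aX]
    by (simp add: smult_smult)
  \<comment> \<open>The coproduct is replaced by an arbitrary \<open>s\<close>, in which both sides
    are linear.\<close>
  have "f (act2 J X aJ aX s (pureK K J X c x)) = aX (lift B (\<lambda>x y. counit B x \<odot>\<^bsub>B\<^esub> y) s) (c \<odot>\<^bsub>X\<^esub> x)"
    if s: "s \<in> carrier (tensK K B B)" for s
    by (rule lin_eq_tens[OF B_vs B_vs lin_comp[OF bil_r[OF l(1) p(1)] f(1)] lin_comp[OF cu(1) bil_r[OF aX y]] _ s])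
      (use c x v in \<open>simp add: l(2) f(2) cu(3) eq sm bil_cl[OF aX]\<close>)
  then show "f (act2 J X aJ aX (comult B b) (pureK K J X c x)) = aX b (c \<odot>\<^bsub>X\<^esub> x)"
    using b bialgD(12)[OF B] by simp
  have "g (act2 X J aX aJ s (pureK K X J x c)) = aX (lift B (\<lambda>x y. counit B y \<odot>\<^bsub>B\<^esub> x) s) (c \<odot>\<^bsub>X\<^esub> x)"
    if s: "s \<in> carrier (tensK K B B)" for s
    by (rule lin_eq_tens[OF B_vs B_vs lin_comp[OF bil_r[OF r(1) p(2)] g(1)] lin_comp[OF cu(2) bil_r[OF aX y]] _ s])
      (use c x v in \<open>simp add: r(2) g(2) cu(4) eq sm bil_cl[OF aX]\<close>)
  then show "g (act2 X J aX aJ (comult B b) (pureK K X J x c)) = aX b (c \<odot>\<^bsub>X\<^esub> x)"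
    using b bialgD(13)[OF B] by simp
qed

lemma bull_tensor: "quot_tensor K B {} (\<lambda>_ _. {}) pK Ld Rd (tens_diag K B) J \<one>\<^bsub>K\<^esub>
    (\<lambda>X c x. c \<odot>\<^bsub>X\<^esub> x) (\<lambda>X x c. c \<odot>\<^bsub>X\<^esub> x) (bull_data K B)"
proof -
  interpret q: quot_tensor0 K B "{}" "\<lambda>_ _. {}" pK Ld Rd "tens_diag K B" by (rule b0)
  have sl: "bil J X X (\<lambda>c x. c \<odot>\<^bsub>X\<^esub> x)" "bil X J X (\<lambda>x c. c \<odot>\<^bsub>X\<^esub> x)" if "bm X" for X
  proof -
    have J_ops: "c \<oplus>\<^bsub>J\<^esub> d = c \<oplus>\<^bsub>K\<^esub> d" "c \<odot>\<^bsub>J\<^esub> d = c \<otimes>\<^bsub>K\<^esub> d" if "c \<in> carrier K" "d \<in> carrier K" for c d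
      using that by simp_all
    have lc: "c \<odot>\<^bsub>X\<^esub> (d \<odot>\<^bsub>X\<^esub> x) = d \<odot>\<^bsub>X\<^esub> (c \<odot>\<^bsub>X\<^esub> x)" if "c \<in> carrier K" "d \<in> carrier K" "x \<in> carrier X" for c d x
      using smult_lcomm[of X c d x] that \<open>bm X\<close> by simp
    show "bil J X X (\<lambda>c x. c \<odot>\<^bsub>X\<^esub> x)"
      using that by (intro bilI linI) (simp_all add: J_ops smult_add add_smult smult_smult lc)
    then show "bil X J X (\<lambda>x c. c \<odot>\<^bsub>X\<^esub> x)" by (auto simp: bil_def)
  qed
  have lu: "lin (tensK K J X) X (lift X (\<lambda>c x. c \<odot>\<^bsub>X\<^esub> x))" "\<And>c x. c \<in> carrier K \<Longrightarrow> x \<in> carrier X \<Longrightarrow> lift X (\<lambda>c x. c \<odot>\<^bsub>X\<^esub> x) (pureK K J X c x) = c \<odot>\<^bsub>X\<^esub> x"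
    and ru: "lin (tensK K X J) X (lift X (\<lambda>x c. c \<odot>\<^bsub>X\<^esub> x))" "\<And>c x. c \<in> carrier K \<Longrightarrow> x \<in> carrier X \<Longrightarrow> lift X (\<lambda>x c. c \<odot>\<^bsub>X\<^esub> x) (pureK K X J x c) = c \<odot>\<^bsub>X\<^esub> x"
    if "bm X" for X
    using q.P_lift[OF J_bm that bm_vs[OF that] sl(1)[OF that]] q.P_lift[OF that J_bm bm_vs[OF that] sl(2)[OF that]] by auto
  have Jl: "bil B (base_space K) (base_space K) (la J)" "bil B (base_space K) (base_space K) (ra J)"
    using lact_bil[OF J_bm] ract_bil[OF J_bm] by (simp_all add: bil_def J_cong)
  show ?thesis
  proof unfold_locales
    show "bull_data K B = \<lparr>tenO = tens_diag K B, tenA = (\<lambda>f g. mk_arrow (tens_diag K B (src f) (src g)) (tens_diag K B (trg f) (trg g))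
         (lift (tens_diag K B (trg f) (trg g)) (\<lambda>x y. pureK K (trg f) (trg g) (f $ x) (g $ y)))), munit = J,
       asc = (\<lambda>X Y Z. mk_arrow (tens_diag K B (tens_diag K B X Y) Z) (tens_diag K B X (tens_diag K B Y Z)) (q.ascf X Y Z)),
       lun = (\<lambda>X. mk_arrow (tens_diag K B J X) X (lift X (\<lambda>c x. c \<odot>\<^bsub>X\<^esub> x))),
       run = (\<lambda>X. mk_arrow (tens_diag K B X J) X (lift X (\<lambda>x c. c \<odot>\<^bsub>X\<^esub> x)))\<rparr>"
      by (simp add: bull_data_def Let_def q.ascf_def)
  next
    fix f g b x y assume a: "f \<in> Ar C" "g \<in> Ar C" "b \<in> carrier B" "x \<in> carrier (src f)" "y \<in> carrier (src g)"
    note F = ArD[OF a(1)] and G = ArD[OF a(2)]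
    note v = bm_vs[OF F(1)] bm_vs[OF G(1)] bm_vs[OF F(2)] bm_vs[OF G(2)]
    show "lift (tens_diag K B (trg f) (trg g)) (\<lambda>x y. pureK K (trg f) (trg g) (f $ x) (g $ y))
        (lact (tens_diag K B (src f) (src g)) b (pureK K (src f) (src g) x y)) =
      lact (tens_diag K B (trg f) (trg g)) b (pureK K (trg f) (trg g) (f $ x) (g $ y))"
      using a F(1,2) G(1,2) tens_map_act[where aX = "la (src f)" and aY = "la (src g)" and aX' = "la (trg f)" and aY' = "la (trg g)"
          and s = "comult B b" and t = "pureK K (src f) (src g) x y", OF v F(3) G(3)]
      by (simp add: diag_act_pure tens_map_pure[OF v F(3) G(3)] lact_bil F(4) G(4))
    show "lift (tens_diag K B (trg f) (trg g)) (\<lambda>x y. pureK K (trg f) (trg g) (f $ x) (g $ y))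
        (ract (tens_diag K B (src f) (src g)) (pureK K (src f) (src g) x y) b) =
      ract (tens_diag K B (trg f) (trg g)) (pureK K (trg f) (trg g) (f $ x) (g $ y)) b"
      using a F(1,2) G(1,2) tens_map_act[where aX = "ra (src f)" and aY = "ra (src g)" and aX' = "ra (trg f)" and aY' = "ra (trg g)"
          and s = "comult B b" and t = "pureK K (src f) (src g) x y", OF v F(3) G(3)]
      by (simp add: diag_act_pure tens_map_pure[OF v F(3) G(3)] ract_bil F(5) G(5))
  next
    fix X Y Z b x y z assume a: "bm X" "bm Y" "bm Z" "b \<in> carrier B" "x \<in> carrier X" "y \<in> carrier Y" "z \<in> carrier Z"
    have v: "vs X" "vs Y" "vs Z" using a by auto
    have e: "act2 (tensK K X Y) Z (la (tens_diag K B X Y)) l s t = act2 (tensK K X Y) Z (dg X Y (la X) (la Y)) l s t"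
      "act2 (tensK K X Y) Z (ra (tens_diag K B X Y)) l s t = act2 (tensK K X Y) Z (dg X Y (ra X) (ra Y)) l s t"
      if "s \<in> carrier (tensK K B B)" "t \<in> carrier (tensK K (tensK K X Y) Z)" for l s t
      by (rule act2_cong[OF B_vs B_vs _ v(3) _ _ that]; use v in \<open>simp add: diag_act\<close>)+
    have e': "act2 X (tensK K Y Z) l (la (tens_diag K B Y Z)) s t = act2 X (tensK K Y Z) l (dg Y Z (la Y) (la Z)) s t"
      "act2 X (tensK K Y Z) l (ra (tens_diag K B Y Z)) s t = act2 X (tensK K Y Z) l (dg Y Z (ra Y) (ra Z)) s t"
      if "s \<in> carrier (tensK K B B)" "t \<in> carrier (tensK K X (tensK K Y Z))" for l s t
      by (rule act2_cong[OF B_vs B_vs v(1) _ _ _ that]; use v in \<open>simp add: diag_act\<close>)+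
    show "q.ascf X Y Z (lact (tens_diag K B (tens_diag K B X Y) Z) b (pureK K (tens_diag K B X Y) Z (pureK K X Y x y) z)) =
        lact (tens_diag K B X (tens_diag K B Y Z)) b (pureK K X (tens_diag K B Y Z) x (pureK K Y Z y z))"
      using a v asc_dg[OF a(1-3) lact_bil lact_bil lact_bil a(4-7)] by (simp add: diag_act dg_def[of "tens_diag K B X Y"] dg_def[of X "tens_diag K B Y Z"] e e')
    show "q.ascf X Y Z (ract (tens_diag K B (tens_diag K B X Y) Z) (pureK K (tens_diag K B X Y) Z (pureK K X Y x y) z) b) =
        ract (tens_diag K B X (tens_diag K B Y Z)) (pureK K X (tens_diag K B Y Z) x (pureK K Y Z y z)) b"
      using a v asc_dg[OF a(1-3) ract_bil ract_bil ract_bil a(4-7)] by (simp add: diag_act dg_def[of "tens_diag K B X Y"] dg_def[of X "tens_diag K B Y Z"] e e')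
  next
    fix X u b x assume a: "bm X" "u \<in> carrier J" "b \<in> carrier B" "x \<in> carrier X"
    then have u: "u \<in> carrier K" by simp
    note ul = unit_act[OF a(1) lact_bil[OF a(1)] Jl(1) _ a(3) u a(4) lu[OF a(1)] ru[OF a(1)]]
    note ur = unit_act[OF a(1) ract_bil[OF a(1)] Jl(2) _ a(3) u a(4) lu[OF a(1)] ru[OF a(1)]]
    show "lift X (\<lambda>c x. c \<odot>\<^bsub>X\<^esub> x) (lact (tens_diag K B J X) b (pureK K J X u x)) = lact X b (u \<odot>\<^bsub>X\<^esub> x)"
      "lift X (\<lambda>x c. c \<odot>\<^bsub>X\<^esub> x) (lact (tens_diag K B X J) b (pureK K X J x u)) = lact X b (u \<odot>\<^bsub>X\<^esub> x)"
      using a by (simp_all add: diag_act_pure ul)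
    show "lift X (\<lambda>c x. c \<odot>\<^bsub>X\<^esub> x) (ract (tens_diag K B J X) (pureK K J X u x) b) = ract X (u \<odot>\<^bsub>X\<^esub> x) b"
      "lift X (\<lambda>x c. c \<odot>\<^bsub>X\<^esub> x) (ract (tens_diag K B X J) (pureK K X J x u) b) = ract X (u \<odot>\<^bsub>X\<^esub> x) b"
      using a by (simp_all add: diag_act_pure ur K_mult(1))
  next
    fix X u x assume a: "bm X" "u \<in> carrier J" "x \<in> carrier X"
    have "pureK K J X \<one>\<^bsub>K\<^esub> (u \<odot>\<^bsub>X\<^esub> x) = u \<odot>\<^bsub>tensK K J X\<^esub> pureK K J X \<one>\<^bsub>K\<^esub> x"
      using a lin_smult[OF bil_l[OF bil_pure[of J X "{}"]], of "\<one>\<^bsub>K\<^esub>" u x] by simp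
    also have "\<dots> = pureK K J X u x"
      using a lin_smult[OF bil_r[OF bil_pure[of J X "{}"]], of x u "\<one>\<^bsub>K\<^esub>"] by (simp add: K_mult)
    finally show "pureK K J X \<one>\<^bsub>K\<^esub> (u \<odot>\<^bsub>X\<^esub> x) = pureK K J X u x" .
    have "pureK K X J (u \<odot>\<^bsub>X\<^esub> x) \<one>\<^bsub>K\<^esub> = u \<odot>\<^bsub>tensK K X J\<^esub> pureK K X J x \<one>\<^bsub>K\<^esub>"
      using a lin_smult[OF bil_r[OF bil_pure[of X J "{}"]], of "\<one>\<^bsub>K\<^esub>" u x] by simp
    also have "\<dots> = pureK K X J x u"
      using a lin_smult[OF bil_l[OF bil_pure[of X J "{}"]], of x u "\<one>\<^bsub>K\<^esub>"] by (simp add: K_mult)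
    finally show "pureK K X J (u \<odot>\<^bsub>X\<^esub> x) \<one>\<^bsub>K\<^esub> = pureK K X J x u" .
  next
    fix X Y u x y assume a: "bm X" "bm Y" "u \<in> carrier J" "x \<in> carrier X" "y \<in> carrier Y"
    then show "pureK K X Y x (u \<odot>\<^bsub>Y\<^esub> y) = pureK K X Y (u \<odot>\<^bsub>X\<^esub> x) y"
      using lin_smult[OF bil_l[OF bil_pure[of X Y "{}"]], of x u y] lin_smult[OF bil_r[OF bil_pure[of X Y "{}"]], of y u x] by simp
  qed (use sl in \<open>simp_all add: lin_smult[OF ArD(3)]\<close>)
qed

lemma b: "ctensor K B (bull_data K B) pK (\<lambda>X c x. c \<odot>\<^bsub>X\<^esub> x) (\<lambda>X x c. c \<odot>\<^bsub>X\<^esub> x) (tens_diag K B) (tenA (bull_data K B)) J"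
  using quot_tensor.ctensor[OF bull_tensor] .

subsection \<open>The interchange law\<close>

text \<open>The interchange law as a bilinear map of its two arguments, before it descends to the
  tensor product over \<open>B\<close>. On this level it is compatible with the actions of all of B
  \<otimes> B.\<close>

definition zf :: "'u bimod \<Rightarrow> 'u bimod \<Rightarrow> 'u bimod \<Rightarrow> 'u bimod \<Rightarrow> 'u \<Rightarrow> 'u \<Rightarrow> 'u"
  where "zf X Y Z W s t = (let P = tens_diag K B (tensB K B X Z) (tensB K B Y W) in
    lift P (\<lambda>a e. lift P (\<lambda>c d. pureK K (tensB K B X Z) (tensB K B Y W) (pureB K B X Z a c) (pureB K B Y W e d)) t) s)"

lemma zeta_eq: "zeta (bimod_duoidal K B) X Y Z W =
    mk_arrow (tensB K B (tens_diag K B X Y) (tens_diag K B Z W)) (tens_diag K B (tensB K B X Z) (tensB K B Y W))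
      (lift (tens_diag K B (tensB K B X Z) (tensB K B Y W)) (zf X Y Z W))"
  by (simp add: bimod_duoidal_def Let_def zf_def[abs_def])

lemma pureB_bil: "bm X \<Longrightarrow> bm Y \<Longrightarrow> bil X Y (tensB K B X Y) (pB X Y)"
  using quot_tensor0.P_bil[OF o0] .

lemma pureB_cl: "bm X \<Longrightarrow> bm Y \<Longrightarrow> x \<in> carrier X \<Longrightarrow> y \<in> carrier Y \<Longrightarrow> pureB K B X Y x y \<in> carrier (tensB K B X Y)"
  using quot_tensor0.P_cl[OF o0] .

context
  fixes X Y Z W :: "'u bimod"
  assumes X: "bm X" and Y: "bm Y" and Z: "bm Z" and W: "bm W"
begin

lemma zf:
  shows zf_bil: "bil (tensK K X Y) (tensK K Z W) (tensK K (tensB K B X Z) (tensB K B Y W)) (zf X Y Z W)"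
    and zf_pure: "\<And>x y z w. x \<in> carrier X \<Longrightarrow> y \<in> carrier Y \<Longrightarrow> z \<in> carrier Z \<Longrightarrow> w \<in> carrier W \<Longrightarrow>
      zf X Y Z W (pureK K X Y x y) (pureK K Z W z w) =
      pureK K (tensB K B X Z) (tensB K B Y W) (pureB K B X Z x z) (pureB K B Y W y w)"
proof -
  let ?P = "tensK K (tensB K B X Z) (tensB K B Y W)"
  let ?f = "\<lambda>x y z w. pureK K (tensB K B X Z) (tensB K B Y W) (pureB K B X Z x z) (pureB K B Y W y w)"
  have v: "vs X" "vs Y" "vs Z" "vs W" "vs (tensB K B X Z)" "vs (tensB K B Y W)" using X Y Z W by auto
  note p = pureB_bil[OF X Z] pureB_bil[OF Y W]
  note c = pureB_cl[OF X Z] pureB_cl[OF Y W]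
  have l: "\<And>y z w. y \<in> carrier Y \<Longrightarrow> z \<in> carrier Z \<Longrightarrow> w \<in> carrier W \<Longrightarrow> lin X ?P (\<lambda>x. ?f x y z w)"
    "\<And>x z w. x \<in> carrier X \<Longrightarrow> z \<in> carrier Z \<Longrightarrow> w \<in> carrier W \<Longrightarrow> lin Y ?P (\<lambda>y. ?f x y z w)"
    "\<And>x y w. x \<in> carrier X \<Longrightarrow> y \<in> carrier Y \<Longrightarrow> w \<in> carrier W \<Longrightarrow> lin Z ?P (\<lambda>z. ?f x y z w)"
    "\<And>x y z. x \<in> carrier X \<Longrightarrow> y \<in> carrier Y \<Longrightarrow> z \<in> carrier Z \<Longrightarrow> lin W ?P (\<lambda>w. ?f x y z w)"
    using v c bil_l[OF p(1)] bil_r[OF p(1)] bil_l[OF p(2)] bil_r[OF p(2)]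
    by (auto intro!: lin_pureL lin_pureR)
  have e: "zf X Y Z W = (\<lambda>s t. lift ?P (\<lambda>x y. lift ?P (?f x y) t) s)"
    by (simp add: zf_def[abs_def] Let_def)
  show "bil (tensK K X Y) (tensK K Z W) ?P (zf X Y Z W)" unfolding e
    by (rule lift2_bil) (use v l in auto)
  show "zf X Y Z W (pureK K X Y x y) (pureK K Z W z w) = ?f x y z w"
    if "x \<in> carrier X" "y \<in> carrier Y" "z \<in> carrier Z" "w \<in> carrier W" for x y z w
    unfolding e by (rule lift2_pure[of X Y Z W]) (use v l that in auto)
qed

text \<open>Each equation is trilinear, and on pure tensors it concerns the two products over
  \<open>B\<close> separately: balancing for the first, the definition of the actions for the other
  two. At u = \<Delta>(b) they make \<zeta> a well-defined bimodule map; at u = \<open>S\<close> and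
  its inverse they give its compatibility with the braiding.\<close>

lemma zf_act:
  assumes s: "s \<in> carrier (tensK K X Y)" and t: "t \<in> carrier (tensK K Z W)" and u: "u \<in> carrier (tensK K B B)"
  shows "zf X Y Z W (actR X Y u s) t = zf X Y Z W s (actL Z W u t)"
    "zf X Y Z W (actL X Y u s) t =
      actL (tensB K B X Z) (tensB K B Y W) u (zf X Y Z W s t)"
    "zf X Y Z W s (actR Z W u t) =
      actR (tensB K B X Z) (tensB K B Y W) u (zf X Y Z W s t)"
proof -
  have v: "vs X" "vs Y" "vs Z" "vs W" "vs (tensB K B X Z)" "vs (tensB K B Y W)" using X Y Z W by auto
  have b: "bm (tensB K B X Z)" "bm (tensB K B Y W)" using X Y Z W by auto
  note c = pureB_cl[OF X Z] pureB_cl[OF Y W]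
  note rX = act2[OF B_vs B_vs v(1,2,1,2) ract_bil[OF X] ract_bil[OF Y]] and lX = act2[OF B_vs B_vs v(1,2,1,2) lact_bil[OF X] lact_bil[OF Y]]
  note rZ = act2[OF B_vs B_vs v(3,4,3,4) ract_bil[OF Z] ract_bil[OF W]] and lZ = act2[OF B_vs B_vs v(3,4,3,4) lact_bil[OF Z] lact_bil[OF W]]
  note rT = act2[OF B_vs B_vs v(5,6,5,6) ract_bil[OF b(1)] ract_bil[OF b(2)]] and lT = act2[OF B_vs B_vs v(5,6,5,6) lact_bil[OF b(1)] lact_bil[OF b(2)]]
  note S = X Y Z W v c zf_pure pureB_bal
  show "zf X Y Z W (actR X Y u s) t = zf X Y Z W s (actL Z W u t)"
    by (rule tri_ext[OF B_vs B_vs v(1-4) tri_1[OF rX(1) zf_bil] tri_3[OF lZ(1) zf_bil] _ u s t])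
      (simp add: rX(2) lZ(2) S)
  show "zf X Y Z W (actL X Y u s) t =
      actL (tensB K B X Z) (tensB K B Y W) u (zf X Y Z W s t)"
    by (rule tri_ext[OF B_vs B_vs v(1-4) tri_1[OF lX(1) zf_bil] tri_2[OF zf_bil lT(1)] _ u s t])
      (simp add: lX(2) lT(2) S)
  show "zf X Y Z W s (actR Z W u t) =
      actR (tensB K B X Z) (tensB K B Y W) u (zf X Y Z W s t)"
    by (rule tri_ext[OF B_vs B_vs v(1-4) tri_3[OF rZ(1) zf_bil] tri_2[OF zf_bil rT(1)] _ u s t])
      (simp add: rZ(2) rT(2) S)
qed

lemma zeta:
  shows zeta_Ar: "zeta (bimod_duoidal K B) X Y Z W \<in> Ar C"
    and zeta_pure: "\<And>s t. s \<in> carrier (tensK K X Y) \<Longrightarrow> t \<in> carrier (tensK K Z W) \<Longrightarrow>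
      zeta (bimod_duoidal K B) X Y Z W $ (pureB K B (tens_diag K B X Y) (tens_diag K B Z W) s t) = zf X Y Z W s t"
proof -
  let ?S = "tens_diag K B X Y" and ?T = "tens_diag K B Z W" and ?P = "tens_diag K B (tensB K B X Z) (tensB K B Y W)"
  have S: "bm ?S" "bm ?T" "bm ?P" using X Y Z W by auto
  have b: "bil ?S ?T ?P (zf X Y Z W)" using zf_bil by simp
  note m = lin_cl[OF bil_l[OF lact_bil]] lin_cl[OF bil_l[OF ract_bil]]
  have r: "zf X Y Z W (ract ?S s c) t = zf X Y Z W s (lact ?T c t)"
    if "c \<in> carrier B" "s \<in> carrier ?S" "t \<in> carrier ?T" for c s t
    using that zf_act(1)[of s t "comult B c"] by (simp add: diag_act dg_def)
  have P: "lin (tensB K B ?S ?T) ?P (lift ?P (zf X Y Z W))"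
    "\<And>s t. s \<in> carrier ?S \<Longrightarrow> t \<in> carrier ?T \<Longrightarrow> lift ?P (zf X Y Z W) (pureB K B ?S ?T s t) = zf X Y Z W s t"
    using quot_tensor0.P_lift[OF o0 S(1,2) bm_vs[OF S(3)] b r] by blast+
  have cl: "s \<in> carrier ?S \<Longrightarrow> t \<in> carrier ?T \<Longrightarrow> zf X Y Z W s t \<in> carrier ?P" for s t
    by (rule bil_cl[OF b])
  note ac = lact_cl[OF S(1)] ract_cl[OF S(2)]
  show "zeta (bimod_duoidal K B) X Y Z W \<in> Ar C"
    unfolding zeta_eq
  proof (rule quot_tensor0.P_arrow[OF o0 S P(1)])
    fix c s t assume a: "c \<in> carrier B" "s \<in> carrier ?S" "t \<in> carrier ?T"
    have "lift ?P (zf X Y Z W) (lact (tensB K B ?S ?T) c (pureB K B ?S ?T s t)) = zf X Y Z W (lact ?S c s) t"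
      using a ac S by (simp only: lact_tensB P(2))
    also have "\<dots> = lact ?P c (zf X Y Z W s t)"
      using a zf_act(2)[of s t "comult B c"] cl[OF a(2,3)] by (simp add: diag_act dg_def)
    finally show "lift ?P (zf X Y Z W) (lact (tensB K B ?S ?T) c (pureB K B ?S ?T s t)) =
        lact ?P c (lift ?P (zf X Y Z W) (pureB K B ?S ?T s t))" using a by (simp only: P(2))
    have "lift ?P (zf X Y Z W) (ract (tensB K B ?S ?T) (pureB K B ?S ?T s t) c) = zf X Y Z W s (ract ?T t c)"
      using a ac S by (simp only: ract_tensB P(2))
    also have "\<dots> = ract ?P (zf X Y Z W s t) c"
      using a zf_act(3)[of s t "comult B c"] cl[OF a(2,3)] by (simp add: diag_act dg_def)
    finally show "lift ?P (zf X Y Z W) (ract (tensB K B ?S ?T) (pureB K B ?S ?T s t) c) =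
        ract ?P (lift ?P (zf X Y Z W) (pureB K B ?S ?T s t)) c" using a by (simp only: P(2))
  qed
  show "zeta (bimod_duoidal K B) X Y Z W $ (pureB K B ?S ?T s t) = zf X Y Z W s t"
    if "s \<in> carrier (tensK K X Y)" "t \<in> carrier (tensK K Z W)" for s t
  proof -
    have st: "s \<in> carrier ?S" "t \<in> carrier ?T" using that by auto
    then have "pureB K B ?S ?T s t \<in> carrier (tensB K B ?S ?T)" by (rule pureB_cl[OF S(1,2)])
    then show ?thesis unfolding zeta_eq using P(2)[OF st] by (simp only: mk_arrow_fields)
  qed
qed

end

section \<open>The axioms of the duoidal category\<close>

abbreviation "\<DD> \<equiv> bimod_duoidal K B"

lemma duo_simps [simp]: "circ \<DD> = circ_data K B" "bull \<DD> = bull_data K B"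
  by (simp_all add: bimod_duoidal_def Let_def)

lemma duo_arrows: "Delta_I \<DD> = mk_arrow I (tens_diag K B I I) (comult B)"
    "m_J \<DD> = mk_arrow (tensB K B J J) J (lift J (\<lambda>k k'. k \<otimes>\<^bsub>K\<^esub> k'))" "eps_I \<DD> = mk_arrow I J (counit B)"
  by (simp_all add: bimod_duoidal_def Let_def)

text \<open>On I \<bullet> I the diagonal actions are left and right multiplication by \<Delta>(b)
  in the tensor algebra, so linearity of this arrow is multiplicativity of \<Delta>.\<close>

lemma Delta_I: "Delta_I \<DD> \<in> Ar C" "\<And>b. b \<in> carrier B \<Longrightarrow> Delta_I \<DD> $ b = comult B b"
proof -
  have l: "dg I I (la I) (la I) b t = act2 B B (mult B) (mult B) (comult B b) t"
    "dg I I (ra I) (ra I) b t = act2 B B opm opm (comult B b) t"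
    if "b \<in> carrier B" "t \<in> carrier (tensK K B B)" for b t
  proof -
    have e: "act2 I I = act2 B B" by (intro ext) (simp add: act2_def)
    show "dg I I (la I) (la I) b t = act2 B B (mult B) (mult B) (comult B b) t"
      "dg I I (ra I) (ra I) b t = act2 B B opm opm (comult B b) t"
      unfolding dg_def e by (rule act2_cong[of B B B B]; use that in simp)+
  qed
  show "Delta_I \<DD> \<in> Ar C" unfolding duo_arrows
  proof (rule mk_arrow_Ar)
    fix b x assume a: "b \<in> carrier B" "x \<in> carrier I"
    show "comult B (lact I b x) = lact (tens_diag K B I I) b (comult B x)"
      using a by (simp add: diag_act l comult_mult)
    show "comult B (ract I x b) = ract (tens_diag K B I I) (comult B x) b"
      using a comult_opm[of b x] by (simp add: diag_act l)
  qed simp_all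
qed (simp_all add: duo_arrows)

lemma eps_I: "eps_I \<DD> \<in> Ar C" "\<And>b. b \<in> carrier B \<Longrightarrow> eps_I \<DD> $ b = counit B b"
  unfolding duo_arrows
  by (rule mk_arrow_Ar) (simp_all add: J_cong bialgD(3)[OF B] counit_B)

lemma m_J: "m_J \<DD> \<in> Ar C" "\<And>c d. c \<in> carrier K \<Longrightarrow> d \<in> carrier K \<Longrightarrow> m_J \<DD> $ (pureB K B J J c d) = c \<otimes>\<^bsub>K\<^esub> d"
proof -
  have b: "bil J J J (\<lambda>c d. c \<otimes>\<^bsub>K\<^esub> d)" using K_bil by (simp add: bil_def J_cong)
  have r: "ract J c b \<otimes>\<^bsub>K\<^esub> d = c \<otimes>\<^bsub>K\<^esub> lact J b d" if "b \<in> carrier B" "c \<in> carrier J" "d \<in> carrier J" for b c d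
    using that by (simp add: K_mult(2))
  have P: "lin (tensB K B J J) J (lift J (\<lambda>k k'. k \<otimes>\<^bsub>K\<^esub> k'))"
    "\<And>c d. c \<in> carrier J \<Longrightarrow> d \<in> carrier J \<Longrightarrow> lift J (\<lambda>k k'. k \<otimes>\<^bsub>K\<^esub> k') (pureB K B J J c d) = c \<otimes>\<^bsub>K\<^esub> d"
    using quot_tensor0.P_lift[OF o0 J_bm J_bm bm_vs[OF J_bm] b r] by blast+
  show "m_J \<DD> \<in> Ar C" unfolding duo_arrows
    by (rule quot_tensor0.P_arrow[OF o0 J_bm J_bm J_bm P(1)]) (simp_all add: P(2) K_mult(2) del: triv_fields(3,4))
  show "m_J \<DD> $ (pureB K B J J c d) = c \<otimes>\<^bsub>K\<^esub> d" if "c \<in> carrier K" "d \<in> carrier K" for c d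
    unfolding duo_arrows using that P(2)[of c d] pureB_cl[OF J_bm J_bm, of c d] by simp
qed

text \<open>A set that determines the linear maps out of \<open>X\<close>. Targets are bimodule
  records because a definition cannot quantify over record types, and arrows have no other targets.
  Iterating \<open>spans_ten\<close> yields nested pure tensors in any bracketing.\<close>

definition spans :: "'u bimod \<Rightarrow> 'u set \<Rightarrow> bool"
  where "spans X G \<longleftrightarrow> bm X \<and> G \<subseteq> carrier X \<and> (\<forall>(P :: 'u bimod) f g. lin X P f \<longrightarrow> lin X P g \<longrightarrow>
    (\<forall>x\<in>G. f x = g x) \<longrightarrow> (\<forall>x\<in>carrier X. f x = g x))"

lemma spansD:
  fixes P :: "'u bimod"
  assumes "spans X G" "lin X P f" "lin X P g" "\<And>x. x \<in> G \<Longrightarrow> f x = g x" "x \<in> carrier X"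
  shows "f x = g x"
  using assms(1)[unfolded spans_def, THEN conjunct2, THEN conjunct2, rule_format, OF assms(2-5)] .

lemma spans_all: "bm X \<Longrightarrow> spans X (carrier X)" by (simp add: spans_def)

lemma arr_spans:
  assumes "spans X G" "f \<in> Ar C" "g \<in> Ar C" "src f = X" "src g = X" "trg f = trg g" "\<And>x. x \<in> G \<Longrightarrow> f $ x = g $ x"
  shows "f = g"
proof (rule arr_eqI)
  fix x assume "x \<in> carrier (src g)"
  then show "f $ x = g $ x"
    using spansD[OF assms(1), of "trg g" "map_of_arrow f" "map_of_arrow g" x] assms ArD(3)[OF assms(2)] ArD(3)[OF assms(3)] by simp
qed (use assms in auto)

end

lemma (in ctensor) spans_ten:
  assumes X: "spans X G" and Y: "spans Y G'"
  shows "spans (X \<diamondop> Y) ((\<lambda>(x, y). pt X Y x y) ` (G \<times> G'))"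
proof -
  have b: "bm X" "bm Y" and G: "G \<subseteq> carrier X" "G' \<subseteq> carrier Y" using X Y by (auto simp: spans_def)
  have "f t = g t" if f: "lin (X \<diamondop> Y) P f" "lin (X \<diamondop> Y) P g" and e: "\<And>x y. x \<in> G \<Longrightarrow> y \<in> G' \<Longrightarrow> f (pt X Y x y) = g (pt X Y x y)"
    and t: "t \<in> carrier (X \<diamondop> Y)" for P :: "'u bimod" and f g t
  proof (rule lin_ext2[OF b f _ t])
    have p: "lin Y P (\<lambda>y. f (pt X Y x y))" "lin Y P (\<lambda>y. g (pt X Y x y))" if "x \<in> carrier X" for x
      using lin_comp[OF bil_l[OF pt_bil[OF b] that] f(1)] lin_comp[OF bil_l[OF pt_bil[OF b] that] f(2)] by auto
    have q: "lin X P (\<lambda>x. f (pt X Y x y))" "lin X P (\<lambda>x. g (pt X Y x y))" if "y \<in> carrier Y" for y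
      using lin_comp[OF bil_r[OF pt_bil[OF b] that] f(1)] lin_comp[OF bil_r[OF pt_bil[OF b] that] f(2)] by auto
    have 1: "f (pt X Y x y) = g (pt X Y x y)" if "x \<in> G" "y \<in> carrier Y" for x y
      by (rule spansD[OF Y p e]) (use that G in auto)
    show "f (pt X Y x y) = g (pt X Y x y)" if "x \<in> carrier X" "y \<in> carrier Y" for x y
      by (rule spansD[OF X q 1]) (use that in auto)
  qed
  note e = this
  show ?thesis unfolding spans_def
  proof (intro conjI allI impI ballI)
    show "(\<lambda>(x, y). pt X Y x y) ` (G \<times> G') \<subseteq> carrier (X \<diamondop> Y)" using b G by (auto intro!: pt_cl)
  qed (use b in simp, rule e, auto)
qed

text \<open>A copy of \<open>bial\<close> that carries the two tensor products as interpretations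
  \<open>o\<close> and \<open>b\<close>; \<open>bial\<close> itself is what \<open>ctensor\<close>
  extends.\<close>

locale bimod_duo = bial K B for K :: "('u :: infinite) ring" and B

sublocale bimod_duo \<subseteq> o: ctensor K B "circ_data K B" "\<lambda>X Y x y. pureB K B X Y x y" lact ract "tensB K B" "tenA (circ_data K B)" "regular_bimod B"
  by (rule o)

sublocale bimod_duo \<subseteq> b: ctensor K B "bull_data K B" "\<lambda>X Y x y. pureK K X Y x y" "\<lambda>X c x. c \<odot>\<^bsub>X\<^esub> x" "\<lambda>X x c. c \<odot>\<^bsub>X\<^esub> x"
    "tens_diag K B" "tenA (bull_data K B)" "trivial_bimod K B"
  by (rule b)

context bimod_duo begin

declare diag_fields [simp del] diag_cong [simp del] reg_fields [simp del] reg_cong [simp del] triv_fields [simp del]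
  act2_struct [simp del]

abbreviation circO (infixr \<open>\<star>\<close> 75) where "circO \<equiv> tensB K B"
abbreviation circA (infixr \<open>\<star>\<^sub>a\<close> 75) where "circA \<equiv> tenA (circ_data K B)"
abbreviation bullO (infixr \<open>\<bullet>\<close> 75) where "bullO \<equiv> tens_diag K B"
abbreviation bullA (infixr \<open>\<bullet>\<^sub>a\<close> 75) where "bullA \<equiv> tenA (bull_data K B)"
abbreviation cmpC (infixr \<open>\<cdot>\<close> 65) where "cmpC \<equiv> cmp C"

lemma T_ops [simp]: "tenO (circ_data K B) = tensB K B" "munit (circ_data K B) = I"
  "tenO (bull_data K B) = tens_diag K B" "munit (bull_data K B) = J"
  by (simp_all only: o.T_ops b.T_ops)

lemma zeta_st [simp]: "src (zeta \<DD> X Y Z W) = (X \<bullet> Y) \<star> (Z \<bullet> W)" "trg (zeta \<DD> X Y Z W) = (X \<star> Z) \<bullet> (Y \<star> W)"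
  by (simp_all add: zeta_eq)

lemma zeta_Ar' [simp]: "bm X \<Longrightarrow> bm Y \<Longrightarrow> bm Z \<Longrightarrow> bm W \<Longrightarrow> zeta \<DD> X Y Z W \<in> Ar C"
  by (rule zeta_Ar)

lemma zeta_val [simp]: "bm X \<Longrightarrow> bm Y \<Longrightarrow> bm Z \<Longrightarrow> bm W \<Longrightarrow> x \<in> carrier X \<Longrightarrow> y \<in> carrier Y \<Longrightarrow> z \<in> carrier Z \<Longrightarrow> w \<in> carrier W \<Longrightarrow>
    zeta \<DD> X Y Z W $ (pureB K B (X \<bullet> Y) (Z \<bullet> W) (pureK K X Y x y) (pureK K Z W z w)) =
    pureK K (X \<star> Z) (Y \<star> W) (pureB K B X Z x z) (pureB K B Y W y w)"
  by (simp add: zeta_pure zf_pure)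

lemma unit_st [simp]: "src (Delta_I \<DD>) = I" "trg (Delta_I \<DD>) = I \<bullet> I" "src (m_J \<DD>) = J \<star> J" "trg (m_J \<DD>) = J"
  "src (eps_I \<DD>) = I" "trg (eps_I \<DD>) = J"
  by (simp_all add: duo_arrows)

lemma I_car [simp]: "carrier I = carrier B" and J_car [simp]: "carrier J = carrier K"
  by (simp_all add: reg_fields triv_fields)
lemmas I_act [simp] = reg_fields(5,6)
lemmas J_act' [simp] = triv_fields(5,6)
lemma pure_I: "tens_class K I I Q = tens_class K B B Q" by (simp add: reg_cong)

lemmas unit_vals [simp] = Delta_I eps_I m_J

lemma comult_II [simp]: "b \<in> carrier B \<Longrightarrow> comult B b \<in> carrier (I \<bullet> I)"
  by (simp add: diag_fields reg_cong)

lemma lin_diag: "lin (X \<bullet> Y) N = lin (tensK K X Y) N" "lin N (X \<bullet> Y) = lin N (tensK K X Y)"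
  by (simp_all add: diag_cong)

text \<open>Stated for any \<open>s\<close>, because the values of the comultiplication of the unit
  object are not pure. For pure \<open>s\<close> the unit isomorphisms turn the interchanged tensor
  into the action of the two legs. At s = \<Delta>(b) the right-hand side is the diagonal action,
  that is, the value of the unit isomorphism of X \<bullet> Y.\<close>

lemma Delta_unit:
  assumes X: "bm X" "bm Y" and x: "x \<in> carrier X" "y \<in> carrier Y" and s: "s \<in> carrier (I \<bullet> I)"
  shows "(lun (circ_data K B) X \<bullet>\<^sub>a lun (circ_data K B) Y) $ (zeta \<DD> I I X Y $ pureB K B (I \<bullet> I) (X \<bullet> Y) s (pureK K X Y x y)) =
      actL X Y s (pureK K X Y x y)" (is "?f s = _")
    "(run (circ_data K B) X \<bullet>\<^sub>a run (circ_data K B) Y) $ (zeta \<DD> X Y I I $ pureB K B (X \<bullet> Y) (I \<bullet> I) (pureK K X Y x y) s) =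
      actR X Y s (pureK K X Y x y)" (is "?g s = _")
proof -
  have v: "vs X" "vs Y" using X by auto
  have p: "pureK K X Y x y \<in> carrier (X \<bullet> Y)" "pureK K X Y x y \<in> carrier (tensK K X Y)" using X x v by simp_all
  note L = act2[OF B_vs B_vs v v lact_bil[OF X(1)] lact_bil[OF X(2)]] and R = act2[OF B_vs B_vs v v ract_bil[OF X(1)] ract_bil[OF X(2)]]
  have e: "tensK K I I = tensK K B B" by (simp add: reg_cong)
  have l: "lin (tensK K B B) (X \<bullet> Y) ?f"
    using lin_comp[OF lin_comp[OF bil_r[OF o.pt_bil p(1)] ArD(3)[of "zeta \<DD> I I X Y", simplified]]
        ArD(3)[of "lun (circ_data K B) X \<bullet>\<^sub>a lun (circ_data K B) Y", simplified]] X
    by (simp add: lin_diag(1)[of I I] e)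
  have r: "lin (tensK K B B) (X \<bullet> Y) ?g"
    using lin_comp[OF lin_comp[OF bil_l[OF o.pt_bil p(1)] ArD(3)[of "zeta \<DD> X Y I I", simplified]]
        ArD(3)[of "run (circ_data K B) X \<bullet>\<^sub>a run (circ_data K B) Y", simplified]] X
    by (simp add: lin_diag(1)[of I I] e)
  have s': "s \<in> carrier (tensK K B B)" using s by (simp add: diag_fields e)
  show "?f s = actL X Y s (pureK K X Y x y)"
    by (rule lin_eq_tens[OF B_vs B_vs l bil_r[OF L(1) p(2), folded lin_diag(2)] _ s'])
      (use X x zeta_val[of I I X Y _ _ x y] in \<open>simp add: L(2) pure_I\<close>)
  show "?g s = actR X Y s (pureK K X Y x y)"
    by (rule lin_eq_tens[OF B_vs B_vs r bil_r[OF R(1) p(2), folded lin_diag(2)] _ s'])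
      (use X x zeta_val[of X Y I I x y] in \<open>simp add: R(2) pure_I\<close>)
qed

lemma spansK: "spans X G \<Longrightarrow> spans Y G' \<Longrightarrow> spans (X \<bullet> Y) ((\<lambda>(x, y). pureK K X Y x y) ` (G \<times> G'))"
  by (rule b.spans_ten)
lemma spansB: "spans X G \<Longrightarrow> spans Y G' \<Longrightarrow> spans (X \<star> Y) ((\<lambda>(x, y). pureB K B X Y x y) ` (G \<times> G'))"
  by (rule o.spans_ten)

lemma pure_scale: "bm X \<Longrightarrow> bm Y \<Longrightarrow> c \<in> carrier K \<Longrightarrow> d \<in> carrier K \<Longrightarrow> x \<in> carrier X \<Longrightarrow> y \<in> carrier Y \<Longrightarrow>
    pureB K B X Y (c \<odot>\<^bsub>X\<^esub> x) (d \<odot>\<^bsub>Y\<^esub> y) = (c \<otimes>\<^bsub>K\<^esub> d) \<odot>\<^bsub>X \<star> Y\<^esub> pureB K B X Y x y"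
  using lin_smult[OF bil_r[OF pureB_bil, of X Y "d \<odot>\<^bsub>Y\<^esub> y"], of c x] lin_smult[OF bil_l[OF pureB_bil, of X Y x], of d y]
  by (simp add: smult_smult)

text \<open>The underlying space of a bimonoid and the algebra built from it are records of different types.\<close>

definition same :: "'u bimod \<Rightarrow> 'u bialg \<Rightarrow> bool"
  where "same X A \<longleftrightarrow> carrier X = carrier A \<and> add X = add A \<and> zero X = zero A \<and> smult X = smult A"

lemma same_cong:
  assumes "same X A"
  shows "carrier X = carrier A" "smult X = smult A" "vs X \<longleftrightarrow> vs A" "lin X N = lin A N" "lin N X = lin N A"
    "tens_quot K X N Q = tens_quot K A N Q" "tens_quot K N X Q = tens_quot K N A Q"
    "tens_class K X N Q = tens_class K A N Q" "tens_class K N X Q = tens_class K N A Q" "lift X = lift A"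
proof -
  note s = assms[unfolded same_def]
  show "carrier X = carrier A" "smult X = smult A" by (simp_all add: s)
  show "vs X \<longleftrightarrow> vs A" "lin X N = lin A N" "lin N X = lin N A"
    "tens_quot K X N Q = tens_quot K A N Q" "tens_quot K N X Q = tens_quot K N A Q"
    "tens_class K X N Q = tens_class K A N Q" "tens_class K N X Q = tens_class K N A Q" "lift X = lift A"
    by (rule vs_cong lin_cong tens_quot_cong tens_class_cong lift_cong_struct; simp add: s)+
qed

context
  fixes X :: "'u bimod" and A :: "'u bialg"
  assumes X: "bm X" and A: "same X A"
begin

lemma A_vs: "vs A" using X same_cong(3)[OF A] by simp

text \<open>Translates coassociativity as an equation of arrows into the equation of
  \<open>Dl\<close> and \<open>Dr\<close>. It serves the unit object, with \<open>B\<close> itself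
  as bialgebra, and every bimonoid.\<close>

lemma Dl_asc:
  assumes d: "d \<in> Ar C" "src d = X" "trg d = X \<bullet> X" "comult A = map_of_arrow d" and s: "s \<in> carrier (tensK K A A)"
  shows "asc (bull_data K B) X X X $ ((d \<bullet>\<^sub>a ide C X) $ s) = Dl A s"
    "(ide C X \<bullet>\<^sub>a d) $ s = Dr A s"
proof -
  note c = same_cong[OF A]
  have v: "vs A" by (rule A_vs)
  have dl: "lin A (tensK K A A) (comult A)" using ArD(3)[OF d(1), unfolded d(2,3) lin_diag c] d(4) by simp
  have e: "tensK K X (X \<bullet> X) = tensK K A (tensK K A A)" "tensK K (X \<bullet> X) X = tensK K (tensK K A A) A"
    "tensK K A (X \<bullet> X) = tensK K A (tensK K A A)" "tensK K (X \<bullet> X) A = tensK K (tensK K A A) A"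
    by (simp_all add: c diag_cong)
  have pe: "tens_class K (X \<bullet> X) X Q = tens_class K (tensK K A A) A Q" "tens_class K X (X \<bullet> X) Q = tens_class K A (tensK K A A) Q"
    "tens_class K (X \<bullet> X) A Q = tens_class K (tensK K A A) A Q" "tens_class K A (X \<bullet> X) Q = tens_class K A (tensK K A A) Q" for Q
    by (simp_all add: c diag_cong)
  have a: "lin (tensK K (tensK K A A) A) (tensK K A (tensK K A A)) (map_of_arrow (asc (bull_data K B) X X X))"
    using ArD(3)[of "asc (bull_data K B) X X X"] X by (simp add: lin_diag e c)
  have d1: "lin (tensK K A A) (tensK K (tensK K A A) A) (map_of_arrow (d \<bullet>\<^sub>a ide C X))"
    and d2: "lin (tensK K A A) (tensK K A (tensK K A A)) (map_of_arrow (ide C X \<bullet>\<^sub>a d))"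
    using ArD(3)[of "d \<bullet>\<^sub>a ide C X"] ArD(3)[of "ide C X \<bullet>\<^sub>a d"] X d by (simp_all add: lin_diag e c)
  have p: "lin (tensK K A A) (tensK K (tensK K A A) A) (\<lambda>u. pureK K (tensK K A A) A u c)" if "c \<in> carrier A" for c
    by (rule lin_pureL) (use that v in simp_all)
  \<comment> \<open>In \<open>Dl\<close> the first bracket is a coproduct, so the associator is
    evaluated with an arbitrary tensor \<open>u\<close> in that bracket.\<close>
  have 1: "asc (bull_data K B) X X X $ (pureK K (tensK K A A) A u x) = asc3 A x u" if x: "x \<in> carrier A" and u: "u \<in> carrier (tensK K A A)" for u x
    by (rule lin_eq_tens[OF v v lin_comp[OF p[OF x] a] asc3_lin[OF v x] _ u])
      (use x v b.asc_pt[of X X X, OF X X X] in \<open>simp add: asc3_pure pe c\<close>)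
  show "asc (bull_data K B) X X X $ ((d \<bullet>\<^sub>a ide C X) $ s) = Dl A s"
    by (rule lin_eq_tens[OF v v lin_comp[OF d1 a] Dl_lin[OF v dl] _ s])
      (use b.tena_pt[of d "ide C X" X X] X d(1-3) v lin_cl[OF dl] in \<open>simp add: d(4)[symmetric] Dl_pure[OF v dl] 1 pe c\<close>)
  show "(ide C X \<bullet>\<^sub>a d) $ s = Dr A s"
    by (rule lin_eq_tens[OF v v d2 Dr_lin[OF v dl] _ s])
      (use b.tena_pt[of "ide C X" d X X] X d(1-3) v in \<open>simp add: d(4)[symmetric] Dr_pure[OF v dl] pe c\<close>)
qed

lemma counit_asc:
  assumes d: "d \<in> Ar C" "src d = X" "trg d = J" "counit A = map_of_arrow d" and s: "s \<in> carrier (tensK K A A)"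
  shows "lun (bull_data K B) X $ ((d \<bullet>\<^sub>a ide C X) $ s) = lift A (\<lambda>x y. counit A x \<odot>\<^bsub>A\<^esub> y) s"
    "run (bull_data K B) X $ ((ide C X \<bullet>\<^sub>a d) $ s) = lift A (\<lambda>x y. counit A y \<odot>\<^bsub>A\<^esub> x) s"
proof -
  note c = same_cong[OF A]
  have v: "vs A" by (rule A_vs)
  have dl: "lin A (base_space K) (counit A)" using ArD(3)[OF d(1), unfolded d(2,3) J_cong c] d(4) by simp
  have l: "lin (tensK K A A) A (\<lambda>s. lun (bull_data K B) X $ ((d \<bullet>\<^sub>a ide C X) $ s))"
    "lin (tensK K A A) A (\<lambda>s. run (bull_data K B) X $ ((ide C X \<bullet>\<^sub>a d) $ s))"
    using lin_comp[OF ArD(3)[of "d \<bullet>\<^sub>a ide C X"], of X "map_of_arrow (lun (bull_data K B) X)"] ArD(3)[of "lun (bull_data K B) X"]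
      lin_comp[OF ArD(3)[of "ide C X \<bullet>\<^sub>a d"], of X "map_of_arrow (run (bull_data K B) X)"] ArD(3)[of "run (bull_data K B) X"] X d
    by (simp_all add: lin_diag c)
  have k: "x \<in> carrier A \<Longrightarrow> counit A x \<in> carrier K" for x using lin_cl[OF dl] by simp
  show "lun (bull_data K B) X $ ((d \<bullet>\<^sub>a ide C X) $ s) = lift A (\<lambda>x y. counit A x \<odot>\<^bsub>A\<^esub> y) s"
    by (rule lin_eq_tens[OF v v l(1) counit_lift(1)[OF v dl] _ s])
      (use b.tena_pt[of d "ide C X" X X] b.lun_pt[OF X] X d(1-3) k in \<open>simp add: d(4)[symmetric] counit_lift(3)[OF v dl] c\<close>)
  show "run (bull_data K B) X $ ((ide C X \<bullet>\<^sub>a d) $ s) = lift A (\<lambda>x y. counit A y \<odot>\<^bsub>A\<^esub> x) s"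
    by (rule lin_eq_tens[OF v v l(2) counit_lift(2)[OF v dl] _ s])
      (use b.tena_pt[of "ide C X" d X X] b.run_pt[OF X] X d(1-3) k in \<open>simp add: d(4)[symmetric] counit_lift(4)[OF v dl] c\<close>)
qed

end

lemma I_same: "same I B" by (simp add: same_def reg_fields)

lemma I_maps: "comult B = map_of_arrow (Delta_I \<DD>)" "counit B = map_of_arrow (eps_I \<DD>)"
  using bialgD(4,5)[OF B] by (simp_all add: duo_arrows mk_arrow_def extensional_restrict)

lemma duoidal: "duoidal_category C \<DD>"
proof (rule duoidal_category.intro[OF cat.category_axioms], rule duoidal_category_axioms.intro, unfold duo_simps T_ops arr_C Ob_C)
  show "monoidal_category C (circ_data K B)" by (rule o.monoidal)
  show "monoidal_category C (bull_data K B)" by (rule b.monoidal)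
next
  fix X Y Z W assume a: "bm X" "bm Y" "bm Z" "bm W"
  note s = a[THEN spans_all]
  fix U V assume a': "bm U" "bm V"
  note s' = a'[THEN spans_all]
  \<comment> \<open>The spanning set below copies the bracketing of the source: three pairs tensored
    over \<open>K\<close>, then joined over \<open>B\<close>.\<close>
  show "(asc (circ_data K B) X Z U \<bullet>\<^sub>a asc (circ_data K B) Y W V) \<cdot> zeta \<DD> (X \<star> Z) (Y \<star> W) U V \<cdot>
        (zeta \<DD> X Y Z W \<star>\<^sub>a ide C (U \<bullet> V)) =
      zeta \<DD> X Y (Z \<star> U) (W \<star> V) \<cdot> (ide C (X \<bullet> Y) \<star>\<^sub>a zeta \<DD> Z W U V) \<cdot>
        asc (circ_data K B) (X \<bullet> Y) (Z \<bullet> W) (U \<bullet> V)"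
    by (rule arr_spans[OF spansB[OF spansB[OF spansK[OF s(1,2)] spansK[OF s(3,4)]] spansK[OF s']]]) (use a a' in auto)
  show "asc (bull_data K B) (X \<star> W) (Y \<star> U) (Z \<star> V) \<cdot> (zeta \<DD> X Y W U \<bullet>\<^sub>a ide C (Z \<star> V)) \<cdot>
        zeta \<DD> (X \<bullet> Y) Z (W \<bullet> U) V =
      (ide C (X \<star> W) \<bullet>\<^sub>a zeta \<DD> Y Z U V) \<cdot> zeta \<DD> X (Y \<bullet> Z) W (U \<bullet> V) \<cdot>
        (asc (bull_data K B) X Y Z \<star>\<^sub>a asc (bull_data K B) W U V)"
    by (rule arr_spans[OF spansB[OF spansK[OF spansK[OF s(1,2)] s(3)] spansK[OF spansK[OF s(4) s'(1)] s'(2)]]]) (use a a' in auto)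
next
  fix f X X' g Y Y' h Z Z' k W W'
  assume "f \<in> Ar C \<and> src f = X \<and> trg f = X'" "g \<in> Ar C \<and> src g = Y \<and> trg g = Y'"
    "h \<in> Ar C \<and> src h = Z \<and> trg h = Z'" "k \<in> Ar C \<and> src k = W \<and> trg k = W'"
  then have a: "f \<in> Ar C" "g \<in> Ar C" "h \<in> Ar C" "k \<in> Ar C" and
    e: "src f = X" "trg f = X'" "src g = Y" "trg g = Y'" "src h = Z" "trg h = Z'" "src k = W" "trg k = W'" by auto
  note bs = a[THEN ArD(1), unfolded e] and bt = a[THEN ArD(2), unfolded e]
  show "zeta \<DD> X' Y' Z' W' \<cdot> ((f \<bullet>\<^sub>a g) \<star>\<^sub>a (h \<bullet>\<^sub>a k)) = ((f \<star>\<^sub>a h) \<bullet>\<^sub>a (g \<star>\<^sub>a k)) \<cdot> zeta \<DD> X Y Z W"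
    by (rule arr_spans[OF spansB[OF spansK[OF bs(1,2)[THEN spans_all]] spansK[OF bs(3,4)[THEN spans_all]]]])
      (use a e bs bt in auto)
next
  fix X Y assume a: "bm X" "bm Y"
  note s = a[THEN spans_all]
  show "(lun (circ_data K B) X \<bullet>\<^sub>a lun (circ_data K B) Y) \<cdot> zeta \<DD> I I X Y \<cdot> (Delta_I \<DD> \<star>\<^sub>a ide C (X \<bullet> Y)) =
      lun (circ_data K B) (X \<bullet> Y)"
    by (rule arr_spans[OF spansB[OF spans_all[OF I_bm] spansK[OF s]]]) (use a in \<open>auto simp: Delta_unit diag_act_pure\<close>)
  show "(run (circ_data K B) X \<bullet>\<^sub>a run (circ_data K B) Y) \<cdot> zeta \<DD> X Y I I \<cdot> (ide C (X \<bullet> Y) \<star>\<^sub>a Delta_I \<DD>) =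
      run (circ_data K B) (X \<bullet> Y)"
    by (rule arr_spans[OF spansB[OF spansK[OF s] spans_all[OF I_bm]]]) (use a in \<open>auto simp: Delta_unit diag_act_pure\<close>)
  show "lun (bull_data K B) (X \<star> Y) \<cdot> (m_J \<DD> \<bullet>\<^sub>a ide C (X \<star> Y)) \<cdot> zeta \<DD> J X J Y =
      lun (bull_data K B) X \<star>\<^sub>a lun (bull_data K B) Y"
    by (rule arr_spans[OF spansB[OF spansK[OF spans_all[OF J_bm] s(1)] spansK[OF spans_all[OF J_bm] s(2)]]])
      (use a in \<open>auto simp: pure_scale\<close>)
  show "run (bull_data K B) (X \<star> Y) \<cdot> (ide C (X \<star> Y) \<bullet>\<^sub>a m_J \<DD>) \<cdot> zeta \<DD> X J Y J =
      run (bull_data K B) X \<star>\<^sub>a run (bull_data K B) Y"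
    by (rule arr_spans[OF spansB[OF spansK[OF s(1) spans_all[OF J_bm]] spansK[OF s(2) spans_all[OF J_bm]]]])
      (use a in \<open>auto simp: pure_scale\<close>)
next
  show "asc (bull_data K B) I I I \<cdot> (Delta_I \<DD> \<bullet>\<^sub>a ide C I) \<cdot> Delta_I \<DD> = (ide C I \<bullet>\<^sub>a Delta_I \<DD>) \<cdot> Delta_I \<DD>"
    by (rule arr_eqI) (simp_all add: Dl_asc[OF I_bm I_same _ _ _ I_maps(1)] coassoc[OF B])
  show "lun (bull_data K B) I \<cdot> (eps_I \<DD> \<bullet>\<^sub>a ide C I) \<cdot> Delta_I \<DD> = ide C I"
    by (rule arr_eqI) (simp_all add: counit_asc(1)[OF I_bm I_same _ _ _ I_maps(2)] bialgD(12)[OF B])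
  show "run (bull_data K B) I \<cdot> (ide C I \<bullet>\<^sub>a eps_I \<DD>) \<cdot> Delta_I \<DD> = ide C I"
    by (rule arr_eqI) (simp_all add: counit_asc(2)[OF I_bm I_same _ _ _ I_maps(2)] bialgD(13)[OF B])
  show "m_J \<DD> \<cdot> (ide C J \<star>\<^sub>a m_J \<DD>) \<cdot> asc (circ_data K B) J J J = m_J \<DD> \<cdot> (m_J \<DD> \<star>\<^sub>a ide C J)"
    by (rule o.arr_ext3L[of J J J]) (simp_all add: K_mult(2))
  show "m_J \<DD> \<cdot> (eps_I \<DD> \<star>\<^sub>a ide C J) = lun (circ_data K B) J"
    by (rule o.arr_ext2[of I J]) simp_all
  show "m_J \<DD> \<cdot> (ide C J \<star>\<^sub>a eps_I \<DD>) = run (circ_data K B) J"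
    by (rule o.arr_ext2[of J I]) simp_all
qed simp_all

end

context vect begin

subsection \<open>Universal R-matrices\<close>

lemma flip:
  assumes "vs M" "vs N"
  shows flip_lin: "lin (tensK K M N) (tensK K N M) (flip K M N)"
    and flip_pure: "\<And>x y. x \<in> carrier M \<Longrightarrow> y \<in> carrier N \<Longrightarrow> flip K M N (pureK K M N x y) = pureK K N M y x"
proof -
  have b: "bil M N (tensK K N M) (\<lambda>x y. pureK K N M y x)"
    by (rule bilI) (use assms in \<open>auto intro!: lin_pureL lin_pureR\<close>)
  show "lin (tensK K M N) (tensK K N M) (flip K M N)"
    unfolding flip_def[abs_def] by (rule lift_lin) (use assms b in auto)
  show "\<And>x y. x \<in> carrier M \<Longrightarrow> y \<in> carrier N \<Longrightarrow> flip K M N (pureK K M N x y) = pureK K N M y x"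
    unfolding flip_def by (rule lift_pure) (use assms b in auto)
qed

definition "H3 H = tens_alg K H (tens_alg K H H)" for H :: "'u bialg"
text \<open>The leg embeddings into H \<otimes> (H \<otimes> H) are introduced as functions, and not
  only as elements attached to \<open>R\<close>, because their multiplicativity is used to pass to
  the inverse of \<open>R\<close>.\<close>

definition "i12 H t = lift (tensK K H (tensK K H H)) (\<lambda>x y. pureK K H (tensK K H H) x (pureK K H H y \<one>\<^bsub>H\<^esub>)) t" for H :: "'u bialg"
definition "i13 H t = lift (tensK K H (tensK K H H)) (\<lambda>x y. pureK K H (tensK K H H) x (pureK K H H \<one>\<^bsub>H\<^esub> y)) t" for H :: "'u bialg"
definition "i23 H t = lift (tensK K H (tensK K H H)) (\<lambda>x y. pureK K H (tensK K H H) \<one>\<^bsub>H\<^esub> (pureK K H H x y)) t" for H :: "'u bialg"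

lemma quasitriangular_iff: "quasitriangular K H R \<longleftrightarrow> R \<in> Units (tens_alg K H H) \<and>
    (\<forall>h\<in>carrier H. flip K H H (comult H h) = R \<otimes>\<^bsub>tens_alg K H H\<^esub> comult H h \<otimes>\<^bsub>tens_alg K H H\<^esub> inv\<^bsub>tens_alg K H H\<^esub> R) \<and>
    Dr H R = i13 H R \<otimes>\<^bsub>H3 H\<^esub> i12 H R \<and> Dl H R = i13 H R \<otimes>\<^bsub>H3 H\<^esub> i23 H R"
  by (simp add: quasitriangular_def Let_def Dr_def Dl_def asc3_def i12_def i13_def i23_def H3_def)

lemma H3_fields [simp]:
  "carrier (H3 H) = carrier (tensK K H (tensK K H H))" "lin (H3 H) N = lin (tensK K H (tensK K H H)) N"
  "lin N (H3 H) = lin N (tensK K H (tensK K H H))" "bil M N (H3 H) f = bil M N (tensK K H (tensK K H H)) f"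
  "lift (H3 H) = lift (tensK K H (tensK K H H))"
  "\<one>\<^bsub>H3 H\<^esub> = pureK K H (tensK K H H) \<one>\<^bsub>H\<^esub> (pureK K H H \<one>\<^bsub>H\<^esub> \<one>\<^bsub>H\<^esub>)"
  by (simp_all add: H3_def)

lemma H3_ualg: "ualg H \<Longrightarrow> ualg (H3 H)" by (simp add: H3_def)

lemma H3_pure:
  assumes "ualg H" "x \<in> carrier H" "y \<in> carrier H" "s \<in> carrier (tensK K H H)" "t \<in> carrier (tensK K H H)"
  shows "pureK K H (tensK K H H) x s \<otimes>\<^bsub>H3 H\<^esub> pureK K H (tensK K H H) y t =
    pureK K H (tensK K H H) (x \<otimes>\<^bsub>H\<^esub> y) (s \<otimes>\<^bsub>tens_alg K H H\<^esub> t)"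
  using tens_alg_pure[of H "tens_alg K H H" x s y t] assms by (simp add: H3_def)

context
  fixes H :: "'u bialg" assumes H: "ualg H"
begin

lemma i_bil:
  shows i12_bil: "bil H H (tensK K H (tensK K H H)) (\<lambda>x y. pureK K H (tensK K H H) x (pureK K H H y \<one>\<^bsub>H\<^esub>))"
    and i13_bil: "bil H H (tensK K H (tensK K H H)) (\<lambda>x y. pureK K H (tensK K H H) x (pureK K H H \<one>\<^bsub>H\<^esub> y))"
    and i23_bil: "bil H H (tensK K H (tensK K H H)) (\<lambda>x y. pureK K H (tensK K H H) \<one>\<^bsub>H\<^esub> (pureK K H H x y))"
  using H by (auto intro!: bilI lin_pureL lin_pureR)

lemma i_pure:
  assumes "x \<in> carrier H" "y \<in> carrier H"
  shows "i12 H (pureK K H H x y) = pureK K H (tensK K H H) x (pureK K H H y \<one>\<^bsub>H\<^esub>)"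
    "i13 H (pureK K H H x y) = pureK K H (tensK K H H) x (pureK K H H \<one>\<^bsub>H\<^esub> y)"
    "i23 H (pureK K H H x y) = pureK K H (tensK K H H) \<one>\<^bsub>H\<^esub> (pureK K H H x y)"
  unfolding i12_def i13_def i23_def using H i_bil assms by (auto intro!: lift_pure)

lemma i_hom: "alg_hom (tens_alg K H H) (H3 H) (i12 H)" "alg_hom (tens_alg K H H) (H3 H) (i13 H)" "alg_hom (tens_alg K H H) (H3 H) (i23 H)"
proof -
  have "alg_hom (tens_alg K H H) (H3 H) (lift (H3 H) (\<lambda>x y. pureK K H (tensK K H H) x (pureK K H H y \<one>\<^bsub>H\<^esub>)))"
    by (rule alg_hom_lift) (use H i_bil H3_ualg in \<open>simp_all add: H3_pure tens_alg_pure\<close>)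
  then show "alg_hom (tens_alg K H H) (H3 H) (i12 H)" by (simp add: i12_def[abs_def])
  have "alg_hom (tens_alg K H H) (H3 H) (lift (H3 H) (\<lambda>x y. pureK K H (tensK K H H) x (pureK K H H \<one>\<^bsub>H\<^esub> y)))"
    by (rule alg_hom_lift) (use H i_bil H3_ualg in \<open>simp_all add: H3_pure tens_alg_pure\<close>)
  then show "alg_hom (tens_alg K H H) (H3 H) (i13 H)" by (simp add: i13_def[abs_def])
  have "alg_hom (tens_alg K H H) (H3 H) (lift (H3 H) (\<lambda>x y. pureK K H (tensK K H H) \<one>\<^bsub>H\<^esub> (pureK K H H x y)))"
    by (rule alg_hom_lift) (use H i_bil H3_ualg in \<open>simp_all add: H3_pure tens_alg_pure\<close>)
  then show "alg_hom (tens_alg K H H) (H3 H) (i23 H)" by (simp add: i23_def[abs_def])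
qed

end

text \<open>\<Delta> \<otimes> Id is the lift of the map sending x and z to
  \<open>asc3 H z (comult H x)\<close>. This is multiplicative since \<open>asc3\<close> is
  multiplicative jointly in both arguments, the auxiliary fact \<open>a\<close>.\<close>

lemma D_hom:
  assumes H: "bialgebra K H"
  shows "alg_hom (tens_alg K H H) (H3 H) (Dl H)" "alg_hom (tens_alg K H H) (H3 H) (Dr H)"
proof -
  note h = bialgD[OF H]
  have v: "vs H" "vs (tensK K H H)" using h by simp_all
  have a: "asc3 H (c \<otimes>\<^bsub>H\<^esub> d) (s \<otimes>\<^bsub>tens_alg K H H\<^esub> t) = asc3 H c s \<otimes>\<^bsub>H3 H\<^esub> asc3 H d t"
    if cd: "c \<in> carrier H" "d \<in> carrier H" and st: "s \<in> carrier (tensK K H H)" "t \<in> carrier (tensK K H H)" for c d s t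
  proof -
    note l = asc3_lin[OF v(1)]
    have cdc: "c \<otimes>\<^bsub>H\<^esub> d \<in> carrier H" using cd h(1) by simp
    have b1: "bil (tensK K H H) (tensK K H H) (tensK K H (tensK K H H)) (\<lambda>s t. asc3 H (c \<otimes>\<^bsub>H\<^esub> d) (s \<otimes>\<^bsub>tens_alg K H H\<^esub> t))"
      using bil_lin[OF l[OF cdc], of "tensK K H H" "tensK K H H"] ualg_bil[OF tens_ualg[OF h(1) h(1)]] by simp
    have b2: "bil (tensK K H H) (tensK K H H) (tensK K H (tensK K H H)) (\<lambda>s t. asc3 H c s \<otimes>\<^bsub>H3 H\<^esub> asc3 H d t)"
      using bil_comp[OF l[OF cd(1)] l[OF cd(2)], of "H3 H" "\<lambda>s t. s \<otimes>\<^bsub>H3 H\<^esub> t"] ualg_bil[OF H3_ualg[OF h(1)]]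
      by (simp add: H3_def)
    show ?thesis
      by (rule bil_ext[OF v(1) v(1) v(1) v(1) b1 b2 _ st])
        (use cd cdc h(1) in \<open>simp add: tens_alg_pure H3_pure asc3_pure\<close>)
  qed
  have bl: "bil H H (tensK K H (tensK K H H)) (\<lambda>x z. asc3 H z (comult H x))"
    by (rule bilI) (use asc3_lin'[OF v(1)] lin_comp[OF h(2) asc3_lin[OF v(1)]] h(6) in auto)
  have br: "bil H H (tensK K H (tensK K H H)) (\<lambda>x y. pureK K H (tensK K H H) x (comult H y))"
    by (rule bilI) (use v h in \<open>auto intro!: lin_pureL lin_pureR\<close>)
  have "alg_hom (tens_alg K H H) (H3 H) (lift (H3 H) (\<lambda>x z. asc3 H z (comult H x)))"
    by (rule alg_hom_lift) (use h(1) bl H3_ualg v in \<open>simp_all add: a h(6,8,9) asc3_pure\<close>)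
  then show "alg_hom (tens_alg K H H) (H3 H) (Dl H)" by (simp add: Dl_def[abs_def])
  have "alg_hom (tens_alg K H H) (H3 H) (lift (H3 H) (\<lambda>x y. pureK K H (tensK K H H) x (comult H y)))"
    by (rule alg_hom_lift) (use h(1) br H3_ualg in \<open>simp_all add: H3_pure h(6,8,9)\<close>)
  then show "alg_hom (tens_alg K H H) (H3 H) (Dr H)" by (simp add: Dr_def[abs_def])
qed

lemma ualg_Units: assumes "ualg A" "r \<in> Units A"
  shows "r \<in> carrier A" "inv\<^bsub>A\<^esub> r \<in> carrier A" "r \<otimes>\<^bsub>A\<^esub> inv\<^bsub>A\<^esub> r = \<one>\<^bsub>A\<^esub>" "inv\<^bsub>A\<^esub> r \<otimes>\<^bsub>A\<^esub> r = \<one>\<^bsub>A\<^esub>"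
  using assms ualgD(3) monoid.Units_closed monoid.Units_inv_closed monoid.Units_r_inv monoid.Units_l_inv by metis+

lemma ualg_inv_unique: "ualg A \<Longrightarrow> a \<in> carrier A \<Longrightarrow> b \<in> carrier A \<Longrightarrow> c \<in> carrier A \<Longrightarrow>
    b \<otimes>\<^bsub>A\<^esub> a = \<one>\<^bsub>A\<^esub> \<Longrightarrow> a \<otimes>\<^bsub>A\<^esub> c = \<one>\<^bsub>A\<^esub> \<Longrightarrow> b = c"
  by (metis ualg_assoc ualg_l_one ualg_r_one)

text \<open>Inverting f(r) = g(r) h(r) reverses the factors. This turns the coproduct formulas of an
  R-matrix into those of its inverse, which enters the braiding on the other side.\<close>

lemma alg_hom_inv_prod:
  assumes f: "alg_hom A C f" and g: "alg_hom A C g" and h: "alg_hom A C h" and r: "r \<in> Units A"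
    and e: "f r = g r \<otimes>\<^bsub>C\<^esub> h r"
  shows "f (inv\<^bsub>A\<^esub> r) = h (inv\<^bsub>A\<^esub> r) \<otimes>\<^bsub>C\<^esub> g (inv\<^bsub>A\<^esub> r)"
proof -
  note F = alg_homD[OF f] and G = alg_homD[OF g] and H = alg_homD[OF h] and u = ualg_Units[OF F(1) r]
  let ?s = "inv\<^bsub>A\<^esub> r"
  have 1: "f ?s \<otimes>\<^bsub>C\<^esub> f r = \<one>\<^bsub>C\<^esub>" using u by (simp flip: F(5) add: F(4))
  have gi: "g r \<otimes>\<^bsub>C\<^esub> g ?s = \<one>\<^bsub>C\<^esub>" using u by (simp flip: G(5) add: G(4))
  have hi: "h r \<otimes>\<^bsub>C\<^esub> h ?s = \<one>\<^bsub>C\<^esub>" using u by (simp flip: H(5) add: H(4))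
  have c: "g r \<in> carrier C" "g ?s \<in> carrier C" "h r \<in> carrier C" "h ?s \<in> carrier C" "f r \<in> carrier C" "f ?s \<in> carrier C"
    using u F(6) G(6) H(6) by auto
  have "f r \<otimes>\<^bsub>C\<^esub> (h ?s \<otimes>\<^bsub>C\<^esub> g ?s) = g r \<otimes>\<^bsub>C\<^esub> ((h r \<otimes>\<^bsub>C\<^esub> h ?s) \<otimes>\<^bsub>C\<^esub> g ?s)"
    using c F(2) by (simp add: e ualg_assoc)
  then have 2: "f r \<otimes>\<^bsub>C\<^esub> (h ?s \<otimes>\<^bsub>C\<^esub> g ?s) = \<one>\<^bsub>C\<^esub>" using c F(2) hi gi by simp
  show ?thesis by (rule ualg_inv_unique[OF F(2) _ _ _ 1 2]) (use c F(2) in auto)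
qed

text \<open>The conjugation formula for the opposite coproduct is split into two intertwining
  relations, one for \<open>R\<close> and one for its inverse. In this form it can be applied to the
  action on a single side of a bimodule.\<close>

lemma quasiD:
  assumes H: "bialgebra K H" and q: "quasitriangular K H R"
  defines "Ri \<equiv> inv\<^bsub>tens_alg K H H\<^esub> R"
  shows "R \<in> carrier (tensK K H H)" "Ri \<in> carrier (tensK K H H)"
    "R \<otimes>\<^bsub>tens_alg K H H\<^esub> Ri = \<one>\<^bsub>tens_alg K H H\<^esub>" "Ri \<otimes>\<^bsub>tens_alg K H H\<^esub> R = \<one>\<^bsub>tens_alg K H H\<^esub>"
    "\<And>h. h \<in> carrier H \<Longrightarrow> flip K H H (comult H h) \<otimes>\<^bsub>tens_alg K H H\<^esub> R = R \<otimes>\<^bsub>tens_alg K H H\<^esub> comult H h"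
    "\<And>h. h \<in> carrier H \<Longrightarrow> Ri \<otimes>\<^bsub>tens_alg K H H\<^esub> flip K H H (comult H h) = comult H h \<otimes>\<^bsub>tens_alg K H H\<^esub> Ri"
    "Dr H R = i13 H R \<otimes>\<^bsub>H3 H\<^esub> i12 H R" "Dl H R = i13 H R \<otimes>\<^bsub>H3 H\<^esub> i23 H R"
    "Dr H Ri = i12 H Ri \<otimes>\<^bsub>H3 H\<^esub> i13 H Ri" "Dl H Ri = i23 H Ri \<otimes>\<^bsub>H3 H\<^esub> i13 H Ri"
proof -
  note h = bialgD[OF H] and Q = q[unfolded quasitriangular_iff]
  have A: "ualg (tens_alg K H H)" using h(1) by simp
  have R: "R \<in> Units (tens_alg K H H)" using Q by blast
  note u = ualg_Units[OF A R, folded Ri_def]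
  show c: "R \<in> carrier (tensK K H H)" "Ri \<in> carrier (tensK K H H)" using u by simp_all
  show i: "R \<otimes>\<^bsub>tens_alg K H H\<^esub> Ri = \<one>\<^bsub>tens_alg K H H\<^esub>" "Ri \<otimes>\<^bsub>tens_alg K H H\<^esub> R = \<one>\<^bsub>tens_alg K H H\<^esub>" by (rule u)+
  fix x assume x: "x \<in> carrier H"
  have d: "comult H x \<in> carrier (tens_alg K H H)" using h(6)[OF x] by simp
  have f: "flip K H H (comult H x) = R \<otimes>\<^bsub>tens_alg K H H\<^esub> comult H x \<otimes>\<^bsub>tens_alg K H H\<^esub> Ri"
    using Q x by (simp add: Ri_def)
  show "flip K H H (comult H x) \<otimes>\<^bsub>tens_alg K H H\<^esub> R = R \<otimes>\<^bsub>tens_alg K H H\<^esub> comult H x"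
    unfolding f using u d A by (simp add: ualg_assoc[OF A] ualg_mult[OF A] ualg_r_one[OF A] del: tens_alg_fields)
  have "Ri \<otimes>\<^bsub>tens_alg K H H\<^esub> (R \<otimes>\<^bsub>tens_alg K H H\<^esub> (comult H x \<otimes>\<^bsub>tens_alg K H H\<^esub> Ri)) = comult H x \<otimes>\<^bsub>tens_alg K H H\<^esub> Ri"
    using u d A by (simp flip: ualg_assoc[OF A] add: ualg_mult[OF A] ualg_l_one[OF A] del: tens_alg_fields)
  then show "Ri \<otimes>\<^bsub>tens_alg K H H\<^esub> flip K H H (comult H x) = comult H x \<otimes>\<^bsub>tens_alg K H H\<^esub> Ri"
    unfolding f using u d A by (simp add: ualg_assoc[OF A] ualg_mult[OF A] del: tens_alg_fields)
next
  note h = bialgD[OF H] and Q = q[unfolded quasitriangular_iff]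
  have R: "R \<in> Units (tens_alg K H H)" using Q by blast
  show a: "Dr H R = i13 H R \<otimes>\<^bsub>H3 H\<^esub> i12 H R" "Dl H R = i13 H R \<otimes>\<^bsub>H3 H\<^esub> i23 H R" using Q by auto
  show "Dr H Ri = i12 H Ri \<otimes>\<^bsub>H3 H\<^esub> i13 H Ri" "Dl H Ri = i23 H Ri \<otimes>\<^bsub>H3 H\<^esub> i13 H Ri"
    unfolding Ri_def using a by (auto intro!: alg_hom_inv_prod[OF _ _ _ R] D_hom[OF H] i_hom h(1))
qed

end

subsection \<open>The braiding\<close>

locale bimod_qt = bimod_duo K B for K :: "('u :: infinite) ring" and B +
  fixes S :: 'u
  assumes qt: "quasitriangular K B S"
begin

abbreviation "B2 \<equiv> tens_alg K B B"
abbreviation "B3 \<equiv> H3 B"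
definition "Si = inv\<^bsub>B2\<^esub> S"

lemmas q = quasiD[OF B qt, folded Si_def]

text \<open>Conjugation of t to S^-1 t S in a tensor product of bimodules. The braiding is the flip
  followed by this map.\<close>

definition cj :: "'u bimod \<Rightarrow> 'u bimod \<Rightarrow> 'u \<Rightarrow> 'u"
  where "cj X Y t = actR X Y S (actL X Y Si t)"

abbreviation "\<sigma> \<equiv> bimod_braiding K B S"

lemma sigma_eq: "\<sigma> X Y = mk_arrow (X \<bullet> Y) (Y \<bullet> X) (\<lambda>t. cj Y X (flip K X Y t))"
  by (simp add: bimod_braiding_def cj_def lact2_def ract2_def act2_def Si_def)

text \<open>For \<open>actR\<close> the product is reversed: the inner argument acts first and so
  becomes the left factor. That left and right actions commute is what lets conjugations be
  composed.\<close>

lemma act_simps: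
  assumes X: "bm X" "bm Y"
  shows "bil (tensK K B B) (tensK K X Y) (tensK K X Y) (actL X Y)"
    "bil (tensK K B B) (tensK K X Y) (tensK K X Y) (actR X Y)"
    "\<And>s s' t. s \<in> carrier (tensK K B B) \<Longrightarrow> s' \<in> carrier (tensK K B B) \<Longrightarrow> t \<in> carrier (tensK K X Y) \<Longrightarrow>
      actL X Y s (actL X Y s' t) = actL X Y (s \<otimes>\<^bsub>B2\<^esub> s') t"
    "\<And>s s' t. s \<in> carrier (tensK K B B) \<Longrightarrow> s' \<in> carrier (tensK K B B) \<Longrightarrow> t \<in> carrier (tensK K X Y) \<Longrightarrow>
      actR X Y s (actR X Y s' t) = actR X Y (s' \<otimes>\<^bsub>B2\<^esub> s) t"
    "\<And>s s' t. s \<in> carrier (tensK K B B) \<Longrightarrow> s' \<in> carrier (tensK K B B) \<Longrightarrow> t \<in> carrier (tensK K X Y) \<Longrightarrow>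
      actL X Y s (actR X Y s' t) = actR X Y s' (actL X Y s t)"
    "\<And>t. t \<in> carrier (tensK K X Y) \<Longrightarrow> actL X Y \<one>\<^bsub>B2\<^esub> t = t"
    "\<And>t. t \<in> carrier (tensK K X Y) \<Longrightarrow> actR X Y \<one>\<^bsub>B2\<^esub> t = t"
proof -
  note l = gmodD[OF gmod_tens[OF lact_gmod[OF X(1)] lact_gmod[OF X(2)]]]
    and r = gmodD[OF gmod_tens[OF ract_gmod[OF X(1)] ract_gmod[OF X(2)]]]
  show "bil (tensK K B B) (tensK K X Y) (tensK K X Y) (actL X Y)"
    "bil (tensK K B B) (tensK K X Y) (tensK K X Y) (actR X Y)" by (rule l(4) r(4))+
  fix s s' t assume a: "s \<in> carrier (tensK K B B)" "s' \<in> carrier (tensK K B B)" "t \<in> carrier (tensK K X Y)"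
  show "actL X Y s (actL X Y s' t) = actL X Y (s \<otimes>\<^bsub>B2\<^esub> s') t"
    using a by (simp add: l(6) tens_alg_mult)
  show "actR X Y s (actR X Y s' t) = actR X Y (s' \<otimes>\<^bsub>B2\<^esub> s) t"
    using a r(6)[of s s' t] act2_swap[of B B B B B B "mult B" "mult B" s' s] by (simp add: tens_alg_mult ualg_bil)
  show "actL X Y s (actR X Y s' t) = actR X Y s' (actL X Y s t)"
    by (rule act2_commute[of B B B B]) (use a X in \<open>auto simp: lact_bil ract_bil bmD(6)\<close>)
next
  note l = gmodD[OF gmod_tens[OF lact_gmod[OF X(1)] lact_gmod[OF X(2)]]]
    and r = gmodD[OF gmod_tens[OF ract_gmod[OF X(1)] ract_gmod[OF X(2)]]]
  fix t assume "t \<in> carrier (tensK K X Y)"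
  then show "actL X Y \<one>\<^bsub>B2\<^esub> t = t" "actR X Y \<one>\<^bsub>B2\<^esub> t = t"
    using l(7) r(7) by simp_all
qed

lemma act_cl:
  assumes "bm X" "bm Y" "s \<in> carrier (tensK K B B)" "t \<in> carrier (tensK K X Y)"
  shows "actL X Y s t \<in> carrier (tensK K X Y)" "actR X Y s t \<in> carrier (tensK K X Y)"
  using bil_cl[OF act_simps(1)[OF assms(1,2)]] bil_cl[OF act_simps(2)[OF assms(1,2)]] assms(3,4) by auto

lemma cj_lin: assumes "bm X" "bm Y" shows "lin (tensK K X Y) (tensK K X Y) (cj X Y)"
  unfolding cj_def[abs_def] using lin_comp[OF bil_l[OF act_simps(1)[OF assms] q(2)] bil_l[OF act_simps(2)[OF assms] q(1)]] .

lemma cj_cl: "bm X \<Longrightarrow> bm Y \<Longrightarrow> t \<in> carrier (tensK K X Y) \<Longrightarrow> cj X Y t \<in> carrier (tensK K X Y)"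
  using lin_cl[OF cj_lin] .

text \<open>The flip exchanges the legs of the acting tensor as well; this is how the opposite
  coproduct comes in.\<close>

lemma flip_act:
  assumes X: "bm X" "bm Y" and l: "bil B X X l" "bil B Y Y l'" and s: "s \<in> carrier (tensK K B B)" and t: "t \<in> carrier (tensK K X Y)"
  shows "flip K X Y (act2 X Y l l' s t) = act2 Y X l' l (flip K B B s) (flip K X Y t)"
proof -
  have v: "vs X" "vs Y" using X by auto
  note a = act2[OF B_vs B_vs v v l] and b = act2[OF B_vs B_vs v(2,1,2,1) l(2,1)]
  note f = flip[OF v] and g = flip[OF B_vs B_vs]
  show ?thesis
    by (rule bil_ext[OF B_vs B_vs v bil_lin[OF f(1) a(1)] bil_comp[OF g(1) f(1) b(1)] _ s t])
      (simp add: a(2) b(2) f(2) g(2) bil_cl[OF l(1)] bil_cl[OF l(2)])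
qed

lemma flip_cl: "vs X \<Longrightarrow> vs Y \<Longrightarrow> t \<in> carrier (tensK K X Y) \<Longrightarrow> flip K X Y t \<in> carrier (tensK K Y X)"
  using lin_cl[OF flip_lin] .

lemma sigma_fun_lin: "bm X \<Longrightarrow> bm Y \<Longrightarrow> lin (tensK K X Y) (tensK K Y X) (\<lambda>t. cj Y X (flip K X Y t))"
  by (rule lin_comp[OF flip_lin cj_lin]) simp_all

lemma B2_cl: "s \<in> carrier (tensK K B B) \<Longrightarrow> t \<in> carrier (tensK K B B) \<Longrightarrow> s \<otimes>\<^bsub>B2\<^esub> t \<in> carrier (tensK K B B)"
  using ualg_mult[of B2 s t] by simp

lemma sigma_Ar: assumes X: "bm X" and Y: "bm Y" shows "\<sigma> X Y \<in> Ar C"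
  unfolding sigma_eq
proof (rule mk_arrow_Ar)
  show "lin (X \<bullet> Y) (Y \<bullet> X) (\<lambda>t. cj Y X (flip K X Y t))" unfolding lin_diag using sigma_fun_lin[OF X Y] .
  fix b t assume b: "b \<in> carrier B" and "t \<in> carrier (X \<bullet> Y)"
  then have t: "t \<in> carrier (tensK K X Y)" by (simp add: diag_fields)
  let ?f = "flip K X Y t" and ?d = "comult B b"
  have f: "?f \<in> carrier (tensK K Y X)" and fd: "flip K B B ?d \<in> carrier (tensK K B B)" and d: "?d \<in> carrier (tensK K B B)"
    using flip_cl[of X Y t] flip_cl[of B B] t X Y b by simp_all
  note A = act_simps[OF Y X] and c = act_cl[OF Y X] and Q = q(1,2,5,6)
  have j: "cj Y X ?f \<in> carrier (tensK K Y X)" using cj_cl[OF Y X f] .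
  have "cj Y X (flip K X Y (actL X Y ?d t)) = cj Y X (actL Y X (flip K B B ?d) ?f)"
    using flip_act[OF X Y lact_bil[OF X] lact_bil[OF Y] d t] by simp
  \<comment> \<open>Here S^-1 \<Delta>^op(b) = \<Delta>(b) S^-1 brings the coproduct to the
    outside.\<close>
  also have "\<dots> = actR Y X S (actL Y X ?d (actL Y X Si ?f))"
    using Q f fd d b by (simp add: cj_def A(3))
  also have "\<dots> = actL Y X ?d (cj Y X ?f)"
    using Q f d c by (simp add: cj_def A(5))
  finally show "cj Y X (flip K X Y (lact (X \<bullet> Y) b t)) = lact (Y \<bullet> X) b (cj Y X ?f)"
    using b t j by (simp add: diag_act dg_def)
  have "cj Y X (flip K X Y (actR X Y ?d t)) = cj Y X (actR Y X (flip K B B ?d) ?f)"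
    using flip_act[OF X Y ract_bil[OF X] ract_bil[OF Y] d t] by simp
  also have "\<dots> = actR Y X S (actR Y X (flip K B B ?d) (actL Y X Si ?f))"
    using Q f fd by (simp add: cj_def A(5))
  \<comment> \<open>On the right-hand side of the bimodule the relation is \<Delta>^op(b) S = S
    \<Delta>(b).\<close>
  also have "\<dots> = actR Y X ?d (cj Y X ?f)"
    using Q f fd d b c by (simp add: cj_def A(4))
  finally show "cj Y X (flip K X Y (ract (X \<bullet> Y) t b)) = ract (Y \<bullet> X) (cj Y X ?f) b"
    using b t j by (simp add: diag_act dg_def)
qed (use X Y in simp_all)

lemma sigma_st [simp]: "src (\<sigma> X Y) = X \<bullet> Y" "trg (\<sigma> X Y) = Y \<bullet> X" by (simp_all add: sigma_eq)

lemma sigma_Ar' [simp]: "bm X \<Longrightarrow> bm Y \<Longrightarrow> \<sigma> X Y \<in> Ar C" by (rule sigma_Ar)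

lemma sigma_val: "t \<in> carrier (X \<bullet> Y) \<Longrightarrow> \<sigma> X Y $ t = cj Y X (flip K X Y t)"
  by (simp add: sigma_eq)

lemma sigma_pure: "bm X \<Longrightarrow> bm Y \<Longrightarrow> x \<in> carrier X \<Longrightarrow> y \<in> carrier Y \<Longrightarrow> \<sigma> X Y $ (pureK K X Y x y) = cj Y X (pureK K Y X y x)"
  using b.pt_cl[of X Y x y] by (simp add: sigma_val flip_pure)

lemma cj_undo:
  assumes X: "bm X" "bm Y" and t: "t \<in> carrier (tensK K X Y)"
  defines "g \<equiv> \<lambda>t. actR X Y Si (actL X Y S t)"
  shows "g (cj X Y t) = t" "cj X Y (g t) = t"
proof -
  note A = act_simps[OF X] and c = act_cl[OF X]
  show "g (cj X Y t) = t" "cj X Y (g t) = t"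
    using t q(1-4) c unfolding g_def cj_def by (simp_all add: A(3-5) A(6,7)[simplified])
qed

lemma sigma_iso: assumes X: "bm X" and Y: "bm Y" shows "iso_arr C (\<sigma> X Y)"
proof -
  \<comment> \<open>The opposite conjugation, from t to S t S^-1, followed by the flip back.\<close>
  define g where "g = (\<lambda>t. flip K Y X (actR Y X Si (actL Y X S t)))"
  note A = act_simps[OF Y X] and c = act_cl[OF Y X]
  have v: "vs X" "vs Y" using X Y by auto
  have l: "lin (tensK K Y X) (tensK K X Y) g"
    unfolding g_def using lin_comp[OF lin_comp[OF bil_l[OF A(1) q(1)] bil_l[OF A(2) q(2)]] flip_lin[OF v(2,1)]] .
  have ff: "flip K N M (flip K M N t) = t" if "vs M" "vs N" "t \<in> carrier (tensK K M N)" for M N :: "'u bimod" and t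
    by (rule lin_eq_tens[OF that(1,2) lin_comp[OF flip_lin[OF that(1,2)] flip_lin[OF that(2,1)]] lin_id _ that(3)])
      (simp add: flip_pure that(1,2))
  have 1: "g (cj Y X (flip K X Y t)) = t" if t: "t \<in> carrier (tensK K X Y)" for t
    using cj_undo(1)[OF Y X flip_cl[OF v t]] ff[OF v t] by (simp add: g_def)
  have 2: "cj Y X (flip K X Y (g t)) = t" if t: "t \<in> carrier (tensK K Y X)" for t
    unfolding g_def by (subst ff[OF v(2,1)]) (use t q c cj_undo(2)[OF Y X t] in auto)
  show ?thesis
    by (rule iso_lin[of _ g]) (use X Y l 1 2 lin_cl[OF l] in \<open>simp_all add: lin_diag diag_fields sigma_val\<close>)
qed

text \<open>A tensor product of bimodule maps commutes with both actions of B \<otimes> B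
  (\<open>tens_map_act\<close>), in particular with conjugation by \<open>S\<close>.\<close>

lemma sigma_natural:
  assumes f: "f \<in> Ar C" and g: "g \<in> Ar C"
  shows "\<sigma> (trg f) (trg g) \<cdot> (f \<bullet>\<^sub>a g) = (g \<bullet>\<^sub>a f) \<cdot> \<sigma> (src f) (src g)"
proof (rule b.arr_ext2[of "src f" "src g"])
  note F = ArD[OF f] and G = ArD[OF g]
  note v = bm_vs[OF F(1)] bm_vs[OF G(1)] bm_vs[OF F(2)] bm_vs[OF G(2)]
  fix x y assume a: "x \<in> carrier (src f)" "y \<in> carrier (src g)"
  let ?m = "lift (tensK K (trg g) (trg f)) (\<lambda>x y. pureK K (trg g) (trg f) (g $ x) (f $ y))"
  note m = tens_map[OF v(2,1,4,3) G(3) F(3)]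
  have e: "(g \<bullet>\<^sub>a f) $ t = ?m t" if t: "t \<in> carrier (tensK K (src g) (src f))" for t
    by (rule lin_eq_tens[OF v(2,1) _ m(1) _ t])
      (use ArD(3)[OF b.tena_Ar[OF g f]] f g F(1) G(1) m(2) in \<open>simp_all add: lin_diag\<close>)
  let ?p = "pureK K (src g) (src f) y x"
  have p: "?p \<in> carrier (tensK K (src g) (src f))" using v a by simp
  note q' = q(1,2) act_cl[OF G(1) F(1) q(2) p]
  have "?m (cj (src g) (src f) ?p) = cj (trg g) (trg f) (?m ?p)"
    unfolding cj_def using q' p
      tens_map_act[where aX = "ra (src g)" and aY = "ra (src f)" and aX' = "ra (trg g)" and aY' = "ra (trg f)", OF v(2,1,4,3) G(3) F(3)]
      tens_map_act[where aX = "la (src g)" and aY = "la (src f)" and aX' = "la (trg g)" and aY' = "la (trg f)", OF v(2,1,4,3) G(3) F(3)]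
    by (simp add: lact_bil ract_bil F(1,2,4,5) G(1,2,4,5))
  then show "(\<sigma> (trg f) (trg g) \<cdot> (f \<bullet>\<^sub>a g)) $ pureK K (src f) (src g) x y = ((g \<bullet>\<^sub>a f) \<cdot> \<sigma> (src f) (src g)) $ pureK K (src f) (src g) x y"
    using a f g F(1,2) G(1,2) m(2) cj_cl[OF G(1) F(1) p] by (simp add: sigma_pure e)
qed (use ArD(1,2)[OF f] ArD(1,2)[OF g] f g in simp_all)

text \<open>After both braidings, the \<open>S\<close> to the right of the first tensor and the S^-1
  to the left of the second meet across the tensor product over \<open>B\<close> and cancel. What
  remains is S^-1 on the far left and \<open>S\<close> on the far right, which is the conjugation in
  the braiding of the interchanged tensors.\<close>

lemma sigma_zeta:
  assumes b: "bm X" "bm Y" "bm Z" "bm W"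
  shows "\<sigma> (X \<star> Z) (Y \<star> W) \<cdot> zeta \<DD> X Y Z W = zeta \<DD> Y X W Z \<cdot> (\<sigma> X Y \<star>\<^sub>a \<sigma> Z W)"
proof (rule arr_spans[OF spansB[OF spansK[OF spans_all[OF b(1)] spans_all[OF b(2)]] spansK[OF spans_all[OF b(3)] spans_all[OF b(4)]]]])
  fix t assume "t \<in> (\<lambda>(s, t). pureB K B (X \<bullet> Y) (Z \<bullet> W) s t) ` ((\<lambda>(x, y). pureK K X Y x y) ` (carrier X \<times> carrier Y) \<times>
      (\<lambda>(x, y). pureK K Z W x y) ` (carrier Z \<times> carrier W))"
  then obtain x y z w where a: "x \<in> carrier X" "y \<in> carrier Y" "z \<in> carrier Z" "w \<in> carrier W"
    and t: "t = pureB K B (X \<bullet> Y) (Z \<bullet> W) (pureK K X Y x y) (pureK K Z W z w)" by auto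
  let ?p = "pureK K Y X y x" and ?r = "pureK K W Z w z"
  have p: "?p \<in> carrier (tensK K Y X)" "?r \<in> carrier (tensK K W Z)" using b a by auto
  note L = act_simps[OF b(2,1)] and M = act_simps[OF b(4,3)]
  note c = act_cl[OF b(2,1)] act_cl[OF b(4,3)] and za = zf_act[OF b(2,1,4,3)]
  \<comment> \<open>Balancing carries the inner \<open>S\<close> over to the second argument, where
    it meets the inverse.\<close>
  have "zf Y X W Z (cj Y X ?p) (cj W Z ?r) = zf Y X W Z (actL Y X Si ?p) (actL W Z S (cj W Z ?r))"
    unfolding cj_def[of Y X] using za(1)[of "actL Y X Si ?p" "cj W Z ?r" S] q(1,2) c p cj_cl[OF b(4,3) p(2)] by simp
  also have "actL W Z S (cj W Z ?r) = actR W Z S ?r"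
    unfolding cj_def using q(1-4) c p by (simp add: M(3,5) M(6)[simplified])
  also have "zf Y X W Z (actL Y X Si ?p) (actR W Z S ?r) = cj (Y \<star> W) (X \<star> Z) (zf Y X W Z ?p ?r)"
    unfolding cj_def using q(1,2) c p by (simp add: za(2,3))
  finally show "(\<sigma> (X \<star> Z) (Y \<star> W) \<cdot> zeta \<DD> X Y Z W) $ t = (zeta \<DD> Y X W Z \<cdot> (\<sigma> X Y \<star>\<^sub>a \<sigma> Z W)) $ t"
    using a b p unfolding t by (simp add: sigma_pure zeta_pure zf_pure cj_cl)
qed (use b in simp_all)

text \<open>On I \<bullet> I both actions are multiplication in the tensor algebra, so the claim
  reads S^-1 \<Delta>^op(b) S = \<Delta>(b).\<close>

lemma sigma_Delta: "\<sigma> I I \<cdot> Delta_I \<DD> = Delta_I \<DD>"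
proof (rule arr_eqI)
  fix b assume "b \<in> carrier (src (Delta_I \<DD>))"
  then have b: "b \<in> carrier B" by simp
  have e: "act2 I I = act2 B B" "flip K I I = flip K B B"
    by (intro ext; simp add: act2_def flip_def reg_cong)+
  let ?f = "flip K B B (comult B b)"
  have f: "?f \<in> carrier (tensK K B B)" and d: "comult B b \<in> carrier (tensK K B B)" using b flip_cl[of B B] by simp_all
  have l: "actL I I s t = s \<otimes>\<^bsub>B2\<^esub> t" "actR I I s t = t \<otimes>\<^bsub>B2\<^esub> s"
    if st: "s \<in> carrier (tensK K B B)" "t \<in> carrier (tensK K B B)" for s t
  proof -
    have "actL I I s t = act2 B B (mult B) (mult B) s t" "actR I I s t = act2 B B opm opm s t"
      unfolding e by (rule act2_cong[of B B B B]; use that in simp)+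
    then show "actL I I s t = s \<otimes>\<^bsub>B2\<^esub> t" "actR I I s t = t \<otimes>\<^bsub>B2\<^esub> s"
      using st act2_swap[of B B B B B B "mult B" "mult B" t s] by (simp_all add: tens_alg_mult ualg_bil)
  qed
  have "cj I I ?f = (Si \<otimes>\<^bsub>B2\<^esub> ?f) \<otimes>\<^bsub>B2\<^esub> S"
    using q(1,2) f by (simp add: cj_def l B2_cl)
  also have "\<dots> = (comult B b \<otimes>\<^bsub>B2\<^esub> Si) \<otimes>\<^bsub>B2\<^esub> S" using q(6) b by simp
  also have "\<dots> = comult B b"
    using ualg_assoc[of B2 "comult B b" Si S] ualg_r_one[of B2 "comult B b"] q(1,2,4) d by simp
  finally show "(\<sigma> I I \<cdot> Delta_I \<DD>) $ b = Delta_I \<DD> $ b"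
    using b by (simp add: sigma_val e)
qed simp_all

section \<open>Threefold tensor products and the hexagons\<close>

definition "L3 X Y Z = act2 X (tensK K Y Z) (la X) (actL Y Z)"
definition "R3 X Y Z = act2 X (tensK K Y Z) (ra X) (actR Y Z)"

abbreviation (input) "Bt \<equiv> tensK K B (tensK K B B)"

text \<open>The product of \<open>H3 B\<close> is defined through \<open>tens_alg\<close>, whereas
  iterating \<open>gmod_tens\<close> produces nested \<open>act2\<close>. The second equation passes
  from opposite factors to the reversed product twice, in the inner and in the outer tensor
  product.\<close>

lemma B3_mult:
  assumes "s \<in> carrier Bt" "t \<in> carrier Bt"
  shows "act2 B (tensK K B B) (mult B) (act2 B B (mult B) (mult B)) s t = s \<otimes>\<^bsub>B3\<^esub> t"
    "act2 B (tensK K B B) opm (act2 B B opm opm) s t = t \<otimes>\<^bsub>B3\<^esub> s"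
proof -
  have v: "vs B" "vs (tensK K B B)" by simp_all
  have e: "act2 B (tens_alg K B B) = act2 B (tensK K B B)" by (intro ext) (simp add: act2_def)
  have m: "bil B B B (mult B)" "bil (tensK K B B) (tensK K B B) (tensK K B B) (act2 B B (mult B) (mult B))"
    using act2_bil[OF v(1) v(1) v(1) v(1) v(1) v(1) ualg_bil[OF Bs(1)] ualg_bil[OF Bs(1)]] by (simp_all add: ualg_bil)
  have 1: "act2 B (tensK K B B) (mult B) (act2 B B (mult B) (mult B)) s t = s \<otimes>\<^bsub>B3\<^esub> t"
    if "s \<in> carrier Bt" "t \<in> carrier Bt" for s t
    using that unfolding H3_def
    by (subst tens_alg_mult) (auto simp: e intro!: act2_cong[OF v v] tens_alg_mult[symmetric])
  then show "act2 B (tensK K B B) (mult B) (act2 B B (mult B) (mult B)) s t = s \<otimes>\<^bsub>B3\<^esub> t" using assms .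
  have "act2 B (tensK K B B) opm (act2 B B opm opm) s t = act2 B (tensK K B B) opm (\<lambda>y b. act2 B B (mult B) (mult B) b y) s t"
    by (rule act2_cong[OF v v _ _ assms])
      (use act2_swap[OF v(1) v(1) v(1) v(1) v(1) v(1) m(1) m(1)] in auto)
  also have "\<dots> = act2 B (tensK K B B) (mult B) (act2 B B (mult B) (mult B)) t s"
    by (rule act2_swap[OF v v v m assms(2,1)])
  finally show "act2 B (tensK K B B) opm (act2 B B opm opm) s t = t \<otimes>\<^bsub>B3\<^esub> s" using 1[OF assms(2,1)] by simp
qed

lemma diag3: "lin ((X \<bullet> Y) \<bullet> Z) N = lin (tensK K (tensK K X Y) Z) N" "lin (X \<bullet> (Y \<bullet> Z)) N = lin (tensK K X (tensK K Y Z)) N"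
    "lin N ((X \<bullet> Y) \<bullet> Z) = lin N (tensK K (tensK K X Y) Z)" "lin N (X \<bullet> (Y \<bullet> Z)) = lin N (tensK K X (tensK K Y Z))"
    "carrier ((X \<bullet> Y) \<bullet> Z) = carrier (tensK K (tensK K X Y) Z)" "carrier (X \<bullet> (Y \<bullet> Z)) = carrier (tensK K X (tensK K Y Z))"
    "tens_class K (X \<bullet> Y) Z Q = tens_class K (tensK K X Y) Z Q" "tens_class K X (Y \<bullet> Z) Q = tens_class K X (tensK K Y Z) Q"
  by (simp_all add: diag_cong diag_fields)

lemma B3_cl: "s \<in> carrier Bt \<Longrightarrow> t \<in> carrier Bt \<Longrightarrow> s \<otimes>\<^bsub>B3\<^esub> t \<in> carrier Bt"
  using ualg_mult[OF H3_ualg[OF Bs(1)], of s t] by simp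

context
  fixes X Y Z :: "'u bimod"
  assumes b: "bm X" "bm Y" "bm Z"
begin

abbreviation (input) "Tt \<equiv> tensK K X (tensK K Y Z)"

text \<open>\<open>gmod_tens\<close>, applied twice, makes X \<otimes> (Y \<otimes> Z) a bimodule
  over B \<otimes> (B \<otimes> B). Conjugations in different pairs of factors can then be
  multiplied in one algebra.\<close>

lemma LR3:
  shows "bil Bt Tt Tt (L3 X Y Z)" "bil Bt Tt Tt (R3 X Y Z)"
    "\<And>s s' t. s \<in> carrier Bt \<Longrightarrow> s' \<in> carrier Bt \<Longrightarrow> t \<in> carrier Tt \<Longrightarrow> L3 X Y Z s (L3 X Y Z s' t) = L3 X Y Z (s \<otimes>\<^bsub>B3\<^esub> s') t"
    "\<And>s s' t. s \<in> carrier Bt \<Longrightarrow> s' \<in> carrier Bt \<Longrightarrow> t \<in> carrier Tt \<Longrightarrow> R3 X Y Z s (R3 X Y Z s' t) = R3 X Y Z (s' \<otimes>\<^bsub>B3\<^esub> s) t"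
    "\<And>s s' t. s \<in> carrier Bt \<Longrightarrow> s' \<in> carrier Bt \<Longrightarrow> t \<in> carrier Tt \<Longrightarrow> L3 X Y Z s (R3 X Y Z s' t) = R3 X Y Z s' (L3 X Y Z s t)"
proof -
  note l = gmodD[OF gmod_tens[OF lact_gmod[OF b(1)] gmod_tens[OF lact_gmod[OF b(2)] lact_gmod[OF b(3)]]], folded L3_def]
    and r = gmodD[OF gmod_tens[OF ract_gmod[OF b(1)] gmod_tens[OF ract_gmod[OF b(2)] ract_gmod[OF b(3)]]], folded R3_def]
  show "bil Bt Tt Tt (L3 X Y Z)" "bil Bt Tt Tt (R3 X Y Z)" by (rule l(4) r(4))+
  fix s s' t assume a: "s \<in> carrier Bt" "s' \<in> carrier Bt" "t \<in> carrier Tt"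
  show "L3 X Y Z s (L3 X Y Z s' t) = L3 X Y Z (s \<otimes>\<^bsub>B3\<^esub> s') t" using l(6)[OF a] a by (simp add: B3_mult)
  show "R3 X Y Z s (R3 X Y Z s' t) = R3 X Y Z (s' \<otimes>\<^bsub>B3\<^esub> s) t" using r(6)[OF a] a by (simp add: B3_mult)
  have i: "actL Y Z u (actR Y Z w v) = actR Y Z w (actL Y Z u v)"
    if "u \<in> carrier (tensK K B B)" "w \<in> carrier (tensK K B B)" "v \<in> carrier (tensK K Y Z)" for u v w
    using act_simps(5)[OF b(2,3) that] .
  show "L3 X Y Z s (R3 X Y Z s' t) = R3 X Y Z s' (L3 X Y Z s t)"
    unfolding L3_def R3_def
    by (rule act2_commute[where A = B and A' = "tensK K B B" and C = B and C' = "tensK K B B" and M = X and N = "tensK K Y Z"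
        and l = "la X" and l' = "actL Y Z" and r = "ra X" and r' = "actR Y Z"])
      (use a b in \<open>simp_all add: bmD(6) lact_bil ract_bil act_simps(1,2) i\<close>)
qed

lemma LR3_pure:
  assumes "p \<in> carrier B" "q \<in> carrier B" "r \<in> carrier B" "x \<in> carrier X" "y \<in> carrier Y" "z \<in> carrier Z"
  shows "L3 X Y Z (pureK K B (tensK K B B) p (pureK K B B q r)) (pureK K X (tensK K Y Z) x (pureK K Y Z y z)) =
      pureK K X (tensK K Y Z) (lact X p x) (pureK K Y Z (lact Y q y) (lact Z r z))"
    "R3 X Y Z (pureK K B (tensK K B B) p (pureK K B B q r)) (pureK K X (tensK K Y Z) x (pureK K Y Z y z)) =
      pureK K X (tensK K Y Z) (ract X x p) (pureK K Y Z (ract Y y q) (ract Z z r))"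
  using act3_pure[OF b lact_bil[OF b(1)] lact_bil[OF b(2)] lact_bil[OF b(3)] assms]
    act3_pure[OF b ract_bil[OF b(1)] ract_bil[OF b(2)] ract_bil[OF b(3)] assms]
  by (simp_all add: L3_def R3_def)

lemma LR3_i23:
  assumes "s \<in> carrier (tensK K B B)" "x \<in> carrier X" "t \<in> carrier (tensK K Y Z)"
  shows "L3 X Y Z (i23 B s) (pureK K X (tensK K Y Z) x t) = pureK K X (tensK K Y Z) x (actL Y Z s t)"
    "R3 X Y Z (i23 B s) (pureK K X (tensK K Y Z) x t) = pureK K X (tensK K Y Z) x (actR Y Z s t)"
proof -
  have e: "i23 B s = pureK K B (tensK K B B) \<one>\<^bsub>B\<^esub> s"
    by (rule lin_eq_tens[OF B_vs B_vs alg_homD(3)[OF i_hom(3)[OF Bs(1)], simplified] pure_lin2 _ assms(1)])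
      (simp_all add: i_pure)
  show "L3 X Y Z (i23 B s) (pureK K X (tensK K Y Z) x t) = pureK K X (tensK K Y Z) x (actL Y Z s t)"
    "R3 X Y Z (i23 B s) (pureK K X (tensK K Y Z) x t) = pureK K X (tensK K Y Z) x (actR Y Z s t)"
    using act3_pure'[OF b lact_bil[OF b(1)] lact_bil[OF b(2)] lact_bil[OF b(3)] ualg_one[OF Bs(1)] assms]
      act3_pure'[OF b ract_bil[OF b(1)] ract_bil[OF b(2)] ract_bil[OF b(3)] ualg_one[OF Bs(1)] assms] b assms
    by (simp_all add: L3_def R3_def e)
qed

lemma asc_ascd: "t \<in> carrier (tensK K (tensK K X Y) Z) \<Longrightarrow> asc (bull_data K B) X Y Z $ t = ascd X Y Z t"
  using quot_tensor.T_simps(4)[OF bull_tensor] by (simp add: diag3(5))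

text \<open>The first leg of \<open>s\<close> acts on X \<bullet> Y diagonally, so after
  rebracketing \<open>s\<close> acts through (\<Delta> \<otimes> Id)(s). The actions of X \<bullet>
  Y are replaced by \<open>dg\<close> beforehand, which is their value on the carrier.\<close>

lemma ascd_act:
  assumes s: "s \<in> carrier (tensK K B B)" and t: "t \<in> carrier (tensK K (tensK K X Y) Z)"
  shows "ascd X Y Z (actL (X \<bullet> Y) Z s t) = L3 X Y Z (Dl B s) (ascd X Y Z t)"
    "ascd X Y Z (actR (X \<bullet> Y) Z s t) = R3 X Y Z (Dl B s) (ascd X Y Z t)"
proof -
  have v: "vs X" "vs Y" "vs Z" "vs (tensK K X Y)" "vs (tensK K Y Z)" using b by auto
  note al = ascd_lin[OF b]
  have D: "Dl B s \<in> carrier Bt" using lin_cl[OF Dl_lin[OF B_vs Bcomult(2)] s] .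
  have c: "actL (X \<bullet> Y) Z s t = act2 (tensK K X Y) Z (dg X Y (la X) (la Y)) (la Z) s t"
     "actR (X \<bullet> Y) Z s t = act2 (tensK K X Y) Z (dg X Y (ra X) (ra Y)) (ra Z) s t"
    if "t \<in> carrier (tensK K (tensK K X Y) Z)" for t
    unfolding act2_struct
    by (rule act2_cong[OF B_vs B_vs _ _ _ _ s that]; use v in \<open>simp add: diag_act\<close>)+
  have l: "lin (tensK K (tensK K X Y) Z) (tensK K (tensK K X Y) Z) (act2 (tensK K X Y) Z (dg X Y (la X) (la Y)) (la Z) s)"
    "lin (tensK K (tensK K X Y) Z) (tensK K (tensK K X Y) Z) (act2 (tensK K X Y) Z (dg X Y (ra X) (ra Y)) (ra Z) s)"
    using bil_l[OF act2_bil[OF B_vs B_vs v(4,3,4,3) gmodD(4)[OF dg_lact[OF b(1,2)]] lact_bil[OF b(3)]] s]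
      bil_l[OF act2_bil[OF B_vs B_vs v(4,3,4,3) gmodD(4)[OF dg_ract[OF b(1,2)]] ract_bil[OF b(3)]] s] by auto
  show "ascd X Y Z (actL (X \<bullet> Y) Z s t) = L3 X Y Z (Dl B s) (ascd X Y Z t)"
    unfolding c(1)[OF t]
    by (rule b.lin_ext3L[OF b, unfolded diag3, OF lin_comp[OF l(1) al] lin_comp[OF al bil_l[OF LR3(1) D]] _ t])
      (simp add: asc_act_L[OF b lact_bil[OF b(1)] lact_bil[OF b(2)] lact_bil[OF b(3)] s] ascd_pure[OF b] L3_def)
  show "ascd X Y Z (actR (X \<bullet> Y) Z s t) = R3 X Y Z (Dl B s) (ascd X Y Z t)"
    unfolding c(2)[OF t]
    by (rule b.lin_ext3L[OF b, unfolded diag3, OF lin_comp[OF l(2) al] lin_comp[OF al bil_l[OF LR3(2) D]] _ t])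
      (simp add: asc_act_L[OF b ract_bil[OF b(1)] ract_bil[OF b(2)] ract_bil[OF b(3)] s] ascd_pure[OF b] R3_def)
qed

lemma act_Dr:
  assumes s: "s \<in> carrier (tensK K B B)" and x: "x \<in> carrier X" and t: "t \<in> carrier (tensK K Y Z)"
  shows "actL X (Y \<bullet> Z) s (pureK K X (tensK K Y Z) x t) = L3 X Y Z (Dr B s) (pureK K X (tensK K Y Z) x t)"
    and "actR X (Y \<bullet> Z) s (pureK K X (tensK K Y Z) x t) = R3 X Y Z (Dr B s) (pureK K X (tensK K Y Z) x t)"
proof -
  have v: "vs X" "vs Y" "vs Z" "vs (tensK K X Y)" "vs (tensK K Y Z)" using b by auto
  have p: "pureK K X (tensK K Y Z) x t \<in> carrier Tt" using v x t by simp
  have c: "actL X (Y \<bullet> Z) s (pureK K X (tensK K Y Z) x t) = act2 X (tensK K Y Z) (la X) (dg Y Z (la Y) (la Z)) s (pureK K X (tensK K Y Z) x t)"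
     "actR X (Y \<bullet> Z) s (pureK K X (tensK K Y Z) x t) = act2 X (tensK K Y Z) (ra X) (dg Y Z (ra Y) (ra Z)) s (pureK K X (tensK K Y Z) x t)"
    unfolding act2_struct
    by (rule act2_cong[OF B_vs B_vs _ _ _ _ s p]; use v in \<open>simp add: diag_act\<close>)+
  show "actL X (Y \<bullet> Z) s (pureK K X (tensK K Y Z) x t) = L3 X Y Z (Dr B s) (pureK K X (tensK K Y Z) x t)"
    "actR X (Y \<bullet> Z) s (pureK K X (tensK K Y Z) x t) = R3 X Y Z (Dr B s) (pureK K X (tensK K Y Z) x t)"
    unfolding c L3_def R3_def
    using asc_act_R[OF b lact_bil[OF b(1)] lact_bil[OF b(2)] lact_bil[OF b(3)] s x t]
      asc_act_R[OF b ract_bil[OF b(1)] ract_bil[OF b(2)] ract_bil[OF b(3)] s x t] by auto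
qed

text \<open>Acting on the first two factors before rebracketing is acting with legs 1 and 2 after
  it. \<open>s\<close> and \<open>s'\<close> are independent variables, so that the claim is
  bilinear in them and can be checked on pure tensors.\<close>

lemma i12_act:
  assumes s: "s \<in> carrier (tensK K B B)" "s' \<in> carrier (tensK K B B)" and x: "x \<in> carrier X" "y \<in> carrier Y" "z \<in> carrier Z"
  shows "ascd X Y Z (pureK K (tensK K X Y) Z (actR X Y s (actL X Y s' (pureK K X Y x y))) z) =
    R3 X Y Z (i12 B s) (L3 X Y Z (i12 B s') (pureK K X (tensK K Y Z) x (pureK K Y Z y z)))"
proof -
  have v: "vs X" "vs Y" "vs Z" "vs (tensK K X Y)" "vs (tensK K Y Z)" using b by auto
  note A = act_simps[OF b(1,2)]
  have p: "pureK K X Y x y \<in> carrier (tensK K X Y)" "pureK K X (tensK K Y Z) x (pureK K Y Z y z) \<in> carrier Tt" using v x by simp_all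
  have pl: "lin (tensK K X Y) (tensK K (tensK K X Y) Z) (\<lambda>w. pureK K (tensK K X Y) Z w z)" by (rule pure_lin1) (use v x in auto)
  note i = alg_homD(3)[OF i_hom(1)[OF Bs(1)], simplified]
  note L = act2[OF B_vs B_vs v(1,2,1,2) lact_bil[OF b(1)] lact_bil[OF b(2)]] and R = act2[OF B_vs B_vs v(1,2,1,2) ract_bil[OF b(1)] ract_bil[OF b(2)]]
  show ?thesis
    by (rule bil_ext[OF B_vs B_vs B_vs B_vs
      bil_lin[OF lin_comp[OF pl ascd_lin[OF b]] bil_comp[OF lin_id bil_r[OF A(1) p(1)] A(2)]]
      bil_comp[OF i lin_comp[OF i bil_r[OF LR3(1) p(2)]] LR3(2)] _ s])
      (use x b in \<open>simp add: L(2) R(2) i_pure LR3_pure ascd_pure[OF b]\<close>)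
qed

end

text \<open>The left actions multiply to S_23^-1 S_13^-1 and the right actions, in reversed order,
  to S_13 S_23; by the coproduct formulas these are \<Delta> \<otimes> Id of S^-1 and of
  \<open>S\<close>. The second equation is the same with legs 12 and Id \<otimes> \<Delta>. Two
  consecutive conjugations thus become one.\<close>

lemma R_factor:
  assumes b: "bm X" "bm Y" "bm Z" and t: "t \<in> carrier (tensK K X (tensK K Y Z))"
  shows "R3 X Y Z (i23 B S) (L3 X Y Z (i23 B Si) (R3 X Y Z (i13 B S) (L3 X Y Z (i13 B Si) t))) =
      R3 X Y Z (Dl B S) (L3 X Y Z (Dl B Si) t)"
    "R3 X Y Z (i12 B S) (L3 X Y Z (i12 B Si) (R3 X Y Z (i13 B S) (L3 X Y Z (i13 B Si) t))) =
      R3 X Y Z (Dr B S) (L3 X Y Z (Dr B Si) t)"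
proof -
  have c: "i12 B s \<in> carrier Bt" "i13 B s \<in> carrier Bt" "i23 B s \<in> carrier Bt" if "s \<in> carrier (tensK K B B)" for s
    using that i_hom[OF Bs(1), THEN alg_homD(6)] by simp_all
  note cS = c[OF q(1)] c[OF q(2)]
  have l: "s \<in> carrier Bt \<Longrightarrow> t \<in> carrier (tensK K X (tensK K Y Z)) \<Longrightarrow> L3 X Y Z s t \<in> carrier (tensK K X (tensK K Y Z))"
    "s \<in> carrier Bt \<Longrightarrow> t \<in> carrier (tensK K X (tensK K Y Z)) \<Longrightarrow> R3 X Y Z s t \<in> carrier (tensK K X (tensK K Y Z))" for s t
    using bil_cl[OF LR3(1)[OF b]] bil_cl[OF LR3(2)[OF b]] by auto
  show "R3 X Y Z (i23 B S) (L3 X Y Z (i23 B Si) (R3 X Y Z (i13 B S) (L3 X Y Z (i13 B Si) t))) =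
      R3 X Y Z (Dl B S) (L3 X Y Z (Dl B Si) t)"
    using cS t by (simp add: l LR3(3-5)[OF b] q(8,10) B3_cl)
  show "R3 X Y Z (i12 B S) (L3 X Y Z (i12 B Si) (R3 X Y Z (i13 B S) (L3 X Y Z (i13 B Si) t))) =
      R3 X Y Z (Dr B S) (L3 X Y Z (Dr B Si) t)"
    using cS t by (simp add: l LR3(3-5)[OF b] q(7,9) B3_cl)
qed

lemma id_sigma:
  assumes b: "bm X" "bm Y" "bm Z" and a: "x \<in> carrier X" "y \<in> carrier Y" "z \<in> carrier Z"
  shows "(ide C Y \<bullet>\<^sub>a \<sigma> X Z) $ (pureK K Y (tensK K X Z) y (pureK K X Z x z)) = pureK K Y (tensK K Z X) y (cj Z X (pureK K Z X z x))"
    "(\<sigma> X Z \<bullet>\<^sub>a ide C Y) $ (pureK K (tensK K X Z) Y (pureK K X Z x z) y) = pureK K (tensK K Z X) Y (cj Z X (pureK K Z X z x)) y"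
proof -
  have e: "tens_class K Y (M \<bullet> N) Q = tens_class K Y (tensK K M N) Q" "tens_class K (M \<bullet> N) Y Q = tens_class K (tensK K M N) Y Q" for M N Q
    by (simp_all add: diag_cong)
  show "(ide C Y \<bullet>\<^sub>a \<sigma> X Z) $ (pureK K Y (tensK K X Z) y (pureK K X Z x z)) = pureK K Y (tensK K Z X) y (cj Z X (pureK K Z X z x))"
    "(\<sigma> X Z \<bullet>\<^sub>a ide C Y) $ (pureK K (tensK K X Z) Y (pureK K X Z x z) y) = pureK K (tensK K Z X) Y (cj Z X (pureK K Z X z x)) y"
    using b.tena_pt[of "ide C Y" "\<sigma> X Z" Y "X \<bullet> Z" y "pureK K X Z x z"] b.tena_pt[of "\<sigma> X Z" "ide C Y" "X \<bullet> Z" Y "pureK K X Z x z" y] b a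
    by (simp_all add: e sigma_pure)
qed

text \<open>\<open>s\<close> and \<open>s'\<close> stand for \<open>S\<close> and its inverse in the
  first braiding, whose value is not a pure tensor. That braiding acts on y and x; in the final
  order y, z, x these are factors 1 and 3, hence \<open>i13\<close>. The second braiding concerns z
  and x, that is, factors 2 and 3.\<close>

lemma hexagon1_pure:
  assumes b: "bm X" "bm Y" "bm Z" and a: "x \<in> carrier X" "y \<in> carrier Y" "z \<in> carrier Z"
    and s: "s \<in> carrier (tensK K B B)" "s' \<in> carrier (tensK K B B)"
  shows "(ide C Y \<bullet>\<^sub>a \<sigma> X Z) $ (ascd Y X Z (pureK K (tensK K Y X) Z
      (actR Y X s (actL Y X s' (pureK K Y X y x))) z)) =
    R3 Y Z X (i23 B S) (L3 Y Z X (i23 B Si) (R3 Y Z X (i13 B s) (L3 Y Z X (i13 B s') (pureK K Y (tensK K Z X) y (pureK K Z X z x)))))"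
proof -
  have v: "vs X" "vs Y" "vs Z" "vs (tensK K Y X)" "vs (tensK K Z X)" using b by auto
  have b': "bm Y" "bm X" "bm Z" and b'': "bm Y" "bm Z" "bm X" using b by auto
  have p: "pureK K Y X y x \<in> carrier (tensK K Y X)" "pureK K Y (tensK K Z X) y (pureK K Z X z x) \<in> carrier (tensK K Y (tensK K Z X))" using v a by simp_all
  have pl: "lin (tensK K Y X) (tensK K (tensK K Y X) Z) (\<lambda>w. pureK K (tensK K Y X) Z w z)" by (rule pure_lin1) (use v a in auto)
  note A = act_simps[OF b(2,1)]
  note i = alg_homD(3)[OF i_hom(2)[OF Bs(1)], simplified]
  have c23: "i23 B S \<in> carrier Bt" "i23 B Si \<in> carrier Bt"
    using q(1,2) alg_homD(6)[OF i_hom(3)[OF Bs(1)]] by simp_all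
  have si: "lin (tensK K Y (tensK K X Z)) (tensK K Y (tensK K Z X)) (map_of_arrow (ide C Y \<bullet>\<^sub>a \<sigma> X Z))"
    using ArD(3)[of "ide C Y \<bullet>\<^sub>a \<sigma> X Z"] b by (simp add: diag3)
  note L = act2[OF B_vs B_vs v(2,1,2,1) lact_bil[OF b(2)] lact_bil[OF b(1)]] and R = act2[OF B_vs B_vs v(2,1,2,1) ract_bil[OF b(2)] ract_bil[OF b(1)]]
  show ?thesis
    by (rule bil_ext[OF B_vs B_vs B_vs B_vs
      bil_lin[OF lin_comp[OF lin_comp[OF pl ascd_lin[OF b']] si] bil_comp[OF lin_id bil_r[OF A(1) p(1)] A(2)]]
      bil_lin[OF lin_comp[OF bil_l[OF LR3(1)[OF b''] c23(2)] bil_l[OF LR3(2)[OF b''] c23(1)]]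
        bil_comp[OF i lin_comp[OF i bil_r[OF LR3(1)[OF b''] p(2)]] LR3(2)[OF b'']]] _ s])
      (use a b v q(1,2) act_cl[OF b(3,1)] in \<open>simp add: L(2) R(2) i_pure LR3_pure[OF b''] ascd_pure[OF b'] id_sigma LR3_i23[OF b''] cj_def\<close>)
qed

text \<open>On the left x passes y \<otimes> z in one step, and the diagonal action on Y \<bullet> Z
  produces \<Delta> \<otimes> Id of \<open>S\<close> and of its inverse. On the right there are two
  conjugations, in legs 13 and 23. \<open>R_factor\<close> identifies them.\<close>

lemma hexagon1:
  assumes b: "bm X" "bm Y" "bm Z"
  shows "asc (bull_data K B) Y Z X \<cdot> \<sigma> X (Y \<bullet> Z) \<cdot> asc (bull_data K B) X Y Z =
      (ide C Y \<bullet>\<^sub>a \<sigma> X Z) \<cdot> asc (bull_data K B) Y X Z \<cdot> (\<sigma> X Y \<bullet>\<^sub>a ide C Z)"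
proof (rule b.arr_ext3L[OF b])
  have b': "bm Y" "bm X" "bm Z" and b'': "bm Y" "bm Z" "bm X" using b by auto
  have v: "vs X" "vs Y" "vs Z" "vs (tensK K Y X)" "vs (tensK K Y Z)" using b by auto
  fix x y z assume a: "x \<in> carrier X" "y \<in> carrier Y" "z \<in> carrier Z"
  let ?p = "pureK K (tensK K Y Z) X (pureK K Y Z y z) x"
  have p: "?p \<in> carrier (tensK K (tensK K Y Z) X)" using v a by simp
  have yz: "bm (Y \<bullet> Z)" using b by simp
  have cd: "tensK K (Y \<bullet> Z) X = tensK K (tensK K Y Z) X" by (simp add: diag_cong)
  note ac = act_cl[OF yz b(1), unfolded cd]
  have "cj (Y \<bullet> Z) X ?p \<in> carrier (tensK K (tensK K Y Z) X)" using cj_cl[OF yz b(1), unfolded cd] p .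
  then have "asc (bull_data K B) Y Z X $ (cj (Y \<bullet> Z) X ?p) = R3 Y Z X (Dl B S) (L3 Y Z X (Dl B Si) (ascd Y Z X ?p))"
    using p q(1,2) ac by (simp add: asc_ascd[OF b''] cj_def ascd_act[OF b''])
  also have "\<dots> = (ide C Y \<bullet>\<^sub>a \<sigma> X Z) $ (ascd Y X Z (pureK K (tensK K Y X) Z (cj Y X (pureK K Y X y x)) z))"
    using a v q(1,2) hexagon1_pure[OF b a q(1,2)] by (simp add: cj_def R_factor[OF b''] ascd_pure[OF b''])
  finally have 1: "asc (bull_data K B) Y Z X $ (cj (Y \<bullet> Z) X ?p) =
     (ide C Y \<bullet>\<^sub>a \<sigma> X Z) $ (asc (bull_data K B) Y X Z $ (pureK K (tensK K Y X) Z (cj Y X (pureK K Y X y x)) z))"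
    using a v cj_cl[OF b(2,1)] by (simp add: asc_ascd[OF b'])
  have e: "tens_class K (Y \<bullet> Z) X {} = tens_class K (tensK K Y Z) X {}" "tens_class K (Y \<bullet> X) Z {} = tens_class K (tensK K Y X) Z {}"
    by (simp_all add: diag_cong)
  show "(asc (bull_data K B) Y Z X \<cdot> \<sigma> X (Y \<bullet> Z) \<cdot> asc (bull_data K B) X Y Z) $ (pureK K (X \<bullet> Y) Z (pureK K X Y x y) z) =
      ((ide C Y \<bullet>\<^sub>a \<sigma> X Z) \<cdot> asc (bull_data K B) Y X Z \<cdot> (\<sigma> X Y \<bullet>\<^sub>a ide C Z)) $ (pureK K (X \<bullet> Y) Z (pureK K X Y x y) z)"
    using a b 1[folded e] by (simp add: sigma_pure)
qed (use b in simp_all)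

text \<open>In the final order z, x, y the first braiding concerns factors 1 and 3, the second one
  factors 1 and 2. The inverse associator is known on pure tensors (\<open>iv\<close>), which
  suffices as both sides are bilinear in \<open>s\<close> and \<open>s'\<close>.\<close>

lemma hexagon2_pure:
  assumes b: "bm X" "bm Y" "bm Z" and a: "x \<in> carrier X" "y \<in> carrier Y" "z \<in> carrier Z"
    and s: "s \<in> carrier (tensK K B B)" "s' \<in> carrier (tensK K B B)"
  shows "ascd Z X Y ((\<sigma> X Z \<bullet>\<^sub>a ide C Y) $ (inv_arr C (asc (bull_data K B) X Z Y) $ (pureK K X (tensK K Z Y) x
      (actR Z Y s (actL Z Y s' (pureK K Z Y z y)))))) =
    R3 Z X Y (i12 B S) (L3 Z X Y (i12 B Si) (R3 Z X Y (i13 B s) (L3 Z X Y (i13 B s') (pureK K Z (tensK K X Y) z (pureK K X Y x y)))))"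
proof -
  have v: "vs X" "vs Y" "vs Z" "vs (tensK K Z Y)" "vs (tensK K X Y)" using b by auto
  have b': "bm X" "bm Z" "bm Y" and b'': "bm Z" "bm X" "bm Y" using b by auto
  have p: "pureK K Z Y z y \<in> carrier (tensK K Z Y)" "pureK K Z (tensK K X Y) z (pureK K X Y x y) \<in> carrier (tensK K Z (tensK K X Y))" using v a by simp_all
  have pl: "lin (tensK K Z Y) (tensK K X (tensK K Z Y)) (\<lambda>w. pureK K X (tensK K Z Y) x w)" by (rule pure_lin2) (use v a in auto)
  note A = act_simps[OF b(3,2)]
  note i = alg_homD(3)[OF i_hom(2)[OF Bs(1)], simplified]
  have c12: "i12 B S \<in> carrier Bt" "i12 B Si \<in> carrier Bt"
    using q(1,2) alg_homD(6)[OF i_hom(1)[OF Bs(1)]] by simp_all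
  have si: "lin (tensK K (tensK K X Z) Y) (tensK K (tensK K Z X) Y) (map_of_arrow (\<sigma> X Z \<bullet>\<^sub>a ide C Y))"
    using ArD(3)[of "\<sigma> X Z \<bullet>\<^sub>a ide C Y"] b by (simp add: diag3)
  have ii: "lin (tensK K X (tensK K Z Y)) (tensK K (tensK K X Z) Y) (map_of_arrow (inv_arr C (asc (bull_data K B) X Z Y)))"
    using ArD(3)[of "inv_arr C (asc (bull_data K B) X Z Y)"] b by (simp add: diag3)
  have iv: "inv_arr C (asc (bull_data K B) X Z Y) $ (pureK K X (tensK K Z Y) x (pureK K Z Y z1 y1)) = pureK K (tensK K X Z) Y (pureK K X Z x z1) y1"
    if "z1 \<in> carrier Z" "y1 \<in> carrier Y" for z1 y1
    using b.iasc(4)[OF b' a(1) that] by (simp add: diag3)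
  note L = act2[OF B_vs B_vs v(3,2,3,2) lact_bil[OF b(3)] lact_bil[OF b(2)]] and R = act2[OF B_vs B_vs v(3,2,3,2) ract_bil[OF b(3)] ract_bil[OF b(2)]]
  show ?thesis
    by (rule bil_ext[OF B_vs B_vs B_vs B_vs
      bil_lin[OF lin_comp[OF lin_comp[OF lin_comp[OF pl ii] si] ascd_lin[OF b'']] bil_comp[OF lin_id bil_r[OF A(1) p(1)] A(2)]]
      bil_lin[OF lin_comp[OF bil_l[OF LR3(1)[OF b''] c12(2)] bil_l[OF LR3(2)[OF b''] c12(1)]]
        bil_comp[OF i lin_comp[OF i bil_r[OF LR3(1)[OF b''] p(2)]] LR3(2)[OF b'']]] _ s])
      (use a b v q(1,2) in \<open>simp add: L(2) R(2) i_pure LR3_pure[OF b''] iv id_sigma cj_def i12_act[OF b'']\<close>)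
qed

text \<open>The outer associator occurs inverted on the left. Both sides are therefore compared
  after applying the associator, where the actions have the form met in \<open>R_factor\<close>, and
  the associator is cancelled at the end.\<close>

lemma hexagon2:
  assumes b: "bm X" "bm Y" "bm Z"
  shows "inv_arr C (asc (bull_data K B) Z X Y) \<cdot> \<sigma> (X \<bullet> Y) Z \<cdot> inv_arr C (asc (bull_data K B) X Y Z) =
      (\<sigma> X Z \<bullet>\<^sub>a ide C Y) \<cdot> inv_arr C (asc (bull_data K B) X Z Y) \<cdot> (ide C X \<bullet>\<^sub>a \<sigma> Y Z)" (is "?l = ?r")
proof -
  have b': "bm X" "bm Z" "bm Y" and b'': "bm Z" "bm X" "bm Y" using b by auto
  have v: "vs X" "vs Y" "vs Z" "vs (tensK K Z Y)" "vs (tensK K X Y)" using b by auto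
  let ?a = "asc (bull_data K B) Z X Y"
  obtain g where g: "inverse_arr C ?a g" and gi: "inv_arr C ?a = g" 
    by (rule b.asc_inverse[OF b'']) (rule that)
  have ga: "cmp C g ?a = ide C ((Z \<bullet> X) \<bullet> Y)" "cmp C ?a g = ide C (Z \<bullet> (X \<bullet> Y))" "src g = Z \<bullet> (X \<bullet> Y)" "g \<in> Ar C" "trg g = (Z \<bullet> X) \<bullet> Y"
    using g by (auto simp: inverse_arr_def arr_C)
  have g1: "g $ (?a $ t) = t" if "t \<in> carrier ((Z \<bullet> X) \<bullet> Y)" for t
    using that arg_cong[OF ga(1), of "\<lambda>f. f $ t"] by simp
  have g2: "?a $ (g $ t) = t" if "t \<in> carrier (Z \<bullet> (X \<bullet> Y))" for t
    using that arg_cong[OF ga(2), of "\<lambda>f. f $ t"] ga(3) by simp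
  show ?thesis
  proof (rule arr_spans[OF spansK[OF spans_all[OF b(1)] spansK[OF spans_all[OF b(2)] spans_all[OF b(3)]]]])
    fix t assume "t \<in> (\<lambda>(x, y). pureK K X (Y \<bullet> Z) x y) ` (carrier X \<times> (\<lambda>(x, y). pureK K Y Z x y) ` (carrier Y \<times> carrier Z))"
    then obtain x y z where a: "x \<in> carrier X" "y \<in> carrier Y" "z \<in> carrier Z" and t: "t = pureK K X (Y \<bullet> Z) x (pureK K Y Z y z)" by auto
    let ?p = "pureK K Z (X \<bullet> Y) z (pureK K X Y x y)" and ?p' = "pureK K Z (tensK K X Y) z (pureK K X Y x y)"
    have pp: "?p = ?p'" and p: "?p \<in> carrier (tensK K Z (tensK K X Y))" using v a by (simp_all add: diag_cong)
    have xy: "bm (X \<bullet> Y)" using b by simp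
    have cd: "tensK K Z (X \<bullet> Y) = tensK K Z (tensK K X Y)" by (simp add: diag_cong)
    have cjp: "cj Z (X \<bullet> Y) ?p \<in> carrier (Z \<bullet> (X \<bullet> Y))" using cj_cl[OF b(3) xy, unfolded cd, OF p] by (simp add: diag3)
    have lhs: "?l $ t = g $ (cj Z (X \<bullet> Y) ?p)" using a b by (simp add: t gi sigma_pure)
    have "?a $ (?l $ t) = cj Z (X \<bullet> Y) ?p" unfolding lhs by (rule g2[OF cjp])
    also have "\<dots> = R3 Z X Y (Dr B S) (L3 Z X Y (Dr B Si) ?p')"
    proof -
      \<comment> \<open>\<open>act_Dr\<close> speaks of tensors with a pure outer bracket, but the
        right action is applied to the result of the left one; the formula is extended by
        linearity.\<close>
      have LD: "actR Z (X \<bullet> Y) s w = R3 Z X Y (Dr B s) w"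
        if s: "s \<in> carrier (tensK K B B)" and w: "w \<in> carrier (tensK K Z (tensK K X Y))" for s w
        using w
      proof (rule lin_eq_tens[OF v(3,5) _ _ _, rotated 3])
        show "lin (tensK K Z (tensK K X Y)) (tensK K Z (tensK K X Y)) (actR Z (X \<bullet> Y) s)"
          using bil_l[OF act_simps(2)[OF b(3) xy] s] unfolding cd .
        show "lin (tensK K Z (tensK K X Y)) (tensK K Z (tensK K X Y)) (R3 Z X Y (Dr B s))"
          by (rule bil_l[OF LR3(2)[OF b'']]) (rule lin_cl[OF Dr_lin[OF B_vs Bcomult(2)] s])
      qed (rule act_Dr(2)[OF b'' s])
      show ?thesis
        using a v q(1,2) act_cl(1)[OF b(3) xy q(2), unfolded cd, OF p] unfolding cj_def pp
        by (simp add: LD act_Dr(1)[OF b''])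
    qed
    also have "\<dots> = ascd Z X Y (?r $ t)"
    proof -
      have e: "tens_class K X (Z \<bullet> Y) Q = tens_class K X (tensK K Z Y) Q" for Q by (simp add: diag_cong)
      have "?r $ t = (\<sigma> X Z \<bullet>\<^sub>a ide C Y) $ (inv_arr C (asc (bull_data K B) X Z Y) $ (pureK K X (tensK K Z Y) x (cj Z Y (pureK K Z Y z y))))"
        using a b by (simp add: t sigma_pure e)
      then show ?thesis using hexagon2_pure[OF b a q(1,2)] p pp by (simp add: R_factor[OF b''] cj_def)
    qed
    also have "\<dots> = ?a $ (?r $ t)"
    proof -
      have "?r $ t \<in> carrier ((Z \<bullet> X) \<bullet> Y)"
        by (rule val_cl) (use a b t in simp_all)
      then show ?thesis using asc_ascd[OF b''] by (simp add: diag3)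
    qed
    finally have eq: "?a $ (?l $ t) = ?a $ (?r $ t)" .
    have "?l $ t \<in> carrier ((Z \<bullet> X) \<bullet> Y)" "?r $ t \<in> carrier ((Z \<bullet> X) \<bullet> Y)"
      by (rule val_cl; use a b t in simp)+
    note m = this
    have "?l $ t = g $ (?a $ (?l $ t))" by (rule g1[OF m(1), symmetric])
    also have "\<dots> = g $ (?a $ (?r $ t))" by (simp only: eq)
    also have "\<dots> = ?r $ t" by (rule g1[OF m(2)])
    finally show "?l $ t = ?r $ t" .
  qed (use b in simp_all)
qed

lemma braided: "bullet_braided_duoidal_category C \<DD> \<sigma>"
proof (rule bullet_braided_duoidal_category.intro[OF duoidal], rule bullet_braided_duoidal_category_axioms.intro, unfold duo_simps T_ops Ob_C)
  show "braided_monoidal_category C (bull_data K B) \<sigma>"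
  proof (rule braided_monoidal_category.intro[OF b.monoidal], rule braided_monoidal_category_axioms.intro, unfold T_ops Ob_C arr_C)
    fix f X X' g Y Y' assume "f \<in> Ar C \<and> src f = X \<and> trg f = X'" "g \<in> Ar C \<and> src g = Y \<and> trg g = Y'"
    then show "\<sigma> X' Y' \<cdot> (f \<bullet>\<^sub>a g) = (g \<bullet>\<^sub>a f) \<cdot> \<sigma> X Y" using sigma_natural[of f g] by blast
  next
    fix X Y Z assume a: "bm X" "bm Y" "bm Z"
    show "asc (bull_data K B) Y Z X \<cdot> \<sigma> X (Y \<bullet> Z) \<cdot> asc (bull_data K B) X Y Z =
      (ide C Y \<bullet>\<^sub>a \<sigma> X Z) \<cdot> asc (bull_data K B) Y X Z \<cdot> (\<sigma> X Y \<bullet>\<^sub>a ide C Z)" by (rule hexagon1[OF a])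
    show "inv_arr C (asc (bull_data K B) Z X Y) \<cdot> \<sigma> (X \<bullet> Y) Z \<cdot> inv_arr C (asc (bull_data K B) X Y Z) =
      (\<sigma> X Z \<bullet>\<^sub>a ide C Y) \<cdot> inv_arr C (asc (bull_data K B) X Z Y) \<cdot> (ide C X \<bullet>\<^sub>a \<sigma> Y Z)" by (rule hexagon2[OF a])
  qed (simp_all add: sigma_iso)
qed (rule sigma_zeta sigma_Delta; assumption)+

end

subsection \<open>Coslice categories and quasitriangular bialgebras\<close>

lemma coslice_fields [simp]:
  "Ob (coslice X C) = {f \<in> Ar C. dom_of C f = X}" "dom_of (coslice X C) = src" "cod_of (coslice X C) = trg"
  "ide (coslice X C) f = \<lparr>src = f, trg = f, map_of_arrow = ide C (cod_of C f)\<rparr>"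
  "cmp (coslice X C) k h = \<lparr>src = src h, trg = trg k, map_of_arrow = cmp C (map_of_arrow k) (map_of_arrow h)\<rparr>"
  by (simp_all add: coslice_def)

lemma coslice_Ar: "a \<in> Ar (coslice X C) \<longleftrightarrow> src a \<in> Ar C \<and> trg a \<in> Ar C \<and> dom_of C (src a) = X \<and> dom_of C (trg a) = X \<and>
    map_of_arrow a \<in> arr C (cod_of C (src a)) (cod_of C (trg a)) \<and> cmp C (map_of_arrow a) (src a) = trg a"
  unfolding coslice_def by (cases a) auto

lemma (in category) coslice_category: "category (coslice X C)"
proof
  fix f assume "f \<in> Ob (coslice X C)"
  then have f: "f \<in> arr C X (cod_of C f)" by (auto simp: arr_def)
  then show "ide (coslice X C) f \<in> arr (coslice X C) f f"
    using ide_arr[OF cod_Ob[of f]] ide_cmp[OF f] by (auto simp: arr_def coslice_Ar)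
next
  fix f g X' Y Z assume a: "f \<in> arr (coslice X C) X' Y" "g \<in> arr (coslice X C) Y Z"
  then have m: "map_of_arrow f \<in> arr C (cod_of C X') (cod_of C Y)" "map_of_arrow g \<in> arr C (cod_of C Y) (cod_of C Z)"
    and x: "X' \<in> arr C X (cod_of C X')" "cmp C (map_of_arrow f) X' = Y" "cmp C (map_of_arrow g) Y = Z"
    by (auto simp: arr_def coslice_Ar)
  have "cmp C (cmp C (map_of_arrow g) (map_of_arrow f)) X' = Z"
    using cmp_assoc[OF x(1) m] x(2,3) by simp
  then show "cmp (coslice X C) g f \<in> arr (coslice X C) X' Z"
    using a cmp_arr[OF m] by (auto simp: arr_def coslice_Ar)
next
  fix f X' Y assume a: "f \<in> arr (coslice X C) X' Y"
  then have m: "map_of_arrow f \<in> arr C (cod_of C X') (cod_of C Y)" by (auto simp: arr_def coslice_Ar)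
  show "cmp (coslice X C) f (ide (coslice X C) X') = f" "cmp (coslice X C) (ide (coslice X C) Y) f = f"
    using a cmp_ide[OF m] ide_cmp[OF m] by (auto simp: arr_def)
next
  fix f g h W X' Y Z assume a: "f \<in> arr (coslice X C) W X'" "g \<in> arr (coslice X C) X' Y" "h \<in> arr (coslice X C) Y Z"
  then have m: "map_of_arrow f \<in> arr C (cod_of C W) (cod_of C X')" "map_of_arrow g \<in> arr C (cod_of C X') (cod_of C Y)"
    "map_of_arrow h \<in> arr C (cod_of C Y) (cod_of C Z)" by (auto simp: arr_def coslice_Ar)
  show "cmp (coslice X C) h (cmp (coslice X C) g f) = cmp (coslice X C) (cmp (coslice X C) h g) f"
    using cmp_assoc[OF m] by simp
qed (auto simp: coslice_Ar)

section \<open>The category of quasitriangular bialgebras\<close>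

context vect begin

definition tmap :: "('u, 'u, 'x) module_scheme \<Rightarrow> ('u \<Rightarrow> 'u) \<Rightarrow> 'u \<Rightarrow> 'u"
  where "tmap H f t = lift (tensK K H H) (\<lambda>x y. pureK K H H (f x) (f y)) t"

lemma tmap:
  assumes "vs A" "vs H" "lin A H f"
  shows tmap_lin: "lin (tensK K A A) (tensK K H H) (tmap H f)"
    and tmap_pure: "\<And>x y. x \<in> carrier A \<Longrightarrow> y \<in> carrier A \<Longrightarrow> tmap H f (pureK K A A x y) = pureK K H H (f x) (f y)"
  using tens_map[OF assms(1,1,2,2,3,3)] by (simp_all add: tmap_def[abs_def])

text \<open>Morphisms are composed with \<open>compose\<close>, which restricts to the carrier;
  \<open>tmap\<close> does not see the difference.\<close>

lemma tmap_cong: "vs A \<Longrightarrow> (\<And>x. x \<in> carrier A \<Longrightarrow> f x = g x) \<Longrightarrow> t \<in> carrier (tensK K A A) \<Longrightarrow> tmap H f t = tmap H g t"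
  unfolding tmap_def by (rule lift_cong[of A A]) auto

lemma tmap_id: "vs A \<Longrightarrow> t \<in> carrier (tensK K A A) \<Longrightarrow> tmap A (\<lambda>x. x) t = t"
  by (rule lin_eq_tens[of A A "{}" "tensK K A A" "tmap A (\<lambda>x. x)" "\<lambda>t. t"]) (simp_all add: tmap_lin tmap_pure)

lemma tmap_comp: "vs A \<Longrightarrow> vs H \<Longrightarrow> vs L \<Longrightarrow> lin A H f \<Longrightarrow> lin H L g \<Longrightarrow> t \<in> carrier (tensK K A A) \<Longrightarrow>
    tmap L g (tmap H f t) = tmap L (\<lambda>x. g (f x)) t"
  by (rule lin_eq_tens[of A A "{}" "tensK K L L" "\<lambda>t. tmap L g (tmap H f t)" "tmap L (\<lambda>x. g (f x))"])
    (simp_all add: tmap_pure lin_comp[OF tmap_lin tmap_lin] tmap_lin lin_comp lin_cl)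

lemma bialgebraI:
  assumes A: "ualg H" and l: "lin H (tensK K H H) (comult H)" "lin H (base_space K) (counit H)"
    and e: "comult H \<in> extensional (carrier H)" "counit H \<in> extensional (carrier H)"
    and c: "\<And>h. h \<in> carrier H \<Longrightarrow> Dl H (comult H h) = Dr H (comult H h)"
    and "\<And>h. h \<in> carrier H \<Longrightarrow> lift H (\<lambda>x y. counit H x \<odot>\<^bsub>H\<^esub> y) (comult H h) = h"
    and "\<And>h. h \<in> carrier H \<Longrightarrow> lift H (\<lambda>x y. counit H y \<odot>\<^bsub>H\<^esub> x) (comult H h) = h"
    and "\<And>x y. x \<in> carrier H \<Longrightarrow> y \<in> carrier H \<Longrightarrow> comult H (x \<otimes>\<^bsub>H\<^esub> y) = comult H x \<otimes>\<^bsub>tens_alg K H H\<^esub> comult H y"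
    and "comult H \<one>\<^bsub>H\<^esub> = pureK K H H \<one>\<^bsub>H\<^esub> \<one>\<^bsub>H\<^esub>"
    and "\<And>x y. x \<in> carrier H \<Longrightarrow> y \<in> carrier H \<Longrightarrow> counit H (x \<otimes>\<^bsub>H\<^esub> y) = counit H x \<otimes>\<^bsub>K\<^esub> counit H y"
    and "counit H \<one>\<^bsub>H\<^esub> = \<one>\<^bsub>K\<^esub>"
  shows "bialgebra K H"
proof -
  have cl: "x \<in> carrier H \<Longrightarrow> counit H x \<in> carrier K" for x using lin_cl[OF l(2)] by simp
  have a: "x \<in> carrier H \<Longrightarrow> y \<in> carrier H \<Longrightarrow> counit H (x \<oplus>\<^bsub>H\<^esub> y) = counit H x \<oplus>\<^bsub>K\<^esub> counit H y" for x y
    using lin_add[OF l(2)] cl by simp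
  have "comult H \<in> ring_hom H (tens_alg K H H)"
    by (rule ring_hom_memI) (use assms lin_cl[OF l(1)] lin_add[OF l(1)] in auto)
  moreover have "counit H \<in> ring_hom H K"
    by (rule ring_hom_memI) (use assms cl a in auto)
  ultimately show ?thesis
    using assms(1-8) unfolding bialgebra_def linear_map_iff Dl_def Dr_def asc3_def by blast
qed

lemma bialgebra_map_iff: "bialgebra_map K A H f \<longleftrightarrow> lin A H f \<and> f \<in> extensional (carrier A) \<and>
    (\<forall>x\<in>carrier A. \<forall>y\<in>carrier A. f (x \<otimes>\<^bsub>A\<^esub> y) = f x \<otimes>\<^bsub>H\<^esub> f y) \<and> f \<one>\<^bsub>A\<^esub> = \<one>\<^bsub>H\<^esub> \<and>
    (\<forall>a\<in>carrier A. comult H (f a) = tmap H f (comult A a) \<and> counit H (f a) = counit A a)"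
  unfolding bialgebra_map_def linear_map_iff ring_hom_def tmap_def lin_def by blast

abbreviation "qtb X \<equiv> quasitriangular_bialgebra K (fst X) (snd X)"

lemma qtb_bialg: "qtb X \<Longrightarrow> bialgebra K (fst X)" by (simp add: quasitriangular_bialgebra_def)

lemma qtb_cl: "qtb X \<Longrightarrow> snd X \<in> carrier (tensK K (fst X) (fst X))"
  using quasiD(1)[of "fst X" "snd X"] by (simp add: quasitriangular_bialgebra_def)

lemma QTr_fields [simp]:
  "Ob (QTrBialg K) = {X. qtb X}" "dom_of (QTrBialg K) = src" "cod_of (QTrBialg K) = trg"
  "ide (QTrBialg K) X = \<lparr>src = X, trg = X, map_of_arrow = (\<lambda>x\<in>carrier (fst X). x)\<rparr>"
  "cmp (QTrBialg K) g f = \<lparr>src = src f, trg = trg g, map_of_arrow = compose (carrier (fst (src f))) (map_of_arrow g) (map_of_arrow f)\<rparr>"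
  by (auto simp: QTrBialg_def)

lemma QTr_Ar: "a \<in> Ar (QTrBialg K) \<longleftrightarrow> qtb (src a) \<and> qtb (trg a) \<and> bialgebra_map K (fst (src a)) (fst (trg a)) (map_of_arrow a) \<and>
    tmap (fst (trg a)) (map_of_arrow a) (snd (src a)) = snd (trg a)"
  unfolding QTrBialg_def tmap_def by (cases a) auto

lemma bialgebra_map_id: "bialgebra K A \<Longrightarrow> bialgebra_map K A A (\<lambda>x\<in>carrier A. x)"
proof -
  assume A: "bialgebra K A"
  note a = bialgD[OF A]
  have v: "vs A" using a(1) by simp
  have "tmap A (\<lambda>x\<in>carrier A. x) t = t" if "t \<in> carrier (tensK K A A)" for t
    using tmap_cong[OF v _ that, of "\<lambda>x\<in>carrier A. x" "\<lambda>x. x" A] tmap_id[OF v that] by simp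
  then show ?thesis unfolding bialgebra_map_iff using a(1,6) v by (simp add: lin_def)
qed

lemma bialgebra_map_comp:
  assumes A: "bialgebra K A" "bialgebra K H" "bialgebra K L" and f: "bialgebra_map K A H f" and g: "bialgebra_map K H L g"
  shows "bialgebra_map K A L (compose (carrier A) g f)"
    and "t \<in> carrier (tensK K A A) \<Longrightarrow> tmap L (compose (carrier A) g f) t = tmap L g (tmap H f t)"
proof -
  have v: "vs A" "vs H" "vs L" using A[THEN bialgD(1)] by simp_all
  note F = f[unfolded bialgebra_map_iff] and G = g[unfolded bialgebra_map_iff]
  have fl: "lin A H f" and gl: "lin H L g" using F G by blast+
  have fc: "x \<in> carrier A \<Longrightarrow> f x \<in> carrier H" for x using lin_cl[OF fl] .
  have e: "tmap L (compose (carrier A) g f) t = tmap L g (tmap H f t)" if "t \<in> carrier (tensK K A A)" for t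
    using tmap_cong[OF v(1) _ that, of "compose (carrier A) g f" "\<lambda>x. g (f x)" L] tmap_comp[OF v fl gl that]
    by (simp add: compose_def)
  have l: "lin A L (compose (carrier A) g f)"
    using lin_comp[OF fl gl] v by (simp add: lin_def compose_def)
  show "bialgebra_map K A L (compose (carrier A) g f)"
    unfolding bialgebra_map_iff
  proof (intro conjI ballI)
    fix x y assume "x \<in> carrier A" "y \<in> carrier A"
    then show "compose (carrier A) g f (x \<otimes>\<^bsub>A\<^esub> y) = compose (carrier A) g f x \<otimes>\<^bsub>L\<^esub> compose (carrier A) g f y"
      using F G fc bialgD(1)[OF A(1)] by (simp add: compose_def)
  next
    fix a assume "a \<in> carrier A"
    then show "comult L (compose (carrier A) g f a) = tmap L (compose (carrier A) g f) (comult A a)"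
      "counit L (compose (carrier A) g f a) = counit A a"
      using F G fc bialgD(6)[OF A(1)] by (simp_all add: e, simp_all add: compose_def)
  qed (use l F G bialgD(1)[OF A(1)] in \<open>simp_all add: compose_def\<close>)
  show "t \<in> carrier (tensK K A A) \<Longrightarrow> tmap L (compose (carrier A) g f) t = tmap L g (tmap H f t)" by (rule e)
qed

lemma QTr_category: "category (QTrBialg K)"
proof
  fix X assume X: "X \<in> Ob (QTrBialg K)"
  then have q: "qtb X" by simp
  have v: "vs (fst X)" using bialgD(1)[OF qtb_bialg[OF q]] by simp
  have "tmap (fst X) (\<lambda>x\<in>carrier (fst X). x) (snd X) = snd X"
    using tmap_cong[OF v _ qtb_cl[OF q], of "\<lambda>x\<in>carrier (fst X). x" "\<lambda>x. x" "fst X"] tmap_id[OF v qtb_cl[OF q]] by simp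
  then show "ide (QTrBialg K) X \<in> arr (QTrBialg K) X X"
    using q bialgebra_map_id[OF qtb_bialg[OF q]] by (simp add: arr_def QTr_Ar)
next
  fix f g X Y Z assume a: "f \<in> arr (QTrBialg K) X Y" "g \<in> arr (QTrBialg K) Y Z"
  then have q: "qtb X" "qtb Y" "qtb Z" and m: "bialgebra_map K (fst X) (fst Y) (map_of_arrow f)" "bialgebra_map K (fst Y) (fst Z) (map_of_arrow g)"
    and t: "tmap (fst Y) (map_of_arrow f) (snd X) = snd Y" "tmap (fst Z) (map_of_arrow g) (snd Y) = snd Z"
    by (auto simp: arr_def QTr_Ar)
  note c = bialgebra_map_comp[OF q[THEN qtb_bialg] m]
  show "cmp (QTrBialg K) g f \<in> arr (QTrBialg K) X Z"
    using a q c(1) c(2)[OF qtb_cl[OF q(1)]] t by (simp add: arr_def QTr_Ar)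
next
  fix f X Y assume a: "f \<in> arr (QTrBialg K) X Y"
  then have m: "lin (fst X) (fst Y) (map_of_arrow f)" "map_of_arrow f \<in> extensional (carrier (fst X))" and s: "src f = X" "trg f = Y"
    by (auto simp: arr_def QTr_Ar bialgebra_map_iff)
  have "compose (carrier (fst X)) (map_of_arrow f) (\<lambda>x\<in>carrier (fst X). x) = map_of_arrow f"
    "compose (carrier (fst X)) (\<lambda>x\<in>carrier (fst Y). x) (map_of_arrow f) = map_of_arrow f"
    using m(2) lin_cl[OF m(1)] by (auto simp: compose_def extensional_def restrict_def fun_eq_iff)
  then show "cmp (QTrBialg K) f (ide (QTrBialg K) X) = f" "cmp (QTrBialg K) (ide (QTrBialg K) Y) f = f"
    using s by simp_all
next
  fix f g h W X Y Z assume a: "f \<in> arr (QTrBialg K) W X" "g \<in> arr (QTrBialg K) X Y" "h \<in> arr (QTrBialg K) Y Z"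
  then have m: "lin (fst W) (fst X) (map_of_arrow f)" and s: "src f = W" "src g = X"
    by (auto simp: arr_def QTr_Ar bialgebra_map_iff)
  show "cmp (QTrBialg K) h (cmp (QTrBialg K) g f) = cmp (QTrBialg K) (cmp (QTrBialg K) h g) f"
    using s lin_cl[OF m] by (auto simp: compose_def restrict_def fun_eq_iff)
qed (auto simp: QTr_Ar)

subsection \<open>Transport of R-matrices along bialgebra maps\<close>

lemma tmap_hom:
  assumes A: "bialgebra K A" "bialgebra K H" and f: "bialgebra_map K A H f"
  shows "alg_hom (tens_alg K A A) (tens_alg K H H) (tmap H f)"
proof -
  have u: "ualg A" "ualg H" using A[THEN bialgD(1)] .
  note F = f[unfolded bialgebra_map_iff]
  have l: "lin A H f" using F by blast
  have "bil A A (tensK K H H) (\<lambda>x y. pureK K H H (f x) (f y))"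
    by (rule bil_comp[OF l l bil_pure]) (use u in auto)
  then have "alg_hom (tens_alg K A A) (tens_alg K H H) (lift (tens_alg K H H) (\<lambda>x y. pureK K H H (f x) (f y)))"
    by (intro alg_hom_lift) (use u F lin_cl[OF l] in \<open>simp_all add: tens_alg_pure\<close>)
  then show ?thesis by (simp add: tmap_def[abs_def])
qed

text \<open>The image of R^-1 inverts the image of \<open>R\<close>, and f \<otimes> f \<otimes> f
  carries the coproduct formulas of \<open>R\<close> to those of its image. The intertwining
  relation is a hypothesis because it concerns all elements of \<open>H\<close>, not only those in
  the image of \<open>f\<close>.\<close>

lemma quasi_transport:
  assumes A: "bialgebra K A" "bialgebra K H" and f: "bialgebra_map K A H f" and q: "quasitriangular K A R"
    and i: "\<And>h. h \<in> carrier H \<Longrightarrow> flip K H H (comult H h) \<otimes>\<^bsub>tens_alg K H H\<^esub> tmap H f R = tmap H f R \<otimes>\<^bsub>tens_alg K H H\<^esub> comult H h"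
  shows "quasitriangular K H (tmap H f R)"
proof -
  have u: "ualg A" "ualg H" using A[THEN bialgD(1)] .
  have v: "vs A" "vs H" "vs (tensK K A A)" "vs (tensK K H H)" using u by simp_all
  note F = f[unfolded bialgebra_map_iff]
  have l: "lin A H f" and fc: "\<And>x. x \<in> carrier A \<Longrightarrow> f x \<in> carrier H" using F lin_cl by blast+
  note th = tmap_hom[OF A f] and t2 = tmap[OF v(1,2) l] and Q = quasiD[OF A(1) q]
  note T = alg_homD[OF th]
  let ?R = "tmap H f R" and ?Ri = "tmap H f (inv\<^bsub>tens_alg K A A\<^esub> R)"
  have u2: "ualg (tens_alg K H H)" using u by simp
  have Rc: "?R \<in> carrier (tens_alg K H H)" "?Ri \<in> carrier (tens_alg K H H)" using T(6)[of R] T(6)[of "inv\<^bsub>tens_alg K A A\<^esub> R"] Q(1,2) by simp_all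
  have RR: "?R \<otimes>\<^bsub>tens_alg K H H\<^esub> ?Ri = \<one>\<^bsub>tens_alg K H H\<^esub>" "?Ri \<otimes>\<^bsub>tens_alg K H H\<^esub> ?R = \<one>\<^bsub>tens_alg K H H\<^esub>"
    using T(5)[of R "inv\<^bsub>tens_alg K A A\<^esub> R"] T(5)[of "inv\<^bsub>tens_alg K A A\<^esub> R" R] T(4) Q(1-4) by simp_all
  have U: "?R \<in> Units (tens_alg K H H)" unfolding Units_def using Rc RR by blast
  note iv = ualg_Units[OF u2 U]
  \<comment> \<open>The map f \<otimes> f \<otimes> f. It commutes with the leg embeddings since
    \<open>f\<close> preserves the unit, and with \<open>Dl\<close> and \<open>Dr\<close> since
    \<open>f\<close> preserves the coproduct.\<close>
  define t3 where "t3 = lift (tensK K H (tensK K H H)) (\<lambda>x s. pureK K H (tensK K H H) (f x) (tmap H f s))"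
  have b3: "bil A (tensK K A A) (tensK K H (tensK K H H)) (\<lambda>x s. pureK K H (tensK K H H) (f x) (tmap H f s))"
    by (rule bil_comp[OF l t2(1) bil_pure]) (use v in auto)
  have t3l: "lin (tensK K A (tensK K A A)) (tensK K H (tensK K H H)) t3"
    unfolding t3_def by (rule lift_lin) (use v b3 in auto)
  have t3p: "t3 (pureK K A (tensK K A A) x s) = pureK K H (tensK K H H) (f x) (tmap H f s)"
    if "x \<in> carrier A" "s \<in> carrier (tensK K A A)" for x s
    unfolding t3_def by (rule lift_pure) (use v b3 that in auto)
  have t3h: "alg_hom (H3 A) (H3 H) t3"
  proof -
    have "alg_hom (tens_alg K A (tens_alg K A A)) (H3 H) (lift (H3 H) (\<lambda>x s. pureK K H (tensK K H H) (f x) (tmap H f s)))"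
      by (rule alg_hom_lift)
        (use u F b3 fc T lin_cl[OF t2(1)] in \<open>simp_all add: H3_ualg H3_pure t2(2)\<close>)
    then show ?thesis by (simp add: t3_def[abs_def] H3_def)
  qed
  have cA: "comult A x \<in> carrier (tensK K A A)" if "x \<in> carrier A" for x using bialgD(6)[OF A(1) that] .
  note o = ualg_one[OF u(1)] ualg_one[OF u(2)]
  note iA = i_pure[OF u(1)] and iH = i_pure[OF u(2)]
  note hA = i_hom[OF u(1), THEN alg_homD(3)] and hH = i_hom[OF u(2), THEN alg_homD(3)]
  have n: "t3 (i12 A t) = i12 H (tmap H f t)" "t3 (i13 A t) = i13 H (tmap H f t)" "t3 (i23 A t) = i23 H (tmap H f t)"
    "t3 (Dl A t) = Dl H (tmap H f t)" "t3 (Dr A t) = Dr H (tmap H f t)" if t: "t \<in> carrier (tensK K A A)" for t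
  proof -
    have f1: "f \<one>\<^bsub>A\<^esub> = \<one>\<^bsub>H\<^esub>" using F by blast
    show "t3 (i12 A t) = i12 H (tmap H f t)"
      by (rule lin_eq_tens[OF v(1,1) lin_comp[OF hA(1)[simplified] t3l] lin_comp[OF t2(1) hH(1)[simplified]] _ t])
        (use u v o fc in \<open>simp add: iA iH t3p t2(2) f1\<close>)
    show "t3 (i13 A t) = i13 H (tmap H f t)"
      by (rule lin_eq_tens[OF v(1,1) lin_comp[OF hA(2)[simplified] t3l] lin_comp[OF t2(1) hH(2)[simplified]] _ t])
        (use u v o fc in \<open>simp add: iA iH t3p t2(2) f1\<close>)
    show "t3 (i23 A t) = i23 H (tmap H f t)"
      by (rule lin_eq_tens[OF v(1,1) lin_comp[OF hA(3)[simplified] t3l] lin_comp[OF t2(1) hH(3)[simplified]] _ t])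
        (use u v o fc in \<open>simp add: iA iH t3p t2(2) f1\<close>)
    have a3: "t3 (asc3 A z w) = asc3 H (f z) (tmap H f w)" if z: "z \<in> carrier A" and w: "w \<in> carrier (tensK K A A)" for z w
      by (rule lin_eq_tens[OF v(1,1) lin_comp[OF asc3_lin[OF v(1) z] t3l] lin_comp[OF t2(1) asc3_lin[OF v(2) fc[OF z]]] _ w])
        (use v z fc in \<open>simp add: asc3_pure t3p t2(2)\<close>)
    have cf: "comult H (f x) = tmap H f (comult A x)" if "x \<in> carrier A" for x using F that by blast
    show "t3 (Dl A t) = Dl H (tmap H f t)"
      by (rule lin_eq_tens[OF v(1,1) lin_comp[OF Dl_lin[OF v(1) bialgD(2)[OF A(1)]] t3l] lin_comp[OF t2(1) Dl_lin[OF v(2) bialgD(2)[OF A(2)]]] _ t])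
        (use v fc cA bialgD(2)[OF A(1)] bialgD(2)[OF A(2)] in \<open>simp add: Dl_pure t2(2) a3 cf\<close>)
    show "t3 (Dr A t) = Dr H (tmap H f t)"
      by (rule lin_eq_tens[OF v(1,1) lin_comp[OF Dr_lin[OF v(1) bialgD(2)[OF A(1)]] t3l] lin_comp[OF t2(1) Dr_lin[OF v(2) bialgD(2)[OF A(2)]]] _ t])
        (use v fc cA bialgD(2)[OF A(1)] bialgD(2)[OF A(2)] in \<open>simp add: Dr_pure t2(2) t3p cf\<close>)
  qed
  have ic: "i12 A R \<in> carrier (H3 A)" "i13 A R \<in> carrier (H3 A)" "i23 A R \<in> carrier (H3 A)"
    using Q(1) i_hom[OF u(1), THEN alg_homD(6)] by simp_all
  have fl: "flip K H H (comult H h) = ?R \<otimes>\<^bsub>tens_alg K H H\<^esub> comult H h \<otimes>\<^bsub>tens_alg K H H\<^esub> inv\<^bsub>tens_alg K H H\<^esub> ?R"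
    if h: "h \<in> carrier H" for h
  proof -
    have c: "flip K H H (comult H h) \<in> carrier (tens_alg K H H)" "comult H h \<in> carrier (tens_alg K H H)"
      using lin_cl[OF flip_lin[OF v(2,2)]] bialgD(6)[OF A(2) h] by simp_all
    have "?R \<otimes>\<^bsub>tens_alg K H H\<^esub> comult H h \<otimes>\<^bsub>tens_alg K H H\<^esub> inv\<^bsub>tens_alg K H H\<^esub> ?R =
        flip K H H (comult H h) \<otimes>\<^bsub>tens_alg K H H\<^esub> ?R \<otimes>\<^bsub>tens_alg K H H\<^esub> inv\<^bsub>tens_alg K H H\<^esub> ?R" using i[OF h] by simp
    also have "\<dots> = flip K H H (comult H h)"
      using ualg_assoc[OF u2 c(1) iv(1,2)] ualg_r_one[OF u2 c(1)] iv(3) by simp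
    finally show ?thesis by simp
  qed
  note t5 = alg_homD(5)[OF t3h]
  show ?thesis unfolding quasitriangular_iff
    using U fl Q(1,7,8) t5[OF ic(2,1)] t5[OF ic(2,3)] n[OF Q(1)] by simp
qed

end

text \<open>With the two lemmas that follow, this turns an equation of arrows into an equivalent
  equation of values. As rewrite rules they translate each bimonoid axiom in both directions at
  once.\<close>

lemma (in bial) arr_iff: "f \<in> Ar C \<Longrightarrow> g \<in> Ar C \<Longrightarrow> src f = X \<Longrightarrow> src g = X \<Longrightarrow> trg f = trg g \<Longrightarrow>
    f = g \<longleftrightarrow> (\<forall>x\<in>carrier X. f $ x = g $ x)"
  by (auto intro: arr_eqI)

lemma (in ctensor) arr_iff2: "bm X \<Longrightarrow> bm Y \<Longrightarrow> f \<in> Ar C \<Longrightarrow> g \<in> Ar C \<Longrightarrow> src f = X \<diamondop> Y \<Longrightarrow> src g = X \<diamondop> Y \<Longrightarrow>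
    trg f = trg g \<Longrightarrow> f = g \<longleftrightarrow> (\<forall>x\<in>carrier X. \<forall>y\<in>carrier Y. f $ (pt X Y x y) = g $ (pt X Y x y))"
  by (auto intro: arr_ext2)

lemma (in ctensor) arr_iff3: "bm X \<Longrightarrow> bm Y \<Longrightarrow> bm Z \<Longrightarrow> f \<in> Ar C \<Longrightarrow> g \<in> Ar C \<Longrightarrow> src f = (X \<diamondop> Y) \<diamondop> Z \<Longrightarrow>
    src g = (X \<diamondop> Y) \<diamondop> Z \<Longrightarrow> trg f = trg g \<Longrightarrow> f = g \<longleftrightarrow> (\<forall>x\<in>carrier X. \<forall>y\<in>carrier Y. \<forall>z\<in>carrier Z.
      f $ (pt (X \<diamondop> Y) Z (pt X Y x y) z) = g $ (pt (X \<diamondop> Y) Z (pt X Y x y) z))"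
  by (auto intro: arr_ext3L)

lemma (in bimod_duo) tmap_val:
  assumes b: "bm X" "bm Y" and s: "same X A" "same Y L" and f: "f \<in> Ar C" "src f = X" "trg f = Y"
    and t: "t \<in> carrier (tensK K A A)"
  shows "(f \<bullet>\<^sub>a f) $ t = tmap L (map_of_arrow f) t"
proof -
  note c = same_cong[OF s(1)] same_cong[OF s(2)]
  have v: "vs A" "vs L" using b c by auto
  have l: "lin A L (map_of_arrow f)" using ArD(3)[OF f(1), unfolded f(2,3) c] .
  have l2: "lin (tensK K A A) (tensK K L L) (map_of_arrow (f \<bullet>\<^sub>a f))"
    using ArD(3)[of "f \<bullet>\<^sub>a f"] f by (simp add: lin_diag c)
  show ?thesis
    by (rule lin_eq_tens[OF v(1,1) l2 tmap_lin[OF v l] _ t])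
      (use b.tena_pt[OF f(1,1,2,2)] f v l in \<open>simp add: tmap_pure c\<close>)
qed

text \<open>If \<open>B\<close> acts by multiplication with \<open>h b\<close>, then B \<otimes> B
  acts by multiplication with (h \<otimes> h)(s). The product of \<open>A\<close> is assumed
  bilinear rather than an algebra product, so that the lemma is at hand before any axiom of
  \<open>A\<close>.\<close>

lemma (in bimod_duo) act_mult_gen:
  assumes X: "bm X" and sm: "same X A" and mb: "bil A A A (mult A)" and h: "lin B A h"
    and s: "s \<in> carrier (tensK K B B)" and t: "t \<in> carrier (tensK K A A)"
  shows "(\<And>b x. b \<in> carrier B \<Longrightarrow> x \<in> carrier A \<Longrightarrow> lact X b x = h b \<otimes>\<^bsub>A\<^esub> x) \<Longrightarrow>
      actL X X s t = tmap A h s \<otimes>\<^bsub>tens_alg K A A\<^esub> t"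
    and "(\<And>b x. b \<in> carrier B \<Longrightarrow> x \<in> carrier A \<Longrightarrow> ract X x b = x \<otimes>\<^bsub>A\<^esub> h b) \<Longrightarrow>
      actR X X s t = t \<otimes>\<^bsub>tens_alg K A A\<^esub> tmap A h s"
proof -
  note c = same_cong[OF sm]
  have v: "vs A" using X c(3) by simp
  have hc: "b \<in> carrier B \<Longrightarrow> h b \<in> carrier A" for b using lin_cl[OF h] .
  note a = act2[OF v v v v v v mb mb] and tm = tmap[OF B_vs v h]
  have ts: "tmap A h s \<in> carrier (tensK K A A)" using lin_cl[OF tm(1) s] .
  have op: "bil A A A (\<lambda>a b. b \<otimes>\<^bsub>A\<^esub> a)" using mb by (auto simp: bil_def)
  note a' = act2[OF v v v v v v op op]
  have e: "act2 X X = act2 A A" by (simp add: act2_def[abs_def] c)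
  have lr: "bil B A A (la X)" "bil B A A (ra X)" using lact_bil[OF X] ract_bil[OF X] by (simp_all add: bil_def c)
  note L = act2[OF B_vs B_vs v v v v lr(1,1)] and R = act2[OF B_vs B_vs v v v v lr(2,2)]
  show "actL X X s t = tmap A h s \<otimes>\<^bsub>tens_alg K A A\<^esub> t"
    if c: "\<And>b x. b \<in> carrier B \<Longrightarrow> x \<in> carrier A \<Longrightarrow> lact X b x = h b \<otimes>\<^bsub>A\<^esub> x"
  proof -
    have "actL X X s t = act2 A A (mult A) (mult A) (tmap A h s) t" unfolding e
      by (rule bil_ext[OF B_vs B_vs v v L(1) bil_comp[OF tm(1) lin_id a(1)] _ s t])
        (simp add: L(2) a(2) tm(2) c hc)
    then show ?thesis using ts t by (simp add: tens_alg_mult)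
  qed
  show "actR X X s t = t \<otimes>\<^bsub>tens_alg K A A\<^esub> tmap A h s"
    if c: "\<And>b x. b \<in> carrier B \<Longrightarrow> x \<in> carrier A \<Longrightarrow> ract X x b = x \<otimes>\<^bsub>A\<^esub> h b"
  proof -
    have "actR X X s t = act2 A A (\<lambda>a b. b \<otimes>\<^bsub>A\<^esub> a) (\<lambda>a b. b \<otimes>\<^bsub>A\<^esub> a) (tmap A h s) t" unfolding e
      by (rule bil_ext[OF B_vs B_vs v v R(1) bil_comp[OF tm(1) lin_id a'(1)] _ s t])
        (simp add: R(2) a'(2) tm(2) c hc)
    also have "\<dots> = act2 A A (mult A) (mult A) t (tmap A h s)"
      by (rule act2_swap[OF v v v v v v mb mb t ts])
    finally show ?thesis using ts t by (simp add: tens_alg_mult)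
  qed
qed

subsection \<open>Bimonoids and bialgebras\<close>

text \<open>Relates the raw data of a bimonoid to the raw data of a bialgebra; all that is required
  of the structure maps is that they are arrows of bimodules. The equivalence of the two sets of
  axioms is thus proved once and applied both to \<open>alg_of\<close> and to
  \<open>bim_of\<close>.\<close>

locale linked = bimod_qt K B S for K :: "('u :: infinite) ring" and B S +
  fixes X :: "('u bimod, 'u bimod_arrow) bimonoid" and A :: "'u bialg"
  assumes H_bm [simp]: "bm (obj X)" and same: "same (obj X) A"
    and m: "mult_of X \<in> arr C (obj X \<star> obj X) (obj X)" and u: "unit_of X \<in> arr C I (obj X)"
    and d: "comult_of X \<in> arr C (obj X) (obj X \<bullet> obj X)" and e: "counit_of X \<in> arr C (obj X) J"
    and mult_ext: "mult A \<in> extensional2 (carrier A) (carrier A)"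
    and mult_val: "x \<in> carrier A \<Longrightarrow> y \<in> carrier A \<Longrightarrow> mult_of X $ pureB K B (obj X) (obj X) x y = x \<otimes>\<^bsub>A\<^esub> y"
    and one_val: "one A = unit_of X $ \<one>\<^bsub>B\<^esub>"
    and d_val: "map_of_arrow (comult_of X) = comult A" and e_val: "map_of_arrow (counit_of X) = counit A"
begin

abbreviation "H \<equiv> obj X"
abbreviation "\<eta> \<equiv> map_of_arrow (unit_of X)"

lemma arrs [simp]: "mult_of X \<in> Ar C" "src (mult_of X) = H \<star> H" "trg (mult_of X) = H"
  "unit_of X \<in> Ar C" "src (unit_of X) = I" "trg (unit_of X) = H"
  "comult_of X \<in> Ar C" "src (comult_of X) = H" "trg (comult_of X) = H \<bullet> H"
  "counit_of X \<in> Ar C" "src (counit_of X) = H" "trg (counit_of X) = J"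
  using m u d e by (simp_all add: arr_C)

lemmas sc = same_cong[OF same]

declare mult_val [simp] d_val [simp] e_val [simp] sc(1) [simp]

lemma H_carrier [simp]: "carrier (H \<bullet> H) = carrier (tensK K A A)" by (simp add: diag_fields sc)

lemma A_vs [simp]: "vs A" using sc(3) by simp

lemma mult_bil: "bil A A A (mult A)"
proof -
  have "bil H H H (\<lambda>x y. mult_of X $ pureB K B H H x y)"
    by (rule bil_lin[OF ArD(3)[of "mult_of X", simplified] pureB_bil[OF H_bm H_bm]])
  then have "bil A A A (\<lambda>x y. mult_of X $ pureB K B H H x y)" by (simp add: bil_def sc)
  then show ?thesis using bil_cong[of A A "\<lambda>x y. mult_of X $ pureB K B H H x y" "mult A" A] by simp
qed

lemma mult_cl [simp]: "x \<in> carrier A \<Longrightarrow> y \<in> carrier A \<Longrightarrow> x \<otimes>\<^bsub>A\<^esub> y \<in> carrier A"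
  by (rule bil_cl[OF mult_bil])

lemma lins: "lin A (tensK K A A) (comult A)" "lin A (base_space K) (counit A)" "lin B A \<eta>"
  using ArD(3)[of "comult_of X"] ArD(3)[of "counit_of X"] ArD(3)[of "unit_of X"]
  by (simp_all add: lin_diag sc J_cong, simp_all add: reg_cong)

lemma cls [simp]: "x \<in> carrier A \<Longrightarrow> comult A x \<in> carrier (tensK K A A)" "x \<in> carrier A \<Longrightarrow> counit A x \<in> carrier K"
  "b \<in> carrier B \<Longrightarrow> \<eta> b \<in> carrier A"
  using lin_cl[OF lins(1)] lin_cl[OF lins(2)] lin_cl[OF lins(3)] by simp_all

lemma exts: "comult A \<in> extensional (carrier A)" "counit A \<in> extensional (carrier A)" "\<eta> \<in> extensional (carrier B)"
  using ArD(6)[of "comult_of X"] ArD(6)[of "counit_of X"] ArD(6)[of "unit_of X"] by simp_all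

text \<open>Interchange followed by multiplication in both factors is the product of the tensor
  algebra. The bimonoid axiom on the coproduct of a product therefore says that
  \<open>comult A\<close> is multiplicative.\<close>

lemma zeta_mult:
  assumes s: "s \<in> carrier (tensK K A A)" and t: "t \<in> carrier (tensK K A A)"
  shows "(mult_of X \<bullet>\<^sub>a mult_of X) $ (zeta \<DD> H H H H $ pureB K B (H \<bullet> H) (H \<bullet> H) s t) = s \<otimes>\<^bsub>tens_alg K A A\<^esub> t"
proof -
  have "bil (H \<bullet> H) (H \<bullet> H) (H \<bullet> H) (\<lambda>s t. (mult_of X \<bullet>\<^sub>a mult_of X) $ (zeta \<DD> H H H H $ pureB K B (H \<bullet> H) (H \<bullet> H) s t))"
    using bil_lin[OF ArD(3)[of "mult_of X \<bullet>\<^sub>a mult_of X", simplified] bil_lin[OF ArD(3)[of "zeta \<DD> H H H H", simplified] pureB_bil[of "H \<bullet> H" "H \<bullet> H"]]] by simp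
  then have b: "bil (tensK K A A) (tensK K A A) (tensK K A A) (\<lambda>s t. (mult_of X \<bullet>\<^sub>a mult_of X) $ (zeta \<DD> H H H H $ pureB K B (H \<bullet> H) (H \<bullet> H) s t))"
    by (simp add: diag_cong sc)
  note a = act2[OF A_vs A_vs A_vs A_vs A_vs A_vs mult_bil mult_bil]
  have "(mult_of X \<bullet>\<^sub>a mult_of X) $ (zeta \<DD> H H H H $ pureB K B (H \<bullet> H) (H \<bullet> H) s t) = act2 A A (mult A) (mult A) s t"
    by (rule bil_ext[OF A_vs A_vs A_vs A_vs b a(1) _ s t])
      (use zeta_val[of H H H H] b.tena_pt[of "mult_of X" "mult_of X" "H \<star> H" "H \<star> H"] o.pt_cl[of H H] in \<open>simp add: a(2) sc(8,9) mult_val[unfolded sc(8,9)]\<close>)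
  then show ?thesis using s t by (simp add: tens_alg_mult)
qed

lemma assoc_iff: "mult_of X \<cdot> (ide C H \<star>\<^sub>a mult_of X) \<cdot> asc (circ_data K B) H H H = mult_of X \<cdot> (mult_of X \<star>\<^sub>a ide C H) \<longleftrightarrow>
    (\<forall>x\<in>carrier A. \<forall>y\<in>carrier A. \<forall>z\<in>carrier A. x \<otimes>\<^bsub>A\<^esub> (y \<otimes>\<^bsub>A\<^esub> z) = x \<otimes>\<^bsub>A\<^esub> y \<otimes>\<^bsub>A\<^esub> z)"
  by (subst o.arr_iff3[of H H H]) (use o.pt_cl[of H H] in simp_all)

text \<open>The unit isomorphisms over \<open>B\<close> are the actions, so each unit axiom
  evaluates on pure tensors to a formula for an action.\<close>

lemma unit_iff:
  "mult_of X \<cdot> (unit_of X \<star>\<^sub>a ide C H) = lun (circ_data K B) H \<longleftrightarrow>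
    (\<forall>b\<in>carrier B. \<forall>x\<in>carrier A. \<eta> b \<otimes>\<^bsub>A\<^esub> x = lact H b x)"
  "mult_of X \<cdot> (ide C H \<star>\<^sub>a unit_of X) = run (circ_data K B) H \<longleftrightarrow>
    (\<forall>x\<in>carrier A. \<forall>b\<in>carrier B. x \<otimes>\<^bsub>A\<^esub> \<eta> b = ract H x b)"
  by (subst o.arr_iff2[of I H], simp_all)
    (subst o.arr_iff2[of H I], simp_all)

lemma comonoid_iff:
  "asc (bull_data K B) H H H \<cdot> (comult_of X \<bullet>\<^sub>a ide C H) \<cdot> comult_of X = (ide C H \<bullet>\<^sub>a comult_of X) \<cdot> comult_of X \<longleftrightarrow>
    (\<forall>x\<in>carrier A. Dl A (comult A x) = Dr A (comult A x))"
  "lun (bull_data K B) H \<cdot> (counit_of X \<bullet>\<^sub>a ide C H) \<cdot> comult_of X = ide C H \<longleftrightarrow>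
    (\<forall>x\<in>carrier A. lift A (\<lambda>x y. counit A x \<odot>\<^bsub>A\<^esub> y) (comult A x) = x)"
  "run (bull_data K B) H \<cdot> (ide C H \<bullet>\<^sub>a counit_of X) \<cdot> comult_of X = ide C H \<longleftrightarrow>
    (\<forall>x\<in>carrier A. lift A (\<lambda>x y. counit A y \<odot>\<^bsub>A\<^esub> x) (comult A x) = x)"
  by ((subst arr_iff[of _ _ H]; simp add: Dl_asc[OF H_bm same, of "comult_of X"] counit_asc[OF H_bm same, of "counit_of X"])+)

lemma bialg_iff:
  "comult_of X \<cdot> mult_of X = (mult_of X \<bullet>\<^sub>a mult_of X) \<cdot> zeta \<DD> H H H H \<cdot> (comult_of X \<star>\<^sub>a comult_of X) \<longleftrightarrow>
    (\<forall>x\<in>carrier A. \<forall>y\<in>carrier A. comult A (x \<otimes>\<^bsub>A\<^esub> y) = comult A x \<otimes>\<^bsub>tens_alg K A A\<^esub> comult A y)"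
  "counit_of X \<cdot> mult_of X = m_J \<DD> \<cdot> (counit_of X \<star>\<^sub>a counit_of X) \<longleftrightarrow>
    (\<forall>x\<in>carrier A. \<forall>y\<in>carrier A. counit A (x \<otimes>\<^bsub>A\<^esub> y) = counit A x \<otimes>\<^bsub>K\<^esub> counit A y)"
  by ((subst o.arr_iff2[of H H]; use o.pt_cl[of H H] in \<open>simp add: zeta_mult\<close>)+)

lemma unit_comonoid_iff:
  "comult_of X \<cdot> unit_of X = (unit_of X \<bullet>\<^sub>a unit_of X) \<cdot> Delta_I \<DD> \<longleftrightarrow>
    (\<forall>b\<in>carrier B. comult A (\<eta> b) = tmap A \<eta> (comult B b))"
  "counit_of X \<cdot> unit_of X = eps_I \<DD> \<longleftrightarrow> (\<forall>b\<in>carrier B. counit A (\<eta> b) = counit B b)"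
  by ((subst arr_iff[of _ _ I]; simp add: tmap_val[OF I_bm H_bm I_same same])+)

lemma cocomm_iff: "\<sigma> H H \<cdot> comult_of X = comult_of X \<longleftrightarrow>
    (\<forall>x\<in>carrier A. cj H H (flip K A A (comult A x)) = comult A x)"
proof -
  have "flip K H H = flip K A A" by (simp add: flip_def[abs_def] sc)
  then show ?thesis by (subst arr_iff[of _ _ H]; simp add: sigma_val)
qed

lemmas act_mult = act_mult_gen[OF H_bm same mult_bil lins(3)]

abbreviation "R \<equiv> tmap A \<eta> S"
abbreviation "A2 \<equiv> tens_alg K A A"

definition compat :: bool
  where "compat \<longleftrightarrow> (\<forall>b\<in>carrier B. \<forall>x\<in>carrier A. lact H b x = \<eta> b \<otimes>\<^bsub>A\<^esub> x \<and> ract H x b = x \<otimes>\<^bsub>A\<^esub> \<eta> b)"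

lemma compatD: "compat \<Longrightarrow> b \<in> carrier B \<Longrightarrow> x \<in> carrier A \<Longrightarrow> lact H b x = \<eta> b \<otimes>\<^bsub>A\<^esub> x"
  "compat \<Longrightarrow> b \<in> carrier B \<Longrightarrow> x \<in> carrier A \<Longrightarrow> ract H x b = x \<otimes>\<^bsub>A\<^esub> \<eta> b"
  by (simp_all add: compat_def)

lemma coc_iff: "cocommutative_bimonoid C \<DD> \<sigma> X \<longleftrightarrow> compat \<and>
    (\<forall>x\<in>carrier A. \<forall>y\<in>carrier A. \<forall>z\<in>carrier A. x \<otimes>\<^bsub>A\<^esub> (y \<otimes>\<^bsub>A\<^esub> z) = x \<otimes>\<^bsub>A\<^esub> y \<otimes>\<^bsub>A\<^esub> z) \<and>
    (\<forall>x\<in>carrier A. Dl A (comult A x) = Dr A (comult A x)) \<and>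
    (\<forall>x\<in>carrier A. lift A (\<lambda>x y. counit A x \<odot>\<^bsub>A\<^esub> y) (comult A x) = x) \<and>
    (\<forall>x\<in>carrier A. lift A (\<lambda>x y. counit A y \<odot>\<^bsub>A\<^esub> x) (comult A x) = x) \<and>
    (\<forall>x\<in>carrier A. \<forall>y\<in>carrier A. comult A (x \<otimes>\<^bsub>A\<^esub> y) = comult A x \<otimes>\<^bsub>A2\<^esub> comult A y) \<and>
    (\<forall>x\<in>carrier A. \<forall>y\<in>carrier A. counit A (x \<otimes>\<^bsub>A\<^esub> y) = counit A x \<otimes>\<^bsub>K\<^esub> counit A y) \<and>
    (\<forall>b\<in>carrier B. comult A (\<eta> b) = tmap A \<eta> (comult B b)) \<and> (\<forall>b\<in>carrier B. counit A (\<eta> b) = counit B b) \<and>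
    (\<forall>x\<in>carrier A. cj H H (flip K A A (comult A x)) = comult A x)"
proof -
  have c: "compat \<longleftrightarrow> (\<forall>b\<in>carrier B. \<forall>x\<in>carrier A. \<eta> b \<otimes>\<^bsub>A\<^esub> x = lact H b x) \<and>
    (\<forall>x\<in>carrier A. \<forall>b\<in>carrier B. x \<otimes>\<^bsub>A\<^esub> \<eta> b = ract H x b)" unfolding compat_def by metis
  show ?thesis
    unfolding cocommutative_bimonoid_def is_bimonoid_def circ_monoid_def bull_comonoid_def Let_def duo_simps T_ops
      assoc_iff unit_iff comonoid_iff bialg_iff unit_comonoid_iff cocomm_iff c
    using m u d e H_bm unfolding Ob_C by blast
qed

abbreviation "under_B \<equiv> bialgebra K A \<and> bialgebra_map K B A \<eta> \<and> compat"

text \<open>The conjugation is R^-1 \<Delta>^op R in the tensor algebra; multiplying from the left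
  by \<open>R\<close>, or by its inverse, passes between the two equations.\<close>

lemma cj_iff:
  assumes a: under_B and x: "x \<in> carrier A"
  shows "cj H H (flip K A A (comult A x)) = comult A x \<longleftrightarrow>
    flip K A A (comult A x) \<otimes>\<^bsub>A2\<^esub> R = R \<otimes>\<^bsub>A2\<^esub> comult A x"
proof -
  let ?f = "flip K A A (comult A x)" and ?Ri = "tmap A \<eta> Si"
  have A: "bialgebra K A" and u: "bialgebra_map K B A \<eta>" and c: compat using a by simp_all
  have U: "ualg A2" using bialgD(1)[OF A] by simp
  note T = alg_homD[OF tmap_hom[OF B A u]]
  have cl: "R \<in> carrier A2" "?Ri \<in> carrier A2" "?f \<in> carrier A2" "comult A x \<in> carrier A2"
    using T(6)[of S] T(6)[of Si] q(1,2) flip_cl[of A A] x by simp_all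
  have RR: "R \<otimes>\<^bsub>A2\<^esub> ?Ri = \<one>\<^bsub>A2\<^esub>" "?Ri \<otimes>\<^bsub>A2\<^esub> R = \<one>\<^bsub>A2\<^esub>"
    using T(5)[of S Si] T(5)[of Si S] T(4) q(1-4) by simp_all
  note as = ualg_assoc[OF U] and mc = ualg_mult[OF U]
  have "cj H H ?f = ?Ri \<otimes>\<^bsub>A2\<^esub> ?f \<otimes>\<^bsub>A2\<^esub> R"
    using act_mult(1)[OF q(2), of ?f] act_mult(2)[OF q(1), of "?Ri \<otimes>\<^bsub>A2\<^esub> ?f"] compatD[OF c] cl mc[OF cl(2,3)]
    by (simp add: cj_def)
  moreover have "R \<otimes>\<^bsub>A2\<^esub> (?Ri \<otimes>\<^bsub>A2\<^esub> ?f \<otimes>\<^bsub>A2\<^esub> R) = ?f \<otimes>\<^bsub>A2\<^esub> R"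
    using as[OF cl(1,2) mc[OF cl(3,1)]] as[OF cl(2,3,1)] RR(1) ualg_l_one[OF U mc[OF cl(3,1)]] by simp
  moreover have "?Ri \<otimes>\<^bsub>A2\<^esub> (R \<otimes>\<^bsub>A2\<^esub> comult A x) = comult A x"
    using as[OF cl(2,1,4)] RR(2) ualg_l_one[OF U cl(4)] by simp
  moreover have "?Ri \<otimes>\<^bsub>A2\<^esub> (?f \<otimes>\<^bsub>A2\<^esub> R) = ?Ri \<otimes>\<^bsub>A2\<^esub> ?f \<otimes>\<^bsub>A2\<^esub> R" using as[OF cl(2,3,1)] by simp
  ultimately show ?thesis by metis
qed

theorem coc_iff_bialgebra: "cocommutative_bimonoid C \<DD> \<sigma> X \<longleftrightarrow> under_B \<and> quasitriangular K A R"
proof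
  assume "cocommutative_bimonoid C \<DD> \<sigma> X"
  note P = this[unfolded coc_iff]
  have c: compat using P by blast
  have one: "\<one>\<^bsub>A\<^esub> = \<eta> \<one>\<^bsub>B\<^esub>" by (rule one_val)
  \<comment> \<open>Multiplication by \<eta>(1) is the action of the unit of \<open>B\<close>, which
    is trivial.\<close>
  have l1: "\<eta> \<one>\<^bsub>B\<^esub> \<otimes>\<^bsub>A\<^esub> x = x" "x \<otimes>\<^bsub>A\<^esub> \<eta> \<one>\<^bsub>B\<^esub> = x" if "x \<in> carrier A" for x
    using compatD[OF c ualg_one[OF Bs(1)] that] lact_one[OF H_bm] ract_one[OF H_bm] that by simp_all
  have "ualg A"
    by (rule ualgI) (use P mult_bil l1 one mult_ext bmD(9,10)[OF H_bm] same in \<open>simp_all add: same_def\<close>)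
  moreover have "comult A (\<eta> \<one>\<^bsub>B\<^esub>) = pureK K A A (\<eta> \<one>\<^bsub>B\<^esub>) (\<eta> \<one>\<^bsub>B\<^esub>)"
    using P bialgD(9)[OF B] by (simp add: tmap_pure[OF B_vs A_vs lins(3)])
  moreover have "counit A (\<eta> \<one>\<^bsub>B\<^esub>) = \<one>\<^bsub>K\<^esub>" using P bialgD(11)[OF B] by simp
  ultimately have A: "bialgebra K A"
    by (intro bialgebraI) (use P lins exts one in simp_all)
  \<comment> \<open>Left linearity of the unit arrow gives \<eta>(b b') = b \<eta>(b'), and
    \<open>b\<close> acts as multiplication by \<eta>(b).\<close>
  have "\<eta> (b \<otimes>\<^bsub>B\<^esub> b') = \<eta> b \<otimes>\<^bsub>A\<^esub> \<eta> b'" if "b \<in> carrier B" "b' \<in> carrier B" for b b'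
    using ArD(4)[of "unit_of X" b b'] that compatD[OF c] by simp
  then have u: "bialgebra_map K B A \<eta>" unfolding bialgebra_map_iff using lins(3) exts(3) one P by simp
  have U: under_B using A u c by simp
  have "quasitriangular K A R"
    by (rule quasi_transport[OF B A u qt]) (use P in \<open>simp add: cj_iff[OF U, symmetric]\<close>)
  with U show "under_B \<and> quasitriangular K A R" by simp
next
  assume a: "under_B \<and> quasitriangular K A R"
  then have A: "bialgebra K A" and u: "bialgebra_map K B A \<eta>" and c: compat and r: "quasitriangular K A R" by simp_all
  note as = ualg_assoc[OF bialgD(1)[OF A]]
  show "cocommutative_bimonoid C \<DD> \<sigma> X" unfolding coc_iff
    using a u[unfolded bialgebra_map_iff] cj_iff quasiD(5)[OF A r] bialgD(8,10,12,13)[OF A] coassoc[OF A] as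
    by simp
qed

end

locale linked2 = linked K B S X A + l': linked K B S X' A'
  for K :: "('u :: infinite) ring" and B S X A X' A'
begin

lemma mor_iff:
  assumes f: "f \<in> arr C (obj X) (obj X')"
  shows "bimonoid_mor C \<DD> X X' f \<longleftrightarrow>
    (\<forall>x\<in>carrier A. \<forall>y\<in>carrier A. f $ (x \<otimes>\<^bsub>A\<^esub> y) = f $ x \<otimes>\<^bsub>A'\<^esub> f $ y) \<and>
    (\<forall>b\<in>carrier B. f $ (\<eta> b) = l'.\<eta> b) \<and>
    (\<forall>x\<in>carrier A. comult A' (f $ x) = tmap A' (map_of_arrow f) (comult A x)) \<and>
    (\<forall>x\<in>carrier A. counit A' (f $ x) = counit A x)"
proof -
  have F: "f \<in> Ar C" "src f = H" "trg f = l'.H" using f by (simp_all add: arr_C)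
  have fc: "x \<in> carrier A \<Longrightarrow> f $ x \<in> carrier A'" for x using val_cl[OF F(1,3), of x] F(2) by simp
  note p = o.pt_cl[of H H, simplified]
  have 1: "f \<cdot> mult_of X = mult_of X' \<cdot> (f \<star>\<^sub>a f) \<longleftrightarrow>
      (\<forall>x\<in>carrier A. \<forall>y\<in>carrier A. f $ (x \<otimes>\<^bsub>A\<^esub> y) = f $ x \<otimes>\<^bsub>A'\<^esub> f $ y)"
    by (subst o.arr_iff2[of H H]; use F fc p in simp)
  have 2: "f \<cdot> unit_of X = unit_of X' \<longleftrightarrow> (\<forall>b\<in>carrier B. f $ (\<eta> b) = l'.\<eta> b)"
    by (subst arr_iff[of _ _ I]; use F in simp)
  have 3: "comult_of X' \<cdot> f = (f \<bullet>\<^sub>a f) \<cdot> comult_of X \<longleftrightarrow>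
      (\<forall>x\<in>carrier A. comult A' (f $ x) = tmap A' (map_of_arrow f) (comult A x))"
    by (subst arr_iff[of _ _ H]; use F in \<open>simp add: tmap_val[OF H_bm l'.H_bm same l'.same]\<close>)
  have 4: "counit_of X' \<cdot> f = counit_of X \<longleftrightarrow> (\<forall>x\<in>carrier A. counit A' (f $ x) = counit A x)"
    by (subst arr_iff[of _ _ H]; use F in simp)
  show ?thesis unfolding bimonoid_mor_def duo_simps 1 2 3 4 using f by blast
qed

text \<open>Preservation of the algebra unit is the clause on the unit maps at b = 1.\<close>

lemma mor_iff_bialgebra: "bimonoid_mor C \<DD> X X' f \<longleftrightarrow> f \<in> arr C (obj X) (obj X') \<and>
    bialgebra_map K A A' (map_of_arrow f) \<and> (\<forall>b\<in>carrier B. f $ (\<eta> b) = l'.\<eta> b)"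
proof (cases "f \<in> arr C (obj X) (obj X')")
  case True
  then have F: "f \<in> Ar C" "src f = H" "trg f = l'.H" by (simp_all add: arr_C)
  have "lin A A' (map_of_arrow f)" "map_of_arrow f \<in> extensional (carrier A)"
    using ArD(3,6)[OF F(1), unfolded F(2,3) sc l'.sc] .
  then show ?thesis unfolding mor_iff[OF True] bialgebra_map_iff one_val l'.one_val using True by auto
qed (simp add: bimonoid_mor_def)

text \<open>Bimodule linearity is automatic: h(b x) = h(\<eta>(b) x) = h(\<eta>(b)) h(x), which is
  the action of b on h(x), and likewise on the right.\<close>

lemma mor_arr:
  assumes c: compat l'.compat and h: "bialgebra_map K A A' h" "\<And>b. b \<in> carrier B \<Longrightarrow> h (\<eta> b) = l'.\<eta> b"
  shows "\<lparr>src = obj X, trg = obj X', map_of_arrow = h\<rparr> \<in> Ar C"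
proof -
  note h1 = h(1)[unfolded bialgebra_map_iff]
  have "x \<in> carrier A \<Longrightarrow> h x \<in> carrier A'" for x using h1 lin_cl[of A A' h] by blast
  then show ?thesis unfolding Ar_C bimodule_map_def linear_map_iff
    using h1 h(2) compatD[OF c(1)] l'.compatD[OF c(2)] by (simp add: sc l'.sc)
qed

text \<open>The multiplication is an arrow out of a tensor product and so determined by its values
  on pure tensors; comultiplication and counit are read off from the fields of \<open>A\<close>.
  With the next lemma this gives equality, and not just isomorphism, in both round trips.\<close>

lemma linked_unique:
  assumes "obj X = obj X'" "A = A'" "\<And>b. b \<in> carrier B \<Longrightarrow> \<eta> b = l'.\<eta> b"
  shows "X = X'"
proof -
  note p = o.pt_cl[of H H, simplified]
  have "mult_of X = mult_of X'"
    by (subst o.arr_iff2[of H H]) (use assms(1,2) mult_val l'.mult_val p in simp_all)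
  moreover have "unit_of X = unit_of X'" by (subst arr_iff[of _ _ I]) (use assms in simp_all)
  moreover have "comult_of X = comult_of X'" using assms arrs(8,9) l'.arrs(8,9) d_val l'.d_val by (intro arrow.equality) simp_all
  moreover have "counit_of X = counit_of X'" using assms arrs(11,12) l'.arrs(11,12) e_val l'.e_val by (intro arrow.equality) simp_all
  ultimately show ?thesis using assms(1) by (intro bimonoid.equality) simp_all
qed

lemma linked_unique':
  assumes X: "X = X'"
  shows "A = A'"
proof -
  have c: "carrier A = carrier A'" and s: "add A = add A'" "zero A = zero A'" "smult A = smult A'"
    using same l'.same X by (simp_all add: same_def)
  have "mult A x y = mult A' x y" for x y
    using mult_val[of x y] l'.mult_val[of x y] mult_ext l'.mult_ext X c
    by (cases "x \<in> carrier A \<and> y \<in> carrier A") (auto simp: extensional2_def)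
  then have "mult A = mult A'" by blast
  then show ?thesis using c s one_val l'.one_val d_val l'.d_val e_val l'.e_val X by (intro bialg.equality) simp_all
qed

end

subsection \<open>From bimonoids to bialgebras under \<open>B\<close> and back\<close>

context bimod_qt begin

text \<open>The product is made \<open>undefined\<close> outside the carrier, as
  \<open>unital_algebra\<close> demands; the other operations inherit this from the bimodule and
  from the arrows.\<close>

definition alg_of :: "('u bimod, 'u bimod_arrow) bimonoid \<Rightarrow> 'u bialg"
  where "alg_of X = (let H = obj X in
    \<lparr>carrier = carrier H, mult = restrict2 (carrier H) (carrier H) (\<lambda>x y. mult_of X $ pureB K B H H x y),
     one = unit_of X $ \<one>\<^bsub>B\<^esub>, zero = zero H, add = add H, smult = smult H,
     comult = map_of_arrow (comult_of X), counit = map_of_arrow (counit_of X)\<rparr>)"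

lemma alg_of_linked: "is_bimonoid C \<DD> X \<Longrightarrow> linked K B S X (alg_of X)"
  unfolding linked_def linked_axioms_def is_bimonoid_def circ_monoid_def bull_comonoid_def Let_def duo_simps T_ops Ob_C
  by (simp add: bimod_qt_axioms same_def alg_of_def Let_def restrict2_def extensional2_def)

text \<open>The bimodule is \<open>A\<close> restricted along \<open>h\<close> on both sides;
  \<open>mk_bimod\<close> resets the ring multiplication fields, which a bimodule record leaves
  undefined.\<close>

definition bim_of :: "'u bialg \<Rightarrow> ('u \<Rightarrow> 'u) \<Rightarrow> ('u bimod, 'u bimod_arrow) bimonoid"
  where "bim_of A h = (let H = mk_bimod B (module.truncate A) (\<lambda>b x. h b \<otimes>\<^bsub>A\<^esub> x) (\<lambda>x b. x \<otimes>\<^bsub>A\<^esub> h b) in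
    \<lparr>obj = H, mult_of = mk_arrow (H \<star> H) H (lift H (mult A)), unit_of = mk_arrow I H h,
     comult_of = mk_arrow H (H \<bullet> H) (comult A), counit_of = mk_arrow H J (counit A)\<rparr>)"

context
  fixes A :: "'u bialg" and h :: "'u \<Rightarrow> 'u"
  assumes A: "bialgebra K A" and h: "bialgebra_map K B A h"
begin

abbreviation "HA \<equiv> obj (bim_of A h)"

lemma HA_eq: "HA = mk_bimod B (module.truncate A) (\<lambda>b x. h b \<otimes>\<^bsub>A\<^esub> x) (\<lambda>x b. x \<otimes>\<^bsub>A\<^esub> h b)"
  by (simp add: bim_of_def Let_def)

lemma hD: "lin B A h" "h \<in> extensional (carrier B)" "h \<one>\<^bsub>B\<^esub> = \<one>\<^bsub>A\<^esub>"
  "\<And>b. b \<in> carrier B \<Longrightarrow> h b \<in> carrier A"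
  "\<And>b c. b \<in> carrier B \<Longrightarrow> c \<in> carrier B \<Longrightarrow> h (b \<otimes>\<^bsub>B\<^esub> c) = h b \<otimes>\<^bsub>A\<^esub> h c"
  "\<And>b. b \<in> carrier B \<Longrightarrow> comult A (h b) = tmap A h (comult B b)" "\<And>b. b \<in> carrier B \<Longrightarrow> counit A (h b) = counit B b"
  using h[unfolded bialgebra_map_iff] lin_cl[of B A h] by blast+

lemma HA_same: "same HA A" by (simp add: same_def HA_eq)

lemma HA_bm: "bm HA"
proof -
  have U: "ualg A" by (rule bialgD(1)[OF A])
  note g = gmod_pull[OF gmod_reg[OF U] B_vs ualg_bil[OF Bs(1)] ualg_one[OF Bs(1)] hD(1,5,3)]
  have "bil A A A (\<lambda>a b. b \<otimes>\<^bsub>A\<^esub> a)" using ualg_bil[OF U] by (auto simp: bil_def)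
  then have op: "gmod (\<lambda>a b. b \<otimes>\<^bsub>A\<^esub> a) \<one>\<^bsub>A\<^esub> A A (\<lambda>a x. x \<otimes>\<^bsub>A\<^esub> a)" using U by (simp add: gmod_def ualg_assoc)
  note g' = gmod_pull[OF op B_vs opm_bil ualg_one[OF Bs(1)] hD(1) _ hD(3)]
  show ?thesis unfolding HA_eq
    by (rule mk_bimod_bm)
      (use U g g' ualgD(6,8)[OF U] hD(4,5) in \<open>simp_all add: gmod_def trunc_cong ualg_assoc\<close>)
qed

lemma HA_act: "b \<in> carrier B \<Longrightarrow> x \<in> carrier A \<Longrightarrow> lact HA b x = h b \<otimes>\<^bsub>A\<^esub> x"
  "b \<in> carrier B \<Longrightarrow> x \<in> carrier A \<Longrightarrow> ract HA x b = x \<otimes>\<^bsub>A\<^esub> h b"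
  by (simp_all add: HA_eq)

text \<open>The product descends to the tensor product over \<open>B\<close> by associativity, x
  h(c) y being bracketed in two ways. Linearity of comultiplication and counit uses that
  \<open>h\<close> preserves them.\<close>

lemma HA_arrows: "mult_of (bim_of A h) \<in> Ar C" "unit_of (bim_of A h) \<in> Ar C" "comult_of (bim_of A h) \<in> Ar C"
    "counit_of (bim_of A h) \<in> Ar C"
  and HA_mult: "\<And>x y. x \<in> carrier A \<Longrightarrow> y \<in> carrier A \<Longrightarrow> mult_of (bim_of A h) $ pureB K B HA HA x y = x \<otimes>\<^bsub>A\<^esub> y"
proof -
  note sc = same_cong[OF HA_same]
  have U: "ualg A" by (rule bialgD(1)[OF A])
  have e: "mult_of (bim_of A h) = mk_arrow (HA \<star> HA) HA (lift HA (mult A))" "unit_of (bim_of A h) = mk_arrow I HA h"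
    "comult_of (bim_of A h) = mk_arrow HA (HA \<bullet> HA) (comult A)" "counit_of (bim_of A h) = mk_arrow HA J (counit A)"
    by (simp_all add: bim_of_def Let_def)
  have b: "bil HA HA HA (mult A)" using ualg_bil[OF U] by (simp add: bil_def sc)
  have r: "ract HA x c \<otimes>\<^bsub>A\<^esub> y = x \<otimes>\<^bsub>A\<^esub> lact HA c y" if "c \<in> carrier B" "x \<in> carrier HA" "y \<in> carrier HA" for c x y
    using that U hD(4) by (simp add: sc HA_act ualg_assoc)
  have P: "lin (HA \<star> HA) HA (lift HA (mult A))"
    "\<And>x y. x \<in> carrier HA \<Longrightarrow> y \<in> carrier HA \<Longrightarrow> lift HA (mult A) (pureB K B HA HA x y) = x \<otimes>\<^bsub>A\<^esub> y"
    using quot_tensor0.P_lift[OF o0 HA_bm HA_bm bm_vs[OF HA_bm] b r] by blast+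
  show "mult_of (bim_of A h) \<in> Ar C" unfolding e
    by (rule quot_tensor0.P_arrow[OF o0 HA_bm HA_bm HA_bm P(1)])
      (use HA_bm U hD(4) in \<open>simp_all add: P(2)[unfolded sc(1)] sc(1) HA_act ualg_assoc\<close>)
  show "mult_of (bim_of A h) $ pureB K B HA HA x y = x \<otimes>\<^bsub>A\<^esub> y" if "x \<in> carrier A" "y \<in> carrier A" for x y
    unfolding e using that P(2)[of x y] o.pt_cl[OF HA_bm HA_bm, of x y] by (simp add: sc(1))
  show "unit_of (bim_of A h) \<in> Ar C" unfolding e
    by (rule mk_arrow_Ar) (use HA_bm hD in \<open>simp_all add: sc reg_cong HA_act\<close>)
  note am = act_mult_gen[OF HA_bm HA_same ualg_bil[OF U] hD(1)]
  show "comult_of (bim_of A h) \<in> Ar C" unfolding e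
  proof (rule mk_arrow_Ar[OF HA_bm diag_bm[OF HA_bm HA_bm]])
    show "lin HA (HA \<bullet> HA) (comult A)" using bialgD(2)[OF A] by (simp add: sc lin_diag)
    fix c x assume a: "c \<in> carrier B" "x \<in> carrier HA"
    then have x: "x \<in> carrier A" "comult A x \<in> carrier (tensK K HA HA)" using bialgD(6)[OF A] by (simp_all add: sc)
    show "comult A (lact HA c x) = lact (HA \<bullet> HA) c (comult A x)"
      using a x U hD(4,6) am(1)[of "comult B c" "comult A x"] bialgD(8)[OF A]
      by (simp add: diag_act dg_def HA_act sc)
    show "comult A (ract HA x c) = ract (HA \<bullet> HA) (comult A x) c"
      using a x U hD(4,6) am(2)[of "comult B c" "comult A x"] bialgD(8)[OF A]
      by (simp add: diag_act dg_def HA_act sc)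
  qed
  show "counit_of (bim_of A h) \<in> Ar C" unfolding e
    by (rule mk_arrow_Ar[OF HA_bm J_bm])
      (use hD(4,7) bialgD(3,7,10)[OF A] in \<open>simp_all add: sc J_cong HA_act\<close>)
qed

lemma bim_of_linked: "linked K B S (bim_of A h) A"
proof -
  have e: "unit_of (bim_of A h) = mk_arrow I HA h"
    "comult_of (bim_of A h) = mk_arrow HA (HA \<bullet> HA) (comult A)" "counit_of (bim_of A h) = mk_arrow HA J (counit A)"
    "src (mult_of (bim_of A h)) = HA \<star> HA" "trg (mult_of (bim_of A h)) = HA"
    by (simp_all add: bim_of_def Let_def)
  show ?thesis
    unfolding linked_def linked_axioms_def arr_C
    using bimod_qt_axioms HA_bm HA_same HA_arrows HA_mult ualgD(7)[OF bialgD(1)[OF A]] bialgD(4,5)[OF A] hD(3)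
    by (simp add: e(4,5), simp add: e(1-3) mk_arrow_def same_cong(1)[OF HA_same] extensional_restrict)
qed

lemma unit_bim_of: "map_of_arrow (unit_of (bim_of A h)) = h"
  using hD(2) by (simp add: bim_of_def Let_def mk_arrow_def extensional_restrict)

end

lemma bim_of_coc:
  assumes A: "bialgebra K A" and h: "bialgebra_map K B A h" and q: "quasitriangular K A (tmap A h S)"
  shows "cocommutative_bimonoid C \<DD> \<sigma> (bim_of A h)"
proof -
  interpret l: linked K B S "bim_of A h" A by (rule bim_of_linked[OF A h])
  have "l.compat" unfolding l.compat_def unit_bim_of[OF A h] using HA_act[OF A h] by simp
  then show ?thesis unfolding l.coc_iff_bialgebra unit_bim_of[OF A h] using A h q by simp
qed

end

text \<open>Both \<open>X\<close> and the reconstructed bimonoid are linked to the same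
  \<open>A\<close>. What has to be seen is that their objects agree as records: the actions agree on
  the carriers by \<open>compat\<close>, and elsewhere both are undefined.\<close>

lemma (in linked) bim_of_inverse:
  assumes c: "cocommutative_bimonoid C \<DD> \<sigma> X"
  shows "bim_of A \<eta> = X"
proof -
  note P = c[unfolded coc_iff_bialgebra]
  have A: "bialgebra K A" and u: "bialgebra_map K B A \<eta>" and k: compat using P by simp_all
  interpret l: linked2 K B S "bim_of A \<eta>" A X A
    by (rule linked2.intro[OF bim_of_linked[OF A u] linked_axioms])
  have f: "lact H b x = restrict2 (carrier B) (carrier A) (\<lambda>b x. \<eta> b \<otimes>\<^bsub>A\<^esub> x) b x"
    "ract H x b = restrict2 (carrier A) (carrier B) (\<lambda>x b. x \<otimes>\<^bsub>A\<^esub> \<eta> b) x b" for b x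
    using compatD[OF k] bmD(11,12)[OF H_bm] by (auto simp: restrict2_def extensional2_def)
  have "obj (bim_of A \<eta>) = H" unfolding HA_eq[OF A u]
    by (rule bimod.equality)
      (use same bmD(13,14)[OF H_bm] f in \<open>simp_all add: mk_bimod_def same_def fun_eq_iff\<close>)
  then show ?thesis by (rule l.linked_unique) (simp_all add: unit_bim_of[OF A u])
qed

subsection \<open>The isomorphism of categories\<close>

context bimod_qt begin

abbreviation "coc \<equiv> cocommutative_bimonoid C \<DD> \<sigma>"
abbreviation "Bim \<equiv> Bimon_coc C \<DD> \<sigma>"
abbreviation "Cos \<equiv> coslice (B, S) (QTrBialg K)"
abbreviation "unit_map X \<equiv> map_of_arrow (unit_of X)"

lemma Bim_fields [simp]: "Ob Bim = {X. coc X}" "dom_of Bim = src" "cod_of Bim = trg"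
  "ide Bim X = \<lparr>src = X, trg = X, map_of_arrow = ide C (obj X)\<rparr>"
  "cmp Bim G F = \<lparr>src = src F, trg = trg G, map_of_arrow = map_of_arrow G \<cdot> map_of_arrow F\<rparr>"
  by (simp_all add: Bimon_coc_def)

lemma Bim_Ar: "F \<in> Ar Bim \<longleftrightarrow> coc (src F) \<and> coc (trg F) \<and> bimonoid_mor C \<DD> (src F) (trg F) (map_of_arrow F)"
  unfolding Bimon_coc_def by (cases F) auto

lemma map_ide: "map_of_arrow (ide C X) = (\<lambda>x\<in>carrier X. x)"
  and map_cmp: "map_of_arrow (g \<cdot> f) = compose (carrier (src f)) (map_of_arrow g) (map_of_arrow f)"
  by (simp_all add: bimod_cat_def)

lemma alg_of_carrier [simp]: "carrier (alg_of X) = carrier (obj X)" by (simp add: alg_of_def Let_def)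

lemma coc_linked: "coc X \<Longrightarrow> linked K B S X (alg_of X)"
  by (rule alg_of_linked) (simp add: cocommutative_bimonoid_def)

lemma cocD:
  assumes "coc X"
  shows "bialgebra K (alg_of X)" "bialgebra_map K B (alg_of X) (unit_map X)"
    "quasitriangular K (alg_of X) (tmap (alg_of X) (unit_map X) S)" "bm (obj X)" "bim_of (alg_of X) (unit_map X) = X"
proof -
  interpret l: linked K B S X "alg_of X" by (rule coc_linked[OF assms])
  show "bialgebra K (alg_of X)" "bialgebra_map K B (alg_of X) (unit_map X)"
    "quasitriangular K (alg_of X) (tmap (alg_of X) (unit_map X) S)" "bm (obj X)"
    using assms unfolding l.coc_iff_bialgebra by simp_all
  show "bim_of (alg_of X) (unit_map X) = X" by (rule l.bim_of_inverse[OF assms])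
qed

lemma coc_mor_iff: "coc X \<Longrightarrow> coc Y \<Longrightarrow> bimonoid_mor C \<DD> X Y f \<longleftrightarrow> f \<in> arr C (obj X) (obj Y) \<and>
    bialgebra_map K (alg_of X) (alg_of Y) (map_of_arrow f) \<and> (\<forall>b\<in>carrier B. f $ (unit_map X b) = unit_map Y b)"
  by (rule linked2.mor_iff_bialgebra[OF linked2.intro[OF coc_linked coc_linked]])

lemma coc_mor_arr:
  assumes "coc X" "coc Y" "bialgebra_map K (alg_of X) (alg_of Y) h" "\<And>b. b \<in> carrier B \<Longrightarrow> h (unit_map X b) = unit_map Y b"
  shows "bimonoid_mor C \<DD> X Y \<lparr>src = obj X, trg = obj Y, map_of_arrow = h\<rparr>"
proof -
  interpret l: linked2 K B S X "alg_of X" Y "alg_of Y"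
    by (rule linked2.intro[OF coc_linked coc_linked, OF assms(1,2)])
  show ?thesis unfolding l.mor_iff_bialgebra
    using l.mor_arr[OF _ _ assms(3,4)] assms l.coc_iff_bialgebra l.l'.coc_iff_bialgebra by (simp add: arr_C)
qed

text \<open>Both \<open>alg_of (bim_of A h)\<close> and \<open>A\<close> are linked to the bimonoid
  \<open>bim_of A h\<close>, and such an algebra is unique.\<close>

lemma alg_of_bim_of:
  assumes A: "bialgebra K A" and h: "bialgebra_map K B A h" and q: "quasitriangular K A (tmap A h S)"
  shows "alg_of (bim_of A h) = A"
  using linked2.linked_unique'[OF linked2.intro[OF coc_linked[OF bim_of_coc[OF A h q]] bim_of_linked[OF A h]]] by simp

lemma unit_map_cl: "coc X \<Longrightarrow> b \<in> carrier B \<Longrightarrow> unit_map X b \<in> carrier (obj X)"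
  using linked.cls(3)[OF coc_linked, of X b] by simp

text \<open>By \<open>coc_mor_iff\<close> identities and composites are inherited from bialgebra
  maps and bimodule arrows, so the bimonoid diagrams are not chased again.\<close>

lemma Bim_category: "category Bim"
proof
  fix X assume X: "X \<in> Ob Bim"
  then have c: "coc X" by simp
  have "bialgebra_map K (alg_of X) (alg_of X) (\<lambda>x\<in>carrier (obj X). x)"
    using bialgebra_map_id[OF cocD(1)[OF c]] by simp
  then show "ide Bim X \<in> arr Bim X X"
    using c cocD(4)[OF c] unit_map_cl[OF c] unfolding arr_def Bim_Ar by (simp add: coc_mor_iff[OF c c] map_ide arr_C)
next
  fix f g X Y Z assume a: "f \<in> arr Bim X Y" "g \<in> arr Bim Y Z"
  then have c: "coc X" "coc Y" "coc Z" and s: "src f = X" "trg g = Z"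
    and mm: "bimonoid_mor C \<DD> X Y (map_of_arrow f)" "bimonoid_mor C \<DD> Y Z (map_of_arrow g)"
    by (auto simp: arr_def Bim_Ar)
  note m = mm(1)[unfolded coc_mor_iff[OF c(1,2)]] mm(2)[unfolded coc_mor_iff[OF c(2,3)]]
  have "bialgebra_map K (alg_of X) (alg_of Z) (compose (carrier (alg_of X)) (map_of_arrow (map_of_arrow g)) (map_of_arrow (map_of_arrow f)))"
    by (rule bialgebra_map_comp(1)[OF c[THEN cocD(1)]]) (use m in simp_all)
  then show "cmp Bim g f \<in> arr Bim X Z"
    using c s m unit_map_cl[OF c(1)] unfolding arr_def Bim_Ar by (simp add: coc_mor_iff[OF c(1,3)] map_cmp arr_C) (simp add: compose_def)
next
  fix f X Y assume a: "f \<in> arr Bim X Y"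
  then have m: "map_of_arrow f \<in> arr C (obj X) (obj Y)" and s: "src f = X" "trg f = Y"
    by (auto simp: arr_def Bim_Ar bimonoid_mor_def)
  show "cmp Bim f (ide Bim X) = f" "cmp Bim (ide Bim Y) f = f"
    using cat.cmp_ide[OF m] cat.ide_cmp[OF m] s by simp_all
next
  fix f g h W X Y Z assume a: "f \<in> arr Bim W X" "g \<in> arr Bim X Y" "h \<in> arr Bim Y Z"
  then have m: "map_of_arrow f \<in> arr C (obj W) (obj X)" "map_of_arrow g \<in> arr C (obj X) (obj Y)" "map_of_arrow h \<in> arr C (obj Y) (obj Z)"
    by (auto simp: arr_def Bim_Ar bimonoid_mor_def)
  show "cmp Bim h (cmp Bim g f) = cmp Bim (cmp Bim h g) f" using cat.cmp_assoc[OF m] by simp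
qed (auto simp: Bim_Ar)

text \<open>The R-matrix of the target is forced, since an arrow out of (B, S) has to send
  \<open>S\<close> to it.\<close>

definition FO :: "('u bimod, 'u bimod_arrow) bimonoid \<Rightarrow> ('u bialg \<times> 'u, 'u \<Rightarrow> 'u) arrow"
  where "FO X = \<lparr>src = (B, S), trg = (alg_of X, tmap (alg_of X) (unit_map X) S), map_of_arrow = unit_map X\<rparr>"

definition FA :: "(('u bimod, 'u bimod_arrow) bimonoid, 'u bimod_arrow) arrow \<Rightarrow>
    (('u bialg \<times> 'u, 'u \<Rightarrow> 'u) arrow, ('u bialg \<times> 'u, 'u \<Rightarrow> 'u) arrow) arrow"
  where "FA F = \<lparr>src = FO (src F), trg = FO (trg F),
    map_of_arrow = \<lparr>src = trg (FO (src F)), trg = trg (FO (trg F)), map_of_arrow = map_of_arrow (map_of_arrow F)\<rparr>\<rparr>"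

text \<open>The R-matrix of the target is dropped without loss: as the arrow maps \<open>S\<close>
  to it, \<open>FO\<close> restores it.\<close>

definition GO :: "('u bialg \<times> 'u, 'u \<Rightarrow> 'u) arrow \<Rightarrow> ('u bimod, 'u bimod_arrow) bimonoid"
  where "GO a = bim_of (fst (trg a)) (map_of_arrow a)"

definition GA :: "(('u bialg \<times> 'u, 'u \<Rightarrow> 'u) arrow, ('u bialg \<times> 'u, 'u \<Rightarrow> 'u) arrow) arrow \<Rightarrow>
    (('u bimod, 'u bimod_arrow) bimonoid, 'u bimod_arrow) arrow"
  where "GA w = \<lparr>src = GO (src w), trg = GO (trg w),
    map_of_arrow = \<lparr>src = obj (GO (src w)), trg = obj (GO (trg w)), map_of_arrow = map_of_arrow (map_of_arrow w)\<rparr>\<rparr>"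

lemma FO_Ar: assumes c: "coc X" shows "FO X \<in> Ar (QTrBialg K)" "src (FO X) = (B, S)"
  using cocD(1-3)[OF c] B qt by (simp_all add: QTr_Ar FO_def quasitriangular_bialgebra_def)

lemma under:
  assumes "a \<in> Ar (QTrBialg K)" "src a = (B, S)"
  shows "coc (GO a)" "alg_of (GO a) = fst (trg a)" "unit_map (GO a) = map_of_arrow a" "FO (GO a) = a"
proof -
  have a: "bialgebra K (fst (trg a))" "bialgebra_map K B (fst (trg a)) (map_of_arrow a)"
    "quasitriangular K (fst (trg a)) (tmap (fst (trg a)) (map_of_arrow a) S)"
    and t: "tmap (fst (trg a)) (map_of_arrow a) S = snd (trg a)"
    using assms unfolding QTr_Ar by (simp_all add: quasitriangular_bialgebra_def)
  show "coc (GO a)" unfolding GO_def by (rule bim_of_coc[OF a])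
  show 1: "alg_of (GO a) = fst (trg a)" unfolding GO_def by (rule alg_of_bim_of[OF a])
  show 2: "unit_map (GO a) = map_of_arrow a" unfolding GO_def by (rule unit_bim_of[OF a(1,2)])
  show "FO (GO a) = a" using 1 2 t assms(2) by (intro arrow.equality) (simp_all add: FO_def)
qed

lemma GO_FO: "coc X \<Longrightarrow> GO (FO X) = X" using cocD(5)[of X] by (simp add: GO_def FO_def)

lemma compose_eq: "compose (carrier B) h f = g \<longleftrightarrow> (\<forall>b\<in>carrier B. h (f b) = g b)" if "g \<in> extensional (carrier B)"
  using that by (auto simp: compose_def fun_eq_iff extensional_def)

lemma unit_map_ext: "coc X \<Longrightarrow> unit_map X \<in> extensional (carrier B)"
  using cocD(2)[of X] unfolding bialgebra_map_iff by blast

text \<open>The two R-matrices are the images of \<open>S\<close> under the unit maps, which the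
  morphism intertwines; by functoriality of f \<otimes> f it sends the first to the second.\<close>

lemma FA_Ar: assumes "F \<in> Ar Bim" shows "FA F \<in> Ar Cos"
proof -
  let ?X = "src F" and ?Y = "trg F" and ?f = "map_of_arrow (map_of_arrow F)"
  have c: "coc ?X" "coc ?Y" and mm: "bimonoid_mor C \<DD> ?X ?Y (map_of_arrow F)" using assms by (simp_all add: Bim_Ar)
  note m = mm[unfolded coc_mor_iff[OF c]]
  have f: "bialgebra_map K (alg_of ?X) (alg_of ?Y) ?f" using m by blast
  have e: "compose (carrier B) ?f (unit_map ?X) = unit_map ?Y" using m by (simp add: compose_eq unit_map_ext[OF c(2)])
  have "tmap (alg_of ?Y) ?f (tmap (alg_of ?X) (unit_map ?X) S) = tmap (alg_of ?Y) (unit_map ?Y) S"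
    using bialgebra_map_comp(2)[OF B cocD(1)[OF c(1)] cocD(1)[OF c(2)] cocD(2)[OF c(1)] f q(1)] e by simp
  then have "\<lparr>src = trg (FO ?X), trg = trg (FO ?Y), map_of_arrow = ?f\<rparr> \<in> Ar (QTrBialg K)"
    using FO_Ar[OF c(1)] FO_Ar[OF c(2)] f by (simp add: QTr_Ar) (simp add: FO_def)
  then show ?thesis using FO_Ar[OF c(1)] FO_Ar[OF c(2)] e by (simp add: coslice_Ar FA_def arr_def) (simp add: FO_def)
qed

lemma GA_Ar: assumes "w \<in> Ar Cos" shows "GA w \<in> Ar Bim"
proof -
  have a: "src w \<in> Ar (QTrBialg K)" "src (src w) = (B, S)" "trg w \<in> Ar (QTrBialg K)" "src (trg w) = (B, S)"
    and h: "map_of_arrow w \<in> arr (QTrBialg K) (trg (src w)) (trg (trg w))" and e: "cmp (QTrBialg K) (map_of_arrow w) (src w) = trg w"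
    using assms unfolding coslice_Ar QTr_fields(2,3) by blast+
  note s = under[OF a(1,2)] and t = under[OF a(3,4)]
  have "compose (carrier B) (map_of_arrow (map_of_arrow w)) (unit_map (GO (src w))) = unit_map (GO (trg w))"
    using arg_cong[OF e, of map_of_arrow] a(2) s(3) t(3) by simp
  then have "b \<in> carrier B \<Longrightarrow> map_of_arrow (map_of_arrow w) (unit_map (GO (src w)) b) = unit_map (GO (trg w)) b" for b
    by (simp add: compose_eq unit_map_ext[OF t(1)])
  moreover have "bialgebra_map K (alg_of (GO (src w))) (alg_of (GO (trg w))) (map_of_arrow (map_of_arrow w))"
    using h s(2) t(2) by (auto simp: arr_def QTr_Ar)
  ultimately show ?thesis using coc_mor_arr[OF s(1) t(1)] s(1) t(1) by (simp add: Bim_Ar GA_def)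
qed

lemma F_functor: "cat_functor Bim Cos FO FA"
proof (rule cat_functor.intro[OF Bim_category category.coslice_category[OF QTr_category]], rule cat_functor_axioms.intro)
  fix X assume "X \<in> Ob Bim"
  then have c: "coc X" by simp
  show "FO X \<in> Ob Cos" using FO_Ar[OF c] by simp
  show "FA (ide Bim X) = ide Cos (FO X)" by (simp add: FA_def map_ide) (simp add: FO_def)
next
  fix f X Y assume a: "f \<in> arr Bim X Y"
  then show "FA f \<in> arr Cos (FO X) (FO Y)" using FA_Ar[of f] by (simp add: arr_def) (simp add: FA_def)
  fix g Z assume "g \<in> arr Bim Y Z"
  then show "FA (cmp Bim g f) = cmp Cos (FA g) (FA f)"
    using a by (simp add: FA_def map_cmp FO_def arr_def Bim_Ar bimonoid_mor_def)
qed

lemma G_functor: "cat_functor Cos Bim GO GA"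
proof (rule cat_functor.intro[OF category.coslice_category[OF QTr_category] Bim_category], rule cat_functor_axioms.intro)
  have car: "carrier (obj (GO a)) = carrier (fst (trg a))" if "a \<in> Ar (QTrBialg K)" "src a = (B, S)" for a
    using under(2)[OF that] alg_of_carrier[of "GO a"] by simp
  fix X assume "X \<in> Ob Cos"
  then have X: "X \<in> Ar (QTrBialg K)" "src X = (B, S)" by simp_all
  show "GO X \<in> Ob Bim" using under(1)[OF X] by simp
  show "GA (ide Cos X) = ide Bim (GO X)"
    using car[OF X] by (auto simp: GA_def map_ide intro: arrow.equality)
next
  have car: "carrier (obj (GO a)) = carrier (fst (trg a))" if "a \<in> Ar (QTrBialg K)" "src a = (B, S)" for a
    using under(2)[OF that] alg_of_carrier[of "GO a"] by simp
  fix f X Y assume a: "f \<in> arr Cos X Y"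
  then show "GA f \<in> arr Bim (GO X) (GO Y)" using GA_Ar[of f] by (simp add: arr_def) (simp add: GA_def)
  fix g Z assume "g \<in> arr Cos Y Z"
  with a have X: "X \<in> Ar (QTrBialg K)" "src X = (B, S)" and s: "src f = X" "src (map_of_arrow f) = trg X" "trg g = Z"
    by (auto simp: arr_def coslice_Ar)
  show "GA (cmp Cos g f) = cmp Bim (GA g) (GA f)"
    using car[OF X] s by (auto simp: GA_def map_cmp intro!: arrow.equality)
qed

theorem bimonoids_iso: "isomorphic_categories Bim Cos"
proof -
  have "GA (FA F) = F" if "F \<in> Ar Bim" for F
  proof -
    have "coc (src F)" "coc (trg F)" "map_of_arrow F \<in> arr C (obj (src F)) (obj (trg F))"
      using that by (simp_all add: Bim_Ar bimonoid_mor_def)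
    then show ?thesis by (intro arrow.equality) (simp_all add: GA_def FA_def GO_FO arr_C)
  qed
  moreover have "FA (GA w) = w" if "w \<in> Ar Cos" for w
  proof -
    have a: "src w \<in> Ar (QTrBialg K)" "src (src w) = (B, S)" "trg w \<in> Ar (QTrBialg K)" "src (trg w) = (B, S)"
      and "map_of_arrow w \<in> arr (QTrBialg K) (trg (src w)) (trg (trg w))" using that by (simp_all add: coslice_Ar)
    then show ?thesis using under(4)[OF a(1,2)] under(4)[OF a(3,4)]
      by (intro arrow.equality) (simp_all add: GA_def FA_def arr_def)
  qed
  ultimately show ?thesis unfolding isomorphic_categories_def
    using F_functor G_functor GO_FO under(4)
    by (intro exI[of _ FO] exI[of _ FA] exI[of _ GO] exI[of _ GA]) simp
qed

end

theorem proposition4p14: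
  fixes K :: "('u :: infinite) ring" and B :: "'u bialg" and S :: 'u
  assumes "field K" and "quasitriangular_hopf_algebra K B S"
  shows "bullet_braided_duoidal_category (bimod_cat K B) (bimod_duoidal K B) (bimod_braiding K B S)
    \<and> isomorphic_categories (Bimon_coc (bimod_cat K B) (bimod_duoidal K B) (bimod_braiding K B S))
        (coslice (B, S) (QTrBialg K))"
proof -
  interpret K: field K by (rule assms(1))
  have B: "bialgebra K B" and S: "quasitriangular K B S"
    using assms(2) by (simp_all add: quasitriangular_hopf_algebra_def hopf_algebra_def)
  interpret bimod_qt K B S
    by unfold_locales (rule B, rule S)
  show ?thesis using braided bimonoids_iso by simp
qed

end
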